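(* Let $F=\alpha^{1+m}\beta^{-m}$, $m\neq0$, be a locally metrizable $m$-Kropina metric of Berwald type on a $4$-dimensional smooth manifold $M$, built from a Lorentzian metric $a$ (signature $(-,+,+,+)$) and a 1-form $b$ with $|b|^2=a^{ij}b_ib_j=0$ everywhere on $M$. Then $F$ is Ricci-flat if and only if it is locally of the form $$F=\left|-2\,du\,dv+H(u,x)\,du^2+\delta_{ab}\,dx^a dx^b\right|^{(1+m)/2}(du)^{-m}$$ such that $H$ satisfies $\delta^{ab}\partial_a\partial_bH=0$; that is, if and only if around each point of $M$ there are coordinates $(u,v,x^3,x^4)$ and a smooth function $H=H(u,x^3,x^4)$ with $\delta^{ab}\partial_a\partial_bH=0$ such that $F$ has this form. Here $a,b\in\{3,4\}$ and $\delta_{ab}$ is the Kronecker symbol.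
   Context: Finsler metrics. Let $M$ be a smooth manifold of dimension $n$, with local coordinates $x^i$ and induced coordinates $(x,y)$ on $TM$ (a tangent vector is $y^i\partial_i$); write $\partial_i=\partial/\partial x^i$, $\bar\partial_i=\partial/\partial y^i$. A conic subbundle of $TM$ is an open subset $\mathcal A\subset TM$ such that $(x,\lambda y)\in\mathcal A$ for all $(x,y)\in\mathcal A$, $\lambda>0$, and whose projection to $M$ is all of $M$. A Finsler metric on $\mathcal A$ is a smooth map $F:\mathcal A\to[0,\infty)$ with $F(x,\lambda y)=\lambda F(x,y)$ for $\lambda>0$ and with nondegenerate fundamental tensor $g_{ij}=\bar\partial_i\bar\partial_j(\tfrac12F^2)$. Connection and curvature. The canonical nonlinear connection has coefficients $N^j_i=\tfrac14\bar\partial_i\big[g^{jk}(y^l\partial_l\bar\partial_kF^2-\partial_kF^2)\big]$. With $\delta_i=\partial_i-N^j_i\bar\partial_j$, its curvature is $R^k_{ij}=\delta_iN^k_j-\delta_jN^k_i$; put $\mathrm{Ric}=R^i_{ij}y^j$ and $R_{ij}=\tfrac12\bar\partial_i\bar\partial_j\mathrm{Ric}$ (the Finsler-Ricci tensor). $F$ is Ricci-flat if $R_{ij}=0$, equivalently $\mathrm{Ric}=0$. $F$ is of Berwald type if $N^k_i=\Gamma^k_{ij}(x)y^j$ for functions $\Gamma^k_{ij}$ on the base; these are then the Christoffel symbols of a torsion-free affine connection on $M$, called the affine connection of $F$. Metrizability. A Berwald metric $F$ is locally metrizable if each point of $M$ has a neighborhood admitting a pseudo-Riemannian metric whose Levi-Civita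 connection is the restriction of the affine connection of $F$. $m$-Kropina metrics. An $m$-Kropina metric is a Finsler metric of the form $F=\alpha^{1+m}\beta^{-m}$ with $\alpha=\sqrt{|a_{ij}y^iy^j|}$, $\beta=b_iy^i$, where $a$ is a (pseudo-)Riemannian metric and $b$ a 1-form on $M$, and $m\in\mathbb R$; $b$ is then nowhere vanishing. The trivial case $m=0$ is excluded. Indices are raised and lowered with $a_{ij}$, and $\mathring\nabla$, $\mathring\Gamma$ denote the Levi-Civita connection of $a$ and its Christoffel symbols. Known fact: for $n>2$, $F$ is of Berwald type iff there is a smooth vector field $f^i$ on $M$ with $\mathring\nabla_j b_i = m (f_k b^k)a_{ij} + b_i f_j - m f_i b_j$. In that case $f$ is unique and the affine connection of $F$ is $\Gamma^\ell_{ij}=\mathring\Gamma^\ell_{ij}+m a^{\ell k}(a_{ij}f_k-a_{jk}f_i-a_{ki}f_j)$. Notation: products such as $du\,dv$ are symmetrized tensor products of 1-forms; in a formula for $F$, quadratic forms and 1-forms are evaluated on the tangent vector $y$. *)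

theory Defs
  imports "HOL-Analysis.Analysis"
begin

section \<open>Smooth functions and directional derivatives\<close>

definition dirderiv ::
    "'a::real_normed_vector \<Rightarrow> ('a \<Rightarrow> 'b::real_normed_vector) \<Rightarrow> 'a \<Rightarrow> 'b" where
  "dirderiv v f = (\<lambda>x. frechet_derivative f (at x) v)"

fun diff_order_on ::
    "nat \<Rightarrow> 'a::real_normed_vector set \<Rightarrow> ('a \<Rightarrow> 'b::real_normed_vector) \<Rightarrow> bool" where
  "diff_order_on 0 U f \<longleftrightarrow> continuous_on U f"
| "diff_order_on (Suc k) U f \<longleftrightarrow>
     (\<forall>x\<in>U. f differentiable (at x)) \<and> (\<forall>v. diff_order_on k U (dirderiv v f))"

text \<open>Only used for open \<open>U\<close>; the values of \<open>f\<close> outside \<open>U\<close> are then irrelevant.\<close>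

definition smooth_on ::
    "'a::real_normed_vector set \<Rightarrow> ('a \<Rightarrow> 'b::real_normed_vector) \<Rightarrow> bool" where
  "smooth_on U f \<longleftrightarrow> (\<forall>k. diff_order_on k U f)"


section \<open>Smooth manifolds\<close>

text \<open>The manifold is the whole (Hausdorff, second countable) type \<open>'m\<close>; its smooth structure is
  a maximal smooth atlas. A chart is a domain together with a coordinate map, whose
  values outside the domain play no role.\<close>

type_synonym ('m, 'n) chart = "'m set \<times> ('m \<Rightarrow> real ^ 'n)"

abbreviation chart_image :: "('m, 'n::finite) chart \<Rightarrow> (real ^ 'n) set" where
  "chart_image c \<equiv> snd c ` fst c"

definition chart_inv :: "('m, 'n::finite) chart \<Rightarrow> real ^ 'n \<Rightarrow> 'm" where
  "chart_inv c = inv_into (fst c) (snd c)"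

definition is_chart :: "('m::topological_space, 'n::finite) chart \<Rightarrow> bool" where
  "is_chart c \<longleftrightarrow> open (fst c) \<and> open (chart_image c) \<and>
     homeomorphism (fst c) (chart_image c) (snd c) (chart_inv c)"

definition transition ::
    "('m, 'n::finite) chart \<Rightarrow> ('m, 'n) chart \<Rightarrow> real ^ 'n \<Rightarrow> real ^ 'n" where
  "transition c d = snd d \<circ> chart_inv c"

definition smoothly_compatible :: "('m, 'n::finite) chart \<Rightarrow> ('m, 'n) chart \<Rightarrow> bool" where
  "smoothly_compatible c d \<longleftrightarrow>
     smooth_on (snd c ` (fst c \<inter> fst d)) (transition c d) \<and>
     smooth_on (snd d ` (fst c \<inter> fst d)) (transition d c)"

definition smooth_structure ::
    "('m::{t2_space, second_countable_topology}, 'n::finite) chart set \<Rightarrow> bool" where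
  "smooth_structure S \<longleftrightarrow>
     (\<forall>c\<in>S. is_chart c) \<and>
     (\<Union>c\<in>S. fst c) = UNIV \<and>
     (\<forall>c\<in>S. \<forall>d\<in>S. smoothly_compatible c d) \<and>
     (\<forall>c. is_chart c \<longrightarrow> (\<forall>d\<in>S. smoothly_compatible c d) \<longrightarrow> c \<in> S)"


section \<open>Tangent vectors and tensor fields\<close>

text \<open>A tangent vector at \<open>p\<close> is the family of its component vectors in all charts around \<open>p\<close>,
  related by the Jacobians of the transition maps (and \<open>0\<close> at all other index values).\<close>

type_synonym ('m, 'n) tvec = "('m, 'n) chart \<Rightarrow> real ^ 'n"

definition tangent_space ::
    "('m, 'n::finite) chart set \<Rightarrow> 'm \<Rightarrow> ('m, 'n) tvec set" where
  "tangent_space S p = {v.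
     (\<forall>c\<in>S. \<forall>d\<in>S. p \<in> fst c \<inter> fst d \<longrightarrow>
        v d = frechet_derivative (transition c d) (at (snd c p)) (v c)) \<and>
     (\<forall>c. \<not> (c \<in> S \<and> p \<in> fst c) \<longrightarrow> v c = 0)}"

definition tangent_bundle ::
    "('m, 'n::finite) chart set \<Rightarrow> ('m \<times> ('m, 'n) tvec) set" where
  "tangent_bundle S = Sigma UNIV (tangent_space S)"

text \<open>The vector with components \<open>y\<close> in the chart \<open>c\<close>, at the point with coordinates \<open>x\<close>.\<close>

definition tvec_of ::
    "('m, 'n::finite) chart set \<Rightarrow> ('m, 'n) chart \<Rightarrow> real ^ 'n \<Rightarrow> real ^ 'n \<Rightarrow> ('m, 'n) tvec" where
  "tvec_of S c x y = (\<lambda>d. if d \<in> S \<and> chart_inv c x \<in> fst d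
     then frechet_derivative (transition c d) (at x) y else 0)"

definition bundle_point ::
    "('m, 'n::finite) chart set \<Rightarrow> ('m, 'n) chart \<Rightarrow>
       (real ^ 'n) \<times> (real ^ 'n) \<Rightarrow> 'm \<times> ('m, 'n) tvec" where
  "bundle_point S c = (\<lambda>(x, y). (chart_inv c x, tvec_of S c x y))"

text \<open>A subset of \<open>TM\<close> in the induced coordinates \<open>(x, y)\<close>.\<close>

definition bundle_coords ::
    "('m, 'n::finite) chart set \<Rightarrow> ('m \<times> ('m, 'n) tvec) set \<Rightarrow> ('m, 'n) chart \<Rightarrow>
       ((real ^ 'n) \<times> (real ^ 'n)) set" where
  "bundle_coords S A c = {z. fst z \<in> chart_image c \<and> bundle_point S c z \<in> A}"

type_synonym ('m, 'n) form1 = "'m \<Rightarrow> ('m, 'n) tvec \<Rightarrow> real"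
type_synonym ('m, 'n) form2 = "'m \<Rightarrow> ('m, 'n) tvec \<Rightarrow> ('m, 'n) tvec \<Rightarrow> real"

definition linear_on_tangent ::
    "('m, 'n::finite) chart set \<Rightarrow> 'm \<Rightarrow> (('m, 'n) tvec \<Rightarrow> real) \<Rightarrow> bool" where
  "linear_on_tangent S p l \<longleftrightarrow>
     (\<forall>v\<in>tangent_space S p. \<forall>w\<in>tangent_space S p. \<forall>r s.
        l (\<lambda>c. r *\<^sub>R v c + s *\<^sub>R w c) = r * l v + s * l w)"

definition comp1 ::
    "('m, 'n::finite) chart set \<Rightarrow> ('m, 'n) form1 \<Rightarrow> ('m, 'n) chart \<Rightarrow> real ^ 'n \<Rightarrow> real ^ 'n" where
  "comp1 S b c x = (\<chi> i. b (chart_inv c x) (tvec_of S c x (axis i 1)))"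

definition comp2 ::
    "('m, 'n::finite) chart set \<Rightarrow> ('m, 'n) form2 \<Rightarrow> ('m, 'n) chart \<Rightarrow>
       real ^ 'n \<Rightarrow> real ^ 'n ^ 'n" where
  "comp2 S g c x = (\<chi> i j. g (chart_inv c x)
     (tvec_of S c x (axis i 1)) (tvec_of S c x (axis j 1)))"

definition one_form ::
    "('m, 'n::finite) chart set \<Rightarrow> ('m, 'n) form1 \<Rightarrow> bool" where
  "one_form S b \<longleftrightarrow>
     (\<forall>p. linear_on_tangent S p (b p)) \<and>
     (\<forall>c\<in>S. smooth_on (chart_image c) (comp1 S b c))"

definition pseudo_riemannian_on ::
    "('m, 'n::finite) chart set \<Rightarrow> 'm set \<Rightarrow> ('m, 'n) form2 \<Rightarrow> bool" where
  "pseudo_riemannian_on S U g \<longleftrightarrow>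
     (\<forall>p\<in>U. \<forall>v\<in>tangent_space S p.
        linear_on_tangent S p (g p v) \<and>
        (\<forall>w\<in>tangent_space S p. g p v w = g p w v) \<and>
        ((\<forall>w\<in>tangent_space S p. g p v w = 0) \<longrightarrow> v = (\<lambda>_. 0))) \<and>
     (\<forall>c\<in>S. smooth_on (snd c ` (fst c \<inter> U)) (comp2 S g c))"

text \<open>Signature \<open>(-, +, \<dots>, +)\<close>: there are orthonormal frames with exactly one negative square.\<close>

definition lorentzian ::
    "('m, 'n::finite) chart set \<Rightarrow> ('m, 'n) form2 \<Rightarrow> bool" where
  "lorentzian S a \<longleftrightarrow> pseudo_riemannian_on S UNIV a \<and>
     (\<forall>p. \<exists>e :: 'n \<Rightarrow> ('m, 'n) tvec. \<exists>k.
        (\<forall>i. e i \<in> tangent_space S p) \<and>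
        (\<forall>i j. a p (e i) (e j) = (if i \<noteq> j then 0 else if i = k then - 1 else 1)))"

definition norm_sq1 ::
    "('m, 'n::finite) chart set \<Rightarrow> ('m, 'n) form2 \<Rightarrow> ('m, 'n) form1 \<Rightarrow>
       ('m, 'n) chart \<Rightarrow> real ^ 'n \<Rightarrow> real" where
  "norm_sq1 S a b c x = (\<Sum>i\<in>UNIV. \<Sum>j\<in>UNIV.
     matrix_inv (comp2 S a c x) $ i $ j * comp1 S b c x $ i * comp1 S b c x $ j)"

definition null_form ::
    "('m, 'n::finite) chart set \<Rightarrow> ('m, 'n) form2 \<Rightarrow> ('m, 'n) form1 \<Rightarrow> bool" where
  "null_form S a b \<longleftrightarrow> (\<forall>c\<in>S. \<forall>x\<in>chart_image c. norm_sq1 S a b c x = 0)"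

text \<open>\<open>christoffel S g c x k i j\<close> is the Levi-Civita coefficient with upper index \<open>k\<close>.\<close>

definition christoffel ::
    "('m, 'n::finite) chart set \<Rightarrow> ('m, 'n) form2 \<Rightarrow> ('m, 'n) chart \<Rightarrow>
       real ^ 'n \<Rightarrow> 'n \<Rightarrow> 'n \<Rightarrow> 'n \<Rightarrow> real" where
  "christoffel S g c x k i j = (1 / 2) * (\<Sum>l\<in>UNIV. matrix_inv (comp2 S g c x) $ k $ l *
     (dirderiv (axis i 1) (\<lambda>x. comp2 S g c x $ j $ l) x +
      dirderiv (axis j 1) (\<lambda>x. comp2 S g c x $ i $ l) x -
      dirderiv (axis l 1) (\<lambda>x. comp2 S g c x $ i $ j) x))"


section \<open>Local Finsler geometry\<close>

text \<open>Here \<open>F\<close> is a function of the induced coordinates \<open>z = (x, y)\<close>; \<open>dx i\<close> and \<open>dy i\<close> are the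
  partial derivatives with respect to \<open>x\<^sup>i\<close> and \<open>y\<^sup>i\<close>.\<close>

definition dx ::
    "'n::finite \<Rightarrow> ((real ^ 'n) \<times> (real ^ 'n) \<Rightarrow> real) \<Rightarrow> (real ^ 'n) \<times> (real ^ 'n) \<Rightarrow> real" where
  "dx i = dirderiv (axis i 1, 0)"

definition dy ::
    "'n::finite \<Rightarrow> ((real ^ 'n) \<times> (real ^ 'n) \<Rightarrow> real) \<Rightarrow> (real ^ 'n) \<times> (real ^ 'n) \<Rightarrow> real" where
  "dy i = dirderiv (0, axis i 1)"

definition fundamental_tensor ::
    "((real ^ 'n::finite) \<times> (real ^ 'n) \<Rightarrow> real) \<Rightarrow> (real ^ 'n) \<times> (real ^ 'n) \<Rightarrow> real ^ 'n ^ 'n" where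
  "fundamental_tensor F z = (\<chi> i j. dy i (dy j (\<lambda>z. (1 / 2) * (F z)\<^sup>2)) z)"

text \<open>\<open>nonlinear_conn F j i\<close> is the coefficient with upper index \<open>j\<close> and lower index \<open>i\<close>.\<close>

definition nonlinear_conn ::
    "((real ^ 'n::finite) \<times> (real ^ 'n) \<Rightarrow> real) \<Rightarrow> 'n \<Rightarrow> 'n \<Rightarrow>
       (real ^ 'n) \<times> (real ^ 'n) \<Rightarrow> real" where
  "nonlinear_conn F j i = (\<lambda>z. (1 / 4) * dy i (\<lambda>z. \<Sum>k\<in>UNIV.
     matrix_inv (fundamental_tensor F z) $ j $ k *
     ((\<Sum>l\<in>UNIV. snd z $ l * dx l (dy k (\<lambda>z. (F z)\<^sup>2)) z) - dx k (\<lambda>z. (F z)\<^sup>2) z)) z)"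

definition horizontal_deriv ::
    "((real ^ 'n::finite) \<times> (real ^ 'n) \<Rightarrow> real) \<Rightarrow> 'n \<Rightarrow>
       ((real ^ 'n) \<times> (real ^ 'n) \<Rightarrow> real) \<Rightarrow> (real ^ 'n) \<times> (real ^ 'n) \<Rightarrow> real" where
  "horizontal_deriv F i G = (\<lambda>z. dx i G z - (\<Sum>j\<in>UNIV. nonlinear_conn F j i z * dy j G z))"

definition nonlinear_curvature ::
    "((real ^ 'n::finite) \<times> (real ^ 'n) \<Rightarrow> real) \<Rightarrow> 'n \<Rightarrow> 'n \<Rightarrow> 'n \<Rightarrow>
       (real ^ 'n) \<times> (real ^ 'n) \<Rightarrow> real" where
  "nonlinear_curvature F k i j = (\<lambda>z.
     horizontal_deriv F i (nonlinear_conn F k j) z -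
     horizontal_deriv F j (nonlinear_conn F k i) z)"

definition Ric ::
    "((real ^ 'n::finite) \<times> (real ^ 'n) \<Rightarrow> real) \<Rightarrow> (real ^ 'n) \<times> (real ^ 'n) \<Rightarrow> real" where
  "Ric F = (\<lambda>z. \<Sum>i\<in>UNIV. \<Sum>j\<in>UNIV. nonlinear_curvature F i i j z * snd z $ j)"

definition finsler_ricci ::
    "((real ^ 'n::finite) \<times> (real ^ 'n) \<Rightarrow> real) \<Rightarrow> 'n \<Rightarrow> 'n \<Rightarrow>
       (real ^ 'n) \<times> (real ^ 'n) \<Rightarrow> real" where
  "finsler_ricci F i j = (\<lambda>z. (1 / 2) * dy i (dy j (Ric F)) z)"


section \<open>Finsler metrics on a manifold\<close>

definition conic_subbundle ::
    "('m, 'n::finite) chart set \<Rightarrow> ('m \<times> ('m, 'n) tvec) set \<Rightarrow> bool" where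
  "conic_subbundle S A \<longleftrightarrow>
     A \<subseteq> tangent_bundle S \<and>
     (\<forall>c\<in>S. open (bundle_coords S A c)) \<and>
     (\<forall>p v r. (p, v) \<in> A \<longrightarrow> 0 < r \<longrightarrow> (p, \<lambda>c. r *\<^sub>R v c) \<in> A) \<and>
     fst ` A = UNIV"

definition finsler_metric ::
    "('m, 'n::finite) chart set \<Rightarrow> ('m \<times> ('m, 'n) tvec) set \<Rightarrow>
       ('m \<times> ('m, 'n) tvec \<Rightarrow> real) \<Rightarrow> bool" where
  "finsler_metric S A F \<longleftrightarrow>
     conic_subbundle S A \<and>
     (\<forall>w\<in>A. 0 \<le> F w) \<and>
     (\<forall>p v r. (p, v) \<in> A \<longrightarrow> 0 < r \<longrightarrow> F (p, \<lambda>c. r *\<^sub>R v c) = r * F (p, v)) \<and>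
     (\<forall>c\<in>S. smooth_on (bundle_coords S A c) (F \<circ> bundle_point S c) \<and>
        (\<forall>z\<in>bundle_coords S A c. invertible (fundamental_tensor (F \<circ> bundle_point S c) z)))"

definition ricci_flat ::
    "('m, 'n::finite) chart set \<Rightarrow> ('m \<times> ('m, 'n) tvec) set \<Rightarrow>
       ('m \<times> ('m, 'n) tvec \<Rightarrow> real) \<Rightarrow> bool" where
  "ricci_flat S A F \<longleftrightarrow>
     (\<forall>c\<in>S. \<forall>z\<in>bundle_coords S A c. \<forall>i j. finsler_ricci (F \<circ> bundle_point S c) i j z = 0)"

text \<open>\<open>\<Gamma> k i j\<close> has upper index \<open>k\<close>.\<close>

definition berwald_coeffs ::
    "('m, 'n::finite) chart set \<Rightarrow> ('m \<times> ('m, 'n) tvec) set \<Rightarrow>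
       ('m \<times> ('m, 'n) tvec \<Rightarrow> real) \<Rightarrow> ('m, 'n) chart \<Rightarrow> real ^ 'n \<Rightarrow>
       ('n \<Rightarrow> 'n \<Rightarrow> 'n \<Rightarrow> real) \<Rightarrow> bool" where
  "berwald_coeffs S A F c x \<Gamma> \<longleftrightarrow>
     (\<forall>y. (x, y) \<in> bundle_coords S A c \<longrightarrow>
        (\<forall>k i. nonlinear_conn (F \<circ> bundle_point S c) k i (x, y) = (\<Sum>j\<in>UNIV. \<Gamma> k i j * y $ j)))"

definition berwald ::
    "('m, 'n::finite) chart set \<Rightarrow> ('m \<times> ('m, 'n) tvec) set \<Rightarrow>
       ('m \<times> ('m, 'n) tvec \<Rightarrow> real) \<Rightarrow> bool" where
  "berwald S A F \<longleftrightarrow> finsler_metric S A F \<and>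
     (\<forall>c\<in>S. \<exists>\<Gamma>. \<forall>x\<in>chart_image c. berwald_coeffs S A F c x (\<Gamma> x))"

text \<open>Uniqueness: the fibres of \<open>A\<close> are open and nonempty, hence span the tangent spaces.\<close>

definition affine_connection ::
    "('m, 'n::finite) chart set \<Rightarrow> ('m \<times> ('m, 'n) tvec) set \<Rightarrow>
       ('m \<times> ('m, 'n) tvec \<Rightarrow> real) \<Rightarrow> ('m, 'n) chart \<Rightarrow> real ^ 'n \<Rightarrow>
       'n \<Rightarrow> 'n \<Rightarrow> 'n \<Rightarrow> real" where
  "affine_connection S A F c x = (THE \<Gamma>. berwald_coeffs S A F c x \<Gamma>)"

definition locally_metrizable ::
    "('m::topological_space, 'n::finite) chart set \<Rightarrow> ('m \<times> ('m, 'n) tvec) set \<Rightarrow>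
       ('m \<times> ('m, 'n) tvec \<Rightarrow> real) \<Rightarrow> bool" where
  "locally_metrizable S A F \<longleftrightarrow>
     (\<forall>p. \<exists>U g. open U \<and> p \<in> U \<and> pseudo_riemannian_on S U g \<and>
        (\<forall>c\<in>S. \<forall>x\<in>snd c ` (fst c \<inter> U).
           christoffel S g c x = affine_connection S A F c x))"


section \<open>Kropina metrics\<close>

text \<open>The power \<open>t\<^sup>s\<close> with real exponent, for those \<open>t\<close> for which it makes sense: negative bases are
  admitted for integer exponents only, where \<open>powr\<close> would return \<open>\<bar>t\<bar>\<^sup>s\<close>. The predicate
  \<open>is_power t s r\<close> says that \<open>t\<^sup>s\<close> is defined and equal to \<open>r\<close>.\<close>

definition is_power :: "real \<Rightarrow> real \<Rightarrow> real \<Rightarrow> bool" where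
  "is_power t s r \<longleftrightarrow>
     0 < t \<and> r = t powr s \<or>
     t = 0 \<and> 0 < s \<and> r = 0 \<or>
     t < 0 \<and> s \<in> \<int> \<and> r = t powi \<lfloor>s\<rfloor>"

definition m_kropina ::
    "('m, 'n::finite) chart set \<Rightarrow> ('m \<times> ('m, 'n) tvec) set \<Rightarrow> real \<Rightarrow>
       ('m, 'n) form2 \<Rightarrow> ('m, 'n) form1 \<Rightarrow> ('m \<times> ('m, 'n) tvec \<Rightarrow> real) \<Rightarrow> bool" where
  "m_kropina S A m a b F \<longleftrightarrow>
     pseudo_riemannian_on S UNIV a \<and> one_form S b \<and> finsler_metric S A F \<and>
     (\<forall>(p, v)\<in>A. \<exists>r s. is_power (sqrt \<bar>a p v v\<bar>) (1 + m) r \<and> is_power (b p v) (- m) s \<and>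
        F (p, v) = r * s)"

text \<open>Coordinates are \<open>(u, v, x\<^sup>3, x\<^sup>4) = (x $ 1, x $ 2, x $ 3, x $ 4)\<close>; the quadratic form is
  \<open>- 2 du dv + H du\<^sup>2 + \<delta>\<^sub>a\<^sub>b dx\<^sup>a dx\<^sup>b\<close>, where \<open>H\<close> is a function of \<open>(u, x\<^sup>3, x\<^sup>4)\<close> only.\<close>

definition transverse :: "real ^ 4 \<Rightarrow> real \<times> real \<times> real" where
  "transverse x = (x $ 1, x $ 3, x $ 4)"

definition pp_wave_quadratic ::
    "(real \<times> real \<times> real \<Rightarrow> real) \<Rightarrow> real ^ 4 \<Rightarrow> real ^ 4 \<Rightarrow> real" where
  "pp_wave_quadratic H x y =
     - 2 * y $ 1 * y $ 2 + H (transverse x) * (y $ 1)\<^sup>2 + (y $ 3)\<^sup>2 + (y $ 4)\<^sup>2"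

definition transverse_laplacian ::
    "(real \<times> real \<times> real \<Rightarrow> real) \<Rightarrow> real \<times> real \<times> real \<Rightarrow> real" where
  "transverse_laplacian H w =
     dirderiv (0, 1, 0) (dirderiv (0, 1, 0) H) w + dirderiv (0, 0, 1) (dirderiv (0, 0, 1) H) w"

end

theory Submission
  imports Defs
begin

text \<open>A local metric \<open>g\<close> with the same connection makes the recurrence form \<open>f\<close> of \<open>a\<close> and \<open>b\<close> exact, so
  \<open>a\<close> and \<open>b\<close> can be rescaled to be parallel without changing \<open>F\<close>. The Finsler-Ricci tensor is
  then the symmetrized Ricci tensor of a Lorentzian metric \<open>a\<close> with parallel null covector \<open>b\<close>. Complete
  \<open>b\<close> to a null coframe \<open>b, l, e, e'\<close> with \<open>a = - 2 b l + e\<^sup>2 + e'\<^sup>2\<close>. Ricci-flatness makes the curvature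
  vanish along the null hypersurfaces \<open>ker b\<close>, so three successive changes of coframe, each solving a leafwise
  Poincare problem, turn the coframe into \<open>du, dv - h du, dx\<^sup>3, dx\<^sup>4\<close> with \<open>h\<close> independent of \<open>v\<close>; this is
  the pp-wave form with \<open>H = 2 h\<close>. Conversely, the connection of such a form is computed from its coframe, and its Ricci
  tensor is \<open>- (1/2) (\<Delta> H) du\<^sup>2\<close>, which gives both the harmonicity of \<open>H\<close> and the converse.\<close>

text \<open>The recurrence form f arises because a Berwald connection annihilates F^2. In
  logarithmic form this reads (1+m) T(y,y) b(y) = 2m a(y,y) c(y), with T and c the covariant
  derivatives of \<open>a\<close> and \<open>b\<close> in one direction. Logarithms exist only where
  a(y,y) and b(y) are nonzero, but both sides are cubic in y, so the identity spreads to all y. As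
  \<open>a\<close> does not vanish on ker b, the linear factor b splits off: T = 2mf a and c =
  (1+m)f b. Two obstacles shape the integration. Solving along ker b with smooth dependence on the
  leaf needs leaves that are coordinate slices, so a potential of the rescaled \<open>b\<close>
  becomes the first coordinate before any frame is built. And independence of v is obtained only
  infinitesimally, so the final chart must have a ball as its image. For the converse the connection
  is not computed from Christoffel symbols: it is read off from the structure equations that the
  coframe should satisfy, and recognised as the Berwald connection because it is symmetric and
  preserves F^2. This is done in an arbitrary chart with u, v, x3, x4 as functions, which takes the
  place of a transformation law for the Finsler-Ricci tensor.\<close>

lemma has_derivative_dirderiv:
  assumes "f differentiable at x"
  shows "(f has_derivative (\<lambda>v. dirderiv v f x)) (at x)"
  using assms unfolding dirderiv_def frechet_derivative_works .

lemma dirderiv_eqI: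
  assumes "(f has_derivative f') (at x)"
  shows "dirderiv v f x = f' v"
  using frechet_derivative_at[OF assms] by (simp add: dirderiv_def)

lemma linear_dirderiv:
  assumes "f differentiable at x"
  shows "linear (\<lambda>v. dirderiv v f x)"
  using has_derivative_linear[OF has_derivative_dirderiv[OF assms]] .

lemma frechet_derivative_cong_open:
  assumes "open U" "x \<in> U" "\<And>y. y \<in> U \<Longrightarrow> f y = g y"
  shows "frechet_derivative f (at x) = frechet_derivative g (at x)"
proof -
  have "(f has_derivative f') (at x) \<longleftrightarrow> (g has_derivative f') (at x)" for f'
    using has_derivative_transform_within_open[OF _ assms(1,2)] assms(3) by metis
  then show ?thesis by (simp add: frechet_derivative_def)
qed

lemma dirderiv_cong_open:
  assumes "open U" "x \<in> U" "\<And>y. y \<in> U \<Longrightarrow> f y = g y"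
  shows "dirderiv v f x = dirderiv v g x"
  using frechet_derivative_cong_open[OF assms] by (simp add: dirderiv_def)

lemma differentiable_cong_open:
  assumes "open U" "x \<in> U" "\<And>y. y \<in> U \<Longrightarrow> f y = g y" "f differentiable at x"
  shows "g differentiable at x"
  using assms has_derivative_transform_within_open unfolding differentiable_def by metis

lemma dirderiv_const [simp]: "dirderiv v (\<lambda>x. c) = (\<lambda>x. 0)"
  by (simp add: dirderiv_def)

lemma dirderiv_linear:
  assumes "bounded_linear L"
  shows "dirderiv v L x = L v"
  using bounded_linear_imp_has_derivative[OF assms] by (rule dirderiv_eqI)

lemma dirderiv_comp_linear:
  assumes "bounded_linear L" "f differentiable at x"
  shows "dirderiv v (\<lambda>x. L (f x)) x = L (dirderiv v f x)"
  by (rule dirderiv_eqI[OF bounded_linear.has_derivative[OF assms(1) has_derivative_dirderiv[OF assms(2)]]])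

lemma dirderiv_bilinear:
  assumes "bounded_bilinear p" "f differentiable at x" "g differentiable at x"
  shows "dirderiv v (\<lambda>x. p (f x) (g x)) x = p (f x) (dirderiv v g x) + p (dirderiv v f x) (g x)"
  by (rule dirderiv_eqI[OF bounded_bilinear.FDERIV[OF assms(1) has_derivative_dirderiv[OF assms(2)]
          has_derivative_dirderiv[OF assms(3)]]])

lemma differentiable_bilinear:
  assumes "bounded_bilinear p" "f differentiable at x" "g differentiable at x"
  shows "(\<lambda>x. p (f x) (g x)) differentiable at x"
  using bounded_bilinear.FDERIV[OF assms(1) has_derivative_dirderiv[OF assms(2)]
      has_derivative_dirderiv[OF assms(3)]] by (rule differentiableI)

lemma dirderiv_add:
  assumes "f differentiable at x" "g differentiable at x"
  shows "dirderiv v (\<lambda>x. f x + g x) x = dirderiv v f x + dirderiv v g x"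
  by (rule dirderiv_eqI[OF has_derivative_add[OF has_derivative_dirderiv[OF assms(1)]
          has_derivative_dirderiv[OF assms(2)]]])

lemma dirderiv_diff:
  assumes "f differentiable at x" "g differentiable at x"
  shows "dirderiv v (\<lambda>x. f x - g x) x = dirderiv v f x - dirderiv v g x"
  by (rule dirderiv_eqI[OF has_derivative_diff[OF has_derivative_dirderiv[OF assms(1)]
          has_derivative_dirderiv[OF assms(2)]]])

lemma dirderiv_sum:
  assumes "\<And>i. i \<in> I \<Longrightarrow> f i differentiable at x"
  shows "dirderiv v (\<lambda>x. \<Sum>i\<in>I. f i x) x = (\<Sum>i\<in>I. dirderiv v (f i) x)"
  by (rule dirderiv_eqI[OF has_derivative_sum]) (simp add: has_derivative_dirderiv assms)

lemmas dirderiv_mult = dirderiv_bilinear[OF bounded_bilinear_mult]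

lemma dirderiv_compose:
  assumes "f differentiable at x" "g differentiable at (f x)"
  shows "dirderiv v (\<lambda>x. g (f x)) x = dirderiv (dirderiv v f x) g (f x)"
  using has_derivative_compose[OF has_derivative_dirderiv[OF assms(1)] has_derivative_dirderiv[OF assms(2)]]
  by (rule dirderiv_eqI)

lemma dirderiv_Basis:
  fixes f :: "'a::euclidean_space \<Rightarrow> 'b::real_normed_vector"
  assumes "f differentiable at x"
  shows "dirderiv v f x = (\<Sum>e\<in>Basis. (v \<bullet> e) *\<^sub>R dirderiv e f x)"
proof -
  interpret linear "\<lambda>v. dirderiv v f x" by (rule linear_dirderiv[OF assms])
  have "dirderiv (\<Sum>e\<in>Basis. (v \<bullet> e) *\<^sub>R e) f x = (\<Sum>e\<in>Basis. (v \<bullet> e) *\<^sub>R dirderiv e f x)"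
    by (simp add: sum scale)
  then show ?thesis by (simp add: euclidean_representation)
qed

lemma dirderiv_axis:
  fixes f :: "real ^ 'n::finite \<Rightarrow> 'b::real_normed_vector"
  assumes "f differentiable at x"
  shows "dirderiv v f x = (\<Sum>i\<in>UNIV. (v $ i) *\<^sub>R dirderiv (axis i 1) f x)"
proof -
  interpret linear "\<lambda>v. dirderiv v f x" by (rule linear_dirderiv[OF assms])
  have "v = (\<Sum>i\<in>UNIV. (v $ i) *\<^sub>R axis i 1)"
    by (simp add: vec_eq_iff axis_def if_distrib cong: if_cong)
  then have "dirderiv v f x = dirderiv (\<Sum>i\<in>UNIV. (v $ i) *\<^sub>R axis i 1) f x" by simp
  also have "\<dots> = (\<Sum>i\<in>UNIV. (v $ i) *\<^sub>R dirderiv (axis i 1) f x)" by (simp add: sum scale)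
  finally show ?thesis .
qed

subsection \<open>Closure properties of smooth functions\<close>

lemma diff_order_on_cong:
  assumes "open U" "\<And>x. x \<in> U \<Longrightarrow> f x = g x"
  shows "diff_order_on k U f \<longleftrightarrow> diff_order_on k U g"
  using assms(2)
proof (induction k arbitrary: f g)
  case 0
  then show ?case by (simp cong: continuous_on_cong)
next
  case (Suc k)
  have "diff_order_on k U (dirderiv v f) \<longleftrightarrow> diff_order_on k U (dirderiv v g)" for v
    by (rule Suc.IH) (rule dirderiv_cong_open[OF assms(1) _ Suc.prems])
  moreover have "f differentiable at x \<longleftrightarrow> g differentiable at x" if "x \<in> U" for x
    using differentiable_cong_open[OF assms(1) that] Suc.prems by metis
  ultimately show ?case by simp
qed

lemma diff_order_on_subset:
  "diff_order_on k U f \<Longrightarrow> V \<subseteq> U \<Longrightarrow> diff_order_on k V f"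
  by (induction k arbitrary: f) (auto intro: continuous_on_subset)

lemma diff_order_on_continuous: "diff_order_on k U f \<Longrightarrow> continuous_on U f"
  by (cases k) (auto intro!: differentiable_imp_continuous_on simp: differentiable_on_def
      differentiable_at_withinI)

lemma diff_order_on_SucD: "diff_order_on (Suc k) U f \<Longrightarrow> diff_order_on k U f"
proof (induction k arbitrary: f)
  case 0
  then show ?case by (metis diff_order_on_continuous diff_order_on.simps(1))
next
  case (Suc k)
  then show ?case by (metis diff_order_on.simps(2))
qed

lemma diff_order_on_const: "diff_order_on k U (\<lambda>x. c)"
  by (induction k arbitrary: c) auto

lemma diff_order_on_linear: "bounded_linear L \<Longrightarrow> diff_order_on k U L"
proof (cases k)
  case 0
  assume "bounded_linear L"
  then show ?thesis using 0 by (simp add: linear_continuous_on)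
next
  case (Suc j)
  assume L: "bounded_linear L"
  have "dirderiv v L = (\<lambda>x. L v)" for v by (rule ext) (rule dirderiv_linear[OF L])
  then show ?thesis using Suc L
    by (simp add: diff_order_on_const bounded_linear_imp_differentiable)
qed

lemma diff_order_on_comp_linear:
  assumes "open U" "bounded_linear L" "diff_order_on k U f"
  shows "diff_order_on k U (\<lambda>x. L (f x))"
  using assms(3)
proof (induction k arbitrary: f)
  case 0
  then show ?case using assms(2) by (auto intro: bounded_linear.continuous_on)
next
  case (Suc k)
  have "diff_order_on k U (dirderiv v (\<lambda>x. L (f x)))" for v
  proof -
    have "diff_order_on k U (\<lambda>x. L (dirderiv v f x))"
      using Suc by simp
    then show ?thesis
      by (subst diff_order_on_cong[OF assms(1)]) (use Suc.prems assms(2) in \<open>auto simp: dirderiv_comp_linear\<close>)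
  qed
  moreover have "(\<lambda>x. L (f x)) differentiable at x" if "x \<in> U" for x
    using Suc.prems that
    by (intro differentiableI[OF bounded_linear.has_derivative[OF assms(2) has_derivative_dirderiv]]) auto
  ultimately show ?case by simp
qed

lemma diff_order_on_add:
  assumes "open U" "diff_order_on k U f" "diff_order_on k U g"
  shows "diff_order_on k U (\<lambda>x. f x + g x)"
  using assms(2,3)
proof (induction k arbitrary: f g)
  case 0
  then show ?case by (auto intro: continuous_intros)
next
  case (Suc k)
  have "diff_order_on k U (dirderiv v (\<lambda>x. f x + g x))" for v
  proof -
    have "diff_order_on k U (\<lambda>x. dirderiv v f x + dirderiv v g x)"
      using Suc by simp
    then show ?thesis
      by (subst diff_order_on_cong[OF assms(1)]) (use Suc.prems in \<open>auto simp: dirderiv_add\<close>)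
  qed
  then show ?case using Suc.prems by auto
qed

lemma diff_order_on_sum:
  assumes "open U" "\<And>i. i \<in> I \<Longrightarrow> diff_order_on k U (f i)"
  shows "diff_order_on k U (\<lambda>x. \<Sum>i\<in>I. f i x)"
  using assms(2)
  by (induction I rule: infinite_finite_induct)
     (auto simp: diff_order_on_const intro!: diff_order_on_add[OF assms(1)])

lemma diff_order_on_bilinear:
  assumes "open U" "bounded_bilinear p" "diff_order_on k U f" "diff_order_on k U g"
  shows "diff_order_on k U (\<lambda>x. p (f x) (g x))"
  using assms(3,4)
proof (induction k arbitrary: f g)
  case 0
  then show ?case using assms(2) by (auto intro: bounded_bilinear.continuous_on)
next
  case (Suc k)
  have "diff_order_on k U (dirderiv v (\<lambda>x. p (f x) (g x)))" for v
  proof -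
    have "diff_order_on k U (\<lambda>x. p (f x) (dirderiv v g x) + p (dirderiv v f x) (g x))"
      using Suc.prems diff_order_on_SucD[OF Suc.prems(1)] diff_order_on_SucD[OF Suc.prems(2)]
      by (intro diff_order_on_add[OF assms(1)] Suc.IH) auto
    then show ?thesis
      by (subst diff_order_on_cong[OF assms(1)])
         (use Suc.prems assms(2) in \<open>auto simp: dirderiv_bilinear\<close>)
  qed
  moreover have "(\<lambda>x. p (f x) (g x)) differentiable at x" if "x \<in> U" for x
    using Suc.prems that by (intro differentiable_bilinear[OF assms(2)]) auto
  ultimately show ?case by simp
qed

text \<open>The chain rule differentiates \<open>g\<close> in the direction
  \<open>dirderiv v f x\<close>, which moves with \<open>x\<close>, while
  \<open>diff_order_on\<close> speaks of fixed directions. Expanding that direction over the finite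
  \<open>Basis\<close> leaves products to which the induction on \<open>k\<close> applies, with
  \<open>g\<close> generalised and \<open>f\<close> fixed.\<close>

lemma diff_order_on_compose:
  fixes g :: "'a::euclidean_space \<Rightarrow> 'b::real_normed_vector"
  assumes "open U" "diff_order_on k V g" "diff_order_on k U f" "\<And>x. x \<in> U \<Longrightarrow> f x \<in> V"
  shows "diff_order_on k U (\<lambda>x. g (f x))"
  using assms(2,3)
proof (induction k arbitrary: g)
  case 0
  then show ?case using assms(4) by (auto intro: continuous_on_compose2)
next
  case (Suc k)
  have fk: "diff_order_on k U f" using diff_order_on_SucD[OF Suc.prems(2)] .
  have "diff_order_on k U (dirderiv v (\<lambda>x. g (f x)))" for v
  proof -
    have "diff_order_on k U (\<lambda>x. \<Sum>e\<in>Basis. (dirderiv v f x \<bullet> e) *\<^sub>R dirderiv e g (f x))"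
    proof (intro diff_order_on_sum[OF assms(1)] diff_order_on_bilinear[OF assms(1) bounded_bilinear_scaleR])
      fix e :: 'a
      show "diff_order_on k U (\<lambda>x. dirderiv v f x \<bullet> e)"
        by (rule diff_order_on_comp_linear[OF assms(1) bounded_linear_inner_left]) (use Suc.prems in auto)
      show "diff_order_on k U (\<lambda>x. dirderiv e g (f x))"
        by (rule Suc.IH[OF _ fk]) (use Suc.prems in auto)
    qed
    moreover have "dirderiv v (\<lambda>x. g (f x)) x
        = (\<Sum>e\<in>Basis. (dirderiv v f x \<bullet> e) *\<^sub>R dirderiv e g (f x))" if "x \<in> U" for x
    proof -
      have g: "g differentiable at (f x)" and f: "f differentiable at x"
        using Suc.prems assms(4) that by auto
      show ?thesis using dirderiv_compose[OF f g] dirderiv_Basis[OF g] by metis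
    qed
    ultimately show ?thesis
      by (subst diff_order_on_cong[OF assms(1)]) auto
  qed
  moreover have "(\<lambda>x. g (f x)) differentiable at x" if "x \<in> U" for x
  proof -
    have "g differentiable at (f x)" "f differentiable at x"
      using Suc.prems assms(4) that by auto
    then show ?thesis using differentiable_chain_at[of f x g] by (simp add: o_def)
  qed
  ultimately show ?case by simp
qed

lemma smooth_on_cong:
  "open U \<Longrightarrow> (\<And>x. x \<in> U \<Longrightarrow> f x = g x) \<Longrightarrow> smooth_on U f \<longleftrightarrow> smooth_on U g"
  unfolding smooth_on_def using diff_order_on_cong by blast

lemma smooth_on_subset: "smooth_on U f \<Longrightarrow> V \<subseteq> U \<Longrightarrow> smooth_on V f"
  unfolding smooth_on_def using diff_order_on_subset by blast

lemma smooth_on_continuous: "smooth_on U f \<Longrightarrow> continuous_on U f"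
  unfolding smooth_on_def using diff_order_on_continuous by blast

lemma smooth_on_differentiable: "smooth_on U f \<Longrightarrow> x \<in> U \<Longrightarrow> f differentiable at x"
  unfolding smooth_on_def using diff_order_on.simps(2) by blast

lemma smooth_on_dirderiv: "smooth_on U f \<Longrightarrow> smooth_on U (dirderiv v f)"
  unfolding smooth_on_def using diff_order_on.simps(2) by blast

lemma smooth_onI:
  assumes "\<And>x. x \<in> U \<Longrightarrow> f differentiable at x" "\<And>v. smooth_on U (dirderiv v f)"
  shows "smooth_on U f"
proof -
  have "diff_order_on k U f" for k
  proof (cases k)
    case 0
    then show ?thesis using assms(1)
      by (auto intro!: differentiable_imp_continuous_on simp: differentiable_on_def differentiable_at_withinI)
  qed (use assms in \<open>auto simp: smooth_on_def\<close>)
  then show ?thesis by (simp add: smooth_on_def)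
qed

lemma smooth_on_const: "smooth_on U (\<lambda>x. c)"
  by (simp add: smooth_on_def diff_order_on_const)

lemma smooth_on_linear: "bounded_linear L \<Longrightarrow> smooth_on U L"
  by (simp add: smooth_on_def diff_order_on_linear)

lemma smooth_on_comp_linear:
  "open U \<Longrightarrow> bounded_linear L \<Longrightarrow> smooth_on U f \<Longrightarrow> smooth_on U (\<lambda>x. L (f x))"
  by (simp add: smooth_on_def diff_order_on_comp_linear)

lemma smooth_on_add: "open U \<Longrightarrow> smooth_on U f \<Longrightarrow> smooth_on U g \<Longrightarrow> smooth_on U (\<lambda>x. f x + g x)"
  by (simp add: smooth_on_def diff_order_on_add)

lemma smooth_on_minus: "open U \<Longrightarrow> smooth_on U f \<Longrightarrow> smooth_on U (\<lambda>x. - f x)"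
  by (rule smooth_on_comp_linear[OF _ bounded_linear_minus[OF bounded_linear_ident]])

lemma smooth_on_diff: "open U \<Longrightarrow> smooth_on U f \<Longrightarrow> smooth_on U g \<Longrightarrow> smooth_on U (\<lambda>x. f x - g x)"
  using smooth_on_add[OF _ _ smooth_on_minus, of U f g] by simp

lemma smooth_on_sum:
  "open U \<Longrightarrow> (\<And>i. i \<in> I \<Longrightarrow> smooth_on U (f i)) \<Longrightarrow> smooth_on U (\<lambda>x. \<Sum>i\<in>I. f i x)"
  by (simp add: smooth_on_def diff_order_on_sum)

lemma smooth_on_bilinear:
  "open U \<Longrightarrow> bounded_bilinear p \<Longrightarrow> smooth_on U f \<Longrightarrow> smooth_on U g \<Longrightarrow> smooth_on U (\<lambda>x. p (f x) (g x))"
  by (simp add: smooth_on_def diff_order_on_bilinear)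

lemmas smooth_on_mult = smooth_on_bilinear[OF _ bounded_bilinear_mult]
lemmas smooth_on_scaleR = smooth_on_bilinear[OF _ bounded_bilinear_scaleR]
lemmas smooth_on_inner = smooth_on_bilinear[OF _ bounded_bilinear_inner]

lemma smooth_on_compose:
  fixes g :: "'a::euclidean_space \<Rightarrow> 'b::real_normed_vector"
  shows "open U \<Longrightarrow> smooth_on V g \<Longrightarrow> smooth_on U f \<Longrightarrow> (\<And>x. x \<in> U \<Longrightarrow> f x \<in> V)
    \<Longrightarrow> smooth_on U (\<lambda>x. g (f x))"
  unfolding smooth_on_def using diff_order_on_compose by metis

lemma smooth_on_prod:
  fixes f :: "'i \<Rightarrow> 'a::real_normed_vector \<Rightarrow> real"
  shows "open U \<Longrightarrow> (\<And>i. i \<in> I \<Longrightarrow> smooth_on U (f i)) \<Longrightarrow> smooth_on U (\<lambda>x. \<Prod>i\<in>I. f i x)"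
  by (induction I rule: infinite_finite_induct) (auto simp: smooth_on_const intro!: smooth_on_mult)

lemma smooth_on_power:
  fixes f :: "'a::real_normed_vector \<Rightarrow> real"
  shows "open U \<Longrightarrow> smooth_on U f \<Longrightarrow> smooth_on U (\<lambda>x. f x ^ k)"
  by (induction k) (auto simp: smooth_on_const intro!: smooth_on_mult)

lemma smooth_on_vec_nth:
  fixes f :: "'a::real_normed_vector \<Rightarrow> 'b::real_normed_vector ^ 'n::finite"
  shows "open U \<Longrightarrow> smooth_on U f \<Longrightarrow> smooth_on U (\<lambda>x. f x $ i)"
  by (rule smooth_on_comp_linear[OF _ bounded_linear_vec_nth])

lemma bounded_linear_axis: "bounded_linear (axis i :: 'b::euclidean_space \<Rightarrow> 'b ^ 'n::finite)"
  by (rule linear_conv_bounded_linear[THEN iffD1])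
     (auto intro!: linearI simp: vec_eq_iff axis_def)

lemma smooth_on_vec_lambda:
  fixes f :: "'n::finite \<Rightarrow> 'a::real_normed_vector \<Rightarrow> 'b::euclidean_space"
  assumes "open U" "\<And>i. smooth_on U (f i)"
  shows "smooth_on U (\<lambda>x. \<chi> i. f i x)"
proof -
  have "(\<lambda>x. \<chi> i. f i x) = (\<lambda>x. \<Sum>i\<in>UNIV. axis i (f i x))"
    by (auto simp: fun_eq_iff vec_eq_iff axis_def)
  then show ?thesis
    using assms by (auto intro!: smooth_on_sum smooth_on_comp_linear[OF _ bounded_linear_axis])
qed

lemma smooth_on_Pair:
  assumes "open U" "smooth_on U f" "smooth_on U g"
  shows "smooth_on U (\<lambda>x. (f x, g x))"
proof -
  have "smooth_on U (\<lambda>x. (f x, 0) + (0, g x))"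
    using assms by (intro smooth_on_add smooth_on_comp_linear[where L = "\<lambda>y. (y, 0)"]
        smooth_on_comp_linear[where L = "\<lambda>y. (0, y)"] bounded_linear_intros)
  then show ?thesis by simp
qed

section \<open>Smoothness of elementary functions\<close>

lemma dirderiv_real:
  fixes f :: "real \<Rightarrow> real"
  assumes "(f has_real_derivative d) (at x)"
  shows "dirderiv v f x = v * d"
  using dirderiv_eqI[OF assms[unfolded has_field_derivative_def]] by simp

text \<open>\<open>dirderiv v\<close> multiplies the ordinary derivative by \<open>v\<close>, so
  \<open>exp\<close> alone does not reproduce itself. Induction on the order works for a whole
  family closed under differentiation, such as the multiples of \<open>exp\<close> or the
  combinations of \<open>sin\<close> and \<open>cos\<close>.\<close>

lemma smooth_on_real_diff_closed:
  fixes \<F> :: "(real \<Rightarrow> real) set"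
  assumes "open U"
    and "\<And>f x. f \<in> \<F> \<Longrightarrow> x \<in> U \<Longrightarrow> f differentiable at x"
    and "\<And>f v. f \<in> \<F> \<Longrightarrow> \<exists>g\<in>\<F>. \<forall>x\<in>U. dirderiv v f x = g x"
    and "f \<in> \<F>"
  shows "smooth_on U f"
proof -
  have "diff_order_on k U f" if "f \<in> \<F>" for k f
    using that
  proof (induction k arbitrary: f)
    case 0
    then show ?case using assms(2)
      by (auto intro!: differentiable_imp_continuous_on simp: differentiable_on_def differentiable_at_withinI)
  next
    case (Suc k)
    have "diff_order_on k U (dirderiv v f)" for v
    proof -
      obtain g where "g \<in> \<F>" "\<forall>x\<in>U. dirderiv v f x = g x" using assms(3) Suc.prems by blast
      then show ?thesis using Suc.IH diff_order_on_cong[OF assms(1)] by metis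
    qed
    then show ?case using assms(2) Suc.prems by auto
  qed
  then show ?thesis using assms(4) by (simp add: smooth_on_def)
qed

lemma smooth_on_exp: "smooth_on U (exp :: real \<Rightarrow> real)"
proof -
  have "smooth_on UNIV (exp :: real \<Rightarrow> real)"
  proof (rule smooth_on_real_diff_closed[where \<F> = "range (\<lambda>c x. c * exp x)"])
    show "exp \<in> range (\<lambda>c x. c * exp x :: real)" by (rule image_eqI[of _ _ 1]) auto
    fix f :: "real \<Rightarrow> real" assume "f \<in> range (\<lambda>c x. c * exp x)"
    then obtain c where f: "f = (\<lambda>x. c * exp x)" by blast
    have d: "(f has_real_derivative c * exp x) (at x)" for x
      unfolding f by (auto intro!: derivative_eq_intros)
    show "f differentiable at x" for x using d real_differentiable_def by blast
    show "\<exists>g\<in>range (\<lambda>c x. c * exp x). \<forall>x\<in>UNIV. dirderiv v f x = g x" for v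
      by (rule bexI[of _ "\<lambda>x. (v * c) * exp x"]) (auto simp: dirderiv_real[OF d])
  qed auto
  then show ?thesis by (rule smooth_on_subset) simp
qed

lemma smooth_on_sin_cos: "smooth_on U (sin :: real \<Rightarrow> real)" "smooth_on U (cos :: real \<Rightarrow> real)"
proof -
  define \<F> where "\<F> = {f. \<exists>c d. f = (\<lambda>x::real. c * sin x + d * cos x)}"
  have "smooth_on UNIV f" if "f \<in> \<F>" for f
  proof (rule smooth_on_real_diff_closed[where \<F> = \<F>, OF _ _ _ that])
    fix f :: "real \<Rightarrow> real" assume "f \<in> \<F>"
    then obtain c e where f: "f = (\<lambda>x. c * sin x + e * cos x)" unfolding \<F>_def by blast
    have d: "(f has_real_derivative c * cos x - e * sin x) (at x)" for x
      unfolding f by (auto intro!: derivative_eq_intros)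
    show "f differentiable at x" for x using d real_differentiable_def by blast
    show "\<exists>g\<in>\<F>. \<forall>x\<in>UNIV. dirderiv v f x = g x" for v
    proof (rule bexI)
      show "(\<lambda>x. (- (v * e)) * sin x + (v * c) * cos x) \<in> \<F>" unfolding \<F>_def by blast
    qed (auto simp: dirderiv_real[OF d] algebra_simps)
  qed auto
  moreover have "(sin :: real \<Rightarrow> real) = (\<lambda>x. 1 * sin x + 0 * cos x)"
    "(cos :: real \<Rightarrow> real) = (\<lambda>x. 0 * sin x + 1 * cos x)" by auto
  then have "sin \<in> \<F>" "cos \<in> \<F>" unfolding \<F>_def by blast+
  ultimately show "smooth_on U (sin :: real \<Rightarrow> real)" "smooth_on U (cos :: real \<Rightarrow> real)"
    using smooth_on_subset[OF _ subset_UNIV] by blast+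
qed

lemma smooth_on_inverse: "smooth_on {x::real. x \<noteq> 0} inverse"
proof -
  have "open {x::real. x \<noteq> 0}" by (simp add: open_Collect_neq)
  then show ?thesis
  proof (rule smooth_on_real_diff_closed[where \<F> = "{f. \<exists>c k. f = (\<lambda>x::real. c * inverse x ^ k)}"])
    show "inverse \<in> {f. \<exists>c k. f = (\<lambda>x::real. c * inverse x ^ k)}" by (auto intro!: exI[of _ 1])
    fix f :: "real \<Rightarrow> real" assume "f \<in> {f. \<exists>c k. f = (\<lambda>x::real. c * inverse x ^ k)}"
    then obtain c k where f: "f = (\<lambda>x. c * inverse x ^ k)" by blast
    have d: "(f has_real_derivative (- (c * real k)) * inverse x ^ Suc k) (at x)" if "x \<noteq> 0" for x
    proof (cases k)
      case 0 then show ?thesis unfolding f by simp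
    next
      case (Suc j)
      show ?thesis unfolding f Suc
        by (rule DERIV_cong[OF DERIV_cmult[OF DERIV_power[OF DERIV_inverse[OF that]]]]) simp
    qed
    show "f differentiable at x" if "x \<in> {x. x \<noteq> 0}" for x
      using d that real_differentiable_def by blast
    show "\<exists>g\<in>{f. \<exists>c k. f = (\<lambda>x::real. c * inverse x ^ k)}. \<forall>x\<in>{x. x \<noteq> 0}. dirderiv v f x = g x" for v
    proof (rule bexI)
      show "(\<lambda>x. (v * (- (c * real k))) * inverse x ^ Suc k) \<in> {f. \<exists>c k. f = (\<lambda>x::real. c * inverse x ^ k)}"
        by blast
    qed (auto simp: dirderiv_real[OF d])
  qed
qed

lemma smooth_on_ln: "smooth_on {x::real. 0 < x} ln"
proof (rule smooth_onI)
  fix x :: real assume "x \<in> {x. 0 < x}"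
  then show "ln differentiable at x"
    using DERIV_ln real_differentiable_def by auto
next
  fix v :: real
  have o: "open {x::real. 0 < x}" by (simp add: open_Collect_less)
  have "smooth_on {x::real. 0 < x} (\<lambda>x. v * inverse x)"
    using o by (intro smooth_on_mult smooth_on_const) (auto intro: smooth_on_subset[OF smooth_on_inverse])
  then show "smooth_on {x::real. 0 < x} (dirderiv v ln)"
    by (subst smooth_on_cong[OF o]) (auto simp: dirderiv_real[OF DERIV_ln])
qed

lemma smooth_on_divide:
  fixes f g :: "'a::real_normed_vector \<Rightarrow> real"
  assumes "open U" "smooth_on U f" "smooth_on U g" "\<And>x. x \<in> U \<Longrightarrow> g x \<noteq> 0"
  shows "smooth_on U (\<lambda>x. f x / g x)"
  unfolding divide_inverse
  by (intro smooth_on_mult smooth_on_compose[OF _ smooth_on_inverse] assms) (use assms in auto)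

lemma smooth_on_exp_comp:
  fixes f :: "'a::real_normed_vector \<Rightarrow> real"
  shows "open U \<Longrightarrow> smooth_on U f \<Longrightarrow> smooth_on U (\<lambda>x. exp (f x))"
  by (rule smooth_on_compose[OF _ smooth_on_exp[of UNIV]]) auto

lemma smooth_on_ln_comp:
  fixes f :: "'a::real_normed_vector \<Rightarrow> real"
  shows "open U \<Longrightarrow> smooth_on U f \<Longrightarrow> (\<And>x. x \<in> U \<Longrightarrow> 0 < f x) \<Longrightarrow> smooth_on U (\<lambda>x. ln (f x))"
  by (rule smooth_on_compose[OF _ smooth_on_ln]) auto

lemma smooth_on_sqrt:
  fixes f :: "'a::real_normed_vector \<Rightarrow> real"
  assumes "open U" "smooth_on U f" "\<And>x. x \<in> U \<Longrightarrow> 0 < f x"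
  shows "smooth_on U (\<lambda>x. sqrt (f x))"
proof -
  have "smooth_on U (\<lambda>x. exp ((1 / 2) * ln (f x)))"
    by (intro smooth_on_exp_comp smooth_on_mult smooth_on_const smooth_on_ln_comp assms)
  moreover have "exp ((1 / 2) * ln (f x)) = sqrt (f x)" if "x \<in> U" for x
    using assms(3)[OF that] by (simp add: powr_half_sqrt[symmetric] powr_def)
  ultimately show ?thesis using smooth_on_cong[OF assms(1)] by (metis (mono_tags, lifting))
qed

subsection \<open>Symmetry of second derivatives\<close>

lemma has_real_derivative_along_line:
  fixes f :: "'a::real_normed_vector \<Rightarrow> real"
  assumes "f differentiable at (p + t *\<^sub>R v)"
  shows "((\<lambda>t. f (p + t *\<^sub>R v)) has_real_derivative dirderiv v f (p + t *\<^sub>R v)) (at t)"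
proof -
  have "((\<lambda>t. f (p + t *\<^sub>R v)) has_derivative (\<lambda>s. dirderiv (s *\<^sub>R v) f (p + t *\<^sub>R v))) (at t)"
    by (rule has_derivative_compose[where g = f and f = "\<lambda>t. p + t *\<^sub>R v", OF _ has_derivative_dirderiv[OF assms]])
       (auto intro!: derivative_eq_intros)
  moreover have "dirderiv (s *\<^sub>R v) f (p + t *\<^sub>R v) = dirderiv v f (p + t *\<^sub>R v) * s" for s
    using linear_scale[OF linear_dirderiv[OF assms]] by simp
  ultimately show ?thesis unfolding has_field_derivative_def by simp
qed

text \<open>Two applications of the mean value theorem. The second difference on the left is
  symmetric in \<open>v\<close> and \<open>w\<close>, so carrying this out in both orders compares
  the two mixed derivatives at nearby points.\<close>

lemma second_difference_mvt:
  fixes f :: "'a::real_normed_vector \<Rightarrow> real"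
  assumes "0 < s"
    and d1: "\<And>\<xi> \<eta>. 0 \<le> \<xi> \<Longrightarrow> \<xi> \<le> s \<Longrightarrow> 0 \<le> \<eta> \<Longrightarrow> \<eta> \<le> s \<Longrightarrow> f differentiable at (x + \<xi> *\<^sub>R v + \<eta> *\<^sub>R w)"
    and d2: "\<And>\<xi> \<eta>. 0 \<le> \<xi> \<Longrightarrow> \<xi> \<le> s \<Longrightarrow> 0 \<le> \<eta> \<Longrightarrow> \<eta> \<le> s \<Longrightarrow>
      dirderiv v f differentiable at (x + \<xi> *\<^sub>R v + \<eta> *\<^sub>R w)"
  shows "\<exists>\<xi> \<eta>. 0 < \<xi> \<and> \<xi> < s \<and> 0 < \<eta> \<and> \<eta> < s \<and>
    f (x + s *\<^sub>R v + s *\<^sub>R w) - f (x + s *\<^sub>R v) - f (x + s *\<^sub>R w) + f x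
      = s * s * dirderiv w (dirderiv v f) (x + \<xi> *\<^sub>R v + \<eta> *\<^sub>R w)"
proof -
  define \<phi> where "\<phi> t = f ((x + s *\<^sub>R w) + t *\<^sub>R v) - f (x + t *\<^sub>R v)" for t
  have D: "(\<phi> has_real_derivative
      dirderiv v f ((x + s *\<^sub>R w) + t *\<^sub>R v) - dirderiv v f (x + t *\<^sub>R v)) (at t)"
    if "0 \<le> t" "t \<le> s" for t
    unfolding \<phi>_def
  proof (intro DERIV_diff has_real_derivative_along_line)
    show "f differentiable at (x + s *\<^sub>R w + t *\<^sub>R v)"
      using d1[of t s] that \<open>0 < s\<close> by (simp add: add.assoc add.commute[of "s *\<^sub>R w"])
    show "f differentiable at (x + t *\<^sub>R v)"
      using d1[OF that order_refl] \<open>0 < s\<close> by simp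
  qed
  obtain \<xi> where \<xi>: "0 < \<xi>" "\<xi> < s" "\<phi> s - \<phi> 0
      = (s - 0) * (dirderiv v f ((x + s *\<^sub>R w) + \<xi> *\<^sub>R v) - dirderiv v f (x + \<xi> *\<^sub>R v))"
    using MVT2[OF \<open>0 < s\<close> D] by auto
  have D': "((\<lambda>t. dirderiv v f ((x + \<xi> *\<^sub>R v) + t *\<^sub>R w)) has_real_derivative
      dirderiv w (dirderiv v f) ((x + \<xi> *\<^sub>R v) + t *\<^sub>R w)) (at t)" if "0 \<le> t" "t \<le> s" for t
    by (rule has_real_derivative_along_line) (use d2[of \<xi> t] \<xi> that in auto)
  obtain \<eta> where \<eta>: "0 < \<eta>" "\<eta> < s"
    "dirderiv v f ((x + \<xi> *\<^sub>R v) + s *\<^sub>R w) - dirderiv v f ((x + \<xi> *\<^sub>R v) + 0 *\<^sub>R w)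
      = (s - 0) * dirderiv w (dirderiv v f) ((x + \<xi> *\<^sub>R v) + \<eta> *\<^sub>R w)"
    using MVT2[OF \<open>0 < s\<close> D'] by auto
  have "f (x + s *\<^sub>R v + s *\<^sub>R w) - f (x + s *\<^sub>R v) - f (x + s *\<^sub>R w) + f x = \<phi> s - \<phi> 0"
    by (simp add: \<phi>_def algebra_simps)
  also have "\<dots> = s * s * dirderiv w (dirderiv v f) (x + \<xi> *\<^sub>R v + \<eta> *\<^sub>R w)"
    using \<xi>(3) \<eta>(3) by (simp add: algebra_simps)
  finally show ?thesis using \<xi> \<eta> by blast
qed

lemma dirderiv_commute_real:
  fixes f :: "'a::real_normed_vector \<Rightarrow> real"
  assumes U: "open U" "x \<in> U" and f: "smooth_on U f"
  shows "dirderiv w (dirderiv v f) x = dirderiv v (dirderiv w f) x"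
proof (rule ccontr)
  assume ne: "dirderiv w (dirderiv v f) x \<noteq> dirderiv v (dirderiv w f) x"
  let ?P = "dirderiv w (dirderiv v f)" and ?Q = "dirderiv v (dirderiv w f)"
  define e where "e = \<bar>?P x - ?Q x\<bar> / 2"
  have e: "e > 0" using ne by (simp add: e_def)
  have "isCont ?P x" "isCont ?Q x"
    using smooth_on_continuous[OF smooth_on_dirderiv[OF smooth_on_dirderiv[OF f]]] U
    by (auto simp: continuous_on_eq_continuous_at)
  then obtain d1 d2 where d: "d1 > 0" "\<And>y. dist y x < d1 \<Longrightarrow> dist (?P y) (?P x) < e"
      "d2 > 0" "\<And>y. dist y x < d2 \<Longrightarrow> dist (?Q y) (?Q x) < e"
    using e unfolding continuous_at_eps_delta by metis
  obtain d3 where d3: "d3 > 0" "ball x d3 \<subseteq> U" using U open_contains_ball by blast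
  define D where "D = min d1 (min d2 d3)"
  have D: "D > 0" using d d3 by (simp add: D_def)
  \<comment> \<open>Small enough that the closed parallelogram spanned by
    \<open>s *\<^sub>R v\<close> and \<open>s *\<^sub>R w\<close> stays within \<open>D / 2\<close>
    of \<open>x\<close>; the 1 keeps the denominator positive when both directions vanish.\<close>
  define s where "s = D / (2 * (norm v + norm w + 1))"
  have n: "norm v + norm w + 1 > 0" by (simp add: add_nonneg_pos)
  have s: "s > 0" using D n by (simp add: s_def)
  have near: "dist (x + \<xi> *\<^sub>R v + \<eta> *\<^sub>R w) x < D" if "0 \<le> \<xi>" "\<xi> \<le> s" "0 \<le> \<eta>" "\<eta> \<le> s" for \<xi> \<eta>
  proof -
    have "dist (x + \<xi> *\<^sub>R v + \<eta> *\<^sub>R w) x = norm (\<xi> *\<^sub>R v + \<eta> *\<^sub>R w)" by (simp add: dist_norm algebra_simps)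
    also have "\<dots> \<le> \<bar>\<xi>\<bar> * norm v + \<bar>\<eta>\<bar> * norm w" by (metis norm_scaleR norm_triangle_ineq)
    also have "\<dots> \<le> s * norm v + s * norm w" using that by (intro add_mono mult_right_mono) auto
    also have "\<dots> \<le> s * (norm v + norm w + 1)" using s by (simp add: algebra_simps)
    also have "\<dots> = D / 2" using n unfolding s_def by (simp add: field_simps)
    finally show ?thesis using D by simp
  qed
  have inU: "x + \<xi> *\<^sub>R v + \<eta> *\<^sub>R w \<in> U" if "0 \<le> \<xi>" "\<xi> \<le> s" "0 \<le> \<eta>" "\<eta> \<le> s" for \<xi> \<eta>
    using near[OF that] d3 by (auto simp: D_def dist_commute)
  obtain \<xi> \<eta> where a: "0 < \<xi>" "\<xi> < s" "0 < \<eta>" "\<eta> < s"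
    "f (x + s *\<^sub>R v + s *\<^sub>R w) - f (x + s *\<^sub>R v) - f (x + s *\<^sub>R w) + f x = s * s * ?P (x + \<xi> *\<^sub>R v + \<eta> *\<^sub>R w)"
    using second_difference_mvt[OF s, of f x v w] inU
      smooth_on_differentiable[OF f] smooth_on_differentiable[OF smooth_on_dirderiv[OF f]] by blast
  have inU': "x + \<xi> *\<^sub>R w + \<eta> *\<^sub>R v \<in> U" if "0 \<le> \<xi>" "\<xi> \<le> s" "0 \<le> \<eta>" "\<eta> \<le> s" for \<xi> \<eta>
    using inU[of \<eta> \<xi>] that by (simp add: algebra_simps)
  obtain \<xi>' \<eta>' where b: "0 < \<xi>'" "\<xi>' < s" "0 < \<eta>'" "\<eta>' < s"
    "f (x + s *\<^sub>R w + s *\<^sub>R v) - f (x + s *\<^sub>R w) - f (x + s *\<^sub>R v) + f x = s * s * ?Q (x + \<xi>' *\<^sub>R w + \<eta>' *\<^sub>R v)"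
    using second_difference_mvt[OF s, of f x w v] inU'
      smooth_on_differentiable[OF f] smooth_on_differentiable[OF smooth_on_dirderiv[OF f]] by blast
  have "f (x + s *\<^sub>R w + s *\<^sub>R v) = f (x + s *\<^sub>R v + s *\<^sub>R w)" by (simp add: algebra_simps)
  then have "?P (x + \<xi> *\<^sub>R v + \<eta> *\<^sub>R w) = ?Q (x + \<xi>' *\<^sub>R w + \<eta>' *\<^sub>R v)"
    using a(5) b(5) s by (smt (verit) mult_eq_0_iff mult_left_cancel)
  moreover have "dist (?P (x + \<xi> *\<^sub>R v + \<eta> *\<^sub>R w)) (?P x) < e"
    using near[of \<xi> \<eta>] a by (intro d) (auto simp: D_def)
  moreover have "dist (?Q (x + \<eta>' *\<^sub>R v + \<xi>' *\<^sub>R w)) (?Q x) < e"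
    using near[of \<eta>' \<xi>'] b by (intro d) (auto simp: D_def)
  then have "dist (?Q (x + \<xi>' *\<^sub>R w + \<eta>' *\<^sub>R v)) (?Q x) < e" by (simp add: algebra_simps)
  \<comment> \<open>The common value would lie within \<open>e\<close> of both mixed derivatives at
    \<open>x\<close>, whose distance is \<open>2 * e\<close>.\<close>
  ultimately show False unfolding dist_real_def e_def by (smt (verit) field_sum_of_halves)
qed

lemma dirderiv_commute:
  fixes f :: "'a::real_normed_vector \<Rightarrow> 'b::euclidean_space"
  assumes U: "open U" "x \<in> U" and f: "smooth_on U f"
  shows "dirderiv w (dirderiv v f) x = dirderiv v (dirderiv w f) x"
proof (rule euclidean_eqI)
  fix b :: 'b
  have *: "dirderiv w (dirderiv v f) x \<bullet> b = dirderiv w (dirderiv v (\<lambda>x. f x \<bullet> b)) x" for v w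
  proof -
    have "dirderiv w (dirderiv v (\<lambda>x. f x \<bullet> b)) x = dirderiv w (\<lambda>x. dirderiv v f x \<bullet> b) x"
      by (rule dirderiv_cong_open[OF U])
         (simp add: dirderiv_comp_linear[OF bounded_linear_inner_left] smooth_on_differentiable[OF f])
    also have "\<dots> = dirderiv w (dirderiv v f) x \<bullet> b"
      by (rule dirderiv_comp_linear[OF bounded_linear_inner_left])
         (rule smooth_on_differentiable[OF smooth_on_dirderiv[OF f] U(2)])
    finally show ?thesis by simp
  qed
  show "dirderiv w (dirderiv v f) x \<bullet> b = dirderiv v (dirderiv w f) x \<bullet> b"
    unfolding * by (rule dirderiv_commute_real[OF U])
      (rule smooth_on_comp_linear[OF U(1) bounded_linear_inner_left f])
qed

subsection \<open>Determinants and inverse matrices\<close>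

lemma smooth_on_det:
  fixes M :: "'a::real_normed_vector \<Rightarrow> real ^ 'n::finite ^ 'n"
  assumes "open U" "\<And>i j. smooth_on U (\<lambda>x. M x $ i $ j)"
  shows "smooth_on U (\<lambda>x. det (M x))"
  unfolding det_def using assms
  by (intro smooth_on_sum smooth_on_mult smooth_on_const smooth_on_prod) auto

lemma matrix_inv_mult:
  fixes M :: "real ^ 'n::finite ^ 'n"
  assumes "invertible M"
  shows "M ** matrix_inv M = mat 1" "matrix_inv M ** M = mat 1"
  using someI_ex[OF assms[unfolded invertible_def]] unfolding matrix_inv_def by auto

lemma matrix_inv_unique:
  fixes M :: "real ^ 'n::finite ^ 'n"
  assumes "M ** B = mat 1"
  shows "matrix_inv M = B"
proof -
  have i: "invertible M" using assms invertible_right_inverse by blast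
  have "matrix_inv M = matrix_inv M ** (M ** B)" by (simp add: assms)
  also have "\<dots> = B" by (simp add: matrix_mul_assoc matrix_inv_mult[OF i])
  finally show ?thesis .
qed

text \<open>Entries written as quotients of determinants visibly depend smoothly on the matrix,
  which gives \<open>smooth_on_matrix_inv\<close>.\<close>

lemma matrix_inv_cramer:
  fixes M :: "real ^ 'n::finite ^ 'n"
  assumes "det M \<noteq> 0"
  shows "matrix_inv M $ k $ l = det (\<chi> i j. if j = k then axis l 1 $ i else M $ i $ j) / det M"
proof -
  have i: "invertible M" using assms by (simp add: invertible_det_nz)
  have "M *v (matrix_inv M *v axis l 1) = axis l 1"
    by (simp add: matrix_vector_mul_assoc matrix_inv_mult[OF i])
  then have "matrix_inv M *v axis l 1
      = (\<chi> k. det (\<chi> i j. if j = k then axis l 1 $ i else M $ i $ j) / det M)"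
    using cramer[OF assms] by blast
  moreover have "(matrix_inv M *v axis l 1) $ k = matrix_inv M $ k $ l"
    by (simp add: matrix_vector_mult_basis column_def)
  ultimately show ?thesis by simp
qed

lemma smooth_on_matrix_inv:
  fixes M :: "'a::real_normed_vector \<Rightarrow> real ^ 'n::finite ^ 'n"
  assumes U: "open U" and M: "\<And>i j. smooth_on U (\<lambda>x. M x $ i $ j)" and d: "\<And>x. x \<in> U \<Longrightarrow> invertible (M x)"
  shows "smooth_on U (\<lambda>x. matrix_inv (M x) $ k $ l)"
proof -
  have nz: "det (M x) \<noteq> 0" if "x \<in> U" for x using d[OF that] by (simp add: invertible_det_nz)
  have "smooth_on U (\<lambda>x. det (\<chi> i j. if j = k then axis l 1 $ i else M x $ i $ j) / det (M x))"
  proof (intro smooth_on_divide[OF U] smooth_on_det[OF U] M nz)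
    show "smooth_on U (\<lambda>x. (\<chi> i j. if j = k then (axis l 1 :: real ^ 'n) $ i else M x $ i $ j) $ i $ j)" for i j
      using M by (cases "j = k") (simp_all add: smooth_on_const)
  qed
  then show ?thesis using nz by (subst smooth_on_cong[OF U]) (auto simp: matrix_inv_cramer)
qed

lemma smooth_on_matrix:
  fixes M :: "'a::real_normed_vector \<Rightarrow> real ^ 'n::finite ^ 'm::finite"
  assumes "open U"
  shows "smooth_on U M \<longleftrightarrow> (\<forall>i j. smooth_on U (\<lambda>x. M x $ i $ j))"
proof
  assume "\<forall>i j. smooth_on U (\<lambda>x. M x $ i $ j)"
  then have "smooth_on U (\<lambda>x. \<chi> i. \<chi> j. M x $ i $ j)"
    by (intro smooth_on_vec_lambda[OF assms]) auto
  then show "smooth_on U M" by simp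
qed (auto intro!: smooth_on_vec_nth[OF assms])

lemma dirderiv_nth:
  fixes f :: "'a::real_normed_vector \<Rightarrow> 'b::real_normed_vector ^ 'n::finite"
  assumes "f differentiable at x"
  shows "dirderiv v (\<lambda>x. f x $ i) x = dirderiv v f x $ i"
  by (rule dirderiv_comp_linear[OF bounded_linear_vec_nth assms])

text \<open>Jacobi's formula. Writing the derivative as \<open>N ** M x\<close> avoids the adjugate:
  row \<open>k\<close> of \<open>N ** M x\<close> is a combination of the rows of
  \<open>M x\<close>, and putting it in place of row \<open>k\<close> leaves only the multiple
  \<open>N $ k $ k\<close> of the determinant.\<close>

lemma dirderiv_det:
  fixes M :: "'a::real_normed_vector \<Rightarrow> real ^ 'n::finite ^ 'n"
  assumes "M differentiable at x" "dirderiv v M x = N ** M x"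
  shows "dirderiv v (\<lambda>x. det (M x)) x = trace N * det (M x)"
proof -
  have M: "(\<lambda>x. M x $ i $ j) differentiable at x" for i j
    using bounded_linear.has_derivative[OF bounded_linear_vec_nth
        bounded_linear.has_derivative[OF bounded_linear_vec_nth has_derivative_dirderiv[OF assms(1)]]]
    by (rule differentiableI)
  have dM: "dirderiv v (\<lambda>x. M x $ i $ j) x = (N ** M x) $ i $ j" for i j
  proof -
    have "(\<lambda>x. M x $ i) differentiable at x"
      using bounded_linear.has_derivative[OF bounded_linear_vec_nth has_derivative_dirderiv[OF assms(1)]]
      by (rule differentiableI)
    then show ?thesis by (simp add: dirderiv_nth assms)
  qed
  have row: "det (\<chi> i. if i = k then row k (N ** M x) else row i (M x)) = N $ k $ k * det (M x)" for k
  proof -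
    have "row k (N ** M x) = (\<Sum>i\<in>UNIV. (N $ k) $ i *s row i (M x))"
      by (simp add: vec_eq_iff row_def matrix_matrix_mult_def vector_scalar_mult_def)
    then show ?thesis using cramer_lemma_transpose[of k "N $ k" "M x"] by (simp only:)
  qed
  have "dirderiv v (\<lambda>x. det (M x)) x = (\<Sum>p\<in>{p. p permutes UNIV}. of_int (sign p) *
      (\<Sum>k\<in>UNIV. (N ** M x) $ k $ p k * (\<Prod>i\<in>UNIV - {k}. M x $ i $ p i)))"
  proof -
    have "((\<lambda>x. of_int (sign p) * (\<Prod>i\<in>UNIV. M x $ i $ p i)) has_derivative
      (\<lambda>v. of_int (sign p) * (\<Sum>k\<in>UNIV. dirderiv v (\<lambda>x. M x $ k $ p k) x * (\<Prod>i\<in>UNIV - {k}. M x $ i $ p i)))) (at x)" for p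
      by (intro has_derivative_mult_right has_derivative_prod has_derivative_dirderiv M)
    then have "((\<lambda>x. det (M x)) has_derivative (\<lambda>v. \<Sum>p\<in>{p. p permutes UNIV}. of_int (sign p) *
      (\<Sum>k\<in>UNIV. dirderiv v (\<lambda>x. M x $ k $ p k) x * (\<Prod>i\<in>UNIV - {k}. M x $ i $ p i)))) (at x)"
      unfolding det_def by (intro has_derivative_sum)
    from dirderiv_eqI[OF this] show ?thesis by (simp add: dM)
  qed
  also have "\<dots> = (\<Sum>k\<in>UNIV. \<Sum>p\<in>{p. p permutes UNIV}. of_int (sign p) *
      ((N ** M x) $ k $ p k * (\<Prod>i\<in>UNIV - {k}. M x $ i $ p i)))"
    by (subst sum.swap) (simp add: sum_distrib_left)
  also have "\<dots> = (\<Sum>k\<in>UNIV. det (\<chi> i. if i = k then row k (N ** M x) else row i (M x)))"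
  proof (rule sum.cong[OF refl])
    fix k :: 'n
    have "(\<Prod>i\<in>UNIV. (\<chi> i. if i = k then row k (N ** M x) else row i (M x)) $ i $ p i)
        = (N ** M x) $ k $ p k * (\<Prod>i\<in>UNIV - {k}. M x $ i $ p i)" for p
      by (subst prod.remove[of UNIV k]) (auto simp: row_def intro!: prod.cong)
    then show "(\<Sum>p\<in>{p. p permutes UNIV}. of_int (sign p) *
      ((N ** M x) $ k $ p k * (\<Prod>i\<in>UNIV - {k}. M x $ i $ p i)))
      = det (\<chi> i. if i = k then row k (N ** M x) else row i (M x))"
      unfolding det_def by simp
  qed
  also have "\<dots> = trace N * det (M x)" by (simp add: row trace_def sum_distrib_right)
  finally show ?thesis .
qed

subsection \<open>Parametric integrals and the relative Poincare lemma\<close>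

text \<open>Differentiation under the integral sign. The derivative is packed as a bounded linear
  map because \<open>leibniz_rule\<close> asks for continuity in the operator norm, which in finite
  dimension reduces to continuity on basis vectors.\<close>

lemma leibniz_rule_dirderiv:
  fixes G :: "('a::euclidean_space \<times> real) \<Rightarrow> real"
  assumes W: "open W" and G: "smooth_on W G" and sub: "\<And>x t. x \<in> U \<Longrightarrow> t \<in> {0..1} \<Longrightarrow> (x, t) \<in> W"
    and U: "open U" "x0 \<in> U"
  shows "((\<lambda>x. integral {0..1} (\<lambda>t. G (x, t))) has_derivative
    (\<lambda>v. integral {0..1} (\<lambda>t. dirderiv (v, 0) G (x0, t)))) (at x0)"
proof -
  obtain r where r: "r > 0" "ball x0 r \<subseteq> U" using U open_contains_ball by blast
  define fx where "fx x t = Blinfun (\<lambda>v. dirderiv (v, 0) G (x, t))" for x t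
  have hd: "((\<lambda>x. G (x, t)) has_derivative (\<lambda>v. dirderiv (v, 0) G (x, t))) (at x)"
    if "(x, t) \<in> W" for x t
    by (rule has_derivative_compose[where f = "\<lambda>x. (x, t)",
          OF _ has_derivative_dirderiv[OF smooth_on_differentiable[OF G that]]])
       (auto intro!: derivative_eq_intros)
  have fx: "blinfun_apply (fx x t) = (\<lambda>v. dirderiv (v, 0) G (x, t))" if "(x, t) \<in> W" for x t
    unfolding fx_def by (rule bounded_linear_Blinfun_apply) (rule has_derivative_bounded_linear[OF hd[OF that]])
  have cG: "continuous_on S (\<lambda>z. dirderiv w G z)" if "S \<subseteq> W" for S w
    using smooth_on_continuous[OF smooth_on_dirderiv[OF G]] that by (rule continuous_on_subset)
  have sub': "ball x0 r \<times> {0..1} \<subseteq> W" using sub r by auto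
  have cfx: "continuous_on (ball x0 r \<times> cbox 0 1) (\<lambda>(x, t). fx x t)"
  proof (rule continuous_on_blinfun_componentwise)
    fix i :: 'a
    have "continuous_on (ball x0 r \<times> cbox 0 1) (dirderiv (i, 0) G)"
      by (rule cG) (use sub' in simp)
    then show "continuous_on (ball x0 r \<times> cbox 0 1) (\<lambda>z. blinfun_apply (case z of (x, t) \<Rightarrow> fx x t) i)"
      by (rule continuous_on_eq) (use sub' fx in auto)
  qed
  have int: "(\<lambda>t. G (x, t)) integrable_on cbox 0 1" if "x \<in> ball x0 r" for x
  proof (rule integrable_continuous)
    show "continuous_on (cbox 0 1) (\<lambda>t. G (x, t))"
      by (rule continuous_on_compose2[OF smooth_on_continuous[OF G]])
         (use sub' that in \<open>auto intro!: continuous_intros\<close>)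
  qed
  have "((\<lambda>x. integral (cbox 0 1) (\<lambda>t. G (x, t))) has_derivative
      blinfun_apply (integral (cbox 0 1) (fx x0))) (at x0 within ball x0 r)"
  proof (rule leibniz_rule[OF _ int cfx])
    show "((\<lambda>x. G (x, t)) has_derivative blinfun_apply (fx x t)) (at x within ball x0 r)"
      if "x \<in> ball x0 r" "t \<in> cbox 0 1" for x t
    proof -
      have "(x, t) \<in> W" using that sub' by auto
      then show ?thesis using hd fx by (metis has_derivative_at_withinI)
    qed
  qed (use r in auto)
  then have main: "((\<lambda>x. integral {0..1} (\<lambda>t. G (x, t))) has_derivative
      blinfun_apply (integral (cbox 0 1) (fx x0))) (at x0)"
    using r by (simp add: at_within_open[of x0 "ball x0 r"])
  have "fx x0 integrable_on cbox 0 1"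
    by (rule integrable_continuous)
       (rule continuous_on_compose2[OF cfx, where f = "\<lambda>t. (x0, t)", simplified],
        use r in \<open>auto intro!: continuous_intros\<close>)
  then have "blinfun_apply (integral (cbox 0 1) (fx x0)) v = integral (cbox 0 1) (\<lambda>t. blinfun_apply (fx x0 t) v)" for v
    by (rule blinfun_apply_integral)
  moreover have "integral (cbox 0 1) (\<lambda>t. blinfun_apply (fx x0 t) v) = integral {0..1} (\<lambda>t. dirderiv (v, 0) G (x0, t))" for v
    unfolding cbox_interval by (rule integral_cong) (use fx[of x0] sub'[THEN subsetD] r in simp)
  ultimately have "blinfun_apply (integral (cbox 0 1) (fx x0)) = (\<lambda>v. integral {0..1} (\<lambda>t. dirderiv (v, 0) G (x0, t)))"
    by auto
  with main show ?thesis by simp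
qed

text \<open>Each derivative is again a parametric integral, with a partial derivative of
  \<open>G\<close> as integrand, so the induction closes once \<open>G\<close> is
  generalised.\<close>

lemma smooth_on_parametric_integral:
  fixes G :: "('a::euclidean_space \<times> real) \<Rightarrow> real"
  assumes W: "open W" and G: "smooth_on W G" and sub: "\<And>x t. x \<in> U \<Longrightarrow> t \<in> {0..1} \<Longrightarrow> (x, t) \<in> W"
    and U: "open U"
  shows "smooth_on U (\<lambda>x. integral {0..1} (\<lambda>t. G (x, t)))"
proof -
  have "diff_order_on k U (\<lambda>x. integral {0..1} (\<lambda>t. G (x, t)))" if "smooth_on W G"
    for k and G :: "'a \<times> real \<Rightarrow> real"
    using that
  proof (induction k arbitrary: G)
    case (0 G)
    have "continuous_on U (\<lambda>x. integral {0..1} (\<lambda>t. G (x, t)))"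
      by (rule has_derivative_continuous_on)
         (rule has_derivative_at_withinI[OF leibniz_rule_dirderiv[where U = U, OF W 0 sub U]])
    then show ?case by simp
  next
    case (Suc k G)
    note d = leibniz_rule_dirderiv[where U = U, OF W Suc.prems sub U]
    have "diff_order_on k U (dirderiv v (\<lambda>x. integral {0..1} (\<lambda>t. G (x, t))))" for v
      by (subst diff_order_on_cong[OF U dirderiv_eqI[OF d]])
         (auto intro!: Suc.IH smooth_on_dirderiv Suc.prems)
    then show ?case using d by (auto intro: differentiableI)
  qed
  then show ?thesis using G by (simp add: smooth_on_def)
qed

text \<open>The homotopy of the Poincare lemma contracts only the coordinates in \<open>I\<close>
  and keeps the others as parameters. Hence closedness along the slices is enough, and the potential
  is still smooth in all variables.\<close>

lemma relative_poincare:
  fixes \<mu> :: "real ^ 'n::finite \<Rightarrow> real ^ 'n" and I :: "'n set"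
  assumes r: "r > 0" and \<mu>: "smooth_on (ball x0 r) \<mu>"
    and closed: "\<And>x i j. x \<in> ball x0 r \<Longrightarrow> i \<in> I \<Longrightarrow> j \<in> I \<Longrightarrow>
      dirderiv (axis i 1) \<mu> x $ j = dirderiv (axis j 1) \<mu> x $ i"
  shows "\<exists>f. smooth_on (ball x0 r) f \<and> (\<forall>x\<in>ball x0 r. \<forall>i\<in>I. dirderiv (axis i 1) f x = \<mu> x $ i)"
proof -
  define P :: "real ^ 'n \<Rightarrow> real ^ 'n" where "P z = (\<chi> i. if i \<in> I then z $ i else 0)" for z
  have P: "linear P" by (auto intro!: linearI simp: P_def vec_eq_iff)
  then have bP: "bounded_linear P" by (simp add: linear_conv_bounded_linear)
  define \<gamma> where "\<gamma> z = fst z - (1 - snd z) *\<^sub>R P (fst z - x0)" for z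
  define W where "W = \<gamma> -` ball x0 r"
  define G where "G z = \<mu> (\<gamma> z) \<bullet> P (fst z - x0)" for z
  have sP: "smooth_on UNIV (\<lambda>z::(real ^ 'n) \<times> real. P (fst z - x0))"
    by (intro smooth_on_comp_linear[OF _ bP] smooth_on_diff smooth_on_const
        smooth_on_linear[OF bounded_linear_fst]) auto
  have s\<gamma>: "smooth_on UNIV \<gamma>"
    unfolding \<gamma>_def by (intro smooth_on_diff smooth_on_scaleR smooth_on_const sP
        smooth_on_linear[OF bounded_linear_fst] smooth_on_linear[OF bounded_linear_snd]) auto
  have W: "open W" unfolding W_def
    by (rule open_vimage) (use smooth_on_continuous[OF s\<gamma>] in auto)
  have sub: "(x, t) \<in> W" if "x \<in> ball x0 r" "t \<in> {0..1}" for x t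
  proof -
    \<comment> \<open>No coordinate of \<open>x - x0\<close> grows under the partial contraction, so
      the path stays in the ball whatever \<open>I\<close> is.\<close>
    have "norm (\<gamma> (x, t) - x0) \<le> norm (x - x0)"
    proof (rule norm_le_componentwise_cart)
      fix i show "norm ((\<gamma> (x, t) - x0) $ i) \<le> norm ((x - x0) $ i)"
      proof (cases "i \<in> I")
        case True
        then have "(\<gamma> (x, t) - x0) $ i = t * (x - x0) $ i" by (simp add: \<gamma>_def P_def algebra_simps)
        then show ?thesis using that(2) by (simp add: abs_mult mult_left_le_one_le)
      qed (simp add: \<gamma>_def P_def)
    qed
    then show ?thesis using that by (auto simp: W_def dist_norm norm_minus_commute)
  qed
  have G: "smooth_on W G" unfolding G_def
    by (intro smooth_on_inner[OF W] smooth_on_compose[OF W \<mu>])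
       (use smooth_on_subset[OF s\<gamma>] smooth_on_subset[OF sP] in \<open>auto simp: W_def\<close>)
  define f where "f x = integral {0..1} (\<lambda>t. G (x, t))" for x
  show ?thesis
  proof (intro exI[of _ f] conjI ballI)
    show "smooth_on (ball x0 r) f"
      unfolding f_def using smooth_on_parametric_integral[OF W G sub] by blast
    fix x i assume x: "x \<in> ball x0 r" and i: "i \<in> I"
    have Pa: "P (axis i 1) = axis i 1" using i by (auto simp: P_def vec_eq_iff axis_def)
    define q where "q = P (x - x0)"
    have \<gamma>b: "\<gamma> (x, t) \<in> ball x0 r" if "t \<in> {0..1}" for t using sub[OF x that] by (simp add: W_def)
    have \<mu>d: "\<mu> differentiable at (\<gamma> (x, t))" if "t \<in> {0..1}" for t
      by (rule smooth_on_differentiable[OF \<mu> \<gamma>b[OF that]])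
    \<comment> \<open>Closedness along the slice turns the derivative of the integrand into the
      \<open>t\<close>-derivative of \<open>t * \<mu> (\<gamma> (x, t)) $ i\<close>, so its integral
      over the unit interval is \<open>\<mu> x $ i\<close>.\<close>
    have dG: "dirderiv (axis i 1, 0) G (x, t) = t * (dirderiv q \<mu> (\<gamma> (x, t)) $ i) + \<mu> (\<gamma> (x, t)) $ i"
      if t: "t \<in> {0..1}" for t
    proof -
      have "(\<gamma> has_derivative (\<lambda>h. fst h - ((1 - t) *\<^sub>R P (fst h) - snd h *\<^sub>R q))) (at (x, t))"
        unfolding \<gamma>_def q_def
        by (auto intro!: derivative_eq_intros bounded_linear.has_derivative[OF bP] simp: algebra_simps)
      from has_derivative_compose[OF this has_derivative_dirderiv[OF \<mu>d[OF t]]]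
      have "((\<lambda>z. \<mu> (\<gamma> z)) has_derivative
        (\<lambda>h. dirderiv (fst h - ((1 - t) *\<^sub>R P (fst h) - snd h *\<^sub>R q)) \<mu> (\<gamma> (x, t)))) (at (x, t))" .
      moreover have "((\<lambda>z. P (fst z - x0)) has_derivative (\<lambda>h. P (fst h))) (at (x, t))"
        by (auto intro!: derivative_eq_intros bounded_linear.has_derivative[OF bP])
      ultimately have "(G has_derivative (\<lambda>h. \<mu> (\<gamma> (x, t)) \<bullet> P (fst h) +
          dirderiv (fst h - ((1 - t) *\<^sub>R P (fst h) - snd h *\<^sub>R q)) \<mu> (\<gamma> (x, t)) \<bullet> q)) (at (x, t))"
        unfolding G_def q_def using has_derivative_inner by fastforce
      from dirderiv_eqI[OF this, of "(axis i 1, 0)"]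
      have "dirderiv (axis i 1, 0) G (x, t) = \<mu> (\<gamma> (x, t)) $ i
          + dirderiv (t *\<^sub>R axis i 1) \<mu> (\<gamma> (x, t)) \<bullet> q"
        by (simp add: Pa inner_axis algebra_simps)
      also have "dirderiv (t *\<^sub>R axis i 1) \<mu> (\<gamma> (x, t)) = t *\<^sub>R dirderiv (axis i 1) \<mu> (\<gamma> (x, t))"
        by (rule linear_scale[OF linear_dirderiv[OF \<mu>d[OF t]]])
      also have "(t *\<^sub>R dirderiv (axis i 1) \<mu> (\<gamma> (x, t))) \<bullet> q
          = t * (\<Sum>j\<in>UNIV. dirderiv (axis i 1) \<mu> (\<gamma> (x, t)) $ j * q $ j)"
        by (simp add: inner_vec_def sum_distrib_left mult.assoc)
      also have "(\<Sum>j\<in>UNIV. dirderiv (axis i 1) \<mu> (\<gamma> (x, t)) $ j * q $ j)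
          = (\<Sum>j\<in>UNIV. q $ j * dirderiv (axis j 1) \<mu> (\<gamma> (x, t)) $ i)"
      proof (rule sum.cong[OF refl])
        fix j show "dirderiv (axis i 1) \<mu> (\<gamma> (x, t)) $ j * q $ j = q $ j * dirderiv (axis j 1) \<mu> (\<gamma> (x, t)) $ i"
        proof (cases "j \<in> I")
          case True then show ?thesis using closed[OF \<gamma>b[OF t] i True] by simp
        qed (simp add: q_def P_def)
      qed
      also have "\<dots> = dirderiv q \<mu> (\<gamma> (x, t)) $ i"
        by (subst (2) dirderiv_axis[OF \<mu>d[OF t]]) (simp add: sum_component)
      finally show ?thesis by simp
    qed
    have "((\<lambda>t. t * \<mu> (\<gamma> (x, t)) $ i) has_vector_derivative dirderiv (axis i 1, 0) G (x, t)) (at t within {0..1})"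
      if t: "t \<in> {0..1}" for t
    proof -
      have "((\<lambda>t. \<gamma> (x, t)) has_derivative (\<lambda>h. h *\<^sub>R q)) (at t)"
        unfolding \<gamma>_def q_def by (auto intro!: derivative_eq_intros simp: algebra_simps)
      from has_derivative_compose[OF this has_derivative_dirderiv[OF \<mu>d[OF t]]]
      have "((\<lambda>t. \<mu> (\<gamma> (x, t)) $ i) has_derivative (\<lambda>h. dirderiv (h *\<^sub>R q) \<mu> (\<gamma> (x, t)) $ i)) (at t)"
        by (rule bounded_linear.has_derivative[OF bounded_linear_vec_nth])
      moreover have "dirderiv (h *\<^sub>R q) \<mu> (\<gamma> (x, t)) $ i = h * dirderiv q \<mu> (\<gamma> (x, t)) $ i" for h
        using linear_scale[OF linear_dirderiv[OF \<mu>d[OF t]]] by simp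
      ultimately have "((\<lambda>t. \<mu> (\<gamma> (x, t)) $ i) has_derivative (\<lambda>h. h * dirderiv q \<mu> (\<gamma> (x, t)) $ i)) (at t)"
        by simp
      from has_derivative_mult[OF has_derivative_ident this]
      have "((\<lambda>t. t * \<mu> (\<gamma> (x, t)) $ i) has_vector_derivative dirderiv (axis i 1, 0) G (x, t)) (at t)"
        unfolding has_vector_derivative_def dG[OF t] by (simp add: algebra_simps)
      then show ?thesis by (rule has_vector_derivative_at_within)
    qed
    then have "((\<lambda>t. dirderiv (axis i 1, 0) G (x, t)) has_integral
        (1 * \<mu> (\<gamma> (x, 1)) $ i - 0 * \<mu> (\<gamma> (x, 0)) $ i)) {0..1}"
      by (intro fundamental_theorem_of_calculus) auto
    then have "integral {0..1} (\<lambda>t. dirderiv (axis i 1, 0) G (x, t)) = \<mu> x $ i"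
      by (simp add: integral_unique \<gamma>_def)
    then show "dirderiv (axis i 1) f x = \<mu> x $ i"
      unfolding f_def using dirderiv_eqI[OF leibniz_rule_dirderiv[where U = "ball x0 r", OF W G sub _ x]] by simp
  qed
qed

subsection \<open>Smooth local inverses\<close>

lemma dirderiv_matrix:
  fixes f :: "real ^ 'n::finite \<Rightarrow> real ^ 'm::finite"
  assumes "f differentiable at x"
  shows "dirderiv v f x = matrix (\<lambda>v. dirderiv v f x) *v v"
proof -
  have "Vector_Spaces.linear (*s) (*s) (\<lambda>v. dirderiv v f x)"
    using linear_dirderiv[OF assms] linear_matrix_vector_mul_eq by blast
  from matrix_works[OF this] show ?thesis by simp
qed

text \<open>The inverse function theorem yields a differentiable \<open>g\<close> whose derivative
  is \<open>matrix_inv (J (g y))\<close>. This expression is differentiable as often as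
  \<open>g\<close> itself, so the order of \<open>g\<close> can be raised one step at a
  time.\<close>

lemma smooth_local_inverse:
  fixes f :: "real ^ 'n::finite \<Rightarrow> real ^ 'n"
  assumes U: "open U" "x0 \<in> U" and f: "smooth_on U f"
    and inv: "invertible (matrix (\<lambda>v. dirderiv v f x0))"
  obtains U' V g where "open U'" "U' \<subseteq> U" "x0 \<in> U'" "open V" "f x0 \<in> V" "homeomorphism U' V f g"
    "smooth_on V g"
proof -
  define J where "J x = matrix (\<lambda>v. dirderiv v f x)" for x
  have J: "smooth_on U (\<lambda>x. J x $ i $ j)" for i j
  proof -
    have "(\<lambda>x. J x $ i $ j) = (\<lambda>x. dirderiv (axis j 1) f x $ i)" by (simp add: J_def matrix_def)
    then show ?thesis using smooth_on_vec_nth[OF U(1) smooth_on_dirderiv[OF f]] by simp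
  qed
  define U1 where "U1 = {x \<in> U. det (J x) \<noteq> 0}"
  have "continuous_on U (\<lambda>x. det (J x))" by (rule smooth_on_continuous[OF smooth_on_det[OF U(1) J]])
  from continuous_open_preimage[OF this U(1), of "- {0}"]
  have U1: "open U1" by (auto simp: U1_def vimage_def Int_def)
  have x0: "x0 \<in> U1" using U inv by (simp add: U1_def J_def invertible_det_nz)
  have U1U: "U1 \<subseteq> U" by (auto simp: U1_def)
  have J1: "smooth_on U1 (\<lambda>x. J x $ i $ j)" for i j by (rule smooth_on_subset[OF J U1U])
  have Ji: "invertible (J x)" if "x \<in> U1" for x using that by (simp add: U1_def invertible_det_nz)
  have fd: "f differentiable at x" if "x \<in> U1" for x
    using smooth_on_differentiable[OF f] that U1U by blast
  define f' where "f' x = Blinfun (\<lambda>v. dirderiv v f x)" for x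
  have f': "blinfun_apply (f' x) = (\<lambda>v. dirderiv v f x)" if "x \<in> U1" for x
    unfolding f'_def
    by (rule bounded_linear_Blinfun_apply) (rule has_derivative_bounded_linear[OF has_derivative_dirderiv[OF fd[OF that]]])
  have d: "(f has_derivative blinfun_apply (f' x)) (at x)" if "x \<in> U1" for x
    using has_derivative_dirderiv[OF fd[OF that]] f'[OF that] by simp
  have c: "continuous_on U1 f'"
  proof (rule continuous_on_blinfun_componentwise)
    fix i :: "real ^ 'n"
    have "continuous_on U1 (dirderiv i f)"
      by (rule continuous_on_subset[OF smooth_on_continuous[OF smooth_on_dirderiv[OF f]] U1U])
    then show "continuous_on U1 (\<lambda>x. blinfun_apply (f' x) i)"
      by (rule continuous_on_eq) (simp add: f')
  qed
  define invf where "invf = Blinfun (\<lambda>v. matrix_inv (J x0) *v v)"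
  have bl: "bounded_linear (\<lambda>v. matrix_inv (J x0) *v v)"
    by (rule matrix_vector_mul_bounded_linear)
  have "invf o\<^sub>L f' x0 = id_blinfun"
  proof (rule blinfun_eqI)
    fix v
    have "blinfun_apply (invf o\<^sub>L f' x0) v = matrix_inv (J x0) *v dirderiv v f x0"
      by (simp add: f'[OF x0] invf_def bounded_linear_Blinfun_apply[OF bl])
    also have "\<dots> = (matrix_inv (J x0) ** J x0) *v v"
      unfolding dirderiv_matrix[OF fd[OF x0], of v] by (simp add: J_def matrix_vector_mul_assoc)
    finally show "blinfun_apply (invf o\<^sub>L f' x0) v = blinfun_apply id_blinfun v"
      by (simp add: matrix_inv_mult[OF Ji[OF x0]])
  qed
  from inverse_function_theorem[OF U1 d c x0 this]
  obtain U' V g g' where *: "open U'" "U' \<subseteq> U1" "x0 \<in> U'" "open V" "f x0 \<in> V" "homeomorphism U' V f g"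
    "\<And>y. y \<in> V \<Longrightarrow> (g has_derivative (g' y)) (at y)"
    "\<And>y. y \<in> V \<Longrightarrow> g' y = inv (blinfun_apply (f' (g y)))"
    "\<And>y. y \<in> V \<Longrightarrow> bij (blinfun_apply (f' (g y)))" by metis
  have gV: "g y \<in> U1" if "y \<in> V" for y using *(2,6) that by (auto simp: homeomorphism_def)
  have dg: "dirderiv v g y = matrix_inv (J (g y)) *v v" if "y \<in> V" for v y
  proof -
    have "dirderiv v g y = inv (blinfun_apply (f' (g y))) v"
      using dirderiv_eqI[OF *(7)[OF that]] *(8)[OF that] by simp
    moreover have "blinfun_apply (f' (g y)) (matrix_inv (J (g y)) *v v) = v"
      unfolding f'[OF gV[OF that]] dirderiv_matrix[OF fd[OF gV[OF that]], of "matrix_inv (J (g y)) *v v"]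
      by (simp add: J_def[symmetric] matrix_vector_mul_assoc matrix_inv_mult[OF Ji[OF gV[OF that]]])
    ultimately show ?thesis using *(9)[OF that] by (metis bij_inv_eq_iff)
  qed
  have gd: "g differentiable at y" if "y \<in> V" for y using *(7)[OF that] by (rule differentiableI)
  have "diff_order_on k V g" for k
  proof (induction k)
    case 0
    then show ?case using *(6) by (simp add: homeomorphism_def)
  next
    case (Suc k)
    have "diff_order_on k V (dirderiv v g)" for v
    proof (subst diff_order_on_cong[OF *(4) dg])
      have "smooth_on U1 (\<lambda>x. matrix_inv (J x) *v v)"
        unfolding matrix_vector_mult_def
        by (intro smooth_on_vec_lambda smooth_on_sum smooth_on_mult smooth_on_const
            smooth_on_matrix_inv U1 J1 Ji)
      then have "diff_order_on k U1 (\<lambda>x. matrix_inv (J x) *v v)" by (simp add: smooth_on_def)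
      then show "diff_order_on k V (\<lambda>y. matrix_inv (J (g y)) *v v)"
        by (rule diff_order_on_compose[OF *(4) _ Suc.IH gV])
    qed auto
    then show ?case using gd by simp
  qed
  then have "smooth_on V g" by (simp add: smooth_on_def)
  with *(1-6) U1U show thesis by (intro that[of U' V g]) auto
qed

subsection \<open>Homogeneity and the canonical nonlinear connection\<close>

lemma matrix_vector_axis: "((M :: real ^ 'n::finite ^ 'm) *v axis k 1) $ j = M $ j $ k"
  by (simp add: matrix_vector_mult_basis column_def)

lemma sum_axis_mult: "(\<Sum>i\<in>UNIV. axis k 1 $ i * f i) = (f k :: real)"
proof -
  have "axis k 1 $ i * f i = (if i = k then f i else 0)" for i by (simp add: axis_def)
  then show ?thesis by simp
qed

lemma dirderiv_vertical:
  fixes G :: "(real ^ 'n::finite) \<times> (real ^ 'n) \<Rightarrow> real"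
  assumes "G differentiable at z"
  shows "dirderiv (0, w) G z = (\<Sum>j\<in>UNIV. w $ j * dy j G z)"
proof -
  interpret linear "\<lambda>v. dirderiv v G z" by (rule linear_dirderiv[OF assms])
  have "(0, w) = (\<Sum>i\<in>UNIV. (w $ i) *\<^sub>R (0 :: real ^ 'n, axis i 1 :: real ^ 'n))"
    by (simp add: prod_eq_iff fst_sum snd_sum vec_eq_iff axis_def if_distrib cong: if_cong)
  then have "dirderiv (0, w) G z = dirderiv (\<Sum>i\<in>UNIV. (w $ i) *\<^sub>R (0 :: real ^ 'n, axis i 1 :: real ^ 'n)) G z"
    by simp
  also have "\<dots> = (\<Sum>j\<in>UNIV. w $ j * dy j G z)" by (simp only: sum scale dy_def real_scaleR_def)
  finally show ?thesis .
qed

lemma dirderiv_vertical_cong: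
  fixes G1 G2 :: "'a::real_normed_vector \<times> 'b::real_normed_vector \<Rightarrow> real"
  assumes "open Y" "y \<in> Y" "\<And>y. y \<in> Y \<Longrightarrow> G1 (x, y) = G2 (x, y)"
    "G1 differentiable at (x, y)" "G2 differentiable at (x, y)"
  shows "dirderiv (0, w) G1 (x, y) = dirderiv (0, w) G2 (x, y)"
proof -
  have *: "dirderiv w (\<lambda>y. G (x, y)) y = dirderiv (0, w) G (x, y)" if "G differentiable at (x, y)"
    for G :: "'a \<times> 'b \<Rightarrow> real"
    by (rule dirderiv_eqI, rule has_derivative_compose[where f = "\<lambda>y. (x, y)",
          OF _ has_derivative_dirderiv[OF that]]) (auto intro!: derivative_eq_intros)
  have "dirderiv w (\<lambda>y. G1 (x, y)) y = dirderiv w (\<lambda>y. G2 (x, y)) y"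
    by (rule dirderiv_cong_open[OF assms(1,2)]) (rule assms(3))
  then show ?thesis by (simp only: *[OF assms(4)] *[OF assms(5)])
qed

text \<open>The homogeneity relation is differentiated along the linear map that scales
  \<open>y\<close> by \<open>r\<close>. The factor \<open>r\<close> on the vertical part of the
  direction is what lowers the degree by one in \<open>homogeneous_vertical\<close>.\<close>

lemma homogeneous_dirderiv:
  fixes G :: "(real ^ 'n::finite) \<times> (real ^ 'n) \<Rightarrow> real"
  assumes D: "open D" and cone: "\<And>x y r. (x, y) \<in> D \<Longrightarrow> 0 < r \<Longrightarrow> (x, r *\<^sub>R y) \<in> D"
    and diff: "\<And>z. z \<in> D \<Longrightarrow> G differentiable at z"
    and hom: "\<And>x y r. (x, y) \<in> D \<Longrightarrow> 0 < r \<Longrightarrow> G (x, r *\<^sub>R y) = r ^ d * G (x, y)"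
    and z: "(x, y) \<in> D" and r: "0 < r"
  shows "dirderiv (v, r *\<^sub>R w) G (x, r *\<^sub>R y) = r ^ d * dirderiv (v, w) G (x, y)"
proof -
  have M: "((\<lambda>z. (fst z, r *\<^sub>R snd z)) has_derivative (\<lambda>h. (fst h, r *\<^sub>R snd h))) (at (x, y))"
    by (auto intro!: derivative_eq_intros)
  have "dirderiv (v, w) (\<lambda>z. G (fst z, r *\<^sub>R snd z)) (x, y) = dirderiv (v, r *\<^sub>R w) G (x, r *\<^sub>R y)"
    using dirderiv_eqI[OF has_derivative_compose[OF M has_derivative_dirderiv[of G]], of "(v, w)"]
      diff[OF cone[OF z r]] by simp
  moreover have "dirderiv (v, w) (\<lambda>z. G (fst z, r *\<^sub>R snd z)) (x, y) = dirderiv (v, w) (\<lambda>z. r ^ d * G z) (x, y)"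
    by (rule dirderiv_cong_open[OF D z]) (use hom r in auto)
  moreover have "dirderiv (v, w) (\<lambda>z. r ^ d * G z) (x, y) = r ^ d * dirderiv (v, w) G (x, y)"
    by (rule dirderiv_comp_linear[OF bounded_linear_mult_right diff[OF z]])
  ultimately show ?thesis by simp
qed

lemma homogeneous_horizontal:
  assumes "open D" "\<And>x y r. (x, y) \<in> D \<Longrightarrow> 0 < r \<Longrightarrow> (x, r *\<^sub>R y) \<in> D"
    "\<And>z. z \<in> D \<Longrightarrow> G differentiable at z"
    "\<And>x y r. (x, y) \<in> D \<Longrightarrow> 0 < r \<Longrightarrow> G (x, r *\<^sub>R y) = r ^ d * G (x, y)"
    "(x, y) \<in> D" "0 < r"
  shows "dx i G (x, r *\<^sub>R y) = r ^ d * dx i G (x, y)"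
  using homogeneous_dirderiv[OF assms, of "axis i 1" 0] by (simp add: dx_def)

lemma homogeneous_vertical:
  assumes "open D" "\<And>x y r. (x, y) \<in> D \<Longrightarrow> 0 < r \<Longrightarrow> (x, r *\<^sub>R y) \<in> D"
    "\<And>z. z \<in> D \<Longrightarrow> G differentiable at z"
    "\<And>x y r. (x, y) \<in> D \<Longrightarrow> 0 < r \<Longrightarrow> G (x, r *\<^sub>R y) = r ^ Suc d * G (x, y)"
    "(x, y) \<in> D" "0 < r"
  shows "dy i G (x, r *\<^sub>R y) = r ^ d * dy i G (x, y)"
proof -
  have "G differentiable at (x, r *\<^sub>R y)" using assms by blast
  from linear_scale[OF linear_dirderiv[OF this], of r "(0, axis i 1)"]
  have "dirderiv (0, r *\<^sub>R axis i 1) G (x, r *\<^sub>R y) = r * dy i G (x, r *\<^sub>R y)" by (simp add: dy_def)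
  moreover have "dirderiv (0, r *\<^sub>R axis i 1) G (x, r *\<^sub>R y) = r ^ Suc d * dy i G (x, y)"
    using homogeneous_dirderiv[OF assms, of 0 "axis i 1"] by (simp only: dy_def)
  ultimately have "r * dy i G (x, r *\<^sub>R y) = r * (r ^ d * dy i G (x, y))"
    by (simp only: power_Suc mult.assoc)
  then show ?thesis using assms(6) by (metis mult_left_cancel less_irrefl)
qed

lemma euler_homogeneous:
  fixes G :: "(real ^ 'n::finite) \<times> (real ^ 'n) \<Rightarrow> real"
  assumes diff: "G differentiable at (x, y)"
    and hom: "\<And>r. 0 < r \<Longrightarrow> G (x, r *\<^sub>R y) = r ^ d * G (x, y)"
  shows "(\<Sum>j\<in>UNIV. y $ j * dy j G (x, y)) = real d * G (x, y)"
proof -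
  have diff': "G differentiable at (x, 1 *\<^sub>R y)" using diff by simp
  have "((\<lambda>t. G (x, t *\<^sub>R y)) has_derivative (\<lambda>h. dirderiv (0, h *\<^sub>R y) G (x, 1 *\<^sub>R y))) (at 1)"
    by (rule has_derivative_compose[where f = "\<lambda>t. (x, t *\<^sub>R y)", OF _ has_derivative_dirderiv[OF diff']])
       (auto intro!: derivative_eq_intros)
  from dirderiv_eqI[OF this, of 1]
  have "dirderiv 1 (\<lambda>t. G (x, t *\<^sub>R y)) 1 = dirderiv (0, y) G (x, y)" by simp
  moreover have "dirderiv 1 (\<lambda>t. G (x, t *\<^sub>R y)) 1 = dirderiv 1 (\<lambda>t. t ^ d * G (x, y)) (1::real)"
    by (rule dirderiv_cong_open[of "{0<..}"]) (use hom in auto)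
  moreover have "((\<lambda>t. t ^ d * G (x, y)) has_real_derivative (real d * G (x, y))) (at 1)"
    by (auto intro!: derivative_eq_intros)
  then have "dirderiv 1 (\<lambda>t. t ^ d * G (x, y)) (1::real) = real d * G (x, y)"
    using dirderiv_real by fastforce
  ultimately show ?thesis using dirderiv_vertical[OF diff] by simp
qed

text \<open>A connection is encoded by the matrices \<open>G i\<close> with \<open>G i $ k $ j = \<Gamma>\<^sup>k\<^sub>i\<^sub>j\<close>.\<close>

locale local_finsler =
  fixes F :: "(real ^ 'n::finite) \<times> (real ^ 'n) \<Rightarrow> real" and D :: "((real ^ 'n) \<times> (real ^ 'n)) set"
  assumes D: "open D" and smooth: "smooth_on D F"
    and cone: "\<And>x y r. (x, y) \<in> D \<Longrightarrow> 0 < r \<Longrightarrow> (x, r *\<^sub>R y) \<in> D"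
    and hom: "\<And>x y r. (x, y) \<in> D \<Longrightarrow> 0 < r \<Longrightarrow> F (x, r *\<^sub>R y) = r * F (x, y)"
    and inv: "\<And>z. z \<in> D \<Longrightarrow> invertible (fundamental_tensor F z)"
begin

definition L where "L = (\<lambda>z. (F z)\<^sup>2)"

lemma smooth_L: "smooth_on D L"
  unfolding L_def by (rule smooth_on_power[OF D smooth])

lemma hom_L: "(x, y) \<in> D \<Longrightarrow> 0 < r \<Longrightarrow> L (x, r *\<^sub>R y) = r ^ 2 * L (x, y)"
  by (simp add: L_def hom power_mult_distrib)

lemma smooth_dx: "smooth_on D f \<Longrightarrow> smooth_on D (dx i f)"
  unfolding dx_def by (rule smooth_on_dirderiv)

lemma smooth_dy: "smooth_on D f \<Longrightarrow> smooth_on D (dy i f)"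
  unfolding dy_def by (rule smooth_on_dirderiv)

lemmas smooth_d = smooth_dx smooth_dy smooth_L
lemmas diff_at = smooth_on_differentiable

lemma dx_dy: "z \<in> D \<Longrightarrow> smooth_on D f \<Longrightarrow> dx i (dy j f) z = dy j (dx i f) z"
  unfolding dx_def dy_def by (rule dirderiv_commute_real[OF D])

lemma hom_dxL: "(x, y) \<in> D \<Longrightarrow> 0 < r \<Longrightarrow> dx i L (x, r *\<^sub>R y) = r ^ 2 * dx i L (x, y)"
  by (rule homogeneous_horizontal[OF D cone diff_at[OF smooth_L] hom_L])

lemma hom_dyL: "(x, y) \<in> D \<Longrightarrow> 0 < r \<Longrightarrow> dy i L (x, r *\<^sub>R y) = r ^ 1 * dy i L (x, y)"
  by (rule homogeneous_vertical[OF D cone diff_at[OF smooth_L]])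
     (simp_all add: hom_L numeral_2_eq_2)

lemma hom_dydyL: "(x, y) \<in> D \<Longrightarrow> 0 < r \<Longrightarrow> dy j (dy i L) (x, r *\<^sub>R y) = r ^ 0 * dy j (dy i L) (x, y)"
  by (rule homogeneous_vertical[OF D cone diff_at[OF smooth_dy[OF smooth_L]]])
     (simp_all add: hom_dyL)

lemma hom_dxdyL: "(x, y) \<in> D \<Longrightarrow> 0 < r \<Longrightarrow> dx j (dy i L) (x, r *\<^sub>R y) = r ^ 1 * dx j (dy i L) (x, y)"
  by (rule homogeneous_horizontal[OF D cone diff_at[OF smooth_dy[OF smooth_L]] hom_dyL])

lemma fundamental_tensor_L:
  assumes "z \<in> D"
  shows "fundamental_tensor F z $ i $ j = (1 / 2) * dy i (dy j L) z"
proof -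
  have 1: "dy j (\<lambda>z. (1 / 2) * (F z)\<^sup>2) z = (1 / 2) * dy j L z" if "z \<in> D" for z
    using dirderiv_comp_linear[OF bounded_linear_mult_right diff_at[OF smooth_L that], of "(0, axis j 1)" "1 / 2"]
    by (simp only: dy_def L_def)
  have "dy i (dy j (\<lambda>z. (1 / 2) * (F z)\<^sup>2)) z = dy i (\<lambda>z. (1 / 2) * dy j L z) z"
    unfolding dy_def[of i] by (rule dirderiv_cong_open[OF D assms 1])
  also have "\<dots> = (1 / 2) * dy i (dy j L) z"
    unfolding dy_def[of i]
    by (rule dirderiv_comp_linear[OF bounded_linear_mult_right diff_at[OF smooth_dy[OF smooth_L] assms]])
  finally show ?thesis by (simp add: fundamental_tensor_def)
qed

definition V where
  "V z = (\<chi> k. (\<Sum>l\<in>UNIV. snd z $ l * dx l (dy k L) z) - dx k L z)"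

text \<open>Four times the usual spray coefficients, whose \<open>y\<close>-derivatives are the
  coefficients of the nonlinear connection.\<close>

definition spray where "spray z = matrix_inv (fundamental_tensor F z) *v V z"

lemma nonlinear_conn_spray: "nonlinear_conn F j i z = (1 / 4) * dy i (\<lambda>z. spray z $ j) z"
  by (simp add: nonlinear_conn_def spray_def V_def matrix_vector_mult_def L_def)

lemma smooth_fundamental: "smooth_on D (\<lambda>z. fundamental_tensor F z $ i $ j)"
proof -
  have "smooth_on D (\<lambda>z. (1 / 2) * dy i (dy j L) z)"
    by (intro smooth_on_mult[OF D] smooth_on_const smooth_d)
  then show ?thesis by (subst smooth_on_cong[OF D fundamental_tensor_L])
qed

lemma smooth_snd: "smooth_on D (\<lambda>z. snd z $ l)"
  by (rule smooth_on_vec_nth[OF D smooth_on_linear[OF bounded_linear_snd]])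

lemma smooth_spray: "smooth_on D (\<lambda>z. spray z $ j)"
  unfolding spray_def matrix_vector_mult_def V_def vec_lambda_beta
  by (intro smooth_on_sum smooth_on_mult smooth_on_diff smooth_d D smooth_snd
      smooth_on_matrix_inv smooth_fundamental inv)

lemma fundamental_spray: "z \<in> D \<Longrightarrow> fundamental_tensor F z *v spray z = V z"
  by (simp add: spray_def matrix_vector_mul_assoc matrix_inv_mult inv)

lemma spray_eqI: "z \<in> D \<Longrightarrow> fundamental_tensor F z *v w = V z \<Longrightarrow> spray z = w"
  unfolding spray_def by (metis matrix_vector_mul_assoc matrix_inv_mult(2) inv matrix_vector_mul_lid)

lemma hom_spray:
  assumes "(x, y) \<in> D" "0 < r"
  shows "spray (x, r *\<^sub>R y) $ j = r ^ 2 * spray (x, y) $ j"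
proof -
  have 1: "fundamental_tensor F (x, r *\<^sub>R y) = fundamental_tensor F (x, y)"
    using assms cone by (simp add: vec_eq_iff fundamental_tensor_L hom_dydyL)
  have 2: "V (x, r *\<^sub>R y) = r ^ 2 *s V (x, y)"
    using assms by (simp add: V_def vec_eq_iff hom_dxdyL hom_dxL right_diff_distrib sum_distrib_left
        power2_eq_square mult_ac)
  show ?thesis unfolding spray_def 1 2 by (simp add: matrix_vector_mult_scaleR scalar_mult_eq_scaleR)
qed

lemma dy_quadratic:
  fixes G :: "'n \<Rightarrow> real ^ 'n ^ 'n"
  assumes sym: "\<And>i j k. G i $ k $ j = G j $ k $ i"
  shows "(\<lambda>z::(real ^ 'n) \<times> (real ^ 'n). \<Sum>i\<in>UNIV. snd z $ i * (G i *v snd z) $ j) differentiable at z"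
    "dy k (\<lambda>z::(real ^ 'n) \<times> (real ^ 'n). \<Sum>i\<in>UNIV. snd z $ i * (G i *v snd z) $ j) z = 2 * (G k *v snd z) $ j"
proof -
  have d: "((\<lambda>z::(real ^ 'n) \<times> (real ^ 'n). \<Sum>i\<in>UNIV. snd z $ i * (G i *v snd z) $ j) has_derivative
     (\<lambda>h. \<Sum>i\<in>UNIV. snd z $ i * (G i *v snd h) $ j + snd h $ i * (G i *v snd z) $ j)) (at z)"
    by (intro has_derivative_sum has_derivative_mult has_derivative_snd has_derivative_ident
        bounded_linear.has_derivative[OF bounded_linear_vec_nth]
        bounded_linear.has_derivative[OF matrix_vector_mul_bounded_linear])
  show "(\<lambda>z::(real ^ 'n) \<times> (real ^ 'n). \<Sum>i\<in>UNIV. snd z $ i * (G i *v snd z) $ j) differentiable at z"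
    by (rule differentiableI[OF d])
  have "dy k (\<lambda>z::(real ^ 'n) \<times> (real ^ 'n). \<Sum>i\<in>UNIV. snd z $ i * (G i *v snd z) $ j) z
      = (\<Sum>i\<in>UNIV. snd z $ i * G i $ j $ k) + (G k *v snd z) $ j"
    unfolding dy_def dirderiv_eqI[OF d] by (simp add: sum.distrib matrix_vector_axis sum_axis_mult)
  also have "(\<Sum>i\<in>UNIV. snd z $ i * G i $ j $ k) = (G k *v snd z) $ j"
    by (simp add: matrix_vector_mult_def sym[of _ j k] mult.commute)
  finally show "dy k (\<lambda>z::(real ^ 'n) \<times> (real ^ 'n). \<Sum>i\<in>UNIV. snd z $ i * (G i *v snd z) $ j) z
     = 2 * (G k *v snd z) $ j" by simp
qed

lemma vertical_fibre:
  assumes "(x, y) \<in> D"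
  shows "open {y. (x, y) \<in> D}" "y \<in> {y. (x, y) \<in> D}"
proof -
  have "{y. (x, y) \<in> D} = Pair x -` D" by auto
  moreover have "open (Pair x -` D)" by (rule open_vimage[OF D]) (auto intro!: continuous_intros)
  ultimately show "open {y. (x, y) \<in> D}" by simp
qed (use assms in simp)

text \<open>A Berwald connection preserves \<open>F\<^sup>2\<close>: since the spray is 2-homogeneous, Euler's relation gives
  \<open>spray\<^sup>j = 2 \<Gamma>\<^sup>j\<^sub>i\<^sub>k y\<^sup>i y\<^sup>k\<close>; contracting \<open>g * spray = V\<close> with \<open>y\<close> shows that \<open>F\<^sup>2\<close> is constant along the
  spray, and differentiating this along \<open>y\<^sup>k\<close> gives the claim.\<close>

lemma berwald_preserves:
  fixes G :: "'n \<Rightarrow> real ^ 'n ^ 'n"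
  assumes sym: "\<And>i j k. G i $ k $ j = G j $ k $ i"
    and N: "\<And>y k i. (x, y) \<in> D \<Longrightarrow> nonlinear_conn F k i (x, y) = (G i *v y) $ k"
    and z: "(x, y) \<in> D"
  shows "dx k L (x, y) = dirderiv (0, G k *v y) L (x, y)"
proof -
  define q where "q j z = (\<Sum>i\<in>UNIV. snd z $ i * (G i *v snd z) $ j)" for j and z :: "(real ^ 'n) \<times> (real ^ 'n)"
  note dq = dy_quadratic[OF sym, folded q_def]
  have S: "spray (x, y) $ j = 2 * q j (x, y)" if "(x, y) \<in> D" for y j
  proof -
    have "2 * spray (x, y) $ j = (\<Sum>i\<in>UNIV. y $ i * dy i (\<lambda>z. spray z $ j) (x, y))"
      using euler_homogeneous[OF diff_at[OF smooth_spray that] hom_spray[OF that]] by simp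
    also have "\<dots> = (\<Sum>i\<in>UNIV. y $ i * (4 * (G i *v y) $ j))"
      using N[OF that, unfolded nonlinear_conn_spray] by (intro sum.cong) (auto simp: field_simps)
    also have "\<dots> = 4 * q j (x, y)" by (simp add: q_def sum_distrib_left mult_ac)
    finally show ?thesis by simp
  qed
  have Vq: "V (x, y) $ k = (\<Sum>j\<in>UNIV. q j (x, y) * dy k (dy j L) (x, y))" if "(x, y) \<in> D" for y k
  proof -
    have "V (x, y) $ k = (fundamental_tensor F (x, y) *v spray (x, y)) $ k"
      by (simp add: fundamental_spray that)
    also have "\<dots> = (\<Sum>j\<in>UNIV. q j (x, y) * dy k (dy j L) (x, y))"
      by (simp add: matrix_vector_mult_def fundamental_tensor_L S that mult_ac)
    finally show ?thesis .
  qed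
  have E: "(\<Sum>l\<in>UNIV. y $ l * dx l L (x, y)) = (\<Sum>j\<in>UNIV. q j (x, y) * dy j L (x, y))" if "(x, y) \<in> D" for y
  proof -
    have "(\<Sum>k\<in>UNIV. y $ k * V (x, y) $ k)
        = (\<Sum>k\<in>UNIV. \<Sum>l\<in>UNIV. y $ k * (y $ l * dx l (dy k L) (x, y))) - (\<Sum>k\<in>UNIV. y $ k * dx k L (x, y))"
      by (simp add: V_def right_diff_distrib sum_subtractf sum_distrib_left)
    also have "(\<Sum>k\<in>UNIV. \<Sum>l\<in>UNIV. y $ k * (y $ l * dx l (dy k L) (x, y)))
        = (\<Sum>l\<in>UNIV. y $ l * (\<Sum>k\<in>UNIV. y $ k * dy k (dx l L) (x, y)))"
      by (subst sum.swap) (simp add: dx_dy that smooth_L sum_distrib_left mult_ac)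
    also have "\<dots> = (\<Sum>l\<in>UNIV. y $ l * (2 * dx l L (x, y)))"
      using euler_homogeneous[OF diff_at[OF smooth_dx[OF smooth_L] that] hom_dxL[OF that]] by simp
    finally have 1: "(\<Sum>k\<in>UNIV. y $ k * V (x, y) $ k) = (\<Sum>l\<in>UNIV. y $ l * dx l L (x, y))"
      by (simp add: sum_distrib_left[symmetric] mult.left_commute[of _ 2])
    have "(\<Sum>k\<in>UNIV. y $ k * V (x, y) $ k)
        = (\<Sum>j\<in>UNIV. q j (x, y) * (\<Sum>k\<in>UNIV. y $ k * dy k (dy j L) (x, y)))"
      unfolding Vq[OF that] sum_distrib_left by (subst sum.swap) (simp add: mult_ac)
    also have "\<dots> = (\<Sum>j\<in>UNIV. q j (x, y) * dy j L (x, y))"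
      using euler_homogeneous[OF diff_at[OF smooth_dy[OF smooth_L] that] hom_dyL[OF that]] by simp
    finally show ?thesis using 1 by simp
  qed
  note dxL = diff_at[OF smooth_dx[OF smooth_L] z] diff_at[OF smooth_dy[OF smooth_L] z] diff_at[OF smooth_L z]
  have sd: "(\<lambda>z::(real ^ 'n) \<times> (real ^ 'n). snd z $ l) differentiable at (x, y)" for l
    by (rule differentiableI[OF bounded_linear_imp_has_derivative[OF
            bounded_linear_compose[OF bounded_linear_vec_nth bounded_linear_snd]]])
  have dsd: "dirderiv (0, axis k 1) (\<lambda>z::(real ^ 'n) \<times> (real ^ 'n). snd z $ l) (x, y) = (if l = k then 1 else 0)" for l
    by (subst dirderiv_linear[OF bounded_linear_compose[OF bounded_linear_vec_nth bounded_linear_snd]])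
       (simp add: axis_def)
  have md: "(\<lambda>z. f z * g z) differentiable at (x, y)" if "f differentiable at (x, y)" "g differentiable at (x, y)"
    for f g :: "(real ^ 'n) \<times> (real ^ 'n) \<Rightarrow> real"
    by (rule differentiable_bilinear[OF bounded_bilinear_mult that])
  have "dy k (\<lambda>z. \<Sum>l\<in>UNIV. snd z $ l * dx l L z) (x, y) = dy k (\<lambda>z. \<Sum>j\<in>UNIV. q j z * dy j L z) (x, y)"
    unfolding dy_def[of k]
    by (rule dirderiv_vertical_cong[OF vertical_fibre[OF z]])
       (use E in \<open>auto intro!: differentiable_sum md sd dxL dq\<close>)
  moreover have "dy k (\<lambda>z. \<Sum>l\<in>UNIV. snd z $ l * dx l L z) (x, y)
      = (\<Sum>l\<in>UNIV. y $ l * dy k (dx l L) (x, y)) + dx k L (x, y)"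
    unfolding dy_def[of k]
    by (subst dirderiv_sum) (auto intro!: md sd dxL simp: dirderiv_mult[OF sd dxL(1)] dsd sum.distrib
        if_distrib[where f = "\<lambda>a. a * _"] cong: if_cong)
  moreover have "dy k (\<lambda>z. \<Sum>j\<in>UNIV. q j z * dy j L z) (x, y)
      = (\<Sum>j\<in>UNIV. q j (x, y) * dy k (dy j L) (x, y)) + (\<Sum>j\<in>UNIV. 2 * (G k *v y) $ j * dy j L (x, y))"
    unfolding dy_def[of k]
    by (subst dirderiv_sum) (auto intro!: md dxL dq simp: dirderiv_mult[OF dq(1) dxL(2)] dq(2)[unfolded dy_def] sum.distrib)
  moreover have "(\<Sum>l\<in>UNIV. y $ l * dy k (dx l L) (x, y)) - dx k L (x, y) = V (x, y) $ k"
    by (simp add: V_def dx_dy z smooth_L)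
  moreover note Vq[OF z, of k]
  ultimately have "2 * dx k L (x, y) = 2 * (\<Sum>j\<in>UNIV. (G k *v y) $ j * dy j L (x, y))"
    by (simp add: sum_distrib_left mult.assoc)
  then show ?thesis using dirderiv_vertical[OF dxL(3)] by simp
qed

text \<open>Converse of \<open>berwald_preserves\<close>. Differentiating the hypothesis in
  \<open>y\<close> and contracting with \<open>y\<close> shows that \<open>2 * q\<close> solves the
  linear system defining the spray, whose matrix is invertible. An open set \<open>Y\<close> of
  directions suffices because the connection takes one further vertical derivative only.\<close>

lemma preserves_berwald:
  fixes G :: "'n \<Rightarrow> real ^ 'n ^ 'n"
  assumes sym: "\<And>i j k. G i $ k $ j = G j $ k $ i"
    and Y: "open Y" "y \<in> Y" and YO: "\<And>y. y \<in> Y \<Longrightarrow> (x, y) \<in> D"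
    and pres: "\<And>y k. y \<in> Y \<Longrightarrow> dx k L (x, y) = dirderiv (0, G k *v y) L (x, y)"
  shows "nonlinear_conn F k i (x, y) = (G i *v y) $ k"
proof -
  define q where "q j z = (\<Sum>i\<in>UNIV. snd z $ i * (G i *v snd z) $ j)" for j and z :: "(real ^ 'n) \<times> (real ^ 'n)"
  note dq = dy_quadratic[OF sym, folded q_def]
  have S: "spray (x, y) = (\<chi> j. 2 * q j (x, y))" if yY: "y \<in> Y" for y
  proof (rule spray_eqI[OF YO[OF yY]])
    note z = YO[OF yY]
    note dL = diff_at[OF smooth_dx[OF smooth_L] z] diff_at[OF smooth_dy[OF smooth_L] z] diff_at[OF smooth_L z]
    have Gd: "((\<lambda>z::(real ^ 'n) \<times> (real ^ 'n). (G l *v snd z) $ j) has_derivative (\<lambda>h. (G l *v snd h) $ j)) (at (x, y))" for l j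
      by (intro bounded_linear.has_derivative[OF bounded_linear_vec_nth]
        bounded_linear.has_derivative[OF matrix_vector_mul_bounded_linear] has_derivative_snd has_derivative_ident)
    have md: "(\<lambda>z. (G l *v snd z) $ j * dy j L z) differentiable at (x, y)" for l j
      by (rule differentiable_bilinear[OF bounded_bilinear_mult differentiableI[OF Gd] dL(2)])
    have 1: "dy m (dx l L) (x, y) = (\<Sum>j\<in>UNIV. (G l *v y) $ j * dy m (dy j L) (x, y) + G l $ j $ m * dy j L (x, y))" for m l
    proof -
      have "dy m (dx l L) (x, y) = dy m (\<lambda>z. \<Sum>j\<in>UNIV. (G l *v snd z) $ j * dy j L z) (x, y)"
        unfolding dy_def[of m]
      proof (rule dirderiv_vertical_cong[OF Y(1) yY _ dL(1)])
        fix y assume "y \<in> Y"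
        then show "dx l L (x, y) = (\<Sum>j\<in>UNIV. (G l *v snd (x, y)) $ j * dy j L (x, y))"
          using pres dirderiv_vertical[OF diff_at[OF smooth_L YO]] by simp
      qed (auto intro!: differentiable_sum md)
      also have "\<dots> = (\<Sum>j\<in>UNIV. (G l *v y) $ j * dy m (dy j L) (x, y) + G l $ j $ m * dy j L (x, y))"
        unfolding dy_def[of m]
        by (subst dirderiv_sum[OF md]) (simp add: dirderiv_mult[OF differentiableI[OF Gd] dL(2)]
            dirderiv_eqI[OF Gd] matrix_vector_mult_basis column_def)
      finally show ?thesis .
    qed
    show "fundamental_tensor F (x, y) *v (\<chi> j. 2 * q j (x, y)) = V (x, y)"
    proof (subst vec_eq_iff, rule allI)
      fix m
      have "V (x, y) $ m = (\<Sum>l\<in>UNIV. y $ l * dy m (dx l L) (x, y)) - dx m L (x, y)"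
        by (simp add: V_def dx_dy z smooth_L)
      also have "(\<Sum>l\<in>UNIV. y $ l * dy m (dx l L) (x, y)) =
          (\<Sum>l\<in>UNIV. \<Sum>j\<in>UNIV. y $ l * (G l *v y) $ j * dy m (dy j L) (x, y)) +
          (\<Sum>l\<in>UNIV. \<Sum>j\<in>UNIV. y $ l * G l $ j $ m * dy j L (x, y))"
        by (simp add: 1 sum_distrib_left sum.distrib distrib_left mult_ac)
      \<comment> \<open>Symmetry of the coefficients turns this sum into the hypothesis at index
        \<open>m\<close>, which cancels the last term of \<open>V\<close>.\<close>
      also have "(\<Sum>l\<in>UNIV. \<Sum>j\<in>UNIV. y $ l * G l $ j $ m * dy j L (x, y)) = dx m L (x, y)"
        unfolding pres[OF yY] dirderiv_vertical[OF dL(3)]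
        by (subst sum.swap) (simp add: matrix_vector_mult_def sum_distrib_right sum_distrib_left sym[of _ _ m] mult_ac)
      also have "(\<Sum>l\<in>UNIV. \<Sum>j\<in>UNIV. y $ l * (G l *v y) $ j * dy m (dy j L) (x, y))
          = (\<Sum>j\<in>UNIV. q j (x, y) * dy m (dy j L) (x, y))"
        by (subst sum.swap) (simp add: q_def sum_distrib_right)
      finally show "(fundamental_tensor F (x, y) *v (\<chi> j. 2 * q j (x, y))) $ m = V (x, y) $ m"
        by (simp add: matrix_vector_mult_def fundamental_tensor_L z mult_ac)
    qed
  qed
  have "dy i (\<lambda>z. spray z $ k) (x, y) = dy i (\<lambda>z. 2 * q k z) (x, y)"
    unfolding dy_def[of i]
  proof (rule dirderiv_vertical_cong[OF Y])
    show "(\<lambda>z. 2 * q k z) differentiable at (x, y)"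
      using dq(1) by (rule differentiable_mult[OF differentiable_const])
  qed (use S diff_at[OF smooth_spray YO[OF Y(2)]] in auto)
  also have "\<dots> = 2 * (2 * (G i *v y) $ k)"
    using dirderiv_comp_linear[OF bounded_linear_mult_right dq(1)] dq(2) by (simp add: dy_def)
  finally show ?thesis by (simp add: nonlinear_conn_spray)
qed

end

section \<open>Curvature of an affine connection and its Finsler-Ricci tensor\<close>

definition riemann :: "('n::finite \<Rightarrow> real ^ 'n \<Rightarrow> real ^ 'n ^ 'n) \<Rightarrow> 'n \<Rightarrow> 'n \<Rightarrow> real ^ 'n \<Rightarrow> real ^ 'n ^ 'n" where
  "riemann G i j x = dirderiv (axis i 1) (G j) x - dirderiv (axis j 1) (G i) x + (G i x ** G j x - G j x ** G i x)"

text \<open>The upper index is contracted with the first form index, as in \<open>Ric\<close>; for a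
  general affine connection the result need not be symmetric.\<close>

definition ricci :: "('n::finite \<Rightarrow> real ^ 'n \<Rightarrow> real ^ 'n ^ 'n) \<Rightarrow> real ^ 'n \<Rightarrow> real ^ 'n ^ 'n" where
  "ricci G x = (\<chi> j l. \<Sum>i\<in>UNIV. riemann G i j x $ i $ l)"

lemma bounded_bilinear_matrix_vector: "bounded_bilinear ((*v) :: real ^ 'n ^ 'm \<Rightarrow> real ^ 'n \<Rightarrow> real ^ 'm)"
  by (rule bilinear_conv_bounded_bilinear[THEN iffD1])
     (auto simp: bilinear_def intro!: linearI simp: matrix_vector_mult_def vec_eq_iff
      algebra_simps sum.distrib sum_distrib_left)

text \<open>Connection coefficients linear in \<open>y\<close> have curvature linear in
  \<open>y\<close>, given by \<open>riemann\<close>. Hence \<open>Ric\<close> is the quadratic form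
  of \<open>ricci\<close>, and half of its vertical Hessian is the symmetrization.\<close>

lemma finsler_ricci_berwald:
  fixes F :: "(real ^ 'n::finite) \<times> (real ^ 'n) \<Rightarrow> real"
  assumes D: "open D" and X: "open X" "\<And>x y. (x, y) \<in> D \<Longrightarrow> x \<in> X"
    and G: "\<And>i. smooth_on X (G i)"
    and N: "\<And>x y k i. (x, y) \<in> D \<Longrightarrow> nonlinear_conn F k i (x, y) = (G i x *v y) $ k"
    and z: "(x, y) \<in> D"
  shows "finsler_ricci F i j (x, y) = (1 / 2) * (ricci G x $ i $ j + ricci G x $ j $ i)"
proof -
  have curv: "nonlinear_curvature F k i j (x, y) = (riemann G i j x *v y) $ k" if z: "(x, y) \<in> D" for x y i j k
  proof -
    have hd: "((\<lambda>z. (G j (fst z) *v snd z) $ k) has_derivative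
        (\<lambda>h. (G j x *v snd h + dirderiv (fst h) (G j) x *v y) $ k)) (at (x, y))" for j
    proof -
      have "((\<lambda>z. G j (fst z)) has_derivative (\<lambda>h. dirderiv (fst h) (G j) x)) (at (x, y))"
        by (rule has_derivative_compose[where f = fst and g = "G j", OF has_derivative_fst[OF has_derivative_ident]])
           (simp add: has_derivative_dirderiv[OF smooth_on_differentiable[OF G X(2)[OF z]]])
      from bounded_bilinear.FDERIV[OF bounded_bilinear_matrix_vector this has_derivative_snd[OF has_derivative_ident]]
      have "((\<lambda>z. G j (fst z) *v snd z) has_derivative
        (\<lambda>h. G j x *v snd h + dirderiv (fst h) (G j) x *v y)) (at (x, y))" by simp
      then show ?thesis by (rule bounded_linear.has_derivative[OF bounded_linear_vec_nth])
    qed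
    have dN: "dirderiv w (nonlinear_conn F k j) (x, y) = (G j x *v snd w + dirderiv (fst w) (G j) x *v y) $ k" for w j
    proof -
      have "dirderiv w (nonlinear_conn F k j) (x, y) = dirderiv w (\<lambda>z. (G j (fst z) *v snd z) $ k) (x, y)"
        by (rule dirderiv_cong_open[OF D z]) (use N in \<open>metis prod.collapse\<close>)
      then show ?thesis using dirderiv_eqI[OF hd] by simp
    qed
    have "horizontal_deriv F i (nonlinear_conn F k j) (x, y)
        = (dirderiv (axis i 1) (G j) x *v y) $ k - ((G j x ** G i x) *v y) $ k" for i j
    proof -
      \<comment> \<open>The vertical part of the horizontal derivative composes the two matrices;
        antisymmetrizing in \<open>i\<close> and \<open>j\<close> yields the commutator in
        \<open>riemann\<close>.\<close>
      have "(\<Sum>m\<in>UNIV. (G i x *v y) $ m * (G j x *v axis m 1) $ k) = (G j x *v (G i x *v y)) $ k"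
        unfolding matrix_vector_axis by (simp add: matrix_vector_mult_def[of "G j x"] mult.commute)
      moreover have "dirderiv 0 (G j) x = 0"
        using linear_0[OF linear_dirderiv[OF smooth_on_differentiable[OF G X(2)[OF z]]]] .
      ultimately show ?thesis
        by (simp add: horizontal_deriv_def dx_def dy_def dN N[OF z] matrix_vector_mul_assoc)
    qed
    then show ?thesis
      by (simp add: nonlinear_curvature_def riemann_def matrix_vector_mult_diff_rdistrib
          matrix_vector_mult_add_rdistrib)
  qed
  have Ric: "Ric F (x, y) = y \<bullet> (ricci G x *v y)" if "(x, y) \<in> D" for x y
  proof -
    have "Ric F (x, y) = (\<Sum>i\<in>UNIV. \<Sum>j\<in>UNIV. \<Sum>l\<in>UNIV. riemann G i j x $ i $ l * y $ l * y $ j)"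
      by (simp add: Ric_def curv[OF that] matrix_vector_mult_def sum_distrib_right)
    also have "\<dots> = (\<Sum>j\<in>UNIV. \<Sum>l\<in>UNIV. \<Sum>i\<in>UNIV. riemann G i j x $ i $ l * y $ l * y $ j)"
      by (subst sum.swap) (intro sum.cong refl sum.swap)
    also have "\<dots> = y \<bullet> (ricci G x *v y)"
      by (simp add: inner_vec_def matrix_vector_mult_def ricci_def sum_distrib_left sum_distrib_right mult_ac)
    finally show ?thesis .
  qed
  have sG: "smooth_on X (\<lambda>x. ricci G x $ j $ l)" for j l
  proof -
    have comp: "smooth_on X (\<lambda>x. G i x $ a $ b)" for i a b
      by (intro smooth_on_vec_nth[OF X(1)] G)
    have dcomp: "smooth_on X (\<lambda>x. dirderiv v (G i) x $ a $ b)" for v i a b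
      by (intro smooth_on_vec_nth[OF X(1)] smooth_on_dirderiv G)
    show ?thesis unfolding ricci_def riemann_def vec_lambda_beta matrix_matrix_mult_def
        vector_minus_component vector_add_component
      by (intro smooth_on_sum smooth_on_add smooth_on_diff smooth_on_mult comp dcomp X(1))
  qed
  then have sR: "smooth_on X (ricci G)" by (subst smooth_on_matrix[OF X(1)]) auto
  have sRO: "smooth_on D (\<lambda>z. ricci G (fst z))"
    by (rule smooth_on_compose[OF D sR smooth_on_linear[OF bounded_linear_fst]]) (use X in auto)
  have d: "((\<lambda>z. snd z \<bullet> (ricci G (fst z) *v snd z)) has_derivative
     (\<lambda>h. snd z \<bullet> (ricci G (fst z) *v snd h + dirderiv h (\<lambda>z. ricci G (fst z)) z *v snd z)
        + snd h \<bullet> (ricci G (fst z) *v snd z))) (at z)" if "z \<in> D" for z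
    by (intro has_derivative_inner bounded_bilinear.FDERIV[OF bounded_bilinear_matrix_vector]
        has_derivative_snd has_derivative_ident has_derivative_dirderiv smooth_on_differentiable[OF sRO that])
  have vert0: "dirderiv (0, w) (\<lambda>z. ricci G (fst z)) z = 0" if "z \<in> D" for z w
  proof -
    have "fst z \<in> X" using X(2)[of "fst z" "snd z"] that by simp
    from has_derivative_compose[where f = fst, OF has_derivative_fst[OF has_derivative_ident]
        has_derivative_dirderiv[OF smooth_on_differentiable[OF sR this]]]
    show ?thesis using dirderiv_eqI linear_0[OF linear_dirderiv[OF smooth_on_differentiable[OF sR \<open>fst z \<in> X\<close>]]]
      by fastforce
  qed
  have d1: "dy j (Ric F) z = (ricci G (fst z) *v snd z) $ j + (transpose (ricci G (fst z)) *v snd z) $ j"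
    if "z \<in> D" for z
  proof -
    have "dy j (Ric F) z = dy j (\<lambda>z. snd z \<bullet> (ricci G (fst z) *v snd z)) z"
      unfolding dy_def by (rule dirderiv_cong_open[OF D that]) (use Ric in \<open>metis prod.collapse\<close>)
    also have "\<dots> = snd z \<bullet> (ricci G (fst z) *v axis j 1) + axis j 1 \<bullet> (ricci G (fst z) *v snd z)"
      unfolding dy_def dirderiv_eqI[OF d[OF that]] vert0[OF that] by simp
    also have "\<dots> = (ricci G (fst z) *v snd z) $ j + (transpose (ricci G (fst z)) *v snd z) $ j"
      unfolding inner_axis' inner_vec_def[of "snd z"] matrix_vector_axis
      by (simp add: matrix_vector_mult_def transpose_def mult.commute)
    finally show ?thesis .
  qed
  have tr: "bounded_linear (transpose :: real ^ 'n ^ 'n \<Rightarrow> _)"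
    by (rule linear_conv_bounded_linear[THEN iffD1]) (auto intro!: linearI simp: transpose_def vec_eq_iff)
  have "((\<lambda>z. (ricci G (fst z) *v snd z) $ j + (transpose (ricci G (fst z)) *v snd z) $ j) has_derivative
     (\<lambda>h. (ricci G (fst (x, y)) *v snd h + dirderiv h (\<lambda>z. ricci G (fst z)) (x, y) *v snd (x, y)) $ j +
        (transpose (ricci G (fst (x, y))) *v snd h
         + transpose (dirderiv h (\<lambda>z. ricci G (fst z)) (x, y)) *v snd (x, y)) $ j)) (at (x, y))"
    by (intro has_derivative_add bounded_linear.has_derivative[OF bounded_linear_vec_nth]
        bounded_bilinear.FDERIV[OF bounded_bilinear_matrix_vector] bounded_linear.has_derivative[OF tr]
        has_derivative_snd has_derivative_ident has_derivative_dirderiv smooth_on_differentiable[OF sRO z])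
  from dirderiv_eqI[OF this, of "(0, axis i 1)"]
  have "dirderiv (0, axis i 1) (\<lambda>z. (ricci G (fst z) *v snd z) $ j + (transpose (ricci G (fst z)) *v snd z) $ j) (x, y)
     = ricci G x $ j $ i + ricci G x $ i $ j"
    by (simp add: vert0[OF z] matrix_vector_mult_basis column_def transpose_def)
       (simp add: matrix_vector_mult_def)
  moreover have "dy i (dy j (Ric F)) (x, y) = dirderiv (0, axis i 1)
      (\<lambda>z. (ricci G (fst z) *v snd z) $ j + (transpose (ricci G (fst z)) *v snd z) $ j) (x, y)"
    unfolding dy_def[of i] by (rule dirderiv_cong_open[OF D z d1])
  ultimately show ?thesis by (simp add: finsler_ricci_def)
qed

subsection \<open>Charts and tangent vectors\<close>

lemma is_chartI:
  assumes "open X" "open V" "homeomorphism X V f h"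
  shows "is_chart (X, f)" and "\<And>y. y \<in> V \<Longrightarrow> chart_inv (X, f) y = h y"
proof -
  have im: "f ` X = V" using assms(3) by (simp add: homeomorphism_def)
  have inv: "chart_inv (X, f) y = h y" if "y \<in> V" for y
    unfolding chart_inv_def using assms(3) that
    by (auto simp: homeomorphism_def intro!: inv_into_f_eq inj_on_inverseI[of _ h])
  then show "\<And>y. y \<in> V \<Longrightarrow> chart_inv (X, f) y = h y" .
  have "homeomorphism X V f (chart_inv (X, f))"
    using homeomorphism_cong[OF assms(3)] inv by auto
  then show "is_chart (X, f)" using assms im by (simp add: is_chart_def)
qed

locale smooth_manifold =
  fixes S :: "('m::{t2_space, second_countable_topology}, 'n::finite) chart set"
  assumes S: "smooth_structure S"
begin

lemma chart: "c \<in> S \<Longrightarrow> is_chart c"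
  using S by (simp add: smooth_structure_def)

lemma compatible: "c \<in> S \<Longrightarrow> d \<in> S \<Longrightarrow> smoothly_compatible c d"
  using S by (simp add: smooth_structure_def)

lemma maximal: "is_chart c \<Longrightarrow> (\<And>d. d \<in> S \<Longrightarrow> smoothly_compatible c d) \<Longrightarrow> c \<in> S"
  using S unfolding smooth_structure_def by blast

lemma covering: obtains c where "c \<in> S" "p \<in> fst c"
  using S unfolding smooth_structure_def by blast

lemma open_dom: "c \<in> S \<Longrightarrow> open (fst c)" and open_im: "c \<in> S \<Longrightarrow> open (chart_image c)"
  using chart by (auto simp: is_chart_def)

lemma hom_chart: "c \<in> S \<Longrightarrow> homeomorphism (fst c) (chart_image c) (snd c) (chart_inv c)"
  using chart by (auto simp: is_chart_def)

lemma chart_inv_chart [simp]: "c \<in> S \<Longrightarrow> p \<in> fst c \<Longrightarrow> chart_inv c (snd c p) = p"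
  using hom_chart by (auto simp: homeomorphism_def)

lemma chart_chart_inv [simp]: "c \<in> S \<Longrightarrow> x \<in> chart_image c \<Longrightarrow> snd c (chart_inv c x) = x"
  using hom_chart by (auto simp: homeomorphism_def)

lemma chart_inv_in: "c \<in> S \<Longrightarrow> x \<in> chart_image c \<Longrightarrow> chart_inv c x \<in> fst c"
  using hom_chart[of c] by (auto simp: homeomorphism_def)

lemma image_eq: "c \<in> S \<Longrightarrow> snd c ` (fst c \<inter> V) = {x \<in> chart_image c. chart_inv c x \<in> V}"
proof (intro set_eqI iffI)
  fix x assume c: "c \<in> S" and "x \<in> {x \<in> chart_image c. chart_inv c x \<in> V}"
  then have "chart_inv c x \<in> V" "x \<in> chart_image c" by auto
  then show "x \<in> snd c ` (fst c \<inter> V)"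
    using c by (intro image_eqI[of _ _ "chart_inv c x"]) (auto simp only: chart_inv_in chart_chart_inv IntI)
qed auto

lemma open_image: "c \<in> S \<Longrightarrow> open V \<Longrightarrow> open (snd c ` (fst c \<inter> V))"
  unfolding image_eq
  using continuous_open_preimage[OF _ open_im, of c "chart_inv c" V] hom_chart[of c]
  by (simp add: homeomorphism_def vimage_def Int_def)

lemma transition_smooth: "c \<in> S \<Longrightarrow> d \<in> S \<Longrightarrow> smooth_on (snd c ` (fst c \<inter> fst d)) (transition c d)"
  using compatible by (auto simp: smoothly_compatible_def)

lemma transition_diff:
  assumes "c \<in> S" "d \<in> S" "x \<in> chart_image c" "chart_inv c x \<in> fst d"
  shows "transition c d differentiable at x"
  by (rule smooth_on_differentiable[OF transition_smooth[OF assms(1,2)]])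
     (use assms image_eq in auto)

lemma transition_in:
  assumes "c \<in> S" "d \<in> S" "x \<in> chart_image c" "chart_inv c x \<in> fst d"
  shows "transition c d x \<in> chart_image d" "chart_inv d (transition c d x) = chart_inv c x"
  using assms by (auto simp: transition_def)

lemma transition_chain:
  assumes "c \<in> S" "d \<in> S" "e \<in> S" "x \<in> chart_image c" "chart_inv c x \<in> fst d" "chart_inv c x \<in> fst e"
  shows "dirderiv v (transition c e) x = dirderiv (dirderiv v (transition c d) x) (transition d e) (transition c d x)"
proof -
  have o: "open (snd c ` (fst c \<inter> fst d))" using open_image open_dom assms by auto
  have x: "x \<in> snd c ` (fst c \<inter> fst d)" using assms image_eq by auto
  have "dirderiv v (transition c e) x = dirderiv v (\<lambda>x. transition d e (transition c d x)) x"
    by (rule dirderiv_cong_open[OF o x]) (use assms in \<open>auto simp: transition_def\<close>)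
  also have "\<dots> = dirderiv (dirderiv v (transition c d) x) (transition d e) (transition c d x)"
    by (rule dirderiv_compose[OF transition_diff transition_diff]) (use assms transition_in in auto)
  finally show ?thesis .
qed

lemma transition_self:
  assumes "c \<in> S" "x \<in> chart_image c"
  shows "dirderiv v (transition c c) x = v"
proof -
  have "dirderiv v (transition c c) x = dirderiv v (\<lambda>x. x) x"
    by (rule dirderiv_cong_open[OF open_im[OF assms(1)] assms(2)]) (use assms in \<open>auto simp: transition_def\<close>)
  then show ?thesis by (simp add: dirderiv_def)
qed

lemma tvec_of_apply:
  "d \<in> S \<Longrightarrow> chart_inv c x \<in> fst d \<Longrightarrow> tvec_of S c x y d = dirderiv y (transition c d) x"
  "\<not> (d \<in> S \<and> chart_inv c x \<in> fst d) \<Longrightarrow> tvec_of S c x y d = 0"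
  by (auto simp: tvec_of_def dirderiv_def)

lemma tvec_of_self:
  "c \<in> S \<Longrightarrow> x \<in> chart_image c \<Longrightarrow> tvec_of S c x y c = y"
  by (simp add: tvec_of_apply chart_inv_in transition_self)

lemma tvec_of_transition:
  assumes "c \<in> S" "d \<in> S" "x \<in> chart_image c" "chart_inv c x \<in> fst d"
  shows "tvec_of S d (transition c d x) (dirderiv y (transition c d) x) = tvec_of S c x y"
proof
  fix e
  show "tvec_of S d (transition c d x) (dirderiv y (transition c d) x) e = tvec_of S c x y e"
    using transition_chain[OF assms(1,2) _ assms(3,4), of e] transition_in(2)[OF assms]
    by (cases "e \<in> S \<and> chart_inv c x \<in> fst e") (auto simp: tvec_of_apply)
qed

lemma bundle_point_transition:
  assumes "c \<in> S" "d \<in> S" "x \<in> chart_image c" "chart_inv c x \<in> fst d"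
  shows "bundle_point S d (transition c d x, dirderiv y (transition c d) x) = bundle_point S c (x, y)"
  using tvec_of_transition[OF assms] transition_in(2)[OF assms] by (simp add: bundle_point_def)

lemma bundle_coords_transition:
  assumes "c \<in> S" "d \<in> S" "x \<in> chart_image c" "chart_inv c x \<in> fst d"
  shows "(transition c d x, dirderiv y (transition c d) x) \<in> bundle_coords S A d \<longleftrightarrow> (x, y) \<in> bundle_coords S A c"
  using bundle_point_transition[OF assms] transition_in[OF assms] assms by (simp add: bundle_coords_def)

lemma tvec_of_in_tangent:
  assumes "c \<in> S" "x \<in> chart_image c"
  shows "tvec_of S c x y \<in> tangent_space S (chart_inv c x)"
proof -
  have "tvec_of S c x y e = frechet_derivative (transition d e) (at (snd d (chart_inv c x))) (tvec_of S c x y d)"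
    if "d \<in> S" "e \<in> S" "chart_inv c x \<in> fst d" "chart_inv c x \<in> fst e" for d e
    using transition_chain[OF assms(1) that(1,2) assms(2) that(3,4)] that
    by (simp add: tvec_of_apply dirderiv_def transition_def)
  then show ?thesis unfolding tangent_space_def
    by (intro CollectI conjI ballI impI allI) (blast, metis tvec_of_apply(2))
qed

lemma tangent_eq_tvec_of:
  assumes "c \<in> S" "p \<in> fst c" "v \<in> tangent_space S p"
  shows "v = tvec_of S c (snd c p) (v c)"
proof
  fix d show "v d = tvec_of S c (snd c p) (v c) d"
  proof (cases "d \<in> S \<and> p \<in> fst d")
    case True
    have "\<forall>c\<in>S. \<forall>d\<in>S. p \<in> fst c \<inter> fst d \<longrightarrow>
        v d = frechet_derivative (transition c d) (at (snd c p)) (v c)"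
      using assms(3) unfolding tangent_space_def by blast
    then have "v d = frechet_derivative (transition c d) (at (snd c p)) (v c)" using True assms by blast
    then show ?thesis using True assms(1,2) by (simp add: tvec_of_def)
  next
    case False
    then have "v d = 0" using assms(3) unfolding tangent_space_def by blast
    then show ?thesis using False assms(1,2) by (auto simp: tvec_of_def)
  qed
qed

lemma tvec_of_linear:
  assumes "c \<in> S" "x \<in> chart_image c"
  shows "tvec_of S c x (r *\<^sub>R y + s *\<^sub>R z) = (\<lambda>e. r *\<^sub>R tvec_of S c x y e + s *\<^sub>R tvec_of S c x z e)"
proof
  fix d show "tvec_of S c x (r *\<^sub>R y + s *\<^sub>R z) d = r *\<^sub>R tvec_of S c x y d + s *\<^sub>R tvec_of S c x z d"
  proof (cases "d \<in> S \<and> chart_inv c x \<in> fst d")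
    case True
    then have "linear (\<lambda>v. dirderiv v (transition c d) x)"
      using assms by (intro linear_dirderiv transition_diff) auto
    then interpret linear "\<lambda>v. dirderiv v (transition c d) x" .
    show ?thesis using True by (simp add: tvec_of_apply add scale)
  qed (auto simp: tvec_of_apply)
qed

lemma bundle_point_scale:
  assumes "c \<in> S" "x \<in> chart_image c"
  shows "bundle_point S c (x, r *\<^sub>R y) = (chart_inv c x, \<lambda>e. r *\<^sub>R tvec_of S c x y e)"
  using tvec_of_linear[OF assms, of r y 0 0] by (simp add: bundle_point_def)

lemma linear_on_tangent_tvec_of:
  assumes "c \<in> S" "x \<in> chart_image c" "linear_on_tangent S (chart_inv c x) l"
  shows "l (tvec_of S c x y) = (\<chi> i. l (tvec_of S c x (axis i 1))) \<bullet> y"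
proof -
  have lin: "linear (\<lambda>y. l (tvec_of S c x y))"
  proof (rule linearI)
    have *: "l (tvec_of S c x (r *\<^sub>R y + s *\<^sub>R z)) = r * l (tvec_of S c x y) + s * l (tvec_of S c x z)" for r s y z
      using assms(3) tvec_of_in_tangent[OF assms(1,2)]
      by (simp add: linear_on_tangent_def tvec_of_linear[OF assms(1,2)])
    show "l (tvec_of S c x (y + z)) = l (tvec_of S c x y) + l (tvec_of S c x z)" for y z
      using *[of 1 y 1 z] by simp
    show "l (tvec_of S c x (r *\<^sub>R y)) = r *\<^sub>R l (tvec_of S c x y)" for r y
      using *[of r y 0 0] by simp
  qed
  have "y = (\<Sum>i\<in>UNIV. (y $ i) *\<^sub>R axis i 1)"
    by (simp add: vec_eq_iff axis_def if_distrib cong: if_cong)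
  then have "l (tvec_of S c x y) = l (tvec_of S c x (\<Sum>i\<in>UNIV. (y $ i) *\<^sub>R axis i 1))" by simp
  also have "\<dots> = (\<Sum>i\<in>UNIV. y $ i * l (tvec_of S c x (axis i 1)))"
    by (simp add: linear_sum[OF lin] linear_scale[OF lin])
  finally show ?thesis by (simp add: inner_vec_def mult.commute)
qed

lemma form1_tvec_of:
  assumes "c \<in> S" "x \<in> chart_image c" "one_form S b"
  shows "b (chart_inv c x) (tvec_of S c x y) = comp1 S b c x \<bullet> y"
  using linear_on_tangent_tvec_of[OF assms(1,2)] assms(3) by (simp add: one_form_def comp1_def)

lemma pseudo_riemannian_at:
  assumes "pseudo_riemannian_on S U g" "p \<in> U" "v \<in> tangent_space S p"
  shows "linear_on_tangent S p (g p v)" "\<And>w. w \<in> tangent_space S p \<Longrightarrow> g p v w = g p w v"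
    "(\<And>w. w \<in> tangent_space S p \<Longrightarrow> g p v w = 0) \<Longrightarrow> v = (\<lambda>_. 0)"
  using assms unfolding pseudo_riemannian_on_def by blast+

lemma form2_tvec_of:
  assumes "c \<in> S" "x \<in> chart_image c" "chart_inv c x \<in> U" "pseudo_riemannian_on S U g"
  shows "g (chart_inv c x) (tvec_of S c x y) (tvec_of S c x z) = y \<bullet> (comp2 S g c x *v z)"
proof -
  let ?p = "chart_inv c x" and ?t = "tvec_of S c x"
  have lin: "linear_on_tangent S ?p (g ?p (?t y))" for y
    by (rule pseudo_riemannian_at(1)[OF assms(4,3) tvec_of_in_tangent[OF assms(1,2)]])
  have sym: "g ?p (?t y) (?t z) = g ?p (?t z) (?t y)" for y z
    by (rule pseudo_riemannian_at(2)[OF assms(4,3)]) (rule tvec_of_in_tangent[OF assms(1,2)])+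
  have ex: "g ?p (?t y) (?t z) = (\<Sum>j\<in>UNIV. g ?p (?t y) (?t (axis j 1)) * z $ j)" for y z
    by (subst linear_on_tangent_tvec_of[OF assms(1,2) lin]) (simp add: inner_vec_def)
  have "g ?p (?t y) (?t z) = g ?p (?t z) (?t y)" by (rule sym)
  also have "\<dots> = (\<Sum>i\<in>UNIV. g ?p (?t (axis i 1)) (?t z) * y $ i)"
    unfolding ex[of z y] by (rule sum.cong[OF refl]) (simp only: sym[of z])
  also have "\<dots> = (\<Sum>i\<in>UNIV. (\<Sum>j\<in>UNIV. comp2 S g c x $ i $ j * z $ j) * y $ i)"
    unfolding ex[of _ z] comp2_def vec_lambda_beta ..
  also have "\<dots> = y \<bullet> (comp2 S g c x *v z)"
    by (simp add: inner_vec_def matrix_vector_mult_def mult.commute)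
  finally show ?thesis .
qed

lemma comp2_sym:
  assumes "c \<in> S" "x \<in> chart_image c" "chart_inv c x \<in> U" "pseudo_riemannian_on S U g"
  shows "comp2 S g c x $ i $ j = comp2 S g c x $ j $ i"
  unfolding comp2_def vec_lambda_beta
  by (rule pseudo_riemannian_at(2)[OF assms(4,3)]) (rule tvec_of_in_tangent[OF assms(1,2)])+

lemma comp2_nondegenerate:
  assumes "c \<in> S" "x \<in> chart_image c" "chart_inv c x \<in> U" "pseudo_riemannian_on S U g"
  shows "invertible (comp2 S g c x)"
proof -
  have "z = 0" if z0: "comp2 S g c x *v z = 0" for z
  proof -
    have "g (chart_inv c x) (tvec_of S c x z) w = 0" if w: "w \<in> tangent_space S (chart_inv c x)" for w
    proof -
      have "w = tvec_of S c x (w c)" using tangent_eq_tvec_of[OF assms(1) chart_inv_in w] assms by simp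
      then have "g (chart_inv c x) (tvec_of S c x z) w = g (chart_inv c x) w (tvec_of S c x z)"
        by (intro pseudo_riemannian_at(2)[OF assms(4,3)] w tvec_of_in_tangent[OF assms(1,2)])
      also have "\<dots> = (w c) \<bullet> (comp2 S g c x *v z)"
        using form2_tvec_of[OF assms] \<open>w = _\<close> by metis
      finally show ?thesis using z0 by simp
    qed
    then have "tvec_of S c x z = (\<lambda>_. 0)"
      by (rule pseudo_riemannian_at(3)[OF assms(4,3) tvec_of_in_tangent[OF assms(1,2)]])
    then show "z = 0" using tvec_of_self[OF assms(1,2), of z] by simp
  qed
  then have "\<exists>B. B ** comp2 S g c x = mat 1"
    by (subst matrix_left_invertible_ker) blast
  then show ?thesis using invertible_left_inverse by blast
qed

lemma comp1_transition:
  assumes "c \<in> S" "d \<in> S" "x \<in> chart_image c" "chart_inv c x \<in> fst d" "one_form S b"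
  shows "comp1 S b d (transition c d x) \<bullet> dirderiv y (transition c d) x = comp1 S b c x \<bullet> y"
  using form1_tvec_of[OF assms(2) transition_in(1)[OF assms(1-4)] assms(5)]
    form1_tvec_of[OF assms(1,3,5)] transition_in(2)[OF assms(1-4)] tvec_of_transition[OF assms(1-4)] by metis

lemma comp2_transition:
  assumes "c \<in> S" "d \<in> S" "x \<in> chart_image c" "chart_inv c x \<in> fst d"
    "chart_inv c x \<in> U" "pseudo_riemannian_on S U g"
  shows "dirderiv y (transition c d) x \<bullet> (comp2 S g d (transition c d x) *v dirderiv z (transition c d) x)
    = y \<bullet> (comp2 S g c x *v z)"
  using form2_tvec_of[OF assms(2) transition_in(1)[OF assms(1-4)] _ assms(6)]
    form2_tvec_of[OF assms(1,3,5,6)] transition_in(2)[OF assms(1-4)] tvec_of_transition[OF assms(1-4)] assms(5) by metis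

lemma smooth_comp2:
  assumes "c \<in> S" "open U" "pseudo_riemannian_on S U g"
  shows "smooth_on (snd c ` (fst c \<inter> U)) (comp2 S g c)"
  using assms by (simp add: pseudo_riemannian_on_def)

text \<open>The map \<open>\<Phi>\<close> is inverted locally, composed with \<open>c\<close> and
  restricted until the image is a ball; maximality of the atlas puts the result in \<open>S\<close>.
  The ball matters later, when a function constant along one coordinate direction has to descend to
  the other coordinates.\<close>

lemma exists_chart:
  assumes c: "c \<in> S" and W: "open W" "W \<subseteq> chart_image c" "x0 \<in> W" and \<Phi>: "smooth_on W \<Phi>"
    and inv: "invertible (matrix (\<lambda>v. dirderiv v \<Phi> x0))"
  obtains d r where "d \<in> S" "0 < r" "chart_image d = ball (\<Phi> x0) r" "fst d \<subseteq> fst c"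
    "chart_inv c x0 \<in> fst d" "\<And>p. p \<in> fst d \<Longrightarrow> snd c p \<in> W"
    "\<And>x. x \<in> chart_image c \<Longrightarrow> chart_inv c x \<in> fst d \<Longrightarrow> transition c d x = \<Phi> x"
proof -
  obtain U' V g where g: "open U'" "U' \<subseteq> W" "x0 \<in> U'" "open V" "\<Phi> x0 \<in> V" "homeomorphism U' V \<Phi> g" "smooth_on V g"
    using smooth_local_inverse[OF W(1,3) \<Phi> inv] by blast
  obtain r where r: "r > 0" "ball (\<Phi> x0) r \<subseteq> V" using g(4,5) open_contains_ball by blast
  let ?B = "ball (\<Phi> x0) r"
  define X where "X = chart_inv c ` (g ` ?B)"
  have h1: "homeomorphism (g ` ?B) ?B \<Phi> g"
  proof (rule homeomorphism_of_subsets[OF g(6)])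
    show "g ` ?B \<subseteq> U'" using g(6) r(2) by (auto simp: homeomorphism_def)
    have "\<Phi> (g y) = y" if "y \<in> ?B" for y using g(6) r(2) that by (auto simp: homeomorphism_def)
    then show "\<Phi> ` g ` ?B = ?B" by (simp add: image_image cong: image_cong_simp)
  qed (use r in auto)
  have gB: "g ` ?B \<subseteq> U'" using g(6) r by (auto simp: homeomorphism_def)
  then have gBc: "g ` ?B \<subseteq> chart_image c" using g(2) W(2) by blast
  have "g ` ?B = U' \<inter> \<Phi> -` ?B" using g(6) r(2) by (force simp: homeomorphism_def)
  moreover have "open (U' \<inter> \<Phi> -` ?B)"
    by (rule continuous_open_preimage[OF _ g(1)]) (use g(6) in \<open>auto simp: homeomorphism_def\<close>)
  ultimately have ogB: "open (g ` ?B)" by simp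
  have h2: "homeomorphism X (g ` ?B) (snd c) (chart_inv c)"
    unfolding X_def
  proof (rule homeomorphism_of_subsets[OF hom_chart[OF c]])
    show "chart_inv c ` g ` ?B \<subseteq> fst c" using gBc chart_inv_in[OF c] by blast
    have "snd c (chart_inv c x) = x" if "x \<in> g ` ?B" for x using gBc c that by auto
    then have "(\<lambda>x. snd c (chart_inv c x)) ` (g ` ?B) = (\<lambda>x. x) ` (g ` ?B)" by (rule image_cong[OF refl])
    then show "snd c ` chart_inv c ` g ` ?B = g ` ?B" by (simp add: image_image)
  qed (use gBc in auto)
  have X: "open X"
  proof -
    have "X = fst c \<inter> snd c -` (g ` ?B)"
    proof (intro set_eqI iffI)
      fix p assume "p \<in> X"
      then show "p \<in> fst c \<inter> snd c -` (g ` ?B)" using h2 gBc chart_inv_in[OF c]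
        unfolding X_def homeomorphism_def by blast
    next
      fix p assume "p \<in> fst c \<inter> snd c -` (g ` ?B)"
      then show "p \<in> X" unfolding X_def using chart_inv_chart[OF c, of p] by (metis IntE imageI vimageE)
    qed
    moreover have "open (fst c \<inter> snd c -` (g ` ?B))"
      by (rule continuous_open_preimage[OF _ open_dom[OF c] ogB]) (use hom_chart[OF c] in \<open>auto simp: homeomorphism_def\<close>)
    ultimately show ?thesis by simp
  qed
  have Xc: "X \<subseteq> fst c" unfolding X_def using gBc c chart_inv_in by blast
  define d where "d = (X, \<Phi> \<circ> snd c)"
  have hd: "homeomorphism X ?B (\<Phi> \<circ> snd c) (chart_inv c \<circ> g)"
    by (rule homeomorphism_compose[OF h2 h1])
  have dchart: "is_chart d" and dinv: "\<And>y. y \<in> ?B \<Longrightarrow> chart_inv d y = chart_inv c (g y)"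
    using is_chartI[OF X _ hd] by (auto simp: d_def)
  have dim: "chart_image d = ?B" using hd by (simp add: d_def homeomorphism_def)
  have Xg: "snd c p \<in> g ` ?B" if "p \<in> X" for p using h2 that by (auto simp: homeomorphism_def)
  \<comment> \<open>Transitions out of \<open>d\<close> factor through \<open>g\<close> and those
    into \<open>d\<close> through \<open>\<Phi>\<close>, so they inherit smoothness from the
    transitions of \<open>c\<close>.\<close>
  have dS: "d \<in> S"
  proof (rule maximal[OF dchart])
    fix e assume e: "e \<in> S"
    have ode: "open (snd d ` (fst d \<inter> fst e))"
    proof -
      have "snd d ` (fst d \<inter> fst e) = ?B \<inter> chart_inv d -` fst e"
      proof (intro set_eqI iffI)
        fix y assume "y \<in> snd d ` (fst d \<inter> fst e)"
        then obtain p where p: "p \<in> fst d" "p \<in> fst e" "y = snd d p" by blast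
        moreover have "chart_inv d y = p" using dchart p unfolding is_chart_def homeomorphism_def by metis
        ultimately show "y \<in> ?B \<inter> chart_inv d -` fst e" using dim by auto
      next
        fix y assume y: "y \<in> ?B \<inter> chart_inv d -` fst e"
        then have "y \<in> chart_image d" using dim by blast
        then have "chart_inv d y \<in> fst d" "snd d (chart_inv d y) = y"
          using dchart unfolding is_chart_def homeomorphism_def by blast+
        then show "y \<in> snd d ` (fst d \<inter> fst e)" using y by (metis IntE IntI imageI vimageE)
      qed
      moreover have "open (?B \<inter> chart_inv d -` fst e)"
        by (rule continuous_open_preimage[OF _ _ open_dom[OF e]])
           (use dchart dim in \<open>auto simp: is_chart_def homeomorphism_def\<close>)
      ultimately show ?thesis by simp
    qed
    have sub: "snd d ` (fst d \<inter> fst e) \<subseteq> ?B" using dim by auto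
    have din: "chart_inv d y \<in> fst e" if "y \<in> snd d ` (fst d \<inter> fst e)" for y
      using that dchart by (auto simp: is_chart_def homeomorphism_def)
    have oc: "open (snd c ` (fst c \<inter> fst e))" using open_image[OF c open_dom[OF e]] .
    have "smooth_on (snd d ` (fst d \<inter> fst e)) (\<lambda>y. transition c e (g y))"
    proof (rule smooth_on_compose[OF ode transition_smooth[OF c e]])
      show "smooth_on (snd d ` (fst d \<inter> fst e)) g" using sub r(2) by (intro smooth_on_subset[OF g(7)]) blast
      fix y assume y: "y \<in> snd d ` (fst d \<inter> fst e)"
      then have "g y \<in> chart_image c" using sub gBc by auto
      moreover have "chart_inv c (g y) \<in> fst e" using din[OF y] dinv y sub by auto
      ultimately show "g y \<in> snd c ` (fst c \<inter> fst e)" using image_eq[OF c] by simp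
    qed
    then have 1: "smooth_on (snd d ` (fst d \<inter> fst e)) (transition d e)"
      by (subst smooth_on_cong[OF ode]) (use dinv sub in \<open>auto simp: transition_def\<close>)
    have oed: "open (snd e ` (fst e \<inter> fst d))" using open_image[OF e, of X] X by (simp add: d_def)
    have "smooth_on (snd e ` (fst e \<inter> fst d)) (\<lambda>y. \<Phi> (transition e c y))"
    proof (rule smooth_on_compose[OF oed \<Phi>])
      show "smooth_on (snd e ` (fst e \<inter> fst d)) (transition e c)"
        by (rule smooth_on_subset[OF transition_smooth[OF e c]]) (use Xc in \<open>auto simp: d_def\<close>)
      fix y assume "y \<in> snd e ` (fst e \<inter> fst d)"
      then obtain p where p: "p \<in> fst e" "p \<in> X" "y = snd e p" by (auto simp: d_def)
      then show "transition e c y \<in> W" using e Xg gB g(2) by (fastforce simp: transition_def)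
    qed
    then have 2: "smooth_on (snd e ` (fst e \<inter> fst d)) (transition e d)"
      by (subst smooth_on_cong[OF oed]) (auto simp: transition_def d_def)
    show "smoothly_compatible d e" unfolding smoothly_compatible_def Int_commute[of "fst d"] using 1 2
      by (simp add: Int_commute)
  qed
  show thesis
  proof (rule that[OF dS r(1) dim])
    show "fst d \<subseteq> fst c" using Xc by (simp add: d_def)
    have "g (\<Phi> x0) = x0" using g(3,6) by (auto simp: homeomorphism_def)
    moreover have "chart_inv c (g (\<Phi> x0)) \<in> X" unfolding X_def by (intro imageI) (use r(1) in simp)
    ultimately show "chart_inv c x0 \<in> fst d" by (simp add: d_def)
    show "snd c p \<in> W" if "p \<in> fst d" for p using Xg[of p] that gB g(2) by (auto simp: d_def)
    show "transition c d x = \<Phi> x" if "x \<in> chart_image c" for x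
      using c that by (simp add: transition_def d_def)
  qed
qed

lemma fibre_nonempty:
  assumes "conic_subbundle S A" "c \<in> S" "x \<in> chart_image c"
  obtains y where "(x, y) \<in> bundle_coords S A c"
proof -
  let ?p = "chart_inv c x"
  have "?p \<in> fst ` A" using assms(1) by (simp add: conic_subbundle_def)
  then obtain v where v: "(?p, v) \<in> A" by auto
  then have "v \<in> tangent_space S ?p" using assms(1) by (auto simp: conic_subbundle_def tangent_bundle_def)
  from tangent_eq_tvec_of[OF assms(2) chart_inv_in[OF assms(2,3)] this]
  have "v = tvec_of S c x (v c)" using assms by simp
  then have "(x, v c) \<in> bundle_coords S A c" using v assms by (simp add: bundle_coords_def bundle_point_def)
  then show thesis using that by blast
qed

lemma local_finsler:
  assumes "finsler_metric S A F" "c \<in> S"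
  shows "local_finsler (F \<circ> bundle_point S c) (bundle_coords S A c)"
proof
  have con: "conic_subbundle S A" using assms by (simp add: finsler_metric_def)
  show "open (bundle_coords S A c)" using con assms(2) by (simp add: conic_subbundle_def)
  show "invertible (fundamental_tensor (F \<circ> bundle_point S c) z)" if "z \<in> bundle_coords S A c" for z
    using assms that by (auto simp: finsler_metric_def)
  show "smooth_on (bundle_coords S A c) (F \<circ> bundle_point S c)"
    using assms by (auto simp: finsler_metric_def)
  fix x y and r :: real assume z: "(x, y) \<in> bundle_coords S A c" and r: "0 < r"
  then have x: "x \<in> chart_image c" and A: "(chart_inv c x, tvec_of S c x y) \<in> A"
    by (auto simp: bundle_coords_def bundle_point_def)
  show "(x, r *\<^sub>R y) \<in> bundle_coords S A c"
    using con A r x by (auto simp: bundle_coords_def bundle_point_scale[OF assms(2) x] conic_subbundle_def)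
  show "(F \<circ> bundle_point S c) (x, r *\<^sub>R y) = r * (F \<circ> bundle_point S c) (x, y)"
  proof -
    have "F (chart_inv c x, \<lambda>e. r *\<^sub>R tvec_of S c x y e) = r * F (chart_inv c x, tvec_of S c x y)"
      using assms(1) A r unfolding finsler_metric_def by blast
    then show ?thesis unfolding o_apply bundle_point_scale[OF assms(2) x] by (simp add: bundle_point_def)
  qed
qed

text \<open>Justifies the definite description in \<open>affine_connection\<close>: the fibre of
  \<open>A\<close> is open, and moving one of its points along an axis isolates a single
  coefficient.\<close>

lemma affine_connection_coeffs:
  assumes "berwald S A F" "c \<in> S" "x \<in> chart_image c"
  shows "berwald_coeffs S A F c x (affine_connection S A F c x)"
proof -
  obtain \<Gamma> where \<Gamma>: "berwald_coeffs S A F c x \<Gamma>" using assms unfolding berwald_def by blast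
  have fm: "finsler_metric S A F" using assms(1) by (simp add: berwald_def)
  interpret local_finsler "F \<circ> bundle_point S c" "bundle_coords S A c" by (rule local_finsler[OF fm assms(2)])
  obtain y0 where y0: "(x, y0) \<in> bundle_coords S A c"
    using fibre_nonempty[of A c x] fm assms by (auto simp: finsler_metric_def)
  have ex1: "\<exists>!\<Gamma>. berwald_coeffs S A F c x \<Gamma>"
  proof (intro ex1I[of _ \<Gamma>] \<Gamma>)
    fix \<Gamma>' :: "'n \<Rightarrow> 'n \<Rightarrow> 'n \<Rightarrow> real" assume \<Gamma>': "berwald_coeffs S A F c x \<Gamma>'"
    have coeff: "\<Gamma>' k i j = \<Gamma> k i j" for k i j
    proof -
      have eq: "(\<Sum>j\<in>UNIV. \<Gamma>' k i j * y $ j) = (\<Sum>j\<in>UNIV. \<Gamma> k i j * y $ j)"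
        if "(x, y) \<in> bundle_coords S A c" for y
        using \<Gamma> \<Gamma>' that unfolding berwald_coeffs_def by metis
      obtain e where e: "e > 0" "ball y0 e \<subseteq> {y. (x, y) \<in> bundle_coords S A c}"
        using vertical_fibre[OF y0] open_contains_ball by blast
      have "y0 + (e / 2) *\<^sub>R axis j 1 \<in> ball y0 e" using e(1) by (simp add: dist_norm)
      then have "(x, y0 + (e / 2) *\<^sub>R axis j 1) \<in> bundle_coords S A c" using e(2) by blast
      from eq[OF this] eq[OF y0]
      have "(\<Sum>l\<in>UNIV. \<Gamma>' k i l * ((e / 2) * axis j 1 $ l)) = (\<Sum>l\<in>UNIV. \<Gamma> k i l * ((e / 2) * axis j 1 $ l))"
        by (simp add: distrib_left sum.distrib)
      then have "(e / 2) * (\<Sum>l\<in>UNIV. axis j 1 $ l * \<Gamma>' k i l) = (e / 2) * (\<Sum>l\<in>UNIV. axis j 1 $ l * \<Gamma> k i l)"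
        by (simp add: sum_distrib_left mult_ac)
      then show ?thesis using e(1) by (simp add: sum_axis_mult)
    qed
    show "\<Gamma>' = \<Gamma>" by (intro ext) (rule coeff)
  qed
  show ?thesis unfolding affine_connection_def by (rule theI'[OF ex1])
qed

end

subsection \<open>Polynomial identities\<close>

lemma cubic_vanishes:
  fixes c0 c1 c2 c3 :: real
  assumes "0 < e" "\<And>t. \<bar>t\<bar> < e \<Longrightarrow> c0 + c1 * t + c2 * t\<^sup>2 + c3 * t ^ 3 = 0"
  shows "c0 = 0" "c1 = 0" "c2 = 0" "c3 = 0"
proof -
  \<comment> \<open>The points 0, t, -t and 2t then all lie in the interval, and four values
    determine a cubic.\<close>
  define t where "t = e / 3"
  have t: "t > 0" "\<bar>t\<bar> < e" "\<bar>- t\<bar> < e" "\<bar>2 * t\<bar> < e" using assms(1) by (auto simp: t_def)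
  show c0: "c0 = 0" using assms(2)[of 0] assms(1) by simp
  have 1: "c1 * t + c2 * t\<^sup>2 + c3 * t ^ 3 = 0" using assms(2)[OF t(2)] c0 by simp
  have 2: "- (c1 * t) + c2 * t\<^sup>2 - c3 * t ^ 3 = 0" using assms(2)[OF t(3)] c0 by simp
  have 3: "2 * (c1 * t) + 4 * (c2 * t\<^sup>2) + 8 * (c3 * t ^ 3) = 0"
    using assms(2)[OF t(4)] c0 by (simp add: power_mult_distrib algebra_simps)
  have "c2 * t\<^sup>2 = 0" "c3 * t ^ 3 = 0" "c1 * t = 0" using 1 2 3 by linarith+
  then show "c1 = 0" "c2 = 0" "c3 = 0" using t by auto
qed

lemma quadratic_form_add:
  fixes A :: "real ^ 'n::finite ^ 'n"
  shows "(y + t *\<^sub>R w) \<bullet> (A *v (y + t *\<^sub>R w))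
    = y \<bullet> (A *v y) + (y \<bullet> (A *v w) + w \<bullet> (A *v y)) * t + (w \<bullet> (A *v w)) * t\<^sup>2"
  by (simp add: matrix_vector_right_distrib matrix_vector_mult_scaleR inner_add_left inner_add_right
      power2_eq_square algebra_simps)

text \<open>On the line through \<open>y0\<close> and \<open>y\<close> both sides are cubic in the
  parameter and agree near 0. This carries identities found where logarithms are defined over to
  every vector.\<close>

lemma cubic_identity_extends:
  fixes T a :: "real ^ 'n::finite ^ 'n" and b c :: "real ^ 'n"
  assumes Y: "open Y" "y0 \<in> Y"
    and eq: "\<And>y. y \<in> Y \<Longrightarrow> \<kappa> * ((y \<bullet> (T *v y)) * (b \<bullet> y)) = \<nu> * ((y \<bullet> (a *v y)) * (c \<bullet> y))"
  shows "\<kappa> * ((y \<bullet> (T *v y)) * (b \<bullet> y)) = \<nu> * ((y \<bullet> (a *v y)) * (c \<bullet> y))"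
proof -
  define w where "w = y - y0"
  obtain e where e: "e > 0" "ball y0 e \<subseteq> Y" using Y open_contains_ball by blast
  define d where "d = e / (norm w + 1)"
  have d: "d > 0" using e by (simp add: d_def add_nonneg_pos)
  define A0 where "A0 = y0 \<bullet> (T *v y0)"
  define A1 where "A1 = y0 \<bullet> (T *v w) + w \<bullet> (T *v y0)"
  define A2 where "A2 = w \<bullet> (T *v w)"
  define Q0 where "Q0 = y0 \<bullet> (a *v y0)"
  define Q1 where "Q1 = y0 \<bullet> (a *v w) + w \<bullet> (a *v y0)"
  define Q2 where "Q2 = w \<bullet> (a *v w)"
  have T: "(y0 + t *\<^sub>R w) \<bullet> (T *v (y0 + t *\<^sub>R w)) = A0 + A1 * t + A2 * t\<^sup>2"
    "(y0 + t *\<^sub>R w) \<bullet> (a *v (y0 + t *\<^sub>R w)) = Q0 + Q1 * t + Q2 * t\<^sup>2" for t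
    unfolding A0_def A1_def A2_def Q0_def Q1_def Q2_def by (rule quadratic_form_add)+
  let ?B0 = "b \<bullet> y0" and ?B1 = "b \<bullet> w" and ?C0 = "c \<bullet> y0" and ?C1 = "c \<bullet> w"
  define p where "p t = (\<kappa> * (A0 * ?B0) - \<nu> * (Q0 * ?C0))
      + (\<kappa> * (A0 * ?B1 + A1 * ?B0) - \<nu> * (Q0 * ?C1 + Q1 * ?C0)) * t
      + (\<kappa> * (A1 * ?B1 + A2 * ?B0) - \<nu> * (Q1 * ?C1 + Q2 * ?C0)) * t\<^sup>2
      + (\<kappa> * (A2 * ?B1) - \<nu> * (Q2 * ?C1)) * t ^ 3" for t
  have p: "\<kappa> * (((y0 + t *\<^sub>R w) \<bullet> (T *v (y0 + t *\<^sub>R w))) * (b \<bullet> (y0 + t *\<^sub>R w)))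
      - \<nu> * (((y0 + t *\<^sub>R w) \<bullet> (a *v (y0 + t *\<^sub>R w))) * (c \<bullet> (y0 + t *\<^sub>R w))) = p t" for t
    unfolding T p_def inner_add_right inner_scaleR_right
    by (simp add: algebra_simps power2_eq_square power3_eq_cube)
  have "p t = 0" if "\<bar>t\<bar> < d" for t
  proof -
    have "\<bar>t\<bar> * norm w \<le> \<bar>t\<bar> * (norm w + 1)" by (simp add: mult_left_mono)
    also have "\<dots> < e" using that by (simp add: d_def pos_less_divide_eq add_nonneg_pos)
    finally have "y0 + t *\<^sub>R w \<in> Y" using e by (intro subsetD[OF e(2)]) (simp add: dist_norm)
    then show ?thesis using eq p[of t] by simp
  qed
  from cubic_vanishes[OF d this[unfolded p_def]]
  have "p 1 = 0" by (simp add: p_def)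
  moreover have "y0 + 1 *\<^sub>R w = y" by (simp add: w_def)
  ultimately show ?thesis using p[of 1] by simp
qed

lemma symmetric_form_eq_0:
  fixes A :: "real ^ 'n::finite ^ 'n"
  assumes sym: "transpose A = A" and 0: "\<And>y. y \<bullet> (A *v y) = 0"
  shows "A = 0"
proof -
  have "A $ i $ j = 0" for i j
  proof -
    have "y \<bullet> (A *v w) + w \<bullet> (A *v y) = 0" for y w
      using quadratic_form_add[of y 1 w A] 0[of "y + 1 *\<^sub>R w"] 0[of y] 0[of w] by simp
    from this[of "axis i 1" "axis j 1"] have "A $ i $ j + A $ j $ i = 0"
      by (simp add: inner_axis' matrix_vector_axis)
    moreover have "transpose A $ i $ j = A $ i $ j" using sym by simp
    then have "A $ j $ i = A $ i $ j" by (simp add: transpose_def)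
    ultimately show ?thesis by simp
  qed
  then show ?thesis by (simp add: vec_eq_iff)
qed

text \<open>Otherwise the product of the two forms, a cubic, vanishes on \<open>Y\<close> and hence
  everywhere. A vector with nonzero square then lies in ker \<open>b\<close>, and displacing it
  along \<open>b\<close> gives a first-order term equal to that square times
  \<open>b \<bullet> b\<close>, a contradiction.\<close>

lemma form_nonzero_in_open:
  fixes a :: "real ^ 'n::finite ^ 'n" and b :: "real ^ 'n"
  assumes Y: "open Y" "Y \<noteq> {}" and sym: "transpose a = a" and a: "a \<noteq> 0" and b: "b \<noteq> 0"
  obtains y where "y \<in> Y" "y \<bullet> (a *v y) \<noteq> 0" "b \<bullet> y \<noteq> 0"
proof (rule ccontr)
  note out = that
  assume no: "\<not> thesis"
  obtain y0 where y0: "y0 \<in> Y" using Y by blast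
  have "y \<bullet> (a *v y) = 0 \<or> b \<bullet> y = 0" if "y \<in> Y" for y
    using no out[OF that] by blast
  then have "0 * ((y \<bullet> (a *v y)) * (b \<bullet> y)) = 1 * ((y \<bullet> (a *v y)) * (b \<bullet> y))" if "y \<in> Y" for y
    using that by auto
  then have z: "(y \<bullet> (a *v y)) * (b \<bullet> y) = 0" for y
    using cubic_identity_extends[OF Y(1) y0, of 0 a b 1 a b y] by simp
  obtain y1 where y1: "y1 \<bullet> (a *v y1) \<noteq> 0" using symmetric_form_eq_0[OF sym] a by blast
  then have b1: "b \<bullet> y1 = 0" using z[of y1] by simp
  have "0 + ((y1 \<bullet> (a *v y1)) * (b \<bullet> b)) * t + ((y1 \<bullet> (a *v b) + b \<bullet> (a *v y1)) * (b \<bullet> b)) * t\<^sup>2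
      + ((b \<bullet> (a *v b)) * (b \<bullet> b)) * t ^ 3 = 0" for t
    using z[of "y1 + t *\<^sub>R b"] unfolding quadratic_form_add inner_add_right inner_scaleR_right b1
    by (simp add: algebra_simps power2_eq_square power3_eq_cube)
  from cubic_vanishes(2)[OF zero_less_one this] show False using y1 b by simp
qed

text \<open>Unique factorization by hand. On ker \<open>b\<close> the left side vanishes while the
  quadratic form of \<open>a\<close> does not vanish identically, so \<open>c\<close> is a multiple
  of \<open>b\<close>; cancelling the factor \<open>b\<close> then determines
  \<open>T\<close>.\<close>

lemma kropina_algebra:
  fixes T a :: "real ^ 'n::finite ^ 'n" and b c :: "real ^ 'n"
  assumes m: "m \<noteq> 0" "1 + m \<noteq> 0" and sym: "transpose a = a" "transpose T = T"
    and b: "b \<noteq> 0" and z0: "b \<bullet> z0 = 0" "z0 \<bullet> (a *v z0) \<noteq> 0"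
    and eq: "\<And>y. (1 + m) * ((y \<bullet> (T *v y)) * (b \<bullet> y)) = (2 * m) * ((y \<bullet> (a *v y)) * (c \<bullet> y))"
  shows "\<exists>f. T = (2 * m * f) *\<^sub>R a \<and> c = ((1 + m) * f) *\<^sub>R b"
proof -
  have c0: "(y \<bullet> (a *v y)) * (c \<bullet> y) = 0" if "b \<bullet> y = 0" for y using eq[of y] m that by simp
  have cz0: "c \<bullet> z0 = 0" using c0[OF z0(1)] z0(2) by simp
  have cz: "c \<bullet> z = 0" if "b \<bullet> z = 0" for z
  proof -
    \<comment> \<open>The quadratic form may vanish at \<open>z\<close> itself. On the line from
      \<open>z0\<close> in direction \<open>z\<close> the first-order term carries the nonzero
      square of \<open>z0\<close>.\<close>
    have "0 + ((z0 \<bullet> (a *v z0)) * (c \<bullet> z)) * t + ((z0 \<bullet> (a *v z) + z \<bullet> (a *v z0)) * (c \<bullet> z)) * t\<^sup>2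
      + ((z \<bullet> (a *v z)) * (c \<bullet> z)) * t ^ 3 = 0" for t
    proof -
      have "b \<bullet> (z0 + t *\<^sub>R z) = 0" using that z0 by (simp add: inner_add_right)
      from c0[OF this] show ?thesis unfolding quadratic_form_add inner_add_right inner_scaleR_right cz0
        by (simp add: algebra_simps power2_eq_square power3_eq_cube)
    qed
    from cubic_vanishes(2)[OF zero_less_one this] show ?thesis using z0 by simp
  qed
  define f where "f = (c \<bullet> b) / ((1 + m) * (b \<bullet> b))"
  have cf: "c = ((1 + m) * f) *\<^sub>R b"
  proof (rule vector_eq_rdot[THEN iffD1], rule allI)
    fix y
    have "c \<bullet> (y - ((b \<bullet> y) / (b \<bullet> b)) *\<^sub>R b) = 0" by (rule cz) (use b in \<open>simp add: inner_diff_right\<close>)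
    then show "c \<bullet> y = (((1 + m) * f) *\<^sub>R b) \<bullet> y"
    proof -
      have "(1 + m) * f = (c \<bullet> b) / (b \<bullet> b)" using m by (simp add: f_def)
      moreover have "c \<bullet> y = (b \<bullet> y) / (b \<bullet> b) * (c \<bullet> b)"
        using \<open>c \<bullet> (y - _) = 0\<close> by (simp add: inner_diff_right)
      ultimately show ?thesis by simp
    qed
  qed
  define R where "R = T - (2 * m * f) *\<^sub>R a"
  have R: "y \<bullet> (R *v y) = y \<bullet> (T *v y) - 2 * m * f * (y \<bullet> (a *v y))" for y
    by (simp add: R_def matrix_vector_mult_diff_rdistrib scaleR_matrix_vector_assoc[symmetric] inner_diff_right)
  have bR: "(b \<bullet> y) * (y \<bullet> (R *v y)) = 0" for y
  proof -
    have "(1 + m) * ((b \<bullet> y) * (y \<bullet> (R *v y))) = 0"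
      using eq[of y] unfolding cf R by (simp add: algebra_simps)
    then show ?thesis using m by simp
  qed
  \<comment> \<open>Off ker \<open>b\<close> the linear factor cancels. On ker \<open>b\<close> the
    vector is displaced along \<open>b\<close> and the first-order terms are compared.\<close>
  have "y \<bullet> (R *v y) = 0" for y
  proof (cases "b \<bullet> y = 0")
    case True
    have "0 + ((y \<bullet> (R *v y)) * (b \<bullet> b)) * t + ((y \<bullet> (R *v b) + b \<bullet> (R *v y)) * (b \<bullet> b)) * t\<^sup>2
      + ((b \<bullet> (R *v b)) * (b \<bullet> b)) * t ^ 3 = 0" for t
      using bR[of "y + t *\<^sub>R b"] unfolding quadratic_form_add inner_add_right inner_scaleR_right True
      by (simp add: algebra_simps power2_eq_square power3_eq_cube)
    from cubic_vanishes(2)[OF zero_less_one this] show ?thesis using b by simp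
  qed (use bR[of y] in simp)
  moreover have "transpose R = R" using sym by (simp add: R_def transpose_def vec_eq_iff)
  ultimately have "R = 0" by (intro symmetric_form_eq_0)
  then show ?thesis using cf by (auto simp: R_def)
qed

subsection \<open>Powers\<close>

text \<open>Squaring removes the distinction between the branches of \<open>is_power\<close>: a
  negative base with integer exponent has the same squared power as its absolute value. This yields
  a formula for F^2 that is insensitive to the signs of the quadratic form and of the
  1-form.\<close>

lemma is_power_square:
  assumes "is_power t e r" "t \<noteq> 0"
  shows "r\<^sup>2 = exp (e * ln (t\<^sup>2))"
proof -
  have *: "(\<bar>t\<bar> powr e)\<^sup>2 = exp (e * ln (t\<^sup>2))"
  proof -
    have "ln (\<bar>t\<bar>\<^sup>2) = 2 * ln \<bar>t\<bar>" using ln_realpow[of "\<bar>t\<bar>" 2] assms(2) by (simp only: zero_less_abs_iff of_nat_numeral)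
    then have l: "ln (t\<^sup>2) = 2 * ln \<bar>t\<bar>" unfolding power2_abs .
    have "(\<bar>t\<bar> powr e)\<^sup>2 = (exp (e * ln \<bar>t\<bar>))\<^sup>2" using assms(2) by (simp add: powr_def)
    also have "\<dots> = exp (2 * (e * ln \<bar>t\<bar>))" by (simp only: exp_double)
    also have "\<dots> = exp (e * (2 * ln \<bar>t\<bar>))" by (simp only: mult.left_commute)
    finally show ?thesis unfolding l .
  qed
  from assms consider "0 < t" "r = t powr e" | "t < 0" "e \<in> \<int>" "r = t powi \<lfloor>e\<rfloor>"
    unfolding is_power_def by auto
  then show ?thesis
  proof cases
    case 1 then show ?thesis using * by simp
  next
    case 2
    then have "\<bar>r\<bar> = \<bar>t\<bar> powi \<lfloor>e\<rfloor>" by (simp add: power_int_abs)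
    also have "\<dots> = \<bar>t\<bar> powr e"
      using \<open>e \<in> \<int>\<close> \<open>t < 0\<close> by (elim Ints_cases) (simp add: powr_real_of_int')
    finally have "\<bar>r\<bar>\<^sup>2 = (\<bar>t\<bar> powr e)\<^sup>2" by (rule arg_cong)
    then show ?thesis using * by simp
  qed
qed

lemma is_power_scale:
  assumes "is_power t e r" "0 < k"
  shows "is_power (k * t) e (k powr e * r)"
proof -
  from assms(1) consider "0 < t" "r = t powr e" | "t = 0" "0 < e" "r = 0" | "t < 0" "e \<in> \<int>" "r = t powi \<lfloor>e\<rfloor>"
    unfolding is_power_def by auto
  then show ?thesis
  proof cases
    case 1 then show ?thesis using assms(2) by (simp add: is_power_def powr_mult)
  next
    case 2 then show ?thesis by (simp add: is_power_def)
  next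
    case 3
    then have "k powr e = k powi \<lfloor>e\<rfloor>" using assms(2) powr_real_of_int'[of k "\<lfloor>e\<rfloor>"] by simp
    then show ?thesis using 3 assms(2) by (simp add: is_power_def power_int_mult_distrib mult_pos_neg)
  qed
qed

lemma is_power_sqrt:
  assumes "0 \<le> t"
  shows "is_power (sqrt t) e r \<longleftrightarrow> is_power t (e / 2) r"
proof (cases "t = 0")
  case False
  then have "sqrt t powr e = t powr (e / 2)"
    using assms by (simp add: powr_half_sqrt[symmetric] powr_powr)
  then show ?thesis using assms False by (auto simp: is_power_def)
qed (auto simp: is_power_def)

subsection \<open>Null frames\<close>

lemma inner_transpose:
  fixes P :: "real ^ 'n::finite ^ 'm::finite"
  shows "x \<bullet> (transpose P *v w) = (P *v x) \<bullet> w"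
  by (simp only: transpose_matrix_vector inner_commute[of x] dot_lmul_matrix inner_commute[of w])

text \<open>\<open>K\<close> is the metric dual of \<open>b\<close>. The vectors \<open>E\<close>
  and \<open>E'\<close> are found in the span of the three spacelike frame vectors, as an
  orthonormal basis of the plane orthogonal to the spatial part of \<open>b\<close>, so that only
  three-dimensional Euclidean geometry is involved.\<close>

lemma null_frame:
  fixes a :: "real ^ 4 ^ 4" and b :: "real ^ 4" and e :: "4 \<Rightarrow> real ^ 4"
  assumes e: "\<And>i j. e i \<bullet> (a *v e j) = (if i \<noteq> j then 0 else if i = k then - 1 else 1)"
    and b: "b \<noteq> 0" and null: "(\<Sum>i\<in>UNIV. \<Sum>j\<in>UNIV. matrix_inv a $ i $ j * b $ i * b $ j) = 0"
  obtains K E E' where "a *v K = b" "b \<bullet> K = 0" "b \<bullet> E = 0" "b \<bullet> E' = 0"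
    "E \<bullet> (a *v E) = 1" "E' \<bullet> (a *v E') = 1" "E \<bullet> (a *v E') = 0" "E' \<bullet> (a *v E) = 0"
proof -
  define \<eta> :: "real ^ 4 ^ 4" where "\<eta> = (\<chi> i j. if i \<noteq> j then 0 else if i = k then - 1 else 1)"
  define P :: "real ^ 4 ^ 4" where "P = (\<chi> i j. e j $ i)"
  have Pe: "P *v axis j 1 = e j" for j by (simp add: P_def vec_eq_iff matrix_vector_axis)
  have P\<eta>: "transpose P ** a ** P = \<eta>"
  proof -
    have "(transpose P ** a ** P) $ i $ j = e i \<bullet> (a *v e j)" for i j
    proof -
      have "(transpose P ** a ** P) $ i $ j = axis i 1 \<bullet> ((transpose P ** a ** P) *v axis j 1)"
        by (simp add: inner_axis' matrix_vector_axis)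
      also have "\<dots> = (P *v axis i 1) \<bullet> (a *v (P *v axis j 1))"
        by (simp only: matrix_vector_mul_assoc[symmetric] inner_transpose)
      finally show ?thesis by (simp add: Pe)
    qed
    then show ?thesis by (simp add: vec_eq_iff \<eta>_def e)
  qed
  have \<eta>\<eta>: "\<eta> ** \<eta> = mat 1"
  proof -
    have "(\<eta> ** \<eta>) $ i $ j = (if i = j then 1 else 0)" for i j
    proof -
      have "(\<eta> ** \<eta>) $ i $ j = (\<Sum>l\<in>UNIV. if l = i then \<eta> $ i $ i * \<eta> $ i $ j else 0)"
        unfolding matrix_matrix_mult_def vec_lambda_beta by (rule sum.cong) (auto simp: \<eta>_def)
      then show ?thesis by (simp add: \<eta>_def)
    qed
    then show ?thesis by (simp add: vec_eq_iff mat_def)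
  qed
  \<comment> \<open>As \<open>\<eta>\<close> is its own inverse, the frame relation gives the
    inverse metric as \<open>P ** \<eta> ** transpose P\<close>.\<close>
  have "(\<eta> ** transpose P ** a) ** P = mat 1"
    using P\<eta> \<eta>\<eta> by (simp add: matrix_mul_assoc[symmetric])
  then have "P ** (\<eta> ** transpose P ** a) = mat 1" using matrix_left_right_inverse by blast
  then have inv1: "(P ** \<eta> ** transpose P) ** a = mat 1" by (simp add: matrix_mul_assoc)
  then have inv2: "a ** (P ** \<eta> ** transpose P) = mat 1" using matrix_left_right_inverse by blast
  then have inva: "matrix_inv a = P ** \<eta> ** transpose P" by (rule matrix_inv_unique)
  define K where "K = matrix_inv a *v b"
  define \<beta> where "\<beta> j = b \<bullet> e j" for j
  have K: "a *v K = b" by (simp add: K_def inva matrix_vector_mul_assoc inv2)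
  have bK: "b \<bullet> K = 0"
    using null by (simp add: K_def inner_vec_def matrix_vector_mult_def sum_distrib_left mult_ac)
  have tP: "(transpose P *v b) $ j = \<beta> j" for j
    by (simp add: transpose_def P_def matrix_vector_mult_def \<beta>_def inner_vec_def mult.commute)
  have "b \<bullet> K = (transpose P *v b) \<bullet> (\<eta> *v (transpose P *v b))"
    unfolding K_def inva
    by (simp only: matrix_vector_mul_assoc[symmetric] inner_transpose[of b "transpose P", unfolded transpose_transpose])
  also have "\<dots> = (\<Sum>i\<in>UNIV. \<beta> i * (if i = k then - \<beta> i else \<beta> i))"
  proof -
    have "(\<eta> *v (transpose P *v b)) $ i = (if i = k then - \<beta> i else \<beta> i)" for i
    proof -
      have "(\<eta> *v (transpose P *v b)) $ i = (\<Sum>j\<in>UNIV. (if j = i then (if i = k then - \<beta> i else \<beta> i) else 0))"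
        unfolding matrix_vector_mult_def[of \<eta>] vec_lambda_beta tP by (rule sum.cong) (auto simp: \<eta>_def)
      then show ?thesis by simp
    qed
    then show ?thesis by (simp add: inner_vec_def tP del: transpose_matrix_vector)
  qed
  finally have bb: "(\<Sum>i\<in>UNIV. \<beta> i * (if i = k then - \<beta> i else \<beta> i)) = 0" using bK by simp
  have ex: "\<exists>i. \<beta> i \<noteq> 0"
  proof (rule ccontr)
    assume "\<not> ?thesis"
    then have "transpose P *v b = 0" by (simp add: vec_eq_iff tP del: transpose_matrix_vector)
    then have "K = 0" by (simp add: K_def inva matrix_vector_mul_assoc[symmetric])
    then show False using K b by simp
  qed
  \<comment> \<open>Lists the three spacelike indices uniformly, whatever the timelike index
    \<open>k\<close> is.\<close>
  define good where "good i1 i2 i3 \<longleftrightarrow> i1 \<noteq> k \<and> i2 \<noteq> k \<and> i3 \<noteq> k \<and> i1 \<noteq> i2 \<and> i1 \<noteq> i3 \<and> i2 \<noteq> i3 \<and>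
    (UNIV :: 4 set) = {k, i1, i2, i3}" for i1 i2 i3
  have "good 2 3 4 \<or> good 1 3 4 \<or> good 1 2 4 \<or> good 1 2 3"
    using exhaust_4[of k] unfolding good_def UNIV_4 by (elim disjE) (simp_all add: insert_commute)
  then obtain i1 i2 i3 where "good i1 i2 i3" by blast
  then have i: "i1 \<noteq> k" "i2 \<noteq> k" "i3 \<noteq> k" "i1 \<noteq> i2" "i1 \<noteq> i3" "i2 \<noteq> i3"
    and U: "(UNIV :: 4 set) = {k, i1, i2, i3}" unfolding good_def by blast+
  \<comment> \<open>Nullity equates the square of the timelike component with the sum of the other
    three squares, so a nonzero \<open>b\<close> has a nonzero spatial part.\<close>
  have nz: "\<beta> i1 \<noteq> 0 \<or> \<beta> i2 \<noteq> 0 \<or> \<beta> i3 \<noteq> 0"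
  proof -
    have "- (\<beta> k * \<beta> k) + \<beta> i1 * \<beta> i1 + \<beta> i2 * \<beta> i2 + \<beta> i3 * \<beta> i3 = 0"
      using bb i unfolding U by simp
    moreover obtain j where "\<beta> j \<noteq> 0" "j \<in> {k, i1, i2, i3}" using ex U by blast
    ultimately show ?thesis by auto
  qed
  define v where "v x1 x2 x3 = x1 *\<^sub>R e i1 + x2 *\<^sub>R e i2 + x3 *\<^sub>R e i3" for x1 x2 x3
  have av: "v x1 x2 x3 \<bullet> (a *v v y1 y2 y3) = x1 * y1 + x2 * y2 + x3 * y3" for x1 x2 x3 y1 y2 y3
    using i by (simp add: v_def matrix_vector_right_distrib matrix_vector_mult_scaleR inner_add_left
        inner_add_right e)
  have bv: "b \<bullet> v x1 x2 x3 = x1 * \<beta> i1 + x2 * \<beta> i2 + x3 * \<beta> i3" for x1 x2 x3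
    by (simp add: v_def \<beta>_def inner_add_right)
  show thesis
  proof (cases "\<beta> i1 = 0 \<and> \<beta> i2 = 0")
    case True
    then show thesis using that[OF K bK, of "v 1 0 0" "v 0 1 0"] by (simp add: av bv)
  next
    case False
    define r where "r = sqrt ((\<beta> i1)\<^sup>2 + (\<beta> i2)\<^sup>2)"
    define s where "s = sqrt ((\<beta> i1)\<^sup>2 + (\<beta> i2)\<^sup>2 + (\<beta> i3)\<^sup>2)"
    have p: "(\<beta> i1)\<^sup>2 + (\<beta> i2)\<^sup>2 > 0" using False by (auto simp: sum_power2_gt_zero_iff)
    then have r: "r > 0" "r * r = (\<beta> i1)\<^sup>2 + (\<beta> i2)\<^sup>2" by (auto simp: r_def)
    have s: "s > 0" "s * s = r * r + (\<beta> i3)\<^sup>2" unfolding r(2) using p by (auto simp: s_def add_pos_nonneg)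
    define E where "E = v (\<beta> i2 / r) (- \<beta> i1 / r) 0"
    \<comment> \<open>The cross product of the unit vector along the spatial part of
      \<open>b\<close> with \<open>E\<close>.\<close>
    define E' where "E' = v (\<beta> i1 * \<beta> i3 / (r * s)) (\<beta> i2 * \<beta> i3 / (r * s)) (- (r * r) / (r * s))"
    have 1: "E \<bullet> (a *v E) = 1"
    proof -
      have "E \<bullet> (a *v E) = ((\<beta> i1)\<^sup>2 + (\<beta> i2)\<^sup>2) / (r * r)"
        by (simp add: E_def av power2_eq_square add_divide_distrib)
      then show ?thesis using r(1) unfolding r(2)[symmetric] by simp
    qed
    have 2: "E' \<bullet> (a *v E') = 1"
    proof -
      have "E' \<bullet> (a *v E') = (((\<beta> i1)\<^sup>2 + (\<beta> i2)\<^sup>2) * (\<beta> i3)\<^sup>2 + (r * r) * (r * r)) / ((r * r) * (s * s))"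
        by (simp add: E'_def av power2_eq_square add_divide_distrib algebra_simps)
      also have "\<dots> = ((r * r) * (s * s)) / ((r * r) * (s * s))"
        unfolding s(2) r(2)[symmetric] by (simp add: algebra_simps)
      also have "\<dots> = 1" using r(1) s(1) by simp
      finally show ?thesis .
    qed
    have 3: "b \<bullet> E = 0" by (simp add: E_def bv)
    have 4: "b \<bullet> E' = 0"
    proof -
      have "b \<bullet> E' = (((\<beta> i1)\<^sup>2 + (\<beta> i2)\<^sup>2) * \<beta> i3 - (r * r) * \<beta> i3) / (r * s)"
        by (simp add: E'_def bv power2_eq_square add_divide_distrib diff_divide_distrib algebra_simps)
      then show ?thesis using r(2) by simp
    qed
    have "E \<bullet> (a *v E') = 0" "E' \<bullet> (a *v E) = 0" by (simp_all add: E_def E'_def av)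
    then show thesis using that[OF K bK 3 4 1 2] by blast
  qed
qed

subsection \<open>The Levi-Civita connection\<close>

definition conn_matrix where
  "conn_matrix S g c i x = (\<chi> k j. christoffel S g c x k i j)"

context smooth_manifold
begin

text \<open>Lowering the upper index cancels the inverse metric and leaves Christoffel symbols of
  the first kind; two of them with exchanged outer indices add up to the derivative of the
  metric.\<close>

lemma conn_matrix_compatible:
  fixes g :: "('m, 'n) form2"
  assumes c: "c \<in> S" and U: "open U" and g: "pseudo_riemannian_on S U g"
    and x: "x \<in> snd c ` (fst c \<inter> U)"
  shows "conn_matrix S g c i x $ k $ j = conn_matrix S g c j x $ k $ i"
    "dirderiv (axis i 1) (comp2 S g c) x
      = transpose (conn_matrix S g c i x) ** comp2 S g c x + comp2 S g c x ** conn_matrix S g c i x"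
proof -
  define X where "X = snd c ` (fst c \<inter> U)"
  define h where "h = comp2 S g c"
  have X: "open X" "x \<in> X" and Xc: "\<And>x. x \<in> X \<Longrightarrow> x \<in> chart_image c \<and> chart_inv c x \<in> U"
    using open_image[OF c U] x image_eq[OF c] by (auto simp: X_def)
  have sm: "smooth_on X h" unfolding h_def X_def by (rule smooth_comp2[OF c U g])
  have sym: "h x $ i $ j = h x $ j $ i" if "x \<in> X" for x i j
    unfolding h_def using comp2_sym[OF c _ _ g] Xc[OF that] by blast
  have inv: "invertible (h x)" unfolding h_def using comp2_nondegenerate[OF c _ _ g] Xc[OF X(2)] by blast
  have row: "(\<lambda>x. h x $ j) differentiable at x" for j
    by (rule smooth_on_differentiable[OF smooth_on_vec_nth[OF X(1) sm] X(2)])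
  define d where "d i j l = dirderiv (axis i 1) (\<lambda>x. h x $ j $ l) x" for i j l
  have d: "dirderiv (axis i 1) h x $ j $ l = d i j l" for i j l
    unfolding d_def by (simp add: dirderiv_nth[OF row] dirderiv_nth[OF smooth_on_differentiable[OF sm X(2)]])
  have dsym: "d i j l = d i l j" for i j l
    unfolding d_def by (rule dirderiv_cong_open[OF X]) (rule sym)
  have \<Gamma>: "conn_matrix S g c i x $ k $ j = (1 / 2) * (\<Sum>l\<in>UNIV. matrix_inv (h x) $ k $ l * (d i j l + d j i l - d l i j))" for i j k
    by (simp add: conn_matrix_def christoffel_def h_def d_def)
  show "conn_matrix S g c i x $ k $ j = conn_matrix S g c j x $ k $ i"
    unfolding \<Gamma> using dsym by (simp add: add.commute)
  have low: "(h x ** conn_matrix S g c i x) $ l $ j = (1 / 2) * (d i j l + d j i l - d l i j)" for i l j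
  proof -
    have "(h x ** conn_matrix S g c i x) $ l $ j
        = (h x *v (matrix_inv (h x) *v (\<chi> l. (1 / 2) * (d i j l + d j i l - d l i j)))) $ l"
      by (simp add: matrix_matrix_mult_def matrix_vector_mult_def \<Gamma> sum_distrib_left mult_ac)
    then show ?thesis by (simp add: matrix_vector_mul_assoc matrix_inv_mult[OF inv])
  qed
  have "(transpose (conn_matrix S g c i x) ** h x) $ l $ j = (h x ** conn_matrix S g c i x) $ j $ l" for l j
    by (simp add: matrix_matrix_mult_def transpose_def sym[OF X(2), of _ j] mult.commute)
  then have tr: "(transpose (conn_matrix S g c i x) ** h x) $ l $ j = (1 / 2) * (d i l j + d l i j - d j i l)" for l j
    by (simp only: low)
  have "dirderiv (axis i 1) h x $ l $ j
     = (transpose (conn_matrix S g c i x) ** h x + h x ** conn_matrix S g c i x) $ l $ j" for l j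
    unfolding vector_add_component tr low d dsym[of i j l] by (simp add: field_simps)
  then show "dirderiv (axis i 1) (comp2 S g c) x
      = transpose (conn_matrix S g c i x) ** comp2 S g c x + comp2 S g c x ** conn_matrix S g c i x"
    unfolding h_def by (simp add: vec_eq_iff)
qed

lemma smooth_conn_matrix:
  fixes g :: "('m, 'n) form2"
  assumes c: "c \<in> S" and U: "open U" and g: "pseudo_riemannian_on S U g"
  shows "smooth_on (snd c ` (fst c \<inter> U)) (conn_matrix S g c i)"
proof -
  have X: "open (snd c ` (fst c \<inter> U))" by (rule open_image[OF c U])
  have sm: "smooth_on (snd c ` (fst c \<inter> U)) (\<lambda>x. comp2 S g c x $ k $ l)" for k l
    by (intro smooth_on_vec_nth[OF X] smooth_comp2[OF c U g])
  have inv: "invertible (comp2 S g c x)" if "x \<in> snd c ` (fst c \<inter> U)" for x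
    by (rule comp2_nondegenerate[OF c _ _ g]) (use that image_eq[OF c] in auto)
  show ?thesis
    unfolding conn_matrix_def christoffel_def
    by (intro smooth_on_vec_lambda smooth_on_mult smooth_on_const smooth_on_sum smooth_on_matrix_inv
        smooth_on_add smooth_on_diff smooth_on_dirderiv X sm inv)
qed

end

subsection \<open>Logarithmic derivative of a Kropina function\<close>

lemma dirderiv_quadratic_pair:
  fixes a :: "real ^ 'n::finite \<Rightarrow> real ^ 'n ^ 'n"
  assumes "a differentiable at x"
  shows "(\<lambda>z. snd z \<bullet> (a (fst z) *v snd z)) differentiable at (x, y)"
    "dirderiv (v, w) (\<lambda>z. snd z \<bullet> (a (fst z) *v snd z)) (x, y)
      = y \<bullet> (dirderiv v a x *v y) + y \<bullet> (a x *v w) + w \<bullet> (a x *v y)"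
proof -
  have "((\<lambda>z. a (fst z)) has_derivative (\<lambda>h. dirderiv (fst h) a x)) (at (x, y))"
    by (rule has_derivative_compose[where f = fst and g = a, OF has_derivative_fst[OF has_derivative_ident]])
       (simp add: has_derivative_dirderiv[OF assms])
  from bounded_bilinear.FDERIV[OF bounded_bilinear_matrix_vector this has_derivative_snd[OF has_derivative_ident]]
  have "((\<lambda>z. a (fst z) *v snd z) has_derivative
      (\<lambda>h. a x *v snd h + dirderiv (fst h) a x *v y)) (at (x, y))" by simp
  from has_derivative_inner[OF has_derivative_snd[OF has_derivative_ident] this]
  have d: "((\<lambda>z. snd z \<bullet> (a (fst z) *v snd z)) has_derivative
     (\<lambda>h. y \<bullet> (a x *v snd h + dirderiv (fst h) a x *v y) + snd h \<bullet> (a x *v y))) (at (x, y))" by simp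
  show "(\<lambda>z. snd z \<bullet> (a (fst z) *v snd z)) differentiable at (x, y)" by (rule differentiableI[OF d])
  show "dirderiv (v, w) (\<lambda>z. snd z \<bullet> (a (fst z) *v snd z)) (x, y)
      = y \<bullet> (dirderiv v a x *v y) + y \<bullet> (a x *v w) + w \<bullet> (a x *v y)"
    unfolding dirderiv_eqI[OF d] by (simp add: inner_add_right)
qed

lemma dirderiv_linear_pair:
  fixes b :: "real ^ 'n::finite \<Rightarrow> real ^ 'n"
  assumes "b differentiable at x"
  shows "(\<lambda>z. b (fst z) \<bullet> snd z) differentiable at (x, y)"
    "dirderiv (v, w) (\<lambda>z. b (fst z) \<bullet> snd z) (x, y) = dirderiv v b x \<bullet> y + b x \<bullet> w"
proof -
  have "((\<lambda>z. b (fst z)) has_derivative (\<lambda>h. dirderiv (fst h) b x)) (at (x, y))"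
    by (rule has_derivative_compose[where f = fst and g = b, OF has_derivative_fst[OF has_derivative_ident]])
       (simp add: has_derivative_dirderiv[OF assms])
  from has_derivative_inner[OF this has_derivative_snd[OF has_derivative_ident]]
  have d: "((\<lambda>z. b (fst z) \<bullet> snd z) has_derivative
     (\<lambda>h. b x \<bullet> snd h + dirderiv (fst h) b x \<bullet> y)) (at (x, y))" by simp
  show "(\<lambda>z. b (fst z) \<bullet> snd z) differentiable at (x, y)" by (rule differentiableI[OF d])
  show "dirderiv (v, w) (\<lambda>z. b (fst z) \<bullet> snd z) (x, y) = dirderiv v b x \<bullet> y + b x \<bullet> w"
    unfolding dirderiv_eqI[OF d] by simp
qed

text \<open>Taking \<open>ln\<close> of the square covers both signs of \<open>f\<close> at
  once.\<close>

lemma has_derivative_ln_square: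
  fixes f :: "'a::real_normed_vector \<Rightarrow> real"
  assumes "(f has_derivative f') (at x)" "f x \<noteq> 0"
  shows "((\<lambda>x. ln ((f x)\<^sup>2)) has_derivative (\<lambda>h. 2 * f' h / f x)) (at x)"
proof -
  have p: "0 < (f x)\<^sup>2" using assms(2) by simp
  show ?thesis
    by (rule has_derivative_eq_rhs[OF has_derivative_ln[OF p has_derivative_power[OF assms(1)]]])
       (use assms(2) in \<open>simp add: fun_eq_iff field_simps power2_eq_square\<close>)
qed

text \<open>Here \<open>f\<close> stands for F^2. Its logarithmic derivative along the horizontal
  lift of \<open>axis k 1\<close> is (1+m) q'/q - 2m t'/t, where q and t are the values of
  \<open>a\<close> and \<open>b\<close> on \<open>y\<close>, and q' and t' those of their covariant
  derivatives. Clearing denominators gives an identity cubic in \<open>y\<close>.\<close>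

lemma kropina_preserved_iff:
  fixes a :: "real ^ 'n::finite \<Rightarrow> real ^ 'n ^ 'n" and b :: "real ^ 'n \<Rightarrow> real ^ 'n"
    and f :: "(real ^ 'n) \<times> (real ^ 'n) \<Rightarrow> real"
  assumes D: "open D" and X: "open X" "\<And>x y. (x, y) \<in> D \<Longrightarrow> x \<in> X" and ab: "smooth_on X a" "smooth_on X b"
    and f: "\<And>x y. (x, y) \<in> D \<Longrightarrow> y \<bullet> (a x *v y) \<noteq> 0 \<Longrightarrow> b x \<bullet> y \<noteq> 0 \<Longrightarrow>
      f (x, y) = exp ((1 + m) / 2 * ln ((y \<bullet> (a x *v y))\<^sup>2) - m * ln ((b x \<bullet> y)\<^sup>2))"
    and z: "(x, y) \<in> D" and nz: "y \<bullet> (a x *v y) \<noteq> 0" "b x \<bullet> y \<noteq> 0"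
  shows "dx k f (x, y) = dirderiv (0, G *v y) f (x, y) \<longleftrightarrow>
    (1 + m) * ((y \<bullet> ((dirderiv (axis k 1) a x - (transpose G ** a x + a x ** G)) *v y)) * (b x \<bullet> y))
      = (2 * m) * ((y \<bullet> (a x *v y)) * ((dirderiv (axis k 1) b x - b x v* G) \<bullet> y))"
proof -
  define q where "q z = snd z \<bullet> (a (fst z) *v snd z)" for z
  define \<beta> where "\<beta> z = b (fst z) \<bullet> snd z" for z
  have qd: "q differentiable at (x, y)" and \<beta>d: "\<beta> differentiable at (x, y)" if "(x, y) \<in> D" for x y
    using dirderiv_quadratic_pair(1)[OF smooth_on_differentiable[OF ab(1) X(2)[OF that]]]
      dirderiv_linear_pair(1)[OF smooth_on_differentiable[OF ab(2) X(2)[OF that]]]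
    by (simp_all add: q_def[abs_def] \<beta>_def[abs_def])
  define D' where "D' = {z \<in> D. q z * \<beta> z \<noteq> 0}"
  have "continuous_on D (\<lambda>z. q z * \<beta> z)"
  proof (rule continuous_at_imp_continuous_on, rule ballI)
    fix z assume "z \<in> D"
    then have "(fst z, snd z) \<in> D" by simp
    from qd[OF this] \<beta>d[OF this] show "isCont (\<lambda>z. q z * \<beta> z) z"
      by (intro continuous_mult differentiable_imp_continuous_within) simp_all
  qed
  from continuous_open_preimage[OF this D, of "- {0}"]
  have D': "open D'" by (auto simp: D'_def vimage_def Int_def)
  have z': "(x, y) \<in> D'" using z nz by (simp add: D'_def q_def \<beta>_def)
  have fD: "f z = exp ((1 + m) / 2 * ln ((q z)\<^sup>2) - m * ln ((\<beta> z)\<^sup>2))" if "z \<in> D'" for z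
    using f[of "fst z" "snd z"] that by (simp add: D'_def q_def \<beta>_def)
  let ?z = "(x, y)"
  have q0: "q ?z \<noteq> 0" and \<beta>0: "\<beta> ?z \<noteq> 0" using nz by (auto simp: q_def \<beta>_def)
  define E where "E = exp ((1 + m) / 2 * ln ((q ?z)\<^sup>2) - m * ln ((\<beta> ?z)\<^sup>2))"
  have "((\<lambda>z. exp ((1 + m) / 2 * ln ((q z)\<^sup>2) - m * ln ((\<beta> z)\<^sup>2))) has_derivative
     (\<lambda>w. E * ((1 + m) * (dirderiv w q ?z / q ?z) - 2 * m * (dirderiv w \<beta> ?z / \<beta> ?z)))) (at ?z)"
  proof (rule has_derivative_eq_rhs)
    show "((\<lambda>z. exp ((1 + m) / 2 * ln ((q z)\<^sup>2) - m * ln ((\<beta> z)\<^sup>2))) has_derivative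
      (\<lambda>w. ((1 + m) / 2 * (2 * dirderiv w q ?z / q ?z) - m * (2 * dirderiv w \<beta> ?z / \<beta> ?z)) *
        exp ((1 + m) / 2 * ln ((q ?z)\<^sup>2) - m * ln ((\<beta> ?z)\<^sup>2)))) (at ?z)"
      by (intro has_derivative_exp has_derivative_diff has_derivative_mult_right has_derivative_ln_square
          has_derivative_dirderiv qd[OF z] \<beta>d[OF z] q0 \<beta>0)
  qed (simp add: E_def fun_eq_iff)
  then have fd: "(f has_derivative
     (\<lambda>w. E * ((1 + m) * (dirderiv w q ?z / q ?z) - 2 * m * (dirderiv w \<beta> ?z / \<beta> ?z)))) (at ?z)"
    by (rule has_derivative_transform_within_open[OF _ D' z']) (simp add: fD)
  have "dx k f ?z - dirderiv (0, G *v y) f ?z = dirderiv (axis k 1, - (G *v y)) f ?z"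
    using linear_diff[OF linear_dirderiv[OF differentiableI[OF fd]], of "(axis k 1, 0)" "(0, G *v y)"]
    by (simp add: dx_def)
  also have "\<dots> = E * ((1 + m) * (dirderiv (axis k 1, - (G *v y)) q ?z / q ?z)
      - 2 * m * (dirderiv (axis k 1, - (G *v y)) \<beta> ?z / \<beta> ?z))"
    by (rule dirderiv_eqI[OF fd])
  finally have diff: "dx k f ?z - dirderiv (0, G *v y) f ?z = \<dots>" .
  have E: "E \<noteq> 0" by (simp add: E_def)
  have "dx k f ?z = dirderiv (0, G *v y) f ?z \<longleftrightarrow> dx k f ?z - dirderiv (0, G *v y) f ?z = 0" by simp
  also have "\<dots> \<longleftrightarrow> (1 + m) * (dirderiv (axis k 1, - (G *v y)) q ?z / q ?z)
      - 2 * m * (dirderiv (axis k 1, - (G *v y)) \<beta> ?z / \<beta> ?z) = 0"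
    unfolding diff using E by (simp only: mult_eq_0_iff simp_thms)
  also have "\<dots> \<longleftrightarrow> (1 + m) * (dirderiv (axis k 1, - (G *v y)) q ?z * \<beta> ?z)
        = (2 * m) * (q ?z * dirderiv (axis k 1, - (G *v y)) \<beta> ?z)"
    using q0 \<beta>0 by (simp add: field_simps)
  finally have 1: "dx k f ?z = dirderiv (0, G *v y) f ?z \<longleftrightarrow>
      (1 + m) * (dirderiv (axis k 1, - (G *v y)) q ?z * \<beta> ?z)
        = (2 * m) * (q ?z * dirderiv (axis k 1, - (G *v y)) \<beta> ?z)" .
  have 2: "dirderiv (axis k 1, - (G *v y)) q ?z
      = y \<bullet> ((dirderiv (axis k 1) a x - (transpose G ** a x + a x ** G)) *v y)"
  proof -
    have "dirderiv (axis k 1, - (G *v y)) q ?z = y \<bullet> (dirderiv (axis k 1) a x *v y)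
        + y \<bullet> (a x *v (- (G *v y))) + (- (G *v y)) \<bullet> (a x *v y)"
      unfolding q_def by (rule dirderiv_quadratic_pair(2)[OF smooth_on_differentiable[OF ab(1) X(2)[OF z]]])
    moreover have "(G *v y) \<bullet> (a x *v y) = y \<bullet> ((transpose G ** a x) *v y)"
      by (simp only: matrix_vector_mul_assoc[symmetric] inner_transpose)
    moreover have "a x *v (- (G *v y)) = - ((a x ** G) *v y)"
      by (simp add: matrix_vector_mul_assoc[symmetric] linear_neg[OF matrix_vector_mul_linear])
    ultimately show ?thesis
      by (simp add: matrix_vector_mult_diff_rdistrib matrix_vector_mult_add_rdistrib inner_diff_right inner_add_right)
  qed
  have 3: "dirderiv (axis k 1, - (G *v y)) \<beta> ?z = (dirderiv (axis k 1) b x - b x v* G) \<bullet> y"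
  proof -
    have "dirderiv (axis k 1, - (G *v y)) \<beta> ?z = dirderiv (axis k 1) b x \<bullet> y + b x \<bullet> (- (G *v y))"
      unfolding \<beta>_def by (rule dirderiv_linear_pair(2)[OF smooth_on_differentiable[OF ab(2) X(2)[OF z]]])
    then show ?thesis by (simp add: inner_diff_left dot_lmul_matrix)
  qed
  show ?thesis using 1 unfolding 2 3 by (simp add: q_def \<beta>_def)
qed

lemma kropina_square:
  assumes "is_power (\<bar>q\<bar>) ((1 + m) / 2) r" "is_power t (- m) s" "q \<noteq> 0" "t \<noteq> 0"
  shows "(r * s)\<^sup>2 = exp ((1 + m) / 2 * ln (q\<^sup>2) - m * ln (t\<^sup>2))"
proof -
  have r: "r\<^sup>2 = exp ((1 + m) / 2 * ln (q\<^sup>2))"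
    using is_power_square[OF assms(1)] assms(3) unfolding power2_abs by simp
  have s: "s\<^sup>2 = exp (- m * ln (t\<^sup>2))" using is_power_square[OF assms(2,4)] .
  show ?thesis unfolding power_mult_distrib r s exp_add[symmetric] by (simp only: minus_mult_left diff_conv_add_uminus)
qed

text \<open>The square of a linear form has a vertical Hessian of rank at most one, which is
  degenerate in dimension at least two. This excludes zeros of \<open>b\<close> and the exponent
  \<open>m = - 1\<close>.\<close>

lemma (in local_finsler) not_square_of_linear:
  assumes z: "(x, y) \<in> D" and L: "\<And>y. (x, y) \<in> D \<Longrightarrow> L (x, y) = (w \<bullet> y)\<^sup>2" and n: "2 \<le> CARD('n)"
  shows False
proof -
  have d1: "((\<lambda>z::(real ^ 'n) \<times> (real ^ 'n). (w \<bullet> snd z)\<^sup>2) has_derivative (\<lambda>h. 2 * (w \<bullet> snd z) * (w \<bullet> snd h))) (at z)" for z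
    by (auto intro!: derivative_eq_intros)
  have d2: "((\<lambda>z::(real ^ 'n) \<times> (real ^ 'n). 2 * (w \<bullet> snd z) * w $ j) has_derivative (\<lambda>h. 2 * (w \<bullet> snd h) * w $ j)) (at z)" for z j
    by (auto intro!: derivative_eq_intros)
  have 1: "dy j L (x, y) = 2 * (w \<bullet> y) * w $ j" if z: "(x, y) \<in> D" for y j
  proof -
    have "dy j L (x, y) = dy j (\<lambda>z. (w \<bullet> snd z)\<^sup>2) (x, y)"
      unfolding dy_def by (rule dirderiv_vertical_cong[OF vertical_fibre[OF z]])
        (use L differentiableI[OF d1] diff_at[OF smooth_L z] in auto)
    then show ?thesis by (simp add: dy_def dirderiv_eqI[OF d1] inner_axis)
  qed
  have "fundamental_tensor F (x, y) $ i $ j = w $ i * w $ j" for i j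
  proof -
    have "dy i (dy j L) (x, y) = dy i (\<lambda>z. 2 * (w \<bullet> snd z) * w $ j) (x, y)"
      unfolding dy_def[of i] by (rule dirderiv_vertical_cong[OF vertical_fibre[OF z]])
        (use 1 differentiableI[OF d2] diff_at[OF smooth_dy[OF smooth_L] z] in auto)
    then show ?thesis using z by (simp add: fundamental_tensor_L dy_def[of i] dirderiv_eqI[OF d2] inner_axis)
  qed
  moreover obtain v :: "real ^ 'n" where v: "v \<noteq> 0" "w \<bullet> v = 0"
    using orthogonal_to_vector_exists[of w] n by (auto simp: orthogonal_def)
  ultimately have "fundamental_tensor F (x, y) *v v = 0"
    by (simp add: vec_eq_iff matrix_vector_mult_def inner_vec_def mult.assoc flip: sum_distrib_left)
  then have "v = 0" using inv[OF z] by (metis invertible_def matrix_vector_mul_assoc matrix_vector_mul_lid matrix_vector_mult_0_right)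
  with v show False by simp
qed

subsection \<open>Parallel data of a locally metrizable Kropina metric\<close>

locale null_kropina = smooth_manifold S
  for S :: "('m::{t2_space, second_countable_topology}, 4) chart set" +
  fixes A :: "('m \<times> ('m, 4) tvec) set" and F :: "'m \<times> ('m, 4) tvec \<Rightarrow> real"
    and a :: "('m, 4) form2" and b :: "('m, 4) form1" and m :: real
  assumes m0: "m \<noteq> 0" and kropina: "m_kropina S A m a b F" and lorentz: "lorentzian S a"
    and null: "null_form S a b" and berwald: "berwald S A F" and metrizable: "locally_metrizable S A F"
begin

lemma fm: "finsler_metric S A F" and oneb: "one_form S b" and pra: "pseudo_riemannian_on S UNIV a"
  using kropina by (simp_all add: m_kropina_def)

lemma lf: "c \<in> S \<Longrightarrow> local_finsler (F \<circ> bundle_point S c) (bundle_coords S A c)"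
  by (rule local_finsler[OF fm])

lemma coords_in: "(x, y) \<in> bundle_coords S A c \<Longrightarrow> x \<in> chart_image c"
  by (simp add: bundle_coords_def)

lemma fibre:
  assumes "c \<in> S" "x \<in> chart_image c"
  obtains y where "(x, y) \<in> bundle_coords S A c"
  using fibre_nonempty[of A c x] fm assms by (auto simp: finsler_metric_def)

lemma smooth_a: "c \<in> S \<Longrightarrow> smooth_on (chart_image c) (comp2 S a c)"
  using smooth_comp2[OF _ open_UNIV pra, of c] by simp

lemma smooth_b: "c \<in> S \<Longrightarrow> smooth_on (chart_image c) (comp1 S b c)"
  using oneb by (simp add: one_form_def)

lemma sym_a: "c \<in> S \<Longrightarrow> x \<in> chart_image c \<Longrightarrow> transpose (comp2 S a c x) = comp2 S a c x"
  using comp2_sym[OF _ _ UNIV_I pra] by (simp add: transpose_def vec_eq_iff)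

lemma inv_a: "c \<in> S \<Longrightarrow> x \<in> chart_image c \<Longrightarrow> invertible (comp2 S a c x)"
  by (rule comp2_nondegenerate[OF _ _ UNIV_I pra])

lemma kropina_form:
  assumes c: "c \<in> S" and z: "(x, y) \<in> bundle_coords S A c"
  shows "\<exists>r s. is_power (sqrt \<bar>y \<bullet> (comp2 S a c x *v y)\<bar>) (1 + m) r \<and> is_power (comp1 S b c x \<bullet> y) (- m) s \<and>
    (F \<circ> bundle_point S c) (x, y) = r * s"
proof -
  have x: "x \<in> chart_image c" and "bundle_point S c (x, y) \<in> A" using z by (auto simp: bundle_coords_def)
  then have "(chart_inv c x, tvec_of S c x y) \<in> A" by (simp add: bundle_point_def)
  then have "\<exists>r s. is_power (sqrt \<bar>a (chart_inv c x) (tvec_of S c x y) (tvec_of S c x y)\<bar>) (1 + m) r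
      \<and> is_power (b (chart_inv c x) (tvec_of S c x y)) (- m) s \<and> F (chart_inv c x, tvec_of S c x y) = r * s"
    using kropina unfolding m_kropina_def by blast
  then show ?thesis
    unfolding form2_tvec_of[OF c x UNIV_I pra] form1_tvec_of[OF c x oneb] by (simp add: bundle_point_def)
qed

text \<open>At a zero of \<open>b\<close> the relation \<open>is_power 0 (- m) s\<close> leaves only
  \<open>s = 0\<close>, so \<open>F\<close> would vanish on the whole fibre.\<close>

lemma b_nonzero:
  assumes c: "c \<in> S" and x: "x \<in> chart_image c"
  shows "comp1 S b c x \<noteq> 0"
proof
  assume 0: "comp1 S b c x = 0"
  interpret local_finsler "F \<circ> bundle_point S c" "bundle_coords S A c" by (rule lf[OF c])
  obtain y where y: "(x, y) \<in> bundle_coords S A c" using fibre[OF c x] .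
  have "L (x, y) = (0 \<bullet> y)\<^sup>2" if z: "(x, y) \<in> bundle_coords S A c" for y
  proof -
    obtain r s where "is_power 0 (- m) s" "(F \<circ> bundle_point S c) (x, y) = r * s"
      using kropina_form[OF c z] 0 by auto
    then show ?thesis by (auto simp: is_power_def L_def)
  qed
  from not_square_of_linear[OF y this] show False by simp
qed

text \<open>For \<open>m = - 1\<close> the root of the quadratic form has exponent 0, so its power
  is 1 wherever it is defined, and \<open>F\<close> would be the linear form
  \<open>b\<close>.\<close>

lemma m1: "1 + m \<noteq> 0"
proof
  assume m1: "1 + m = 0"
  then have "- m = 1" by simp
  obtain c where c: "c \<in> S" "undefined \<in> fst c" by (rule covering)
  define x where "x = snd c undefined"
  have x: "x \<in> chart_image c" using c by (auto simp: x_def)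
  interpret local_finsler "F \<circ> bundle_point S c" "bundle_coords S A c" by (rule lf[OF c(1)])
  obtain y where y: "(x, y) \<in> bundle_coords S A c" using fibre[OF c(1) x] .
  have "L (x, y) = (comp1 S b c x \<bullet> y)\<^sup>2" if z: "(x, y) \<in> bundle_coords S A c" for y
  proof -
    obtain r s where rs: "is_power (sqrt \<bar>y \<bullet> (comp2 S a c x *v y)\<bar>) 0 r" "is_power (comp1 S b c x \<bullet> y) 1 s"
      "(F \<circ> bundle_point S c) (x, y) = r * s"
      using kropina_form[OF c(1) z] m1 \<open>- m = 1\<close> by auto
    have "r = 1" using rs(1) by (auto simp: is_power_def)
    moreover have "s = comp1 S b c x \<bullet> y" using rs(2) by (auto simp: is_power_def)
    ultimately show ?thesis using rs(3) by (simp add: L_def)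
  qed
  from not_square_of_linear[OF y this] show False by simp
qed

lemma frame_at:
  assumes c: "c \<in> S" and x: "x \<in> chart_image c"
  obtains K E E' where "comp2 S a c x *v K = comp1 S b c x" "comp1 S b c x \<bullet> K = 0"
    "comp1 S b c x \<bullet> E = 0" "comp1 S b c x \<bullet> E' = 0"
    "E \<bullet> (comp2 S a c x *v E) = 1" "E' \<bullet> (comp2 S a c x *v E') = 1"
    "E \<bullet> (comp2 S a c x *v E') = 0" "E' \<bullet> (comp2 S a c x *v E) = 0"
proof -
  obtain e :: "4 \<Rightarrow> ('m, 4) tvec" and k where e: "\<And>i. e i \<in> tangent_space S (chart_inv c x)"
    "\<And>i j. a (chart_inv c x) (e i) (e j) = (if i \<noteq> j then 0 else if i = k then - 1 else 1)"
    using lorentz unfolding lorentzian_def by metis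
  have ei: "e i = tvec_of S c x (e i c)" for i
    using tangent_eq_tvec_of[OF c chart_inv_in[OF c x] e(1)] c x by simp
  have "e i c \<bullet> (comp2 S a c x *v e j c) = (if i \<noteq> j then 0 else if i = k then - 1 else 1)" for i j
    using form2_tvec_of[OF c x UNIV_I pra, of "e i c" "e j c"] e(2)[of i j] ei by metis
  moreover have "(\<Sum>i\<in>UNIV. \<Sum>j\<in>UNIV. matrix_inv (comp2 S a c x) $ i $ j * comp1 S b c x $ i * comp1 S b c x $ j) = 0"
    using null c x unfolding null_form_def norm_sq1_def by blast
  ultimately show thesis
    by (rule null_frame[of "\<lambda>i. e i c" "comp2 S a c x" k "comp1 S b c x", OF _ b_nonzero[OF c x]]) (rule that)
qed

text \<open>The connection of \<open>g\<close> is the Berwald connection, hence preserves F^2;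
  \<open>kropina_preserved_iff\<close> turns this into a cubic identity and
  \<open>kropina_algebra\<close> factors it. The number \<open>f\<close> is the \<open>i\<close>-th
  component of the recurrence form.\<close>

lemma recurrence:
  fixes g :: "('m, 4) form2"
  assumes U: "open U" "pseudo_riemannian_on S U g"
    and \<Gamma>: "\<And>c x. c \<in> S \<Longrightarrow> x \<in> snd c ` (fst c \<inter> U) \<Longrightarrow> christoffel S g c x = affine_connection S A F c x"
    and c: "c \<in> S" and x: "x \<in> snd c ` (fst c \<inter> U)"
  defines "G \<equiv> \<lambda>i. conn_matrix S g c i x"
  shows "\<And>y k i. (x, y) \<in> bundle_coords S A c \<Longrightarrow> nonlinear_conn (F \<circ> bundle_point S c) k i (x, y) = (G i *v y) $ k"
    "\<exists>f. dirderiv (axis i 1) (comp2 S a c) x - (transpose (G i) ** comp2 S a c x + comp2 S a c x ** G i)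
        = (2 * m * f) *\<^sub>R comp2 S a c x \<and>
      dirderiv (axis i 1) (comp1 S b c) x - comp1 S b c x v* G i = ((1 + m) * f) *\<^sub>R comp1 S b c x"
proof -
  interpret local_finsler "F \<circ> bundle_point S c" "bundle_coords S A c" by (rule lf[OF c])
  let ?a = "comp2 S a c" and ?b = "comp1 S b c"
  have xc: "x \<in> chart_image c" using x by auto
  have sym: "G i $ k $ j = G j $ k $ i" for i j k
    unfolding G_def by (rule conn_matrix_compatible(1)[OF c U x])
  have "berwald_coeffs S A F c x (christoffel S g c x)"
    using affine_connection_coeffs[OF berwald c xc] \<Gamma>[OF c x] by simp
  then show N: "nonlinear_conn (F \<circ> bundle_point S c) k i (x, y) = (G i *v y) $ k" if "(x, y) \<in> bundle_coords S A c" for y k i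
    using that by (simp add: berwald_coeffs_def G_def conn_matrix_def matrix_vector_mult_def)
  have pres: "dx k L (x, y) = dirderiv (0, G k *v y) L (x, y)" if "(x, y) \<in> bundle_coords S A c" for k y
    by (rule berwald_preserves[OF sym N that])
  have Lf: "L (x, y) = exp ((1 + m) / 2 * ln ((y \<bullet> (?a x *v y))\<^sup>2) - m * ln ((?b x \<bullet> y)\<^sup>2))"
    if z: "(x, y) \<in> bundle_coords S A c" and nz: "y \<bullet> (?a x *v y) \<noteq> 0" "?b x \<bullet> y \<noteq> 0" for x y
  proof -
    obtain r s where "is_power \<bar>y \<bullet> (?a x *v y)\<bar> ((1 + m) / 2) r" "is_power (?b x \<bullet> y) (- m) s"
      "(F \<circ> bundle_point S c) (x, y) = r * s"
      using kropina_form[OF c z] by (auto simp: is_power_sqrt)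
    then show ?thesis using kropina_square[OF _ _ nz] by (simp add: L_def)
  qed
  define T where "T = dirderiv (axis i 1) ?a x - (transpose (G i) ** ?a x + ?a x ** G i)"
  define e where "e = dirderiv (axis i 1) ?b x - ?b x v* G i"
  have id: "(1 + m) * ((y \<bullet> (T *v y)) * (?b x \<bullet> y)) = (2 * m) * ((y \<bullet> (?a x *v y)) * (e \<bullet> y))"
    if "(x, y) \<in> bundle_coords S A c" "y \<bullet> (?a x *v y) \<noteq> 0" "?b x \<bullet> y \<noteq> 0" for y
    unfolding T_def e_def
  proof (rule kropina_preserved_iff[THEN iffD1])
    show "dx i L (x, y) = dirderiv (0, G i *v y) L (x, y)" by (rule pres[OF that(1)])
  qed (fact D open_im[OF c] coords_in smooth_a[OF c] smooth_b[OF c] Lf that)+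
  obtain y0 where y0: "(x, y0) \<in> bundle_coords S A c" using fibre[OF c xc] .
  define Y where "Y = {y. (x, y) \<in> bundle_coords S A c}"
  have Y: "open Y" "Y \<noteq> {}" using vertical_fibre[OF y0] by (auto simp: Y_def)
  have bn: "?b x \<noteq> 0" by (rule b_nonzero[OF c xc])
  \<comment> \<open>A unit vector in ker \<open>b\<close> witnesses that \<open>a\<close> does not
    vanish there, as the factorization requires.\<close>
  obtain K E E' where fr: "?b x \<bullet> E = 0" "E \<bullet> (?a x *v E) = 1" using frame_at[OF c xc] by metis
  have an: "?a x \<noteq> 0" using fr(2) by (metis inner_zero_right matrix_vector_mult_0 zero_neq_one)
  obtain y1 where y1: "y1 \<in> Y" "y1 \<bullet> (?a x *v y1) \<noteq> 0" "?b x \<bullet> y1 \<noteq> 0"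
    using form_nonzero_in_open[OF Y sym_a[OF c xc] an bn] .
  \<comment> \<open>The open set of directions in which both logarithms make sense;
    \<open>y1\<close> shows that it is nonempty.\<close>
  define Y' where "Y' = Y \<inter> {y. (y \<bullet> (?a x *v y)) * (?b x \<bullet> y) \<noteq> 0}"
  have "open {y. (y \<bullet> (?a x *v y)) * (?b x \<bullet> y) \<noteq> 0}"
    by (intro open_Collect_neq continuous_intros linear_continuous_on matrix_vector_mul_bounded_linear)
  then have Y': "open Y'" unfolding Y'_def using Y by blast
  have "y1 \<in> Y'" using y1 by (simp add: Y'_def)
  then have all: "(1 + m) * ((y \<bullet> (T *v y)) * (?b x \<bullet> y)) = (2 * m) * ((y \<bullet> (?a x *v y)) * (e \<bullet> y))" for y
    by (rule cubic_identity_extends[OF Y']) (use id in \<open>auto simp: Y'_def Y_def\<close>)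
  have symT: "transpose T = T"
  proof -
    have "dirderiv (axis i 1) ?a x $ k $ l = dirderiv (axis i 1) ?a x $ l $ k" for k l
    proof -
      have row: "(\<lambda>x. ?a x $ j) differentiable at x" for j
        by (rule smooth_on_differentiable[OF smooth_on_vec_nth[OF open_im[OF c] smooth_a[OF c]] xc])
      have "dirderiv (axis i 1) ?a x $ k $ l = dirderiv (axis i 1) (\<lambda>x. ?a x $ k $ l) x" for k l
        by (simp add: dirderiv_nth[OF row] dirderiv_nth[OF smooth_on_differentiable[OF smooth_a[OF c] xc]])
      moreover have "dirderiv (axis i 1) (\<lambda>x. ?a x $ k $ l) x = dirderiv (axis i 1) (\<lambda>x. ?a x $ l $ k) x"
        by (rule dirderiv_cong_open[OF open_im[OF c] xc]) (rule comp2_sym[OF c _ UNIV_I pra])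
      ultimately show ?thesis by simp
    qed
    then have "transpose (dirderiv (axis i 1) ?a x) = dirderiv (axis i 1) ?a x" by (simp add: transpose_def vec_eq_iff)
    moreover have "transpose (transpose (G i) ** ?a x + ?a x ** G i) = transpose (G i) ** ?a x + ?a x ** G i"
    proof -
      have "transpose (P + Q) = transpose P + transpose Q" for P Q :: "real ^ 4 ^ 4" by (simp add: transpose_def vec_eq_iff)
      then show ?thesis by (simp add: matrix_transpose_mul sym_a[OF c xc] add.commute)
    qed
    moreover have "transpose (P - Q) = transpose P - transpose Q" for P Q :: "real ^ 4 ^ 4" by (simp add: transpose_def vec_eq_iff)
    ultimately show ?thesis unfolding T_def by simp
  qed
  from kropina_algebra[OF m0 m1 sym_a[OF c xc] symT bn fr(1) _ all] fr(2)
  show "\<exists>f. dirderiv (axis i 1) (comp2 S a c) x - (transpose (G i) ** comp2 S a c x + comp2 S a c x ** G i)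
        = (2 * m * f) *\<^sub>R comp2 S a c x \<and>
      dirderiv (axis i 1) (comp1 S b c) x - comp1 S b c x v* G i = ((1 + m) * f) *\<^sub>R comp1 S b c x"
    unfolding T_def e_def by simp
qed

end

lemma matrix_add_right_distrib: "((P :: real ^ 'n ^ 'm) + Q) ** (C :: real ^ 'k ^ 'n::finite) = P ** C + Q ** C"
  by (simp add: matrix_matrix_mult_def vec_eq_iff distrib_right sum.distrib)

lemma scaleR_matrix_mult:
  fixes P :: "real ^ 'n::finite ^ 'm" and Q :: "real ^ 'k ^ 'n"
  shows "(t *\<^sub>R P) ** Q = t *\<^sub>R (P ** Q)" "P ** (t *\<^sub>R Q) = t *\<^sub>R (P ** Q)"
  by (simp_all add: matrix_matrix_mult_def vec_eq_iff sum_distrib_left mult_ac)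

lemma scaleR_vector_matrix:
  fixes P :: "real ^ 'n ^ 'm::finite"
  shows "(t *\<^sub>R x) v* P = t *\<^sub>R (x v* P)"
  by (simp add: vector_matrix_mult_def vec_eq_iff sum_distrib_left mult_ac)

context null_kropina
begin

text \<open>The recurrence form \<open>f\<close> is exact: with \<open>g\<close> a metric of the same connection, \<open>det a / det g\<close>
  has logarithmic derivative \<open>8 m f\<close>. Rescaling \<open>a\<close> and \<open>b\<close> by suitable powers of it makes them
  parallel without changing \<open>F\<close>.\<close>

lemma parallel_data:
  assumes c: "c \<in> S" and p: "p \<in> fst c"
  obtains X a' b' G where "open X" "snd c p \<in> X" "X \<subseteq> chart_image c"
    "smooth_on X a'" "smooth_on X b'" "\<And>i. smooth_on X (G i)"
    "\<And>x i j k. x \<in> X \<Longrightarrow> G i x $ k $ j = G j x $ k $ i"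
    "\<And>x. x \<in> X \<Longrightarrow> transpose (a' x) = a' x"
    "\<And>x i. x \<in> X \<Longrightarrow> dirderiv (axis i 1) a' x = transpose (G i x) ** a' x + a' x ** G i x"
    "\<And>x i. x \<in> X \<Longrightarrow> dirderiv (axis i 1) b' x = b' x v* G i x"
    "\<And>x y k i. (x, y) \<in> bundle_coords S A c \<Longrightarrow> x \<in> X \<Longrightarrow>
      nonlinear_conn (F \<circ> bundle_point S c) k i (x, y) = (G i x *v y) $ k"
    "\<And>x y. (x, y) \<in> bundle_coords S A c \<Longrightarrow> x \<in> X \<Longrightarrow>
      \<exists>r s. is_power \<bar>y \<bullet> (a' x *v y)\<bar> ((1 + m) / 2) r \<and> is_power (b' x \<bullet> y) (- m) s \<and>
        F (bundle_point S c (x, y)) = r * s"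
    "\<And>x. x \<in> X \<Longrightarrow> \<exists>K E E'. a' x *v K = b' x \<and> b' x \<bullet> K = 0 \<and> b' x \<bullet> E = 0 \<and> b' x \<bullet> E' = 0 \<and>
      E \<bullet> (a' x *v E) = 1 \<and> E' \<bullet> (a' x *v E') = 1 \<and> E \<bullet> (a' x *v E') = 0 \<and> E' \<bullet> (a' x *v E) = 0"
    "\<And>x. x \<in> X \<Longrightarrow> \<exists>\<sigma>>0. b' x = \<sigma> *\<^sub>R comp1 S b c x"
    "\<And>x. x \<in> X \<Longrightarrow> \<exists>\<rho>>0. a' x = \<rho> *\<^sub>R comp2 S a c x"
    "\<And>x. x \<in> X \<Longrightarrow> invertible (a' x)"
proof -
  obtain U g where U: "open U" "p \<in> U" "pseudo_riemannian_on S U g"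
    and \<Gamma>: "\<And>c x. c \<in> S \<Longrightarrow> x \<in> snd c ` (fst c \<inter> U) \<Longrightarrow> christoffel S g c x = affine_connection S A F c x"
    using metrizable unfolding locally_metrizable_def by metis
  define X where "X = snd c ` (fst c \<inter> U)"
  define G where "G i = conn_matrix S g c i" for i
  let ?a = "comp2 S a c" and ?b = "comp1 S b c" and ?g = "comp2 S g c"
  have X: "open X" "snd c p \<in> X" "X \<subseteq> chart_image c"
    using open_image[OF c U(1)] p U(2) by (auto simp: X_def)
  have XU: "chart_inv c x \<in> U" if "x \<in> X" for x using that image_eq[OF c] by (auto simp: X_def)
  note rec = recurrence[OF U(1,3) \<Gamma> c, folded X_def G_def]
  note sg = smooth_comp2[OF c U(1,3), folded X_def]
  have sa: "smooth_on X ?a" and sb: "smooth_on X ?b"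
    using smooth_a[OF c] smooth_b[OF c] X(3) smooth_on_subset by blast+
  have ia: "invertible (?a x)" and ig: "invertible (?g x)" if "x \<in> X" for x
    using inv_a[OF c] comp2_nondegenerate[OF c _ XU[OF that] U(3)] X(3) that by auto
  then have da: "det (?a x) \<noteq> 0" and dg: "det (?g x) \<noteq> 0" if "x \<in> X" for x
    using that by (auto simp: invertible_det_nz)
  define \<rho> where "\<rho> \<kappa> x = exp (\<kappa> * (ln ((det (?a x))\<^sup>2) - ln ((det (?g x))\<^sup>2)))" for \<kappa> :: real and x
  have \<rho>pos: "\<rho> \<kappa> x > 0" for \<kappa> x by (simp add: \<rho>_def)
  have sda: "smooth_on X (\<lambda>x. det (?a x))" and sdg: "smooth_on X (\<lambda>x. det (?g x))"
    by (intro smooth_on_det X(1) smooth_on_vec_nth sa sg)+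
  have s\<rho>: "smooth_on X (\<rho> \<kappa>)" for \<kappa>
    unfolding \<rho>_def using da dg
    by (intro smooth_on_exp_comp smooth_on_mult smooth_on_const smooth_on_diff smooth_on_ln_comp
        smooth_on_power sda sdg X(1)) auto
  have d\<rho>: "dirderiv (axis i 1) (\<rho> \<kappa>) x = 16 * m * \<kappa> * f * \<rho> \<kappa> x"
    if x: "x \<in> X" and f: "dirderiv (axis i 1) ?a x - (transpose (G i x) ** ?a x + ?a x ** G i x) = (2 * m * f) *\<^sub>R ?a x"
    for i \<kappa> x f
  proof -
    \<comment> \<open>Writing each derivative as a matrix times the metric makes Jacobi's formula
      applicable. Both traces contain twice the trace of \<open>G i x\<close>, so their difference
      is 2mf times the dimension 4.\<close>
    let ?N = "transpose (G i x) + ?a x ** G i x ** matrix_inv (?a x) + (2 * m * f) *\<^sub>R mat 1"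
    let ?M = "transpose (G i x) + ?g x ** G i x ** matrix_inv (?g x)"
    have "dirderiv (axis i 1) ?a x = ?N ** ?a x"
      using f by (simp add: matrix_add_right_distrib matrix_mul_assoc[symmetric] matrix_inv_mult[OF ia[OF x]]
          scaleR_matrix_mult algebra_simps)
    then have 1: "dirderiv (axis i 1) (\<lambda>x. det (?a x)) x = trace ?N * det (?a x)"
      by (rule dirderiv_det[OF smooth_on_differentiable[OF sa x]])
    have "dirderiv (axis i 1) ?g x = ?M ** ?g x"
      using conn_matrix_compatible(2)[OF c U(1,3), of x i] x unfolding X_def G_def
      by (simp add: matrix_add_right_distrib matrix_mul_assoc[symmetric] matrix_inv_mult[OF ig[OF x]])
    then have 2: "dirderiv (axis i 1) (\<lambda>x. det (?g x)) x = trace ?M * det (?g x)"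
      by (rule dirderiv_det[OF smooth_on_differentiable[OF sg x]])
    have tr: "trace (B ** G i x ** matrix_inv B) = trace (G i x)" if "invertible B" for B :: "real ^ 4 ^ 4" and i x
      using trace_mul_sym[of "B ** G i x" "matrix_inv B"]
      by (simp add: matrix_mul_assoc matrix_inv_mult[OF that])
    have tt: "trace ?N - trace ?M = 8 * m * f"
    proof -
      have "trace ((2 * m * f) *\<^sub>R mat 1 :: real ^ 4 ^ 4) = 8 * m * f"
        by (simp add: trace_def mat_def)
      then show ?thesis by (simp add: trace_add tr ia[OF x] ig[OF x])
    qed
    have "dirderiv (axis i 1) (\<rho> \<kappa>) x = (\<kappa> * (2 * dirderiv (axis i 1) (\<lambda>x. det (?a x)) x / det (?a x)
        - 2 * dirderiv (axis i 1) (\<lambda>x. det (?g x)) x / det (?g x))) * \<rho> \<kappa> x"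
      unfolding \<rho>_def
      by (rule dirderiv_eqI, intro has_derivative_exp has_derivative_mult_right has_derivative_diff
          has_derivative_ln_square has_derivative_dirderiv smooth_on_differentiable[OF sda x]
          smooth_on_differentiable[OF sdg x] da[OF x] dg[OF x])
    also have "2 * dirderiv (axis i 1) (\<lambda>x. det (?a x)) x / det (?a x) = 2 * trace ?N"
      unfolding 1 using da[OF x] by simp
    also have "2 * dirderiv (axis i 1) (\<lambda>x. det (?g x)) x / det (?g x) = 2 * trace ?M"
      unfolding 2 using dg[OF x] by simp
    also have "2 * trace ?N - 2 * trace ?M = 2 * (8 * m * f)" unfolding tt[symmetric] by simp
    finally show ?thesis by simp
  qed
  \<comment> \<open>Chosen so that 16m times the exponent is -2m and -(1+m) respectively, which
    cancels the recurrence of \<open>a\<close> and of \<open>b\<close>. Since (1+m)/2 times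
    \<open>\<kappa>a\<close> equals m times \<open>\<kappa>b\<close>, the two factors cancel in
    \<open>F\<close>.\<close>
  define \<kappa>a \<kappa>b where "\<kappa>a = - (1 / 8 :: real)" and "\<kappa>b = - ((1 + m) / (16 * m))"
  define a' where "a' = (\<lambda>x. \<rho> \<kappa>a x *\<^sub>R ?a x)"
  define b' where "b' = (\<lambda>x. \<rho> \<kappa>b x *\<^sub>R ?b x)"
  show thesis
  proof (rule that[of X a' b' G])
    show "smooth_on X a'" "smooth_on X b'"
      unfolding a'_def b'_def by (intro smooth_on_scaleR X(1) s\<rho> sa sb)+
    show "smooth_on X (G i)" for i
      unfolding G_def X_def by (rule smooth_conn_matrix[OF c U(1,3)])
    show "G i x $ k $ j = G j x $ k $ i" if "x \<in> X" for x i j k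
      using conn_matrix_compatible(1)[OF c U(1,3)] that unfolding X_def G_def by blast
    show "transpose (a' x) = a' x" if "x \<in> X" for x
    proof -
      have "transpose (t *\<^sub>R B) = t *\<^sub>R transpose B" for t and B :: "real ^ 4 ^ 4" by (simp add: transpose_def vec_eq_iff)
      then show ?thesis using sym_a[OF c, of x] that X(3) by (auto simp: a'_def)
    qed
    fix x i assume x: "x \<in> X"
    obtain f where f: "dirderiv (axis i 1) ?a x - (transpose (G i x) ** ?a x + ?a x ** G i x) = (2 * m * f) *\<^sub>R ?a x"
      "dirderiv (axis i 1) ?b x - ?b x v* G i x = ((1 + m) * f) *\<^sub>R ?b x"
      using rec(2)[OF _ _ x, of i] by blast
    have "dirderiv (axis i 1) a' x = \<rho> \<kappa>a x *\<^sub>R dirderiv (axis i 1) ?a x + dirderiv (axis i 1) (\<rho> \<kappa>a) x *\<^sub>R ?a x"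
      unfolding a'_def by (rule dirderiv_bilinear[OF bounded_bilinear_scaleR])
        (rule smooth_on_differentiable[OF s\<rho> x] smooth_on_differentiable[OF sa x])+
    also have "dirderiv (axis i 1) (\<rho> \<kappa>a) x = - (2 * m * f) * \<rho> \<kappa>a x"
      unfolding d\<rho>[OF x f(1)] by (simp add: \<kappa>a_def)
    also have "dirderiv (axis i 1) ?a x = (transpose (G i x) ** ?a x + ?a x ** G i x) + (2 * m * f) *\<^sub>R ?a x"
      using f(1) by (simp add: algebra_simps)
    finally show "dirderiv (axis i 1) a' x = transpose (G i x) ** a' x + a' x ** G i x"
      by (simp add: a'_def scaleR_matrix_mult algebra_simps)
    have "dirderiv (axis i 1) b' x = \<rho> \<kappa>b x *\<^sub>R dirderiv (axis i 1) ?b x + dirderiv (axis i 1) (\<rho> \<kappa>b) x *\<^sub>R ?b x"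
      unfolding b'_def by (rule dirderiv_bilinear[OF bounded_bilinear_scaleR])
        (rule smooth_on_differentiable[OF s\<rho> x] smooth_on_differentiable[OF sb x])+
    also have "dirderiv (axis i 1) (\<rho> \<kappa>b) x = - ((1 + m) * f) * \<rho> \<kappa>b x"
    proof -
      have "16 * m * \<kappa>b = - (1 + m)" using m0 by (simp add: \<kappa>b_def)
      then show ?thesis unfolding d\<rho>[OF x f(1)] by (simp only: minus_mult_left)
    qed
    also have "dirderiv (axis i 1) ?b x = ?b x v* G i x + ((1 + m) * f) *\<^sub>R ?b x"
      using f(2) by (simp add: algebra_simps)
    finally show "dirderiv (axis i 1) b' x = b' x v* G i x"
      by (simp add: b'_def scaleR_right_distrib scaleR_vector_matrix algebra_simps)
  next
    fix x y k i assume "(x, y) \<in> bundle_coords S A c" "x \<in> X"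
    then show "nonlinear_conn (F \<circ> bundle_point S c) k i (x, y) = (G i x *v y) $ k"
      using rec(1) by blast
  next
    fix x y assume z: "(x, y) \<in> bundle_coords S A c" and x: "x \<in> X"
    obtain r s where rs: "is_power \<bar>y \<bullet> (?a x *v y)\<bar> ((1 + m) / 2) r" "is_power (?b x \<bullet> y) (- m) s"
      "F (bundle_point S c (x, y)) = r * s"
      using kropina_form[OF c z] by (auto simp: is_power_sqrt)
    have "\<bar>y \<bullet> (a' x *v y)\<bar> = \<rho> \<kappa>a x * \<bar>y \<bullet> (?a x *v y)\<bar>"
      using \<rho>pos[of \<kappa>a x] by (simp add: a'_def scaleR_matrix_vector_assoc[symmetric] abs_mult)
    moreover have "b' x \<bullet> y = \<rho> \<kappa>b x * (?b x \<bullet> y)" by (simp add: b'_def)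
    moreover have "(\<rho> \<kappa>a x powr ((1 + m) / 2)) * (\<rho> \<kappa>b x powr (- m)) = 1"
    proof -
      let ?t = "ln ((det (?a x))\<^sup>2) - ln ((det (?g x))\<^sup>2)"
      have "(\<rho> \<kappa>a x powr ((1 + m) / 2)) * (\<rho> \<kappa>b x powr (- m))
        = exp (((1 + m) / 2) * (\<kappa>a * ?t) + (- m) * (\<kappa>b * ?t))"
      proof -
        have "\<rho> \<kappa> x powr e = exp (e * (\<kappa> * ?t))" for \<kappa> e by (simp add: powr_def \<rho>_def)
        then show ?thesis by (simp only: exp_add)
      qed
      also have "((1 + m) / 2) * (\<kappa>a * ?t) + (- m) * (\<kappa>b * ?t) = 0"
        using m0 by (simp add: \<kappa>a_def \<kappa>b_def)
      finally show ?thesis by simp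
    qed
    then have "r * s = (\<rho> \<kappa>a x powr ((1 + m) / 2) * r) * (\<rho> \<kappa>b x powr (- m) * s)"
      by (metis (no_types, opaque_lifting) mult.assoc mult.commute mult.left_neutral)
    ultimately show "\<exists>r s. is_power \<bar>y \<bullet> (a' x *v y)\<bar> ((1 + m) / 2) r \<and> is_power (b' x \<bullet> y) (- m) s \<and>
        F (bundle_point S c (x, y)) = r * s"
      using is_power_scale[OF rs(1) \<rho>pos] is_power_scale[OF rs(2) \<rho>pos] rs(3) by metis
  next
    fix x assume x: "x \<in> X"
    then have xc: "x \<in> chart_image c" using X by blast
    obtain K E E' where fr: "?a x *v K = ?b x" "?b x \<bullet> K = 0" "?b x \<bullet> E = 0" "?b x \<bullet> E' = 0"
      "E \<bullet> (?a x *v E) = 1" "E' \<bullet> (?a x *v E') = 1" "E \<bullet> (?a x *v E') = 0" "E' \<bullet> (?a x *v E) = 0"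
      using frame_at[OF c xc] .
    \<comment> \<open>The unit vectors are divided by the root of the metric's factor; the metric
      dual of the 1-form scales by the quotient of the two factors.\<close>
    let ?K = "(\<rho> \<kappa>b x / \<rho> \<kappa>a x) *\<^sub>R K" and ?s = "1 / sqrt (\<rho> \<kappa>a x)"
    have ss: "?s * (?s * \<rho> \<kappa>a x) = 1" using \<rho>pos[of \<kappa>a x] by (simp add: field_simps)
    have "(?s *\<^sub>R P) \<bullet> (a' x *v (?s *\<^sub>R Q)) = (?s * (?s * \<rho> \<kappa>a x)) * (P \<bullet> (?a x *v Q))" for P Q
      by (simp add: a'_def scaleR_matrix_vector_assoc[symmetric] matrix_vector_mult_scaleR)
    then have "(?s *\<^sub>R P) \<bullet> (a' x *v (?s *\<^sub>R Q)) = P \<bullet> (?a x *v Q)" for P Q unfolding ss by simp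
    moreover have "a' x *v ?K = b' x" using \<rho>pos[of \<kappa>a x] fr(1)
      by (simp add: a'_def b'_def scaleR_matrix_vector_assoc[symmetric] matrix_vector_mult_scaleR)
    ultimately show "\<exists>K E E'. a' x *v K = b' x \<and> b' x \<bullet> K = 0 \<and> b' x \<bullet> E = 0 \<and> b' x \<bullet> E' = 0 \<and>
      E \<bullet> (a' x *v E) = 1 \<and> E' \<bullet> (a' x *v E') = 1 \<and> E \<bullet> (a' x *v E') = 0 \<and> E' \<bullet> (a' x *v E) = 0"
      using fr by (intro exI[of _ ?K] exI[of _ "?s *\<^sub>R E"] exI[of _ "?s *\<^sub>R E'"]) (simp add: b'_def)
    show "\<exists>\<sigma>>0. b' x = \<sigma> *\<^sub>R ?b x" "\<exists>\<rho>>0. a' x = \<rho> *\<^sub>R ?a x" using \<rho>pos by (auto simp: b'_def a'_def)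
    show "invertible (a' x)"
      unfolding a'_def using \<rho>pos[of \<kappa>a x] by (intro scalar_invertible ia x) simp
  qed (use X in auto)
qed

end

subsection \<open>Covariant derivatives of covector fields\<close>

text \<open>Multiplying the row by \<open>G i x\<close> from the right is the dual action of the
  connection. In iterated derivatives the index \<open>i\<close> remains a label and is not itself
  differentiated as a tensor slot.\<close>

definition covd :: "('n::finite \<Rightarrow> real ^ 'n \<Rightarrow> real ^ 'n ^ 'n) \<Rightarrow> 'n \<Rightarrow> (real ^ 'n \<Rightarrow> real ^ 'n) \<Rightarrow> real ^ 'n \<Rightarrow> real ^ 'n" where
  "covd G i \<theta> x = dirderiv (axis i 1) \<theta> x - \<theta> x v* G i x"

lemma bounded_bilinear_vector_matrix: "bounded_bilinear ((v*) :: real ^ 'm::finite \<Rightarrow> real ^ 'n::finite ^ 'm \<Rightarrow> real ^ 'n)"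
  by (rule bilinear_conv_bounded_bilinear[THEN iffD1])
     (auto simp: bilinear_def intro!: linearI simp: vector_matrix_mult_def vec_eq_iff
      algebra_simps sum.distrib sum_distrib_left)

lemma vector_matrix_assoc:
  fixes P :: "real ^ 'n::finite ^ 'm::finite" and Q :: "real ^ 'k::finite ^ 'n"
  shows "(x v* P) v* Q = x v* (P ** Q)"
proof (rule vector_eq_rdot[THEN iffD1], rule allI)
  show "((x v* P) v* Q) \<bullet> y = (x v* (P ** Q)) \<bullet> y" for y
    by (simp add: dot_lmul_matrix matrix_vector_mul_assoc)
qed

lemma vector_matrix_distribs:
  fixes P Q :: "real ^ 'n::finite ^ 'm::finite"
  shows "x v* (P - Q) = x v* P - x v* Q" "x v* (P + Q) = x v* P + x v* Q"
    "(x + y) v* P = x v* P + y v* P" "(x - y) v* P = x v* P - y v* P"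
  by (simp_all add: vector_matrix_mult_def vec_eq_iff algebra_simps sum.distrib sum_subtractf)

lemma covd_cong:
  assumes "open X" "x \<in> X" "\<And>x. x \<in> X \<Longrightarrow> \<theta> x = \<psi> x"
  shows "covd G i \<theta> x = covd G i \<psi> x"
  using dirderiv_cong_open[OF assms(1,2), of \<theta> \<psi>] assms(2,3) by (simp add: covd_def)

lemma covd_add:
  "\<theta> differentiable at x \<Longrightarrow> \<psi> differentiable at x \<Longrightarrow>
    covd G i (\<lambda>x. \<theta> x + \<psi> x) x = covd G i \<theta> x + covd G i \<psi> x"
  by (simp add: covd_def dirderiv_add vector_matrix_distribs)

lemma covd_scaleR:
  fixes f :: "real ^ 'n::finite \<Rightarrow> real"
  shows "f differentiable at x \<Longrightarrow> \<theta> differentiable at x \<Longrightarrow>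
    covd G i (\<lambda>x. f x *\<^sub>R \<theta> x) x = dirderiv (axis i 1) f x *\<^sub>R \<theta> x + f x *\<^sub>R covd G i \<theta> x"
  by (simp add: covd_def dirderiv_bilinear[OF bounded_bilinear_scaleR] scaleR_vector_matrix algebra_simps)

lemma smooth_covd:
  fixes \<theta> :: "real ^ 'n::finite \<Rightarrow> real ^ 'n"
  shows "open X \<Longrightarrow> smooth_on X \<theta> \<Longrightarrow> smooth_on X (G i) \<Longrightarrow> smooth_on X (covd G i \<theta>)"
  unfolding covd_def
  by (intro smooth_on_diff smooth_on_dirderiv smooth_on_bilinear[OF _ bounded_bilinear_vector_matrix])

text \<open>Second partial derivatives commute and the mixed first-order terms are symmetric in the
  labels, so only the curvature survives; the minus sign is that of the dual action. Since the
  labels are not differentiated, no torsion term occurs.\<close>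

lemma ricci_identity:
  fixes \<theta> :: "real ^ 'n::finite \<Rightarrow> real ^ 'n"
  assumes X: "open X" "x \<in> X" and \<theta>: "smooth_on X \<theta>" and G: "\<And>i. smooth_on X (G i)"
  shows "covd G i (covd G j \<theta>) x - covd G j (covd G i \<theta>) x = - (\<theta> x v* riemann G i j x)"
proof -
  have d: "\<theta> differentiable at x" "G i differentiable at x" "dirderiv v \<theta> differentiable at x" for i v
    using \<theta> G X(2) by (auto intro: smooth_on_differentiable smooth_on_dirderiv)
  have "covd G i (covd G j \<theta>) x = dirderiv (axis i 1) (dirderiv (axis j 1) \<theta>) x
      - (\<theta> x v* dirderiv (axis i 1) (G j) x + dirderiv (axis i 1) \<theta> x v* G j x)
      - (dirderiv (axis j 1) \<theta> x v* G i x - \<theta> x v* (G j x ** G i x))" for i j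
  proof -
    have "dirderiv (axis i 1) (covd G j \<theta>) x = dirderiv (axis i 1) (dirderiv (axis j 1) \<theta>) x
        - dirderiv (axis i 1) (\<lambda>x. \<theta> x v* G j x) x"
      unfolding covd_def using d
      by (intro dirderiv_diff differentiable_bilinear[OF bounded_bilinear_vector_matrix]) auto
    then show ?thesis
      by (subst covd_def) (simp add: dirderiv_bilinear[OF bounded_bilinear_vector_matrix] d covd_def[of G j]
          vector_matrix_distribs vector_matrix_assoc)
  qed
  then show ?thesis
    using dirderiv_commute[OF X \<theta>, of "axis i 1" "axis j 1"]
    by (simp add: riemann_def vector_matrix_distribs)
qed

text \<open>The torsion-free condition \<open>G i x *v axis j 1 = G j x *v axis i 1\<close> may be
  differentiated; afterwards the derivative terms and the product terms of the cyclic sum cancel in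
  pairs.\<close>

lemma first_bianchi:
  fixes G :: "'n::finite \<Rightarrow> real ^ 'n \<Rightarrow> real ^ 'n ^ 'n"
  assumes X: "open X" "x \<in> X" and G: "\<And>i. smooth_on X (G i)"
    and sym: "\<And>x i j k. x \<in> X \<Longrightarrow> G i x $ k $ j = G j x $ k $ i"
  shows "riemann G i j x *v axis k 1 + riemann G j k x *v axis i 1 + riemann G k i x *v axis j 1 = 0"
proof -
  have s: "G i x *v axis j 1 = G j x *v axis i 1" if "x \<in> X" for i j x
    using sym[OF that] by (simp add: vec_eq_iff matrix_vector_axis)
  have ds: "dirderiv v (G i) x *v axis j 1 = dirderiv v (G j) x *v axis i 1" for i j v
  proof -
    have "dirderiv v (G i) x *v axis j 1 = dirderiv v (\<lambda>x. G i x *v axis j 1) x" for i j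
      by (rule dirderiv_comp_linear[symmetric, OF bounded_bilinear.bounded_linear_left[OF bounded_bilinear_matrix_vector]
            smooth_on_differentiable[OF G X(2)]])
    moreover have "dirderiv v (\<lambda>x. G i x *v axis j 1) x = dirderiv v (\<lambda>x. G j x *v axis i 1) x"
      by (rule dirderiv_cong_open[OF X s])
    ultimately show ?thesis by simp
  qed
  have *: "riemann G i j x *v axis k 1 = dirderiv (axis i 1) (G j) x *v axis k 1 - dirderiv (axis j 1) (G i) x *v axis k 1
      + (G i x *v (G j x *v axis k 1) - G j x *v (G i x *v axis k 1))" for i j k
    by (simp add: riemann_def matrix_vector_mult_diff_rdistrib matrix_vector_mult_add_rdistrib matrix_vector_mul_assoc)
  show ?thesis
    unfolding * using ds[of "axis i 1" j k] ds[of "axis j 1" i k] ds[of "axis k 1" i j]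
      s[OF X(2), of j k] s[OF X(2), of i k] s[OF X(2), of i j] by simp
qed

subsection \<open>Null frames along which the curvature vanishes\<close>

text \<open>The pointwise content of Ricci-flatness: \<open>Om\<close>, \<open>Mm\<close>, \<open>Mn\<close> are the curvature forms of a null frame
  with parallel \<open>b\<close>; the pair symmetry of the curvature comes out of the first Bianchi identity.\<close>

lemma null_frame_curvature:
  fixes R :: "'v::real_inner \<Rightarrow> 'v \<Rightarrow> 'v \<Rightarrow> 'v" and Om Mm Mn :: "'v \<Rightarrow> 'v \<Rightarrow> real"
  assumes eR: "\<And>X Y Z. e \<bullet> R X Y Z = - Om X Y * (e' \<bullet> Z) - Mm X Y * (b \<bullet> Z)"
    and e'R: "\<And>X Y Z. e' \<bullet> R X Y Z = Om X Y * (e \<bullet> Z) - Mn X Y * (b \<bullet> Z)"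
    and lR: "\<And>X Y Z. l \<bullet> R X Y Z = - Mm X Y * (e \<bullet> Z) - Mn X Y * (e' \<bullet> Z)"
    and bianchi: "\<And>X Y Z. R X Y Z + R Y Z X + R Z X Y = 0"
    and alt: "\<And>X Y. Om X Y = - Om Y X" "\<And>X Y. Mm X Y = - Mm Y X" "\<And>X Y. Mn X Y = - Mn Y X"
    and Ric: "\<And>Y Z. e \<bullet> R E Y Z + e' \<bullet> R E' Y Z + l \<bullet> R K Y Z
      + (e \<bullet> R E Z Y + e' \<bullet> R E' Z Y + l \<bullet> R K Z Y) = 0"
    and dual: "b \<bullet> B = 1" "b \<bullet> E = 0" "b \<bullet> E' = 0" "b \<bullet> K = 0"
      "e \<bullet> B = 0" "e \<bullet> E = 1" "e \<bullet> E' = 0" "e \<bullet> K = 0"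
      "e' \<bullet> B = 0" "e' \<bullet> E = 0" "e' \<bullet> E' = 1" "e' \<bullet> K = 0"
  shows "Om K B = 0" "Om K E = 0" "Om K E' = 0" "Om B E = 0" "Om B E' = 0" "Om E E' = 0"
    "Mm K B = 0" "Mm K E = 0" "Mm K E' = 0" "Mm E E' = 0"
    "Mn K B = 0" "Mn K E = 0" "Mn K E' = 0" "Mn E E' = 0"
    "Mn B E = Mm B E'"
proof -
  have eB: "e \<bullet> R X Y Z + e \<bullet> R Y Z X + e \<bullet> R Z X Y = 0" "e' \<bullet> R X Y Z + e' \<bullet> R Y Z X + e' \<bullet> R Z X Y = 0"
    "l \<bullet> R X Y Z + l \<bullet> R Y Z X + l \<bullet> R Z X Y = 0" for X Y Z
    using bianchi[of X Y Z] by (simp_all flip: inner_add_right)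
  have alt0: "Om X X = 0" "Mm X X = 0" "Mn X X = 0" for X using alt[of X X] by simp_all
  note B1 = eB(1)[unfolded eR] and B2 = eB(2)[unfolded e'R] and B3 = eB(3)[unfolded lR]
  show 1: "Om K E = 0" using B1[of K E' E] alt[of E K] by (simp add: dual)
  show 2: "Om K E' = 0" using B2[of K E E'] alt[of E' K] by (simp add: dual)
  \<comment> \<open>These three instances have the shape x + y = 0, x = z, y = z, so all three
    components vanish.\<close>
  have b1: "Om K B + Mm E' K = 0" using B1[of K B E'] by (simp add: dual)
  have b2: "Om K B = Mn E K" using B2[of K B E] by (simp add: dual)
  have b3: "Mm E' K = Mn E K" using B3[of K E E'] alt(3)[of E K] by (simp add: dual)
  show 3: "Om K B = 0" using b1 b2 b3 by simp
  show 4: "Mm K E' = 0" "Mn K E = 0" using b1 b2 3 alt(2)[of K E'] alt(3)[of K E] by simp_all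
  show 5: "Mm K E = 0" using B1[of K B E] alt(2)[of E K] by (simp add: dual)
  show 6: "Mn K E' = 0" using B2[of K B E'] alt(3)[of E' K] by (simp add: dual)
  show 7: "Mm K B = 0" using B3[of K B E] by (simp add: dual)
  show 8: "Mn K B = 0" using B3[of K B E'] by (simp add: dual)
  have c1: "Om B E + Mm E E' = 0" using B1[of B E E'] by (simp add: dual)
  have c2: "Mn E E' = Om E' B" using B2[of B E E'] by (simp add: dual)
  show "Mn B E = Mm B E'" using B3[of B E E'] alt(2)[of E' B] by (simp add: dual)
  \<comment> \<open>So far only the Bianchi identity and antisymmetry were used. The Ricci condition
    now kills \<open>Om E E'\<close> directly, and the remaining components through relations
    opposite in sign to \<open>c1\<close> and \<open>c2\<close>.\<close>
  have r1: "Om E' E = 0" using Ric[of E E] alt0 4 5 6 7 8 unfolding eR e'R lR by (simp add: dual)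
  then show 9: "Om E E' = 0" using alt(1)[of E E'] by simp
  have r2: "Om E' B - Mn E' E = 0"
    using Ric[of B E] alt0 4 5 6 7 8 unfolding eR e'R lR by (simp add: dual)
  then have r3: "Om E' B = 0" using c2 alt(3)[of E E'] by simp
  then show "Om B E' = 0" using alt(1)[of B E'] by simp
  show "Mn E E' = 0" using c2 r3 by simp
  have r4: "- Om E B - Mm E E' = 0"
    using Ric[of B E'] alt0 4 5 6 7 8 unfolding eR e'R lR by (simp add: dual)
  then have "Om B E - Mm E E' = 0" using alt(1)[of B E] by simp
  then show "Om B E = 0" "Mm E E' = 0" using c1 by simp_all
qed

lemma dirderiv_gradient:
  fixes f :: "real ^ 'n::finite \<Rightarrow> real"
  assumes "f differentiable at x" "\<And>i. dirderiv (axis i 1) f x = w $ i"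
  shows "dirderiv y f x = w \<bullet> y"
  by (subst dirderiv_axis[OF assms(1)]) (simp add: assms(2) inner_vec_def mult.commute)

lemma poincare:
  fixes \<mu> :: "real ^ 'n::finite \<Rightarrow> real ^ 'n"
  assumes "r > 0" "smooth_on (ball x0 r) \<mu>"
    "\<And>x i j. x \<in> ball x0 r \<Longrightarrow> dirderiv (axis i 1) \<mu> x $ j = dirderiv (axis j 1) \<mu> x $ i"
  shows "\<exists>f. smooth_on (ball x0 r) f \<and> (\<forall>x\<in>ball x0 r. \<forall>y. dirderiv y f x = \<mu> x \<bullet> y)"
proof -
  have "\<exists>f. smooth_on (ball x0 r) f \<and> (\<forall>x\<in>ball x0 r. \<forall>i\<in>UNIV. dirderiv (axis i 1) f x = \<mu> x $ i)"
    by (rule relative_poincare[OF assms(1,2)]) (rule assms(3))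
  then obtain f where f: "smooth_on (ball x0 r) f" "\<forall>x\<in>ball x0 r. \<forall>i\<in>UNIV. dirderiv (axis i 1) f x = \<mu> x $ i"
    by blast
  have "dirderiv y f x = \<mu> x \<bullet> y" if x: "x \<in> ball x0 r" for x y
    by (rule dirderiv_gradient[OF smooth_on_differentiable[OF f(1) x]]) (use f(2) x in blast)
  then show ?thesis using f(1) by blast
qed

section \<open>Structure equations and curvature forms of a null coframe\<close>

locale null_coframe =
  fixes x0 :: "real ^ 4" and r :: real and a :: "real ^ 4 \<Rightarrow> real ^ 4 ^ 4"
    and G :: "4 \<Rightarrow> real ^ 4 \<Rightarrow> real ^ 4 ^ 4" and b e e' l :: "real ^ 4 \<Rightarrow> real ^ 4"
  assumes r: "0 < r" and sa: "smooth_on (ball x0 r) a" and sG: "\<And>i. smooth_on (ball x0 r) (G i)"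
    and sb: "smooth_on (ball x0 r) b" and se: "smooth_on (ball x0 r) e" and se': "smooth_on (ball x0 r) e'"
    and sl: "smooth_on (ball x0 r) l"
    and Gsym: "\<And>x i j k. x \<in> ball x0 r \<Longrightarrow> G i x $ k $ j = G j x $ k $ i"
    and da: "\<And>x i. x \<in> ball x0 r \<Longrightarrow> dirderiv (axis i 1) a x = transpose (G i x) ** a x + a x ** G i x"
    and db: "\<And>x i. x \<in> ball x0 r \<Longrightarrow> dirderiv (axis i 1) b x = b x v* G i x"
    and nondeg: "\<And>x. x \<in> ball x0 r \<Longrightarrow> invertible (a x)"
    and frame: "\<And>x y z. x \<in> ball x0 r \<Longrightarrow> y \<bullet> (a x *v z) = - ((b x \<bullet> y) * (l x \<bullet> z) + (l x \<bullet> y) * (b x \<bullet> z))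
      + (e x \<bullet> y) * (e x \<bullet> z) + (e' x \<bullet> y) * (e' x \<bullet> z)"
begin

abbreviation "\<Omega> \<equiv> ball x0 r"

lemma o: "open \<Omega>" by simp

lemmas diffs = smooth_on_differentiable[OF sa] smooth_on_differentiable[OF sb] smooth_on_differentiable[OF se]
  smooth_on_differentiable[OF se'] smooth_on_differentiable[OF sl]

definition coframe :: "real ^ 4 \<Rightarrow> real ^ 4 ^ 4" where
  "coframe x = (\<chi> i. if i = 1 then b x else if i = 2 then l x else if i = 3 then e x else e' x)"

definition "Bv x = matrix_inv (coframe x) *v axis 1 1"
definition "Kv x = matrix_inv (coframe x) *v axis 2 1"
definition "Ev x = matrix_inv (coframe x) *v axis 3 1"
definition "E'v x = matrix_inv (coframe x) *v axis 4 1"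

lemma coframe_mult: "(coframe x *v y) $ 1 = b x \<bullet> y" "(coframe x *v y) $ 2 = l x \<bullet> y"
  "(coframe x *v y) $ 3 = e x \<bullet> y" "(coframe x *v y) $ 4 = e' x \<bullet> y"
  by (simp_all add: coframe_def matrix_vector_mult_def inner_vec_def)

lemma coframe_kernel:
  assumes x: "x \<in> \<Omega>" and y: "b x \<bullet> y = 0" "l x \<bullet> y = 0" "e x \<bullet> y = 0" "e' x \<bullet> y = 0"
  shows "y = 0"
proof -
  have "z \<bullet> (a x *v y) = 0" for z using frame[OF x, of z y] y by simp
  then have "a x *v y = 0" by (metis inner_eq_zero_iff)
  then have "matrix_inv (a x) *v (a x *v y) = 0" by simp
  then show ?thesis by (simp add: matrix_vector_mul_assoc matrix_inv_mult[OF nondeg[OF x]])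
qed

lemma coframe_invertible:
  assumes x: "x \<in> \<Omega>"
  shows "invertible (coframe x)"
proof -
  have "y = 0" if "coframe x *v y = 0" for y
    using coframe_kernel[OF x, of y] coframe_mult[of x y] that by simp
  then have "\<exists>C. C ** coframe x = mat 1" by (subst matrix_left_invertible_ker) blast
  then show ?thesis using invertible_left_inverse by blast
qed

lemma dual:
  assumes x: "x \<in> \<Omega>"
  shows "b x \<bullet> Bv x = 1" "b x \<bullet> Ev x = 0" "b x \<bullet> E'v x = 0" "b x \<bullet> Kv x = 0"
    "e x \<bullet> Bv x = 0" "e x \<bullet> Ev x = 1" "e x \<bullet> E'v x = 0" "e x \<bullet> Kv x = 0"
    "e' x \<bullet> Bv x = 0" "e' x \<bullet> Ev x = 0" "e' x \<bullet> E'v x = 1" "e' x \<bullet> Kv x = 0"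
    "l x \<bullet> Bv x = 0" "l x \<bullet> Ev x = 0" "l x \<bullet> E'v x = 0" "l x \<bullet> Kv x = 1"
proof -
  have "coframe x *v (matrix_inv (coframe x) *v axis j 1) = axis j 1" for j
    by (simp add: matrix_vector_mul_assoc matrix_inv_mult[OF coframe_invertible[OF x]])
  note * = arg_cong[where f = "\<lambda>v. v $ i" for i, OF this]
  show "b x \<bullet> Bv x = 1" "b x \<bullet> Ev x = 0" "b x \<bullet> E'v x = 0" "b x \<bullet> Kv x = 0"
    "e x \<bullet> Bv x = 0" "e x \<bullet> Ev x = 1" "e x \<bullet> E'v x = 0" "e x \<bullet> Kv x = 0"
    "e' x \<bullet> Bv x = 0" "e' x \<bullet> Ev x = 0" "e' x \<bullet> E'v x = 1" "e' x \<bullet> Kv x = 0"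
    "l x \<bullet> Bv x = 0" "l x \<bullet> Ev x = 0" "l x \<bullet> E'v x = 0" "l x \<bullet> Kv x = 1"
    unfolding coframe_mult[symmetric] Bv_def Kv_def Ev_def E'v_def * by (simp_all add: axis_def)
qed

lemma expand:
  assumes x: "x \<in> \<Omega>"
  shows "y = (b x \<bullet> y) *\<^sub>R Bv x + (l x \<bullet> y) *\<^sub>R Kv x + (e x \<bullet> y) *\<^sub>R Ev x + (e' x \<bullet> y) *\<^sub>R E'v x"
proof -
  have "y - ((b x \<bullet> y) *\<^sub>R Bv x + (l x \<bullet> y) *\<^sub>R Kv x + (e x \<bullet> y) *\<^sub>R Ev x + (e' x \<bullet> y) *\<^sub>R E'v x) = 0"
    by (rule coframe_kernel[OF x]) (simp_all add: inner_diff_right inner_add_right dual[OF x])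
  then show ?thesis by simp
qed

lemma covector_expand:
  assumes x: "x \<in> \<Omega>"
  shows "w = (w \<bullet> Bv x) *\<^sub>R b x + (w \<bullet> Kv x) *\<^sub>R l x + (w \<bullet> Ev x) *\<^sub>R e x + (w \<bullet> E'v x) *\<^sub>R e' x"
proof (rule vector_eq_rdot[THEN iffD1], rule allI)
  fix y
  have "w \<bullet> y = w \<bullet> ((b x \<bullet> y) *\<^sub>R Bv x + (l x \<bullet> y) *\<^sub>R Kv x + (e x \<bullet> y) *\<^sub>R Ev x + (e' x \<bullet> y) *\<^sub>R E'v x)"
    using expand[OF x, of y] by simp
  then show "w \<bullet> y = ((w \<bullet> Bv x) *\<^sub>R b x + (w \<bullet> Kv x) *\<^sub>R l x + (w \<bullet> Ev x) *\<^sub>R e x + (w \<bullet> E'v x) *\<^sub>R e' x) \<bullet> y"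
    by (simp add: inner_add_right inner_add_left mult.commute)
qed

lemma smooth_dual: "smooth_on \<Omega> (\<lambda>x. matrix_inv (coframe x) *v w)"
proof -
  have "smooth_on \<Omega> (\<lambda>x. coframe x $ i $ j)" for i j
    using sb se se' sl smooth_on_vec_nth[OF o]
    by (cases "i = 1"; cases "i = 2"; cases "i = 3") (simp_all add: coframe_def)
  then show ?thesis unfolding matrix_vector_mult_def
    by (intro smooth_on_vec_lambda smooth_on_sum smooth_on_mult smooth_on_const smooth_on_matrix_inv
        o coframe_invertible)
qed

lemma covd_b: "x \<in> \<Omega> \<Longrightarrow> covd G i b x = 0"
  by (simp add: covd_def db)

text \<open>This is \<open>\<nabla>a = 0\<close> evaluated on \<open>y\<close> and \<open>z\<close>,
  with \<open>a\<close> expanded in the coframe and the derivatives of the parallel \<open>b\<close>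
  dropped.\<close>

lemma covd_metric:
  assumes x: "x \<in> \<Omega>"
  shows "- ((b x \<bullet> y) * (covd G i l x \<bullet> z) + (covd G i l x \<bullet> y) * (b x \<bullet> z))
    + (covd G i e x \<bullet> y) * (e x \<bullet> z) + (e x \<bullet> y) * (covd G i e x \<bullet> z)
    + (covd G i e' x \<bullet> y) * (e' x \<bullet> z) + (e' x \<bullet> y) * (covd G i e' x \<bullet> z) = 0"
proof -
  have inner: "dirderiv v (\<lambda>x. \<theta> x \<bullet> w) x = dirderiv v \<theta> x \<bullet> w" "(\<lambda>x. \<theta> x \<bullet> w) differentiable at x"
    if "\<theta> differentiable at x" for v w and \<theta> :: "real ^ 4 \<Rightarrow> real ^ 4"
    using dirderiv_comp_linear[OF bounded_linear_inner_left that]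
      differentiableI[OF bounded_linear.has_derivative[OF bounded_linear_inner_left has_derivative_dirderiv[OF that]]]
    by auto
  have prod: "dirderiv v (\<lambda>x. (\<theta> x \<bullet> y) * (\<psi> x \<bullet> z)) x
      = (\<theta> x \<bullet> y) * (dirderiv v \<psi> x \<bullet> z) + (dirderiv v \<theta> x \<bullet> y) * (\<psi> x \<bullet> z)"
    "(\<lambda>x. (\<theta> x \<bullet> y) * (\<psi> x \<bullet> z)) differentiable at x"
    if "\<theta> differentiable at x" "\<psi> differentiable at x" for v y z and \<theta> \<psi> :: "real ^ 4 \<Rightarrow> real ^ 4"
    using dirderiv_mult[OF inner(2)[OF that(1)] inner(2)[OF that(2)]] inner that
      differentiable_bilinear[OF bounded_bilinear_mult inner(2)[OF that(1)] inner(2)[OF that(2)]] by auto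
  note ds = diffs[OF x]
  let ?i = "axis i 1 :: real ^ 4"
  have "dirderiv ?i (\<lambda>x. y \<bullet> (a x *v z)) x = dirderiv ?i (\<lambda>x. - ((b x \<bullet> y) * (l x \<bullet> z) + (l x \<bullet> y) * (b x \<bullet> z))
      + (e x \<bullet> y) * (e x \<bullet> z) + (e' x \<bullet> y) * (e' x \<bullet> z)) x"
    by (rule dirderiv_cong_open[OF o x frame])
  also have "(\<lambda>x. - ((b x \<bullet> y) * (l x \<bullet> z) + (l x \<bullet> y) * (b x \<bullet> z)) + (e x \<bullet> y) * (e x \<bullet> z) + (e' x \<bullet> y) * (e' x \<bullet> z))
      = (\<lambda>x. ((e x \<bullet> y) * (e x \<bullet> z) + (e' x \<bullet> y) * (e' x \<bullet> z)) - ((b x \<bullet> y) * (l x \<bullet> z) + (l x \<bullet> y) * (b x \<bullet> z)))"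
    by (simp add: fun_eq_iff)
  finally have 1: "dirderiv ?i (\<lambda>x. y \<bullet> (a x *v z)) x
      = ((e x \<bullet> y) * (dirderiv ?i e x \<bullet> z) + (dirderiv ?i e x \<bullet> y) * (e x \<bullet> z)
        + ((e' x \<bullet> y) * (dirderiv ?i e' x \<bullet> z) + (dirderiv ?i e' x \<bullet> y) * (e' x \<bullet> z)))
      - ((b x \<bullet> y) * (dirderiv ?i l x \<bullet> z) + (dirderiv ?i b x \<bullet> y) * (l x \<bullet> z)
        + ((l x \<bullet> y) * (dirderiv ?i b x \<bullet> z) + (dirderiv ?i l x \<bullet> y) * (b x \<bullet> z)))"
    by (simp only: dirderiv_diff dirderiv_add differentiable_add prod ds)
  have "bounded_linear (\<lambda>M :: real ^ 4 ^ 4. y \<bullet> (M *v z))"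
    by (intro bounded_linear_compose[OF bounded_linear_inner_right]
        bounded_bilinear.bounded_linear_left[OF bounded_bilinear_matrix_vector])
  from dirderiv_comp_linear[OF this ds(1)]
  have "dirderiv ?i (\<lambda>x. y \<bullet> (a x *v z)) x = y \<bullet> (transpose (G i x) *v (a x *v z)) + y \<bullet> (a x *v (G i x *v z))"
    by (simp add: da[OF x] matrix_vector_mult_add_rdistrib inner_add_right matrix_vector_mul_assoc[symmetric]
        del: transpose_matrix_vector)
  also have "y \<bullet> (transpose (G i x) *v (a x *v z)) = (G i x *v y) \<bullet> (a x *v z)" by (rule inner_transpose)
  finally have 2: "dirderiv ?i (\<lambda>x. y \<bullet> (a x *v z)) x
      = (G i x *v y) \<bullet> (a x *v z) + y \<bullet> (a x *v (G i x *v z))" .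
  have c: "covd G i \<theta> x \<bullet> w = dirderiv ?i \<theta> x \<bullet> w - \<theta> x \<bullet> (G i x *v w)" for \<theta> w
    by (simp add: covd_def inner_diff_left dot_lmul_matrix)
  have dbw: "dirderiv ?i b x \<bullet> w = b x \<bullet> (G i x *v w)" for w by (simp add: db[OF x] dot_lmul_matrix)
  show ?thesis using 1[unfolded 2 frame[OF x] dbw] unfolding c by (simp add: algebra_simps)
qed

text \<open>The connection forms of the coframe. Metric compatibility and the parallelism of
  \<open>b\<close> leave exactly three: one for rotations of \<open>e\<close> and \<open>e'\<close>,
  two for null rotations that fix \<open>b\<close>.\<close>

definition "om i x = covd G i e x \<bullet> E'v x"
definition "mu i x = covd G i e x \<bullet> Bv x"
definition "nu i x = covd G i e' x \<bullet> Bv x"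

text \<open>Evaluating \<open>covd_metric\<close> on pairs of dual frame vectors settles every
  component other than \<open>om\<close>, \<open>mu\<close> and \<open>nu\<close>.\<close>

lemma structure_equations:
  assumes x: "x \<in> \<Omega>"
  shows "covd G i e x = om i x *\<^sub>R e' x + mu i x *\<^sub>R b x"
    "covd G i e' x = nu i x *\<^sub>R b x - om i x *\<^sub>R e x"
    "covd G i l x = mu i x *\<^sub>R e x + nu i x *\<^sub>R e' x"
proof -
  note m = covd_metric[OF x, of _ i] and d = dual[OF x]
  have "covd G i e x \<bullet> Kv x = 0" using m[of "Kv x" "Ev x"] by (simp add: d)
  moreover have "covd G i e x \<bullet> Ev x = 0" using m[of "Ev x" "Ev x"] by (simp add: d)
  ultimately show "covd G i e x = om i x *\<^sub>R e' x + mu i x *\<^sub>R b x"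
    by (subst covector_expand[OF x, of "covd G i e x"]) (simp add: om_def mu_def)
  have "covd G i e' x \<bullet> Kv x = 0" using m[of "Kv x" "E'v x"] by (simp add: d)
  moreover have "covd G i e' x \<bullet> E'v x = 0" using m[of "E'v x" "E'v x"] by (simp add: d)
  moreover have "covd G i e' x \<bullet> Ev x = - om i x" using m[of "Ev x" "E'v x"] by (simp add: d om_def)
  ultimately show "covd G i e' x = nu i x *\<^sub>R b x - om i x *\<^sub>R e x"
    by (subst covector_expand[OF x, of "covd G i e' x"]) (simp add: nu_def)
  have "covd G i l x \<bullet> Kv x = 0" using m[of "Kv x" "Bv x"] by (simp add: d)
  moreover have "covd G i l x \<bullet> Bv x = 0" using m[of "Bv x" "Bv x"] by (simp add: d)
  moreover have "covd G i l x \<bullet> Ev x = mu i x" using m[of "Ev x" "Bv x"] by (simp add: d mu_def)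
  moreover have "covd G i l x \<bullet> E'v x = nu i x" using m[of "E'v x" "Bv x"] by (simp add: d nu_def)
  ultimately show "covd G i l x = mu i x *\<^sub>R e x + nu i x *\<^sub>R e' x"
    by (subst covector_expand[OF x, of "covd G i l x"]) simp
qed

lemma smooth_coeffs: "smooth_on \<Omega> (om i)" "smooth_on \<Omega> (mu i)" "smooth_on \<Omega> (nu i)"
  unfolding om_def mu_def nu_def Bv_def E'v_def
  by (intro smooth_on_inner o smooth_covd smooth_dual se se' sG)+

text \<open>Cartan's curvature forms: \<open>d om\<close>, \<open>d mu - om \<and> nu\<close> and
  \<open>d nu + om \<and> mu\<close>.\<close>

definition "Om i j x = dirderiv (axis i 1) (om j) x - dirderiv (axis j 1) (om i) x"
definition "Mm i j x = dirderiv (axis i 1) (mu j) x - dirderiv (axis j 1) (mu i) x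
  + (om j x * nu i x - om i x * nu j x)"
definition "Mn i j x = dirderiv (axis i 1) (nu j) x - dirderiv (axis j 1) (nu i) x
  + (om i x * mu j x - om j x * mu i x)"

text \<open>Differentiate each structure equation once more, antisymmetrize by
  \<open>ricci_identity\<close> and collect coefficients. The row of \<open>b\<close> vanishes
  because \<open>b\<close> is parallel.\<close>

lemma curvature:
  assumes x: "x \<in> \<Omega>"
  shows "b x v* riemann G i j x = 0"
    "e x v* riemann G i j x = - (Om i j x *\<^sub>R e' x + Mm i j x *\<^sub>R b x)"
    "e' x v* riemann G i j x = Om i j x *\<^sub>R e x - Mn i j x *\<^sub>R b x"
    "l x v* riemann G i j x = - (Mm i j x *\<^sub>R e x + Mn i j x *\<^sub>R e' x)"
proof -
  note rid = ricci_identity[where G = G and i = i and j = j, OF o x _ sG]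
  have sd: "om i differentiable at x" "mu i differentiable at x" "nu i differentiable at x" for i
    using smooth_coeffs smooth_on_differentiable x by blast+
  have cdiff: "(\<lambda>x. f x *\<^sub>R \<theta> x) differentiable at x" if "f differentiable at x" "\<theta> differentiable at x"
    for f and \<theta> :: "real ^ 4 \<Rightarrow> real ^ 4"
    by (rule differentiable_bilinear[OF bounded_bilinear_scaleR that])
  note ds = diffs[OF x]
  have z: "covd G i (\<lambda>x. 0) x = 0" for i by (simp add: covd_def vector_matrix_mult_def vec_eq_iff)
  have "covd G i (covd G j b) x = 0" for i j
    using covd_cong[OF o x, of "covd G j b" "\<lambda>x. 0" G i] covd_b z by simp
  then show "b x v* riemann G i j x = 0" using rid[OF sb] by simp
  note st = structure_equations
  have E: "covd G i (covd G j e) x = dirderiv (axis i 1) (om j) x *\<^sub>R e' x + om j x *\<^sub>R covd G i e' x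
      + dirderiv (axis i 1) (mu j) x *\<^sub>R b x" for i j
  proof -
    have "covd G i (covd G j e) x = covd G i (\<lambda>x. om j x *\<^sub>R e' x + mu j x *\<^sub>R b x) x"
      by (rule covd_cong[OF o x st(1)])
    then show ?thesis by (simp add: covd_add covd_scaleR cdiff sd ds covd_b[OF x])
  qed
  show "e x v* riemann G i j x = - (Om i j x *\<^sub>R e' x + Mm i j x *\<^sub>R b x)"
    using rid[OF se] unfolding E st(2)[OF x] Om_def Mm_def
    by (simp add: algebra_simps eq_neg_iff_add_eq_0)
  have E': "covd G i (covd G j e') x = dirderiv (axis i 1) (nu j) x *\<^sub>R b x
      - (dirderiv (axis i 1) (om j) x *\<^sub>R e x + om j x *\<^sub>R covd G i e x)" for i j
  proof -
    have "covd G i (covd G j e') x = covd G i (\<lambda>x. nu j x *\<^sub>R b x + (- om j x) *\<^sub>R e x) x"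
      by (rule covd_cong[OF o x]) (simp add: st(2))
    moreover have n: "(\<lambda>x. - om j x) differentiable at x" using sd by simp
    moreover have "dirderiv (axis i 1) (\<lambda>x. - om j x) x = - dirderiv (axis i 1) (om j) x"
      by (rule dirderiv_comp_linear[OF bounded_linear_minus[OF bounded_linear_ident] sd(1)])
    moreover note covd_add[OF cdiff[OF sd(3) ds(2)] cdiff[OF n ds(3)]] covd_scaleR[OF sd(3) ds(2)]
      covd_scaleR[OF n ds(3)]
    ultimately have "covd G i (covd G j e') x = dirderiv (axis i 1) (nu j) x *\<^sub>R b x +
      (- dirderiv (axis i 1) (om j) x *\<^sub>R e x + - om j x *\<^sub>R covd G i e x)"
      by (simp add: covd_b[OF x] del: scaleR_minus_left)
    then show ?thesis by simp
  qed
  show "e' x v* riemann G i j x = Om i j x *\<^sub>R e x - Mn i j x *\<^sub>R b x"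
    using rid[OF se'] unfolding E' st(1)[OF x] Om_def Mn_def
    by (simp add: algebra_simps eq_neg_iff_add_eq_0)
  have L: "covd G i (covd G j l) x = dirderiv (axis i 1) (mu j) x *\<^sub>R e x + mu j x *\<^sub>R covd G i e x
      + (dirderiv (axis i 1) (nu j) x *\<^sub>R e' x + nu j x *\<^sub>R covd G i e' x)" for i j
  proof -
    have "covd G i (covd G j l) x = covd G i (\<lambda>x. mu j x *\<^sub>R e x + nu j x *\<^sub>R e' x) x"
      by (rule covd_cong[OF o x st(3)])
    then show ?thesis by (simp add: covd_add covd_scaleR cdiff sd ds)
  qed
  show "l x v* riemann G i j x = - (Mm i j x *\<^sub>R e x + Mn i j x *\<^sub>R e' x)"
    using rid[OF sl] unfolding L st(1,2)[OF x] Mm_def Mn_def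
    by (simp add: algebra_simps eq_neg_iff_add_eq_0)
qed

end

lemma sum_cycle: "(\<Sum>i\<in>I. \<Sum>j\<in>I. \<Sum>k\<in>I. f i j k) = (\<Sum>i\<in>I. \<Sum>j\<in>I. \<Sum>k\<in>I. f j k i)"
proof -
  have "(\<Sum>i\<in>I. \<Sum>j\<in>I. \<Sum>k\<in>I. f i j k) = (\<Sum>i\<in>I. \<Sum>k\<in>I. \<Sum>j\<in>I. f i j k)"
    by (rule sum.cong[OF refl sum.swap])
  also have "\<dots> = (\<Sum>k\<in>I. \<Sum>i\<in>I. \<Sum>j\<in>I. f i j k)" by (rule sum.swap)
  finally show ?thesis .
qed

lemma matrix_vector_sum_axis: "(M :: real ^ 'n::finite ^ 'm) *v z = (\<Sum>k\<in>UNIV. (z $ k) *\<^sub>R (M *v axis k 1))"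
  by (simp add: vec_eq_iff sum_component matrix_vector_axis matrix_vector_mult_def[of M z] mult.commute)

lemma inner_matrix_sum:
  "x \<bullet> ((\<chi> i j. f i j) *v y) = (\<Sum>i\<in>UNIV. \<Sum>j\<in>UNIV. x $ i * y $ j * (f i j :: real))"
  by (simp add: inner_vec_def matrix_vector_mult_def sum_distrib_left mult_ac)

context null_coframe
begin

text \<open>The curvature as a trilinear map R(X,Y)Z at a point, so that it can be evaluated on the
  frame instead of on coordinate vectors.\<close>

definition "Rt x X Y Z = (\<Sum>i\<in>UNIV. \<Sum>j\<in>UNIV. (X $ i * Y $ j) *\<^sub>R (riemann G i j x *v Z))"
definition "form2 f x X Y = X \<bullet> ((\<chi> i j. f i j x) *v (Y :: real ^ 4))"

lemma form2_axis: "form2 f x (axis i 1) (axis j 1) = f i j x"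
  by (simp add: form2_def inner_axis' matrix_vector_axis)

lemma form2_alt: "(\<And>i j. f i j x = - f j i x) \<Longrightarrow> form2 f x X Y = - form2 f x Y X"
proof -
  assume alt: "\<And>i j. f i j x = - f j i x"
  have "form2 f x X Y = (\<Sum>i\<in>UNIV. \<Sum>j\<in>UNIV. X $ i * Y $ j * f i j x)" by (simp add: form2_def inner_matrix_sum)
  also have "\<dots> = (\<Sum>j\<in>UNIV. \<Sum>i\<in>UNIV. X $ i * Y $ j * f i j x)" by (rule sum.swap)
  also have "\<dots> = - (\<Sum>j\<in>UNIV. \<Sum>i\<in>UNIV. Y $ j * X $ i * f j i x)"
    by (subst alt) (simp add: sum_negf mult_ac)
  finally show ?thesis by (simp add: form2_def inner_matrix_sum)
qed

lemma inner_Rt: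
  assumes "\<And>i j. \<theta> v* riemann G i j x = f i j x *\<^sub>R \<phi> + g i j x *\<^sub>R \<psi>"
  shows "\<theta> \<bullet> Rt x X Y Z = form2 f x X Y * (\<phi> \<bullet> Z) + form2 g x X Y * (\<psi> \<bullet> Z)"
proof -
  have "\<theta> \<bullet> Rt x X Y Z = (\<Sum>i\<in>UNIV. \<Sum>j\<in>UNIV. X $ i * Y $ j * ((\<theta> v* riemann G i j x) \<bullet> Z))"
    by (simp add: Rt_def inner_sum_right dot_lmul_matrix)
  also have "\<dots> = (\<Sum>i\<in>UNIV. \<Sum>j\<in>UNIV. X $ i * Y $ j * f i j x * (\<phi> \<bullet> Z) + X $ i * Y $ j * g i j x * (\<psi> \<bullet> Z))"
    by (simp add: assms inner_add_left distrib_left mult.assoc)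
  also have "\<dots> = form2 f x X Y * (\<phi> \<bullet> Z) + form2 g x X Y * (\<psi> \<bullet> Z)"
    by (simp add: form2_def inner_matrix_sum sum.distrib sum_distrib_right)
  finally show ?thesis .
qed

lemma Rt_bianchi:
  assumes x: "x \<in> \<Omega>"
  shows "Rt x X Y Z + Rt x Y Z X + Rt x Z X Y = 0"
proof -
  define T where "T i j k = riemann G i j x *v axis k 1" for i j k
  have T: "T i j k + T j k i + T k i j = 0" for i j k
    unfolding T_def by (rule first_bianchi[OF o x sG Gsym])
  have R: "Rt x X Y Z = (\<Sum>i\<in>UNIV. \<Sum>j\<in>UNIV. \<Sum>k\<in>UNIV. (X $ i * Y $ j * Z $ k) *\<^sub>R T i j k)" for X Y Z
    unfolding Rt_def T_def by (subst matrix_vector_sum_axis) (simp add: scaleR_sum_right)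
  have "Rt x Y Z X = (\<Sum>i\<in>UNIV. \<Sum>j\<in>UNIV. \<Sum>k\<in>UNIV. (X $ i * Y $ j * Z $ k) *\<^sub>R T j k i)"
    unfolding R by (subst sum_cycle) (simp add: mult_ac)
  moreover have "Rt x Z X Y = (\<Sum>i\<in>UNIV. \<Sum>j\<in>UNIV. \<Sum>k\<in>UNIV. (X $ i * Y $ j * Z $ k) *\<^sub>R T k i j)"
    unfolding R by (subst sum_cycle, subst sum_cycle) (simp add: mult_ac)
  ultimately have "Rt x X Y Z + Rt x Y Z X + Rt x Z X Y
      = (\<Sum>i\<in>UNIV. \<Sum>j\<in>UNIV. \<Sum>k\<in>UNIV. (X $ i * Y $ j * Z $ k) *\<^sub>R (T i j k + T j k i + T k i j))"
    unfolding R[of X Y Z] by (simp add: sum.distrib scaleR_right_distrib)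
  then show ?thesis by (simp add: T)
qed

lemma trace_frame:
  assumes x: "x \<in> \<Omega>" and T: "linear T"
  shows "(\<Sum>i\<in>UNIV. T (axis i 1) $ i)
    = b x \<bullet> T (Bv x) + l x \<bullet> T (Kv x) + e x \<bullet> T (Ev x) + e' x \<bullet> T (E'v x)"
proof -
  have "T (axis i 1) = b x $ i *\<^sub>R T (Bv x) + l x $ i *\<^sub>R T (Kv x) + e x $ i *\<^sub>R T (Ev x) + e' x $ i *\<^sub>R T (E'v x)" for i
    using expand[OF x, of "axis i 1"] linear_add[OF T] linear_scale[OF T] by (metis inner_axis inner_real_def mult.right_neutral)
  then show ?thesis by (simp add: inner_vec_def sum.distrib)
qed

text \<open>The Ricci contraction is a trace and may be taken in the frame; the term belonging to
  \<open>b\<close> drops out since \<open>b\<close> annihilates the curvature.\<close>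

lemma Rt_ricci:
  assumes x: "x \<in> \<Omega>"
  shows "e x \<bullet> Rt x (Ev x) Y Z + e' x \<bullet> Rt x (E'v x) Y Z + l x \<bullet> Rt x (Kv x) Y Z = Y \<bullet> (ricci G x *v Z)"
proof -
  have lin: "linear (\<lambda>X. Rt x X Y Z)"
    by (rule linearI) (simp_all add: Rt_def sum.distrib distrib_right scaleR_left_distrib scaleR_sum_right mult.assoc)
  have "b x \<bullet> Rt x X Y Z = form2 (\<lambda>i j x. 0) x X Y * (0 \<bullet> Z) + form2 (\<lambda>i j x. 0) x X Y * (0 \<bullet> Z)" for X
    by (rule inner_Rt) (simp add: curvature(1)[OF x])
  then have bR: "b x \<bullet> Rt x X Y Z = 0" for X by simp
  have "Rt x (axis i 1) Y Z $ i = (\<Sum>j\<in>UNIV. \<Sum>k\<in>UNIV. Y $ j * Z $ k * riemann G i j x $ i $ k)" for i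
  proof -
    have "Rt x (axis i 1) Y Z $ i = (\<Sum>p\<in>UNIV. axis i 1 $ p * (\<Sum>j\<in>UNIV. Y $ j * (riemann G p j x *v Z) $ i))"
      by (simp add: Rt_def sum_component sum_distrib_left mult.assoc)
    also have "\<dots> = (\<Sum>j\<in>UNIV. Y $ j * (riemann G i j x *v Z) $ i)" by (rule sum_axis_mult)
    finally show ?thesis by (simp add: matrix_vector_mult_def sum_distrib_left mult_ac)
  qed
  then have "(\<Sum>i\<in>UNIV. Rt x (axis i 1) Y Z $ i)
      = (\<Sum>i\<in>UNIV. \<Sum>j\<in>UNIV. \<Sum>k\<in>UNIV. Y $ j * Z $ k * riemann G i j x $ i $ k)" by simp
  also have "\<dots> = (\<Sum>j\<in>UNIV. \<Sum>k\<in>UNIV. \<Sum>i\<in>UNIV. Y $ j * Z $ k * riemann G i j x $ i $ k)"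
    by (subst sum.swap) (intro sum.cong refl sum.swap)
  also have "\<dots> = Y \<bullet> (ricci G x *v Z)"
    by (simp add: ricci_def inner_matrix_sum sum_distrib_left)
  finally show ?thesis using trace_frame[OF x lin] bR by simp
qed

lemma frame_curvature:
  assumes x: "x \<in> \<Omega>"
  shows "e x \<bullet> Rt x X Y Z = - form2 Om x X Y * (e' x \<bullet> Z) - form2 Mm x X Y * (b x \<bullet> Z)"
    "e' x \<bullet> Rt x X Y Z = form2 Om x X Y * (e x \<bullet> Z) - form2 Mn x X Y * (b x \<bullet> Z)"
    "l x \<bullet> Rt x X Y Z = - form2 Mm x X Y * (e x \<bullet> Z) - form2 Mn x X Y * (e' x \<bullet> Z)"
proof -
  have neg: "form2 (\<lambda>i j x. - f i j x) x X Y = - form2 f x X Y" for f X Y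
    by (simp add: form2_def inner_matrix_sum sum_negf)
  show "e x \<bullet> Rt x X Y Z = - form2 Om x X Y * (e' x \<bullet> Z) - form2 Mm x X Y * (b x \<bullet> Z)"
    using inner_Rt[of "e x" x "\<lambda>i j x. - Om i j x" "e' x" "\<lambda>i j x. - Mm i j x" "b x" X Y Z]
    by (simp add: curvature(2)[OF x] neg)
  show "e' x \<bullet> Rt x X Y Z = form2 Om x X Y * (e x \<bullet> Z) - form2 Mn x X Y * (b x \<bullet> Z)"
    using inner_Rt[of "e' x" x Om "e x" "\<lambda>i j x. - Mn i j x" "b x" X Y Z]
    by (simp add: curvature(3)[OF x] neg)
  show "l x \<bullet> Rt x X Y Z = - form2 Mm x X Y * (e x \<bullet> Z) - form2 Mn x X Y * (e' x \<bullet> Z)"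
    using inner_Rt[of "l x" x "\<lambda>i j x. - Mm i j x" "e x" "\<lambda>i j x. - Mn i j x" "e' x" X Y Z]
    by (simp add: curvature(4)[OF x] neg)
qed

lemma coeffs_from_covd:
  assumes x: "x \<in> \<Omega>" and "covd G i e x = p *\<^sub>R b x" "covd G i e' x = q *\<^sub>R b x"
  shows "om i x = 0" "mu i x = p" "nu i x = q"
  using assms by (simp_all add: om_def mu_def nu_def dual[OF x])

text \<open>Symmetric connection coefficients cancel in the exterior derivative, so closedness of a
  covector field can be tested on covariant derivatives.\<close>

lemma curl_covd:
  assumes x: "x \<in> \<Omega>"
  shows "dirderiv (axis i 1) \<theta> x $ j - dirderiv (axis j 1) \<theta> x $ i = covd G i \<theta> x $ j - covd G j \<theta> x $ i"
proof -
  have "(\<theta> x v* G i x) $ j = (\<theta> x v* G j x) $ i"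
    by (simp add: vector_matrix_mult_def Gsym[OF x, of i _ j])
  then show ?thesis by (simp add: covd_def)
qed

lemma closed_b:
  assumes "x \<in> \<Omega>"
  shows "dirderiv (axis i 1) b x $ j = dirderiv (axis j 1) b x $ i"
  using curl_covd[OF assms, of i b j] covd_b[OF assms] by simp

text \<open>Closedness of \<open>b\<close> reduces the exterior derivative of \<open>f b\<close> to
  \<open>df \<and> b\<close>.\<close>

lemma form2_multiple_b:
  assumes x: "x \<in> \<Omega>" and f: "smooth_on \<Omega> f" and k: "\<And>x i. x \<in> \<Omega> \<Longrightarrow> k i x = f x * b x $ i"
    and M: "\<And>i j. M i j x = dirderiv (axis i 1) (k j) x - dirderiv (axis j 1) (k i) x"
  shows "form2 M x X Y = dirderiv X f x * (b x \<bullet> Y) - dirderiv Y f x * (b x \<bullet> X)"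
proof -
  note fd = smooth_on_differentiable[OF f x]
  have bd: "(\<lambda>x. b x $ j) differentiable at x" for j
    by (rule smooth_on_differentiable[OF smooth_on_vec_nth[OF o sb] x])
  have "dirderiv (axis i 1) (k j) x = f x * dirderiv (axis i 1) b x $ j + dirderiv (axis i 1) f x * b x $ j" for i j
  proof -
    have "dirderiv (axis i 1) (k j) x = dirderiv (axis i 1) (\<lambda>x. f x * b x $ j) x"
      by (rule dirderiv_cong_open[OF o x k])
    then show ?thesis by (simp add: dirderiv_mult[OF fd bd] dirderiv_nth[OF smooth_on_differentiable[OF sb x]])
  qed
  then have M': "M i j x = dirderiv (axis i 1) f x * b x $ j - dirderiv (axis j 1) f x * b x $ i" for i j
    by (simp add: M closed_b[OF x, of i j])
  have "form2 M x X Y = (\<Sum>i\<in>UNIV. \<Sum>j\<in>UNIV. (X $ i * dirderiv (axis i 1) f x) * (b x $ j * Y $ j))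
      - (\<Sum>i\<in>UNIV. \<Sum>j\<in>UNIV. (b x $ i * X $ i) * (Y $ j * dirderiv (axis j 1) f x))"
    unfolding form2_def inner_matrix_sum M' sum_subtractf[symmetric] by (simp add: algebra_simps)
  also have "\<dots> = dirderiv X f x * (b x \<bullet> Y) - dirderiv Y f x * (b x \<bullet> X)"
    unfolding dirderiv_axis[OF fd, of X] dirderiv_axis[OF fd, of Y] sum_product[symmetric]
    by (simp add: inner_vec_def mult.commute)
  finally show ?thesis .
qed

end

section \<open>Reducing the coframe of a Ricci-flat metric to coordinate differentials\<close>

locale local_frame = null_coframe +
  assumes b0: "\<And>x j. x \<in> ball x0 r \<Longrightarrow> j \<noteq> 1 \<Longrightarrow> b x $ j = 0"
    and b1: "\<And>x. x \<in> ball x0 r \<Longrightarrow> b x $ 1 \<noteq> 0"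
    and ric: "\<And>x i j. x \<in> ball x0 r \<Longrightarrow> ricci G x $ i $ j + ricci G x $ j $ i = 0"
begin

text \<open>Since \<open>b\<close> has only its first component, the leaves of ker \<open>b\<close>
  are coordinate slices, and the coordinate vectors other than the first have no \<open>Bv\<close>
  part in the frame. The pointwise vanishing thus becomes vanishing of the components with indices
  different from 1, the form that \<open>relative_poincare\<close> needs.\<close>

lemma curvature_vanishes:
  assumes x: "x \<in> \<Omega>"
  shows "Om i j x = 0"
    "i \<noteq> 1 \<Longrightarrow> j \<noteq> 1 \<Longrightarrow> Mm i j x = 0" "i \<noteq> 1 \<Longrightarrow> j \<noteq> 1 \<Longrightarrow> Mn i j x = 0"
    "form2 Mm x (Kv x) (Bv x) = 0" "form2 Mn x (Kv x) (Bv x) = 0"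
    "form2 Mn x (Bv x) (Ev x) = form2 Mm x (Bv x) (E'v x)"
proof -
  have altOm: "form2 Om x X Y = - form2 Om x Y X" for X Y by (rule form2_alt) (simp add: Om_def)
  have altMm: "form2 Mm x X Y = - form2 Mm x Y X" for X Y by (rule form2_alt) (simp add: Mm_def)
  have altMn: "form2 Mn x X Y = - form2 Mn x Y X" for X Y by (rule form2_alt) (simp add: Mn_def)
  have Ric: "e x \<bullet> Rt x (Ev x) Y Z + e' x \<bullet> Rt x (E'v x) Y Z + l x \<bullet> Rt x (Kv x) Y Z
      + (e x \<bullet> Rt x (Ev x) Z Y + e' x \<bullet> Rt x (E'v x) Z Y + l x \<bullet> Rt x (Kv x) Z Y) = 0" for Y Z
  proof -
    have "Z \<bullet> (ricci G x *v Y) = (\<Sum>i\<in>UNIV. \<Sum>j\<in>UNIV. Y $ i * Z $ j * ricci G x $ j $ i)"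
      by (subst sum.swap) (simp add: inner_vec_def matrix_vector_mult_def sum_distrib_left mult_ac)
    moreover have "Y \<bullet> (ricci G x *v Z) = (\<Sum>i\<in>UNIV. \<Sum>j\<in>UNIV. Y $ i * Z $ j * ricci G x $ i $ j)"
      by (simp add: inner_vec_def matrix_vector_mult_def sum_distrib_left mult_ac)
    ultimately have "Y \<bullet> (ricci G x *v Z) + Z \<bullet> (ricci G x *v Y)
        = (\<Sum>i\<in>UNIV. \<Sum>j\<in>UNIV. Y $ i * Z $ j * (ricci G x $ i $ j + ricci G x $ j $ i))"
      by (simp add: sum.distrib distrib_left)
    then show ?thesis unfolding Rt_ricci[OF x] by (simp add: ric[OF x])
  qed
  note z = null_frame_curvature[where R = "Rt x" and Om = "form2 Om x" and Mm = "form2 Mm x" and Mn = "form2 Mn x"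
      and e = "e x" and e' = "e' x" and b = "b x" and l = "l x" and B = "Bv x" and E = "Ev x" and E' = "E'v x" and K = "Kv x",
      OF frame_curvature[OF x] Rt_bianchi[OF x] altOm altMm altMn Ric dual(1-12)[OF x]]
  have add: "form2 f x (X + X') Y = form2 f x X Y + form2 f x X' Y"
    "form2 f x X (Y + Y') = form2 f x X Y + form2 f x X Y'"
    "form2 f x (t *\<^sub>R X) Y = t * form2 f x X Y" "form2 f x X (t *\<^sub>R Y) = t * form2 f x X Y" for f X X' Y Y' t
    by (simp_all add: form2_def inner_add_left inner_add_right matrix_vector_right_distrib matrix_vector_mult_scaleR)
  have self: "form2 f x X X = 0" if "\<And>X Y. form2 f x X Y = - form2 f x Y X" for f X using that[of X X] by simp
  have ax: "axis i 1 = b x $ i *\<^sub>R Bv x + l x $ i *\<^sub>R Kv x + e x $ i *\<^sub>R Ev x + e' x $ i *\<^sub>R E'v x" for i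
    using expand[OF x, of "axis i 1"] by (simp add: inner_axis)
  have altz: "form2 Om x (Bv x) (Kv x) = 0" "form2 Om x (Ev x) (Kv x) = 0" "form2 Om x (E'v x) (Kv x) = 0"
    "form2 Om x (Ev x) (Bv x) = 0" "form2 Om x (E'v x) (Bv x) = 0" "form2 Om x (E'v x) (Ev x) = 0"
    "form2 Mm x (Ev x) (Kv x) = 0" "form2 Mm x (E'v x) (Kv x) = 0" "form2 Mm x (E'v x) (Ev x) = 0"
    "form2 Mn x (Ev x) (Kv x) = 0" "form2 Mn x (E'v x) (Kv x) = 0" "form2 Mn x (E'v x) (Ev x) = 0"
    using z altOm[of "Bv x" "Kv x"] altOm[of "Ev x" "Kv x"] altOm[of "E'v x" "Kv x"] altOm[of "Ev x" "Bv x"]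
      altOm[of "E'v x" "Bv x"] altOm[of "E'v x" "Ev x"] altMm[of "Ev x" "Kv x"] altMm[of "E'v x" "Kv x"]
      altMm[of "E'v x" "Ev x"] altMn[of "Ev x" "Kv x"] altMn[of "E'v x" "Kv x"] altMn[of "E'v x" "Ev x"] by simp_all
  show "Om i j x = 0"
    unfolding form2_axis[symmetric, of Om i j x] ax by (simp add: add z altz self[OF altOm])
  show "Mm i j x = 0" if "i \<noteq> 1" "j \<noteq> 1"
    unfolding form2_axis[symmetric, of Mm i j x] ax b0[OF x that(1)] b0[OF x that(2)]
    by (simp add: add z altz self[OF altMm])
  show "Mn i j x = 0" if "i \<noteq> 1" "j \<noteq> 1"
    unfolding form2_axis[symmetric, of Mn i j x] ax b0[OF x that(1)] b0[OF x that(2)]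
    by (simp add: add z altz self[OF altMn])
  show "form2 Mm x (Kv x) (Bv x) = 0" "form2 Mn x (Kv x) (Bv x) = 0"
    "form2 Mn x (Bv x) (Ev x) = form2 Mm x (Bv x) (E'v x)"
    by (rule z)+
qed

text \<open>The locale refers to \<open>e\<close>, \<open>e'\<close> and \<open>l\<close> only
  through their smoothness and the expression of \<open>a\<close>, so a new smooth coframe merely
  has to reproduce that expression.\<close>

lemma change_frame:
  assumes "smooth_on \<Omega> e2" "smooth_on \<Omega> e2'" "smooth_on \<Omega> l2"
    and "\<And>x y z. x \<in> \<Omega> \<Longrightarrow> - ((b x \<bullet> y) * (l2 x \<bullet> z) + (l2 x \<bullet> y) * (b x \<bullet> z)) + (e2 x \<bullet> y) * (e2 x \<bullet> z) + (e2' x \<bullet> y) * (e2' x \<bullet> z)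
      = - ((b x \<bullet> y) * (l x \<bullet> z) + (l x \<bullet> y) * (b x \<bullet> z)) + (e x \<bullet> y) * (e x \<bullet> z) + (e' x \<bullet> y) * (e' x \<bullet> z)"
  shows "local_frame x0 r a G b e2 e2' l2"
  by (unfold_locales; (fact r sa sG sb assms(1-3) Gsym da db nondeg b0 b1 ric)?) (simp only: assms(4) frame)

text \<open>Rotating the frame makes \<open>om\<close> vanish, since \<open>om\<close> is closed.\<close>

lemma rotate_frame:
  "\<exists>e2 e2' p q. local_frame x0 r a G b e2 e2' l \<and> smooth_on \<Omega> p \<and> smooth_on \<Omega> q \<and>
    (\<forall>x\<in>\<Omega>. \<forall>i. covd G i e2 x = (p x $ i) *\<^sub>R b x \<and> covd G i e2' x = (q x $ i) *\<^sub>R b x)"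
proof -
  \<comment> \<open>Rotation by an angle \<open>\<psi>\<close> adds \<open>d\<psi>\<close> to
    \<open>om\<close>, so the angle has to be a potential of \<open>- om\<close>.\<close>
  define w where "w x = (\<chi> i. - om i x)" for x
  have sw: "smooth_on \<Omega> w" unfolding w_def by (intro smooth_on_vec_lambda smooth_on_minus o smooth_coeffs)
  have "dirderiv v w x $ j = - dirderiv v (om j) x" if x: "x \<in> \<Omega>" for v j x
  proof -
    have "dirderiv v w x $ j = dirderiv v (\<lambda>x. w x $ j) x"
      by (rule dirderiv_nth[symmetric, OF smooth_on_differentiable[OF sw x]])
    then show ?thesis
      using dirderiv_comp_linear[OF bounded_linear_minus[OF bounded_linear_ident] smooth_on_differentiable[OF smooth_coeffs(1) x]]
      by (simp add: w_def)
  qed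
  then have "\<exists>f. smooth_on \<Omega> f \<and> (\<forall>x\<in>\<Omega>. \<forall>y. dirderiv y f x = w x \<bullet> y)"
    using curvature_vanishes(1) by (intro poincare[OF r sw]) (simp add: Om_def)
  then obtain \<psi> where \<psi>: "smooth_on \<Omega> \<psi>" "\<And>x y. x \<in> \<Omega> \<Longrightarrow> dirderiv y \<psi> x = w x \<bullet> y" by blast
  have d\<psi>: "dirderiv (axis i 1) \<psi> x = - om i x" if "x \<in> \<Omega>" for i x
    using \<psi>(2)[OF that] by (simp add: inner_axis w_def)
  define c s where "c x = cos (\<psi> x)" and "s x = sin (\<psi> x)" for x
  have cs: "smooth_on \<Omega> c" "smooth_on \<Omega> s" unfolding c_def s_def
    by (rule smooth_on_compose[OF o smooth_on_sin_cos(2)[of UNIV] \<psi>(1)]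
        smooth_on_compose[OF o smooth_on_sin_cos(1)[of UNIV] \<psi>(1)], simp)+
  have one: "c x * c x + s x * s x = 1" for x
    unfolding c_def s_def using sin_cos_squared_add[of "\<psi> x"] by (simp add: power2_eq_square)
  have dc: "dirderiv (axis i 1) c x = s x * om i x" "dirderiv (axis i 1) s x = - (c x * om i x)" if x: "x \<in> \<Omega>" for i x
  proof -
    note hd = has_derivative_dirderiv[OF smooth_on_differentiable[OF \<psi>(1) x]]
    show "dirderiv (axis i 1) c x = s x * om i x"
      unfolding c_def s_def using dirderiv_eqI[OF has_derivative_cos[OF hd], of "axis i 1"] d\<psi>[OF x] by simp
    show "dirderiv (axis i 1) s x = - (c x * om i x)"
      unfolding c_def s_def using dirderiv_eqI[OF has_derivative_sin[OF hd], of "axis i 1"] d\<psi>[OF x] by simp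
  qed
  define e2 where "e2 x = c x *\<^sub>R e x + s x *\<^sub>R e' x" for x
  define e2' where "e2' x = c x *\<^sub>R e' x - s x *\<^sub>R e x" for x
  \<comment> \<open>The forms \<open>mu\<close> and \<open>nu\<close> rotate along with the
    frame.\<close>
  define p where "p x = (\<chi> i. c x * mu i x + s x * nu i x)" for x
  define q where "q x = (\<chi> i. c x * nu i x - s x * mu i x)" for x
  have fr: "local_frame x0 r a G b e2 e2' l"
  proof (rule change_frame)
    show "smooth_on \<Omega> e2" "smooth_on \<Omega> e2'" unfolding e2_def e2'_def
      by (intro smooth_on_add smooth_on_diff smooth_on_scaleR o cs se se')+
    fix x y z
    have "(e2 x \<bullet> y) * (e2 x \<bullet> z) + (e2' x \<bullet> y) * (e2' x \<bullet> z)
      = (c x * c x + s x * s x) * ((e x \<bullet> y) * (e x \<bullet> z) + (e' x \<bullet> y) * (e' x \<bullet> z))"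
      by (simp add: e2_def e2'_def inner_add_left inner_diff_left algebra_simps)
    then show "- ((b x \<bullet> y) * (l x \<bullet> z) + (l x \<bullet> y) * (b x \<bullet> z)) + (e2 x \<bullet> y) * (e2 x \<bullet> z) + (e2' x \<bullet> y) * (e2' x \<bullet> z)
      = - ((b x \<bullet> y) * (l x \<bullet> z) + (l x \<bullet> y) * (b x \<bullet> z)) + (e x \<bullet> y) * (e x \<bullet> z) + (e' x \<bullet> y) * (e' x \<bullet> z)"
      by (simp add: one)
  qed (rule sl)
  have sp: "smooth_on \<Omega> p" "smooth_on \<Omega> q" unfolding p_def q_def
    by (intro smooth_on_vec_lambda smooth_on_add smooth_on_diff smooth_on_mult o cs smooth_coeffs)+
  have "covd G i e2 x = (p x $ i) *\<^sub>R b x \<and> covd G i e2' x = (q x $ i) *\<^sub>R b x" if x: "x \<in> \<Omega>" for x i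
  proof -
    have d: "c differentiable at x" "s differentiable at x" "(\<lambda>x. - s x) differentiable at x"
      by (rule smooth_on_differentiable[OF cs(1) x] smooth_on_differentiable[OF cs(2) x]
          differentiable_minus[OF smooth_on_differentiable[OF cs(2) x]])+
    have ds: "dirderiv v (\<lambda>x. - s x) x = - dirderiv v s x" for v
      by (rule dirderiv_comp_linear[OF bounded_linear_minus[OF bounded_linear_ident] d(2)])
    note dd = differentiable_bilinear[OF bounded_bilinear_scaleR]
    note dx = diffs(3,4)[OF x]
    have "covd G i e2 x = dirderiv (axis i 1) c x *\<^sub>R e x + c x *\<^sub>R covd G i e x
        + (dirderiv (axis i 1) s x *\<^sub>R e' x + s x *\<^sub>R covd G i e' x)"
      unfolding e2_def by (simp only: covd_add[OF dd[OF d(1) dx(1)] dd[OF d(2) dx(2)]] covd_scaleR[OF d(1) dx(1)] covd_scaleR[OF d(2) dx(2)])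
    moreover have "covd G i e2' x = dirderiv (axis i 1) c x *\<^sub>R e' x + c x *\<^sub>R covd G i e' x
        + (dirderiv (axis i 1) (\<lambda>x. - s x) x *\<^sub>R e x + (- s x) *\<^sub>R covd G i e x)"
      unfolding e2'_def diff_conv_add_uminus scaleR_minus_left[symmetric]
      by (simp only: covd_add[OF dd[OF d(1) dx(2)] dd[OF d(3) dx(1)]] covd_scaleR[OF d(1) dx(2)] covd_scaleR[OF d(3) dx(1)])
    ultimately show ?thesis unfolding ds dc[OF x] structure_equations[OF x]
      by (simp add: p_def q_def algebra_simps)
  qed
  then show ?thesis using fr sp by blast
qed

text \<open>Adding multiples of \<open>b\<close> makes \<open>e\<close> and \<open>e'\<close> closed: the connection forms are closed along the
  leaves of \<open>ker b\<close>, so they are leafwise exact.\<close>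

lemma shift_frame:
  assumes p: "smooth_on \<Omega> p" "smooth_on \<Omega> q"
    and cov: "\<And>x i. x \<in> \<Omega> \<Longrightarrow> covd G i e x = (p x $ i) *\<^sub>R b x" "\<And>x i. x \<in> \<Omega> \<Longrightarrow> covd G i e' x = (q x $ i) *\<^sub>R b x"
  shows "\<exists>e2 e2' l2 t t'. local_frame x0 r a G b e2 e2' l2 \<and> smooth_on \<Omega> t \<and> smooth_on \<Omega> t' \<and>
    (\<forall>x\<in>\<Omega>. \<forall>i. covd G i e2 x = (t x * b x $ i) *\<^sub>R b x \<and> covd G i e2' x = (t' x * b x $ i) *\<^sub>R b x)"
proof -
  note co = coeffs_from_covd[OF _ cov]
  have dp: "dirderiv v (mu j) x = dirderiv v p x $ j" "dirderiv v (nu j) x = dirderiv v q x $ j" if x: "x \<in> \<Omega>" for v j x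
  proof -
    have "dirderiv v (mu j) x = dirderiv v (\<lambda>x. p x $ j) x" by (rule dirderiv_cong_open[OF o x co(2)])
    then show "dirderiv v (mu j) x = dirderiv v p x $ j"
      by (simp add: dirderiv_nth[OF smooth_on_differentiable[OF p(1) x]])
    have "dirderiv v (nu j) x = dirderiv v (\<lambda>x. q x $ j) x" by (rule dirderiv_cong_open[OF o x co(3)])
    then show "dirderiv v (nu j) x = dirderiv v q x $ j"
      by (simp add: dirderiv_nth[OF smooth_on_differentiable[OF p(2) x]])
  qed
  \<comment> \<open>With \<open>om = 0\<close> the forms \<open>Mm\<close> and \<open>Mn\<close> are
    plain exterior derivatives, and they vanish on pairs of indices other than 1.\<close>
  have closed: "dirderiv (axis i 1) p x $ j = dirderiv (axis j 1) p x $ i" "dirderiv (axis i 1) q x $ j = dirderiv (axis j 1) q x $ i"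
    if x: "x \<in> \<Omega>" and "i \<in> - {1}" "j \<in> - {1}" for x i j
    using curvature_vanishes(2,3)[OF x, of i j] that by (simp_all add: Mm_def Mn_def dp[OF x] co(1)[OF x x])
  obtain f where f: "smooth_on \<Omega> f" "\<forall>x\<in>\<Omega>. \<forall>i\<in>- {1}. dirderiv (axis i 1) f x = p x $ i"
    using relative_poincare[OF r p(1), of "- {1}"] closed(1) by blast
  obtain g where g: "smooth_on \<Omega> g" "\<forall>x\<in>\<Omega>. \<forall>i\<in>- {1}. dirderiv (axis i 1) g x = q x $ i"
    using relative_poincare[OF r p(2), of "- {1}"] closed(2) by blast
  define e2 where "e2 x = e x + (- f x) *\<^sub>R b x" for x
  define e2' where "e2' x = e' x + (- g x) *\<^sub>R b x" for x
  \<comment> \<open>A null rotation fixing \<open>b\<close>; its quadratic coefficient is forced by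
    keeping the metric unchanged.\<close>
  define l2 where "l2 x = l x + (- f x) *\<^sub>R e x + (- g x) *\<^sub>R e' x + ((1 / 2) * (f x * f x + g x * g x)) *\<^sub>R b x" for x
  \<comment> \<open>After the leafwise potential is subtracted only the first component of
    \<open>p\<close> survives, and \<open>b\<close> too has only a first component; the quotient
    exhibits the remainder as a multiple of \<open>b\<close>.\<close>
  define t where "t x = (p x $ 1 - dirderiv (axis 1 1) f x) / b x $ 1" for x
  define t' where "t' x = (q x $ 1 - dirderiv (axis 1 1) g x) / b x $ 1" for x
  have fr: "local_frame x0 r a G b e2 e2' l2"
  proof (rule change_frame)
    show "smooth_on \<Omega> e2" "smooth_on \<Omega> e2'" "smooth_on \<Omega> l2" unfolding e2_def e2'_def l2_def
      by (intro smooth_on_add smooth_on_scaleR smooth_on_minus smooth_on_mult smooth_on_const o f g se se' sb sl)+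
    fix x y z
    show "- ((b x \<bullet> y) * (l2 x \<bullet> z) + (l2 x \<bullet> y) * (b x \<bullet> z)) + (e2 x \<bullet> y) * (e2 x \<bullet> z) + (e2' x \<bullet> y) * (e2' x \<bullet> z)
      = - ((b x \<bullet> y) * (l x \<bullet> z) + (l x \<bullet> y) * (b x \<bullet> z)) + (e x \<bullet> y) * (e x \<bullet> z) + (e' x \<bullet> y) * (e' x \<bullet> z)"
      unfolding e2_def e2'_def l2_def inner_add_left inner_scaleR_left by (simp add: field_simps)
  qed
  have st: "smooth_on \<Omega> t" "smooth_on \<Omega> t'" unfolding t_def t'_def
    by (intro smooth_on_divide smooth_on_diff smooth_on_vec_nth smooth_on_dirderiv o p f g sb b1; assumption)+
  have shift: "covd G i (\<lambda>x. \<theta> x + (- h x) *\<^sub>R b x) x = (((w x $ 1 - dirderiv (axis 1 1) h x) / b x $ 1) * b x $ i) *\<^sub>R b x"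
    if x: "x \<in> \<Omega>" and \<theta>: "smooth_on \<Omega> \<theta>" and h: "smooth_on \<Omega> h"
      and c: "covd G i \<theta> x = (w x $ i) *\<^sub>R b x" and dh: "\<forall>x\<in>\<Omega>. \<forall>i\<in>- {1}. dirderiv (axis i 1) h x = w x $ i"
    for x i \<theta> h w
  proof -
    have d: "\<theta> differentiable at x" "(\<lambda>x. - h x) differentiable at x" "b differentiable at x"
      by (rule smooth_on_differentiable[OF \<theta> x] smooth_on_differentiable[OF sb x]
          differentiable_minus[OF smooth_on_differentiable[OF h x]])+
    have dh': "dirderiv v (\<lambda>x. - h x) x = - dirderiv v h x" for v
      by (rule dirderiv_comp_linear[OF bounded_linear_minus[OF bounded_linear_ident] smooth_on_differentiable[OF h x]])
    have "covd G i (\<lambda>x. \<theta> x + (- h x) *\<^sub>R b x) x = (w x $ i - dirderiv (axis i 1) h x) *\<^sub>R b x"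
      using covd_add[OF d(1) differentiable_bilinear[OF bounded_bilinear_scaleR d(2,3)]] covd_scaleR[OF d(2,3)]
      by (simp add: covd_b[OF x] c dh' algebra_simps)
    also have "w x $ i - dirderiv (axis i 1) h x = ((w x $ 1 - dirderiv (axis 1 1) h x) / b x $ 1) * b x $ i"
    proof (cases "i = 1")
      case True then show ?thesis using b1[OF x] by simp
    next
      case False then show ?thesis using b0[OF x False] dh x by simp
    qed
    finally show ?thesis .
  qed
  have "covd G i e2 x = (t x * b x $ i) *\<^sub>R b x \<and> covd G i e2' x = (t' x * b x $ i) *\<^sub>R b x" if x: "x \<in> \<Omega>" for x i
    unfolding e2_def e2'_def t_def t'_def
    using shift[OF x se f(1) cov(1)[OF x] f(2)] shift[OF x se' g(1) cov(2)[OF x] g(2)] by blast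
  then show ?thesis using fr st by blast
qed

end

context local_frame
begin

text \<open>With \<open>\<nabla>e = t b \<otimes> b\<close> and \<open>\<nabla>e' = t' b \<otimes> b\<close>, the symmetries of the curvature make \<open>t e + t' e'\<close>
  closed along \<open>ker b\<close>; its leafwise potential \<open>h\<close> is what has to be added to \<open>l\<close> to close it.\<close>

lemma closed_frame_coordinates:
  assumes t: "smooth_on \<Omega> t" "smooth_on \<Omega> t'"
    and cov: "\<And>x i. x \<in> \<Omega> \<Longrightarrow> covd G i e x = (t x * b x $ i) *\<^sub>R b x" "\<And>x i. x \<in> \<Omega> \<Longrightarrow> covd G i e' x = (t' x * b x $ i) *\<^sub>R b x"
  shows "\<exists>u v x3 x4 h. smooth_on \<Omega> u \<and> smooth_on \<Omega> v \<and> smooth_on \<Omega> x3 \<and> smooth_on \<Omega> x4 \<and> smooth_on \<Omega> h \<and>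
    (\<forall>x\<in>\<Omega>. \<forall>y. b x \<bullet> y = dirderiv y u x \<and>
      y \<bullet> (a x *v y) = - 2 * dirderiv y u x * dirderiv y v x + 2 * h x * (dirderiv y u x)\<^sup>2
        + (dirderiv y x3 x)\<^sup>2 + (dirderiv y x4 x)\<^sup>2 \<and>
      (dirderiv y u x = 0 \<and> dirderiv y x3 x = 0 \<and> dirderiv y x4 x = 0 \<longrightarrow> dirderiv y h x = 0) \<and>
      (dirderiv y u x = 0 \<and> dirderiv y v x = 0 \<and> dirderiv y x3 x = 0 \<and> dirderiv y x4 x = 0 \<longrightarrow> y = 0))"
proof -
  have co: "om i x = 0" "mu i x = t x * b x $ i" "nu i x = t' x * b x $ i" if x: "x \<in> \<Omega>" for i x
    using coeffs_from_covd[OF x cov(1)[OF x] cov(2)[OF x]] by blast+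
  have closed_e: "dirderiv (axis i 1) e x $ j = dirderiv (axis j 1) e x $ i" if "x \<in> \<Omega>" for x i j
    using curl_covd[OF that, of i e j] cov(1)[OF that] by simp
  have closed_e': "dirderiv (axis i 1) e' x $ j = dirderiv (axis j 1) e' x $ i" if "x \<in> \<Omega>" for x i j
    using curl_covd[OF that, of i e' j] cov(2)[OF that] by simp
  have fMm: "form2 Mm x X Y = dirderiv X t x * (b x \<bullet> Y) - dirderiv Y t x * (b x \<bullet> X)" if x: "x \<in> \<Omega>" for x X Y
    by (rule form2_multiple_b[OF x t(1), of mu]) (simp_all only: co Mm_def x co(1)[OF x] mult_zero_left diff_self add_0_right)
  have fMn: "form2 Mn x X Y = dirderiv X t' x * (b x \<bullet> Y) - dirderiv Y t' x * (b x \<bullet> X)" if x: "x \<in> \<Omega>" for x X Y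
    by (rule form2_multiple_b[OF x t(2), of nu]) (simp_all only: co Mn_def x co(1)[OF x] mult_zero_left diff_self add_0_right)
  \<comment> \<open>The forms \<open>Mm\<close> and \<open>Mn\<close> are now
    \<open>dt \<and> b\<close> and \<open>dt' \<and> b\<close>; evaluation on (K, B), and on (B, E)
    against (B, E'), gives these relations.\<close>
  have dK: "dirderiv (Kv x) t x = 0" "dirderiv (Kv x) t' x = 0" "dirderiv (Ev x) t' x = dirderiv (E'v x) t x"
    if x: "x \<in> \<Omega>" for x
    using curvature_vanishes(4,5,6)[OF x] by (simp_all add: fMm[OF x] fMn[OF x] dual[OF x])
  define \<gamma> where "\<gamma> x = t x *\<^sub>R e x + t' x *\<^sub>R e' x" for x
  have s\<gamma>: "smooth_on \<Omega> \<gamma>" unfolding \<gamma>_def by (intro smooth_on_add smooth_on_scaleR o t se se')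
  have d\<gamma>: "dirderiv v \<gamma> x = t x *\<^sub>R dirderiv v e x + dirderiv v t x *\<^sub>R e x + (t' x *\<^sub>R dirderiv v e' x + dirderiv v t' x *\<^sub>R e' x)"
    if x: "x \<in> \<Omega>" for v x
  proof -
    have d: "t differentiable at x" "t' differentiable at x" "e differentiable at x" "e' differentiable at x"
      by (rule smooth_on_differentiable[OF t(1) x] smooth_on_differentiable[OF t(2) x]
          smooth_on_differentiable[OF se x] smooth_on_differentiable[OF se' x])+
    note dd = differentiable_bilinear[OF bounded_bilinear_scaleR] and db' = dirderiv_bilinear[OF bounded_bilinear_scaleR]
    show ?thesis unfolding \<gamma>_def
      by (simp only: dirderiv_add[OF dd[OF d(1,3)] dd[OF d(2,4)]] db'[OF d(1,3)] db'[OF d(2,4)])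
  qed
  \<comment> \<open>Along ker \<open>b\<close> the differential of such a function has only
    \<open>e\<close> and \<open>e'\<close> components. As \<open>e\<close> and \<open>e'\<close> are
    closed, the remaining obstruction to closing \<open>\<gamma>\<close> is removed by the third
    relation in \<open>dK\<close>.\<close>
  have dt: "dirderiv (axis i 1) f x = e x $ i * dirderiv (Ev x) f x + e' x $ i * dirderiv (E'v x) f x"
    if x: "x \<in> \<Omega>" and i: "i \<noteq> 1" and f: "smooth_on \<Omega> f" "dirderiv (Kv x) f x = 0" for x i f
  proof -
    interpret linear "\<lambda>v. dirderiv v f x" by (rule linear_dirderiv[OF smooth_on_differentiable[OF f(1) x]])
    have "axis i 1 = l x $ i *\<^sub>R Kv x + e x $ i *\<^sub>R Ev x + e' x $ i *\<^sub>R E'v x"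
      using expand[OF x, of "axis i 1"] b0[OF x i] by (simp add: inner_axis)
    then show ?thesis by (simp add: add scale f(2))
  qed
  have "dirderiv (axis i 1) \<gamma> x $ j = dirderiv (axis j 1) \<gamma> x $ i" if x: "x \<in> \<Omega>" and ij: "i \<in> - {1}" "j \<in> - {1}" for x i j
  proof -
    have n: "i \<noteq> 1" "j \<noteq> 1" using ij by auto
    note d = dt[OF x n(1) t(1) dK(1)[OF x]] dt[OF x n(2) t(1) dK(1)[OF x]]
      dt[OF x n(1) t(2) dK(2)[OF x]] dt[OF x n(2) t(2) dK(2)[OF x]]
    show ?thesis
      unfolding d\<gamma>[OF x] vector_add_component vector_scaleR_component d dK(3)[OF x]
        closed_e[OF x, of i j] closed_e'[OF x, of i j] by (simp add: algebra_simps)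
  qed
  then have "\<exists>f. smooth_on \<Omega> f \<and> (\<forall>x\<in>\<Omega>. \<forall>i\<in>- {1}. dirderiv (axis i 1) f x = \<gamma> x $ i)"
    by (rule relative_poincare[OF r s\<gamma>])
  then obtain h where h: "smooth_on \<Omega> h" "\<forall>x\<in>\<Omega>. \<forall>i\<in>- {1}. dirderiv (axis i 1) h x = \<gamma> x $ i" by blast
  \<comment> \<open>The derivative of \<open>l\<close> is \<open>b \<otimes> \<gamma>\<close>, and
    adding \<open>h b\<close> contributes \<open>dh \<otimes> b\<close>. The sum is symmetric
    because \<open>dh\<close> and \<open>\<gamma>\<close> agree off index 1, the only index carried
    by \<open>b\<close>.\<close>
  define l4 where "l4 x = l x + h x *\<^sub>R b x" for x
  have sl4: "smooth_on \<Omega> l4" unfolding l4_def by (intro smooth_on_add smooth_on_scaleR o sl sb h)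
  have closed_l: "dirderiv (axis i 1) l4 x $ j = dirderiv (axis j 1) l4 x $ i" if x: "x \<in> \<Omega>" for x i j
  proof -
    have d: "l differentiable at x" "h differentiable at x" "b differentiable at x"
      by (rule smooth_on_differentiable[OF sl x] smooth_on_differentiable[OF h(1) x] smooth_on_differentiable[OF sb x])+
    have "covd G i l4 x = (b x $ i) *\<^sub>R \<gamma> x + dirderiv (axis i 1) h x *\<^sub>R b x" for i
      unfolding l4_def
      using covd_add[OF d(1) differentiable_bilinear[OF bounded_bilinear_scaleR d(2,3)]] covd_scaleR[OF d(2,3)]
      by (simp add: covd_b[OF x] structure_equations(3)[OF x] co[OF x] \<gamma>_def algebra_simps)
    then have c: "covd G i l4 x $ j = b x $ i * \<gamma> x $ j + dirderiv (axis i 1) h x * b x $ j" for i j by simp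
    have "covd G i l4 x $ j = covd G j l4 x $ i"
      using h(2) x b0[OF x, of i] b0[OF x, of j] unfolding c by (cases "i = 1"; cases "j = 1") simp_all
    then show ?thesis using curl_covd[OF x, of i l4 j] by simp
  qed
  obtain u where u: "smooth_on \<Omega> u" "\<forall>x\<in>\<Omega>. \<forall>y. dirderiv y u x = b x \<bullet> y"
    using poincare[OF r sb closed_b] by blast
  obtain x3 where x3: "smooth_on \<Omega> x3" "\<forall>x\<in>\<Omega>. \<forall>y. dirderiv y x3 x = e x \<bullet> y"
    using poincare[OF r se closed_e] by blast
  obtain x4 where x4: "smooth_on \<Omega> x4" "\<forall>x\<in>\<Omega>. \<forall>y. dirderiv y x4 x = e' x \<bullet> y"
    using poincare[OF r se' closed_e'] by blast
  obtain v where v: "smooth_on \<Omega> v" "\<forall>x\<in>\<Omega>. \<forall>y. dirderiv y v x = l4 x \<bullet> y"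
    using poincare[OF r sl4 closed_l] by blast
  have *: "b x \<bullet> y = dirderiv y u x \<and>
      y \<bullet> (a x *v y) = - 2 * dirderiv y u x * dirderiv y v x + 2 * h x * (dirderiv y u x)\<^sup>2
        + (dirderiv y x3 x)\<^sup>2 + (dirderiv y x4 x)\<^sup>2 \<and>
      (dirderiv y u x = 0 \<and> dirderiv y x3 x = 0 \<and> dirderiv y x4 x = 0 \<longrightarrow> dirderiv y h x = 0) \<and>
      (dirderiv y u x = 0 \<and> dirderiv y v x = 0 \<and> dirderiv y x3 x = 0 \<and> dirderiv y x4 x = 0 \<longrightarrow> y = 0)"
    if x: "x \<in> \<Omega>" for x y
  proof (intro conjI impI)
    note d = u(2)[rule_format, OF x] v(2)[rule_format, OF x] x3(2)[rule_format, OF x] x4(2)[rule_format, OF x]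
    show "b x \<bullet> y = dirderiv y u x" by (simp add: d)
    \<comment> \<open>From \<open>l = dv - h du\<close>, the part \<open>- 2 b l\<close> of the
      metric produces both \<open>- 2 du dv\<close> and \<open>2 h\<close> times the square of
      \<open>du\<close>.\<close>
    show "y \<bullet> (a x *v y) = - 2 * dirderiv y u x * dirderiv y v x + 2 * h x * (dirderiv y u x)\<^sup>2
        + (dirderiv y x3 x)\<^sup>2 + (dirderiv y x4 x)\<^sup>2"
      unfolding d frame[OF x] l4_def by (simp add: inner_add_left power2_eq_square algebra_simps)
    show "dirderiv y h x = 0" if "dirderiv y u x = 0 \<and> dirderiv y x3 x = 0 \<and> dirderiv y x4 x = 0"
    proof -
      have z: "b x \<bullet> y = 0" "e x \<bullet> y = 0" "e' x \<bullet> y = 0" using that by (simp_all add: d)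
      have "b x \<bullet> y = (\<Sum>i\<in>(UNIV :: 4 set). if i = 1 then b x $ 1 * y $ 1 else 0)"
        unfolding inner_vec_def by (rule sum.cong) (use b0[OF x] in auto)
      \<comment> \<open>The first component of \<open>dh\<close>, about which nothing is known,
        therefore does not enter.\<close>
      then have y1: "y $ 1 = 0" using z(1) b1[OF x] by simp
      have "dirderiv y h x = (\<Sum>i\<in>UNIV. y $ i * dirderiv (axis i 1) h x)"
        by (subst dirderiv_axis[OF smooth_on_differentiable[OF h(1) x]]) simp
      also have "\<dots> = (\<Sum>i\<in>UNIV. y $ i * \<gamma> x $ i)"
      proof (rule sum.cong[OF refl])
        fix i show "y $ i * dirderiv (axis i 1) h x = y $ i * \<gamma> x $ i"
          using h(2) x y1 by (cases "i = 1") simp_all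
      qed
      also have "\<dots> = \<gamma> x \<bullet> y" by (simp add: inner_vec_def mult.commute)
      also have "\<dots> = 0" using z by (simp add: \<gamma>_def inner_add_left)
      finally show ?thesis .
    qed
    show "y = 0" if "dirderiv y u x = 0 \<and> dirderiv y v x = 0 \<and> dirderiv y x3 x = 0 \<and> dirderiv y x4 x = 0"
    proof -
      have "b x \<bullet> y = 0" "e x \<bullet> y = 0" "e' x \<bullet> y = 0" "l4 x \<bullet> y = 0" using that by (simp_all add: d)
      then show ?thesis by (intro coframe_kernel[OF x]) (simp_all add: l4_def inner_add_left)
    qed
  qed
  show ?thesis using u(1) v(1) x3(1) x4(1) h(1) * by blast
qed

lemma pp_coordinates:
  "\<exists>u v x3 x4 h. smooth_on \<Omega> u \<and> smooth_on \<Omega> v \<and> smooth_on \<Omega> x3 \<and> smooth_on \<Omega> x4 \<and> smooth_on \<Omega> h \<and>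
    (\<forall>x\<in>\<Omega>. \<forall>y. b x \<bullet> y = dirderiv y u x \<and>
      y \<bullet> (a x *v y) = - 2 * dirderiv y u x * dirderiv y v x + 2 * h x * (dirderiv y u x)\<^sup>2
        + (dirderiv y x3 x)\<^sup>2 + (dirderiv y x4 x)\<^sup>2 \<and>
      (dirderiv y u x = 0 \<and> dirderiv y x3 x = 0 \<and> dirderiv y x4 x = 0 \<longrightarrow> dirderiv y h x = 0) \<and>
      (dirderiv y u x = 0 \<and> dirderiv y v x = 0 \<and> dirderiv y x3 x = 0 \<and> dirderiv y x4 x = 0 \<longrightarrow> y = 0))"
proof -
  obtain e1 e1' p q where 1: "local_frame x0 r a G b e1 e1' l" "smooth_on \<Omega> p" "smooth_on \<Omega> q"
    "\<forall>x\<in>\<Omega>. \<forall>i. covd G i e1 x = (p x $ i) *\<^sub>R b x \<and> covd G i e1' x = (q x $ i) *\<^sub>R b x"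
    using rotate_frame by blast
  interpret f1: local_frame x0 r a G b e1 e1' l by (rule 1(1))
  obtain e2 e2' l2 t t' where 2: "local_frame x0 r a G b e2 e2' l2" "smooth_on \<Omega> t" "smooth_on \<Omega> t'"
    "\<forall>x\<in>\<Omega>. \<forall>i. covd G i e2 x = (t x * b x $ i) *\<^sub>R b x \<and> covd G i e2' x = (t' x * b x $ i) *\<^sub>R b x"
    using f1.shift_frame[OF 1(2,3)] 1(4) by blast
  interpret f2: local_frame x0 r a G b e2 e2' l2 by (rule 2(1))
  show ?thesis by (rule f2.closed_frame_coordinates[OF 2(2,3)]) (use 2(4) in blast)+
qed

end

subsection \<open>Completing squares\<close>

text \<open>Lagrange's method. Completing squares in the coordinates 3 and 4, where \<open>a\<close>
  is positive definite near \<open>x0\<close>, leaves a form \<open>C\<close> in the coordinates 1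
  and 2. The null vector dual to \<open>b\<close> forces its (2,2) entry to vanish, so
  \<open>C\<close> is divisible by the first coordinate form, which is proportional to
  \<open>b\<close>; the cofactor gives \<open>l\<close>.\<close>

lemma initial_frame:
  fixes a :: "real ^ 4 \<Rightarrow> real ^ 4 ^ 4" and b :: "real ^ 4 \<Rightarrow> real ^ 4"
  assumes X: "open X" "x0 \<in> X"
    and sm: "smooth_on X a" "smooth_on X b" "\<And>i. smooth_on X (G i)"
    and Gsym: "\<And>x i j k. x \<in> X \<Longrightarrow> G i x $ k $ j = G j x $ k $ i"
    and da: "\<And>x i. x \<in> X \<Longrightarrow> dirderiv (axis i 1) a x = transpose (G i x) ** a x + a x ** G i x"
    and db: "\<And>x i. x \<in> X \<Longrightarrow> dirderiv (axis i 1) b x = b x v* G i x"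
    and nondeg: "\<And>x. x \<in> X \<Longrightarrow> invertible (a x)"
    and sym: "\<And>x. x \<in> X \<Longrightarrow> transpose (a x) = a x"
    and b0: "\<And>x j. x \<in> X \<Longrightarrow> j \<noteq> 1 \<Longrightarrow> b x $ j = 0" and b1: "\<And>x. x \<in> X \<Longrightarrow> b x $ 1 \<noteq> 0"
    and ric: "\<And>x i j. x \<in> X \<Longrightarrow> ricci G x $ i $ j + ricci G x $ j $ i = 0"
    and K: "\<And>x. x \<in> X \<Longrightarrow> \<exists>K. a x *v K = b x \<and> b x \<bullet> K = 0"
    and pos: "a x0 $ 3 $ 3 > 0" "a x0 $ 3 $ 3 * a x0 $ 4 $ 4 - a x0 $ 3 $ 4 * a x0 $ 3 $ 4 > 0"
  shows "\<exists>r e e' l. local_frame x0 r a G b e e' l \<and> ball x0 r \<subseteq> X"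
proof -
  define \<alpha> where "\<alpha> x = a x $ 3 $ 3" for x
  define \<Delta> where "\<Delta> x = a x $ 3 $ 3 * a x $ 4 $ 4 - a x $ 3 $ 4 * a x $ 3 $ 4" for x
  have sc: "smooth_on X (\<lambda>x. a x $ i $ j)" for i j by (intro smooth_on_vec_nth X sm)
  have s\<alpha>: "smooth_on X \<alpha>" "smooth_on X \<Delta>" unfolding \<alpha>_def \<Delta>_def
    by (intro smooth_on_diff smooth_on_mult sc X)+
  define P where "P = {x \<in> X. \<alpha> x > 0 \<and> \<Delta> x > 0}"
  have "continuous_on X (\<lambda>x. (\<alpha> x, \<Delta> x))" by (intro continuous_on_Pair smooth_on_continuous s\<alpha>)
  from continuous_open_preimage[OF this X(1), of "{0<..} \<times> {0<..}"]
  have "open (X \<inter> (\<lambda>x. (\<alpha> x, \<Delta> x)) -` ({0<..} \<times> {0<..}))" by (simp add: open_Times)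
  moreover have "X \<inter> (\<lambda>x. (\<alpha> x, \<Delta> x)) -` ({0<..} \<times> {0<..}) = P" by (auto simp: P_def)
  ultimately have "open P" by simp
  moreover have "x0 \<in> P" using X(2) pos by (simp add: P_def \<alpha>_def \<Delta>_def)
  ultimately obtain r where r: "r > 0" "ball x0 r \<subseteq> P" using open_contains_ball by blast
  let ?O = "ball x0 r"
  have inX: "x \<in> X" and p: "\<alpha> x > 0" "\<Delta> x > 0" if "x \<in> ?O" for x using r(2) that by (auto simp: P_def)
  have OX: "?O \<subseteq> X" using inX by blast
  have O: "open ?O" by simp
  \<comment> \<open>The Schur complement: what remains at coordinate 4 after the first square is
    split off.\<close>
  define \<delta> where "\<delta> x = \<Delta> x / \<alpha> x" for x
  have p\<delta>: "\<delta> x > 0" if "x \<in> ?O" for x using p[OF that] by (simp add: \<delta>_def)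
  define e where "e x = (1 / sqrt (\<alpha> x)) *\<^sub>R (a x $ 3)" for x
  define e' where "e' x = (1 / sqrt (\<delta> x)) *\<^sub>R (a x $ 4 - (a x $ 3 $ 4 / \<alpha> x) *\<^sub>R (a x $ 3))" for x
  define C where "C x i j = a x $ i $ j - e x $ i * e x $ j - e' x $ i * e' x $ j" for x i j
  \<comment> \<open>Solves \<open>C = - (b \<otimes> l + l \<otimes> b)\<close>, given that
    \<open>b\<close> has only its first component and \<open>C\<close> only the entries (1,1), (1,2)
    and (2,1).\<close>
  define l :: "real ^ 4 \<Rightarrow> real ^ 4" where "l x = (- (C x 1 1 / 2) / b x $ 1) *\<^sub>R axis 1 1 + (- C x 1 2 / b x $ 1) *\<^sub>R axis 2 1" for x
  have scO: "smooth_on ?O (\<lambda>x. a x $ i $ j)" "smooth_on ?O (\<lambda>x. a x $ i)" "smooth_on ?O b" for i j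
    using smooth_on_subset[OF sc OX] smooth_on_subset[OF smooth_on_vec_nth[OF X(1) sm(1)] OX]
      smooth_on_subset[OF sm(2) OX] by auto
  have sO: "smooth_on ?O \<alpha>" "smooth_on ?O \<Delta>" using s\<alpha> OX smooth_on_subset by blast+
  have s\<delta>: "smooth_on ?O \<delta>" unfolding \<delta>_def
    by (intro smooth_on_divide O sO) (use p(1) in force)
  have nz: "sqrt (\<alpha> x) \<noteq> 0" "sqrt (\<delta> x) \<noteq> 0" "\<alpha> x \<noteq> 0" if "x \<in> ?O" for x
    using p(1)[OF that] p\<delta>[OF that] by auto
  have se: "smooth_on ?O e" unfolding e_def
    by (intro smooth_on_scaleR smooth_on_divide smooth_on_const smooth_on_sqrt O sO scO p nz)
  have se': "smooth_on ?O e'" unfolding e'_def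
    by (intro smooth_on_scaleR smooth_on_diff smooth_on_divide smooth_on_const smooth_on_sqrt O sO s\<delta> scO p p\<delta> nz)
  have sC: "smooth_on ?O (\<lambda>x. C x i j)" for i j unfolding C_def
    by (intro smooth_on_diff smooth_on_mult smooth_on_vec_nth O scO se se')
  have sl: "smooth_on ?O l" unfolding l_def
    by (intro smooth_on_add smooth_on_scaleR smooth_on_divide smooth_on_minus smooth_on_const smooth_on_vec_nth O scO sC)
       ((rule b1[OF inX], assumption) | simp)+
  have asym: "a x $ i $ j = a x $ j $ i" if "x \<in> ?O" for x i j
  proof -
    have "transpose (a x) $ j $ i = a x $ j $ i" using sym[OF inX[OF that]] by simp
    then show ?thesis by (simp add: transpose_def)
  qed
  have Csym: "C x i j = C x j i" if "x \<in> ?O" for x i j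
    unfolding C_def asym[OF that, of i j] by (simp add: mult.commute)
  have e3: "e x $ 3 = sqrt (\<alpha> x)" "e' x $ 3 = 0" "e' x $ 4 = sqrt (\<delta> x)" if x: "x \<in> ?O" for x
  proof -
    show "e x $ 3 = sqrt (\<alpha> x)" using p(1)[OF x] by (simp add: e_def \<alpha>_def[symmetric] real_div_sqrt)
    have a3: "a x $ 3 $ 3 = \<alpha> x" by (simp add: \<alpha>_def)
    show "e' x $ 3 = 0" using nz(3)[OF x] asym[OF x, of 4 3] by (simp add: e'_def a3)
    have "a x $ 4 $ 4 - a x $ 3 $ 4 / \<alpha> x * a x $ 3 $ 4 = \<delta> x"
      using nz(3)[OF x] by (simp add: \<delta>_def \<Delta>_def a3 field_simps)
    then show "e' x $ 4 = sqrt (\<delta> x)" using p\<delta>[OF x] by (simp add: e'_def real_div_sqrt)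
  qed
  have C3: "C x 3 j = 0" if x: "x \<in> ?O" for x j
    using nz(1)[OF x] unfolding C_def e3[OF x] by (simp add: e_def)
  have C4: "C x 4 j = 0" if x: "x \<in> ?O" for x j
  proof -
    have "e x $ 4 * e x $ j = a x $ 3 $ 4 * a x $ 3 $ j / \<alpha> x"
      using p(1)[OF x] by (simp add: e_def)
    moreover have "e' x $ 4 * e' x $ j = a x $ 4 $ j - a x $ 3 $ 4 / \<alpha> x * a x $ 3 $ j"
      using nz(2)[OF x] unfolding e3[OF x] by (simp add: e'_def)
    ultimately show ?thesis by (simp add: C_def)
  qed
  have C22: "C x 2 2 = 0" if x: "x \<in> ?O" for x
  proof -
    note xX = inX[OF x]
    obtain K where K: "a x *v K = b x" "b x \<bullet> K = 0" using K[OF xX] by blast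
    have "b x \<bullet> K = b x $ 1 * K $ 1" using b0[OF xX] by (simp add: inner_vec_def sum_4)
    then have K1: "K $ 1 = 0" using K(2) b1[OF xX] by simp
    have "(a x *v K) $ i = a x $ i \<bullet> K" for i by (simp add: matrix_vector_mult_def inner_vec_def)
    then have row: "a x $ i \<bullet> K = b x $ i" for i using K(1) by metis
    have eK: "e x \<bullet> K = 0" using row[of 3] b0[OF xX, of 3] by (simp add: e_def)
    have e'K: "e' x \<bullet> K = 0"
      using row[of 3] row[of 4] b0[OF xX, of 3] b0[OF xX, of 4] by (simp add: e'_def inner_diff_left)
    have CK: "(\<Sum>j\<in>UNIV. C x i j * K $ j) = b x $ i" for i
    proof -
      have "(\<Sum>j\<in>UNIV. C x i j * K $ j) = a x $ i \<bullet> K - e x $ i * (e x \<bullet> K) - e' x $ i * (e' x \<bullet> K)"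
        by (simp add: C_def inner_vec_def sum_subtractf left_diff_distrib sum_distrib_left mult.assoc)
      then show ?thesis using row eK e'K by simp
    qed
    have z: "C x i 3 = 0" "C x i 4 = 0" for i using Csym[OF x] C3[OF x] C4[OF x] by metis+
    \<comment> \<open>As \<open>K\<close> has no first component, \<open>C K = b\<close> reduces to
      two equations for \<open>K $ 2\<close>; the one whose right side is the nonzero
      \<open>b x $ 1\<close> shows that \<open>K $ 2\<close> is nonzero.\<close>
    have "C x 2 2 * K $ 2 = 0" using CK[of 2] b0[OF xX, of 2] K1 by (simp add: sum_4 z)
    moreover have "C x 1 2 * K $ 2 = b x $ 1" using CK[of 1] K1 by (simp add: sum_4 z)
    ultimately show ?thesis using b1[OF xX] by auto
  qed
  have fr: "y \<bullet> (a x *v z) = - ((b x \<bullet> y) * (l x \<bullet> z) + (l x \<bullet> y) * (b x \<bullet> z)) + (e x \<bullet> y) * (e x \<bullet> z) + (e' x \<bullet> y) * (e' x \<bullet> z)"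
    if x: "x \<in> ?O" for x y z
  proof -
    note xX = inX[OF x]
    have "(\<Sum>i\<in>UNIV. \<Sum>j\<in>UNIV. y $ i * z $ j * C x i j) = y \<bullet> (a x *v z) - (e x \<bullet> y) * (e x \<bullet> z) - (e' x \<bullet> y) * (e' x \<bullet> z)"
    proof -
      have "(\<Sum>i\<in>UNIV. \<Sum>j\<in>UNIV. y $ i * z $ j * C x i j) = (\<Sum>i\<in>UNIV. \<Sum>j\<in>UNIV. y $ i * z $ j * a x $ i $ j)
          - (\<Sum>i\<in>UNIV. \<Sum>j\<in>UNIV. (e x $ i * y $ i) * (e x $ j * z $ j))
          - (\<Sum>i\<in>UNIV. \<Sum>j\<in>UNIV. (e' x $ i * y $ i) * (e' x $ j * z $ j))"
        unfolding sum_subtractf[symmetric] by (simp add: C_def algebra_simps)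
      moreover have "y \<bullet> (a x *v z) = (\<Sum>i\<in>UNIV. \<Sum>j\<in>UNIV. y $ i * z $ j * a x $ i $ j)"
        using inner_matrix_sum[of y "\<lambda>i j. a x $ i $ j" z] by simp
      ultimately show ?thesis unfolding sum_product[symmetric] by (simp add: inner_vec_def)
    qed
    moreover have "C x i 3 = 0" "C x i 4 = 0" for i using Csym[OF x] C3[OF x] C4[OF x] by metis+
    then have "(\<Sum>i\<in>UNIV. \<Sum>j\<in>UNIV. y $ i * z $ j * C x i j)
      = y $ 1 * z $ 1 * C x 1 1 + (y $ 1 * z $ 2 + y $ 2 * z $ 1) * C x 1 2"
      using C3[OF x] C4[OF x] C22[OF x] Csym[OF x, of 2 1] by (simp add: sum_4 algebra_simps)
    moreover have "b x \<bullet> w = b x $ 1 * w $ 1" for w using b0[OF xX] by (simp add: inner_vec_def sum_4)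
    moreover have "b x $ 1 * (l x \<bullet> w) = - (C x 1 1 / 2 * w $ 1 + C x 1 2 * w $ 2)" for w
    proof -
      have "l x \<bullet> w = (- (C x 1 1 / 2) / b x $ 1) * w $ 1 + (- C x 1 2 / b x $ 1) * w $ 2"
        unfolding l_def inner_add_left inner_scaleR_left inner_axis' by simp
      then show ?thesis using b1[OF xX] by (simp add: field_simps)
    qed
    then have "(b x $ 1 * y $ 1) * (l x \<bullet> z) = - (C x 1 1 / 2 * z $ 1 + C x 1 2 * z $ 2) * y $ 1"
      "(l x \<bullet> y) * (b x $ 1 * z $ 1) = - (C x 1 1 / 2 * y $ 1 + C x 1 2 * y $ 2) * z $ 1"
      by (metis mult.commute mult.left_commute)+
    ultimately show ?thesis by (simp add: algebra_simps)
  qed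
  have "local_frame x0 r a G b e e' l"
  proof
    show "smooth_on ?O a" "smooth_on ?O (G i)" "smooth_on ?O b" for i
      using sm OX smooth_on_subset by blast+
    show "b x $ j = 0" if "x \<in> ?O" "j \<noteq> 1" for x j using b0[OF inX[OF that(1)] that(2)] .
  qed (fact r(1) se se' sl fr Gsym[OF inX] da[OF inX] db[OF inX] nondeg[OF inX] b1[OF inX] ric[OF inX])+
  then show ?thesis using OX by blast
qed

lemma dual_basis:
  fixes b l e e' :: "real ^ 4"
  assumes ker: "\<And>y. b \<bullet> y = 0 \<Longrightarrow> l \<bullet> y = 0 \<Longrightarrow> e \<bullet> y = 0 \<Longrightarrow> e' \<bullet> y = 0 \<Longrightarrow> y = 0"
  obtains B K E E' where "b \<bullet> B = 1" "b \<bullet> K = 0" "b \<bullet> E = 0" "b \<bullet> E' = 0"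
    "l \<bullet> B = 0" "l \<bullet> K = 1" "l \<bullet> E = 0" "l \<bullet> E' = 0"
    "e \<bullet> B = 0" "e \<bullet> K = 0" "e \<bullet> E = 1" "e \<bullet> E' = 0"
    "e' \<bullet> B = 0" "e' \<bullet> K = 0" "e' \<bullet> E = 0" "e' \<bullet> E' = 1"
proof -
  define C :: "real ^ 4 ^ 4" where "C = (\<chi> i. if i = 1 then b else if i = 2 then l else if i = 3 then e else e')"
  have C: "(C *v y) $ 1 = b \<bullet> y" "(C *v y) $ 2 = l \<bullet> y" "(C *v y) $ 3 = e \<bullet> y" "(C *v y) $ 4 = e' \<bullet> y" for y
    by (simp_all add: C_def matrix_vector_mult_def inner_vec_def)
  have "y = 0" if "C *v y = 0" for y using ker[of y] C[of y] that by simp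
  then have "\<exists>D. D ** C = mat 1" by (subst matrix_left_invertible_ker) blast
  then have "invertible C" using invertible_left_inverse by blast
  then have "C *v (matrix_inv C *v axis j 1) = axis j 1" for j
    by (simp add: matrix_vector_mul_assoc matrix_inv_mult)
  note * = arg_cong[where f = "\<lambda>v. v $ i" for i, OF this]
  show thesis
    by (rule that[of "matrix_inv C *v axis 1 1" "matrix_inv C *v axis 2 1" "matrix_inv C *v axis 3 1" "matrix_inv C *v axis 4 1"])
       (simp_all only: C[symmetric] *, simp_all add: axis_def)
qed

text \<open>A matrix is determined by its action on the four coframe rows. Expanding in the dual
  basis shows that symmetry of the prescribed rows passes on to the connection.\<close>

lemma connection_from_coframe:
  fixes b l e e' :: "real ^ 4" and Wb Wl We We' :: "4 \<Rightarrow> real ^ 4"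
  assumes ker: "\<And>y. b \<bullet> y = 0 \<Longrightarrow> l \<bullet> y = 0 \<Longrightarrow> e \<bullet> y = 0 \<Longrightarrow> e' \<bullet> y = 0 \<Longrightarrow> y = 0"
    and sym: "\<And>i j. Wb i $ j = Wb j $ i" "\<And>i j. Wl i $ j = Wl j $ i" "\<And>i j. We i $ j = We j $ i" "\<And>i j. We' i $ j = We' j $ i"
  shows "\<exists>M. (\<forall>i. b v* M i = Wb i \<and> l v* M i = Wl i \<and> e v* M i = We i \<and> e' v* M i = We' i) \<and>
    (\<forall>i j k. M i $ k $ j = (M j :: real ^ 4 ^ 4) $ k $ i)"
proof -
  obtain B K E E' where d: "b \<bullet> B = 1" "b \<bullet> K = 0" "b \<bullet> E = 0" "b \<bullet> E' = 0"
    "l \<bullet> B = 0" "l \<bullet> K = 1" "l \<bullet> E = 0" "l \<bullet> E' = 0"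
    "e \<bullet> B = 0" "e \<bullet> K = 0" "e \<bullet> E = 1" "e \<bullet> E' = 0"
    "e' \<bullet> B = 0" "e' \<bullet> K = 0" "e' \<bullet> E = 0" "e' \<bullet> E' = 1"
    using dual_basis[OF ker] .
  define M :: "4 \<Rightarrow> real ^ 4 ^ 4" where
    "M i = (\<chi> k j. Wb i $ j * B $ k + Wl i $ j * K $ k + We i $ j * E $ k + We' i $ j * E' $ k)" for i
  have "\<theta> v* M i = (\<theta> \<bullet> B) *\<^sub>R Wb i + (\<theta> \<bullet> K) *\<^sub>R Wl i + (\<theta> \<bullet> E) *\<^sub>R We i + (\<theta> \<bullet> E') *\<^sub>R We' i" for \<theta> i
    by (simp add: vec_eq_iff vector_matrix_mult_def M_def inner_vec_def distrib_left distrib_right sum.distrib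
        sum_distrib_right sum_distrib_left mult_ac)
  then have "b v* M i = Wb i" "l v* M i = Wl i" "e v* M i = We i" "e' v* M i = We' i" for i by (simp_all add: d)
  moreover have "M i $ k $ j = M j $ k $ i" for i j k
    by (simp add: M_def sym(1)[of i j] sym(2)[of i j] sym(3)[of i j] sym(4)[of i j])
  ultimately show ?thesis by blast
qed

lemma matrix_eq_on_open:
  fixes P Q :: "real ^ 'n::finite ^ 'm"
  assumes Y: "open Y" "y0 \<in> Y" and eq: "\<And>y. y \<in> Y \<Longrightarrow> P *v y = Q *v y"
  shows "P = Q"
proof -
  obtain d where d: "d > 0" "ball y0 d \<subseteq> Y" using Y open_contains_ball by blast
  have "P $ k $ j = Q $ k $ j" for k j
  proof -
    have "y0 + (d / 2) *\<^sub>R axis j 1 \<in> Y" using d by (intro subsetD[OF d(2)]) (simp add: dist_norm)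
    from eq[OF this] eq[OF Y(2)] have "(d / 2) *\<^sub>R (P *v axis j 1) = (d / 2) *\<^sub>R (Q *v axis j 1)"
      by (simp add: matrix_vector_right_distrib matrix_vector_mult_scaleR)
    then have "P *v axis j 1 = Q *v axis j 1" using d(1) by simp
    then show ?thesis by (metis matrix_vector_axis)
  qed
  then show ?thesis by (simp add: vec_eq_iff)
qed

section \<open>The Ricci tensor of a pp-wave Kropina metric\<close>

definition grad :: "(real ^ 'n::finite \<Rightarrow> real) \<Rightarrow> real ^ 'n \<Rightarrow> real ^ 'n" where
  "grad f x = (\<chi> i. dirderiv (axis i 1) f x)"

lemma grad_inner: "f differentiable at x \<Longrightarrow> grad f x \<bullet> y = dirderiv y f x"
  by (rule dirderiv_gradient[symmetric]) (simp_all add: grad_def)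

lemma smooth_grad: "open X \<Longrightarrow> smooth_on X f \<Longrightarrow> smooth_on X (grad f)"
  unfolding grad_def by (intro smooth_on_vec_lambda smooth_on_dirderiv)

lemma dirderiv_grad:
  assumes "open X" "x \<in> X" "smooth_on X f"
  shows "dirderiv (axis i 1) (grad f) x $ j = dirderiv (axis j 1) (grad f) x $ i"
proof -
  have "dirderiv v (grad f) x $ j = dirderiv v (dirderiv (axis j 1) f) x" for v j
    using dirderiv_nth[OF smooth_on_differentiable[OF smooth_grad[OF assms(1,3)] assms(2)], of v j]
    by (simp add: grad_def)
  then show ?thesis using dirderiv_commute[OF assms] by simp
qed

lemma outer_product: "y \<bullet> ((\<chi> i j. p $ i * q $ j) *v z) = (p \<bullet> y) * (q \<bullet> z)" for p q y z :: "real ^ 'n::finite"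
  unfolding inner_matrix_sum by (simp add: inner_vec_def sum_product mult_ac)

context null_kropina
begin

text \<open>The connection matrices \<open>M\<close> below are those of the pp-wave metric; they preserve \<open>F\<close>, hence
  coincide with the Berwald connection by invertibility of the fundamental tensor.\<close>

lemma pp_wave_ricci:
  fixes u v x3 x4 :: "real ^ 4 \<Rightarrow> real" and H :: "real \<times> real \<times> real \<Rightarrow> real"
  assumes c: "c \<in> S" and X: "open X" "X \<subseteq> chart_image c"
    and G: "\<And>i. smooth_on X (G i)" and Gsym: "\<And>x i j k. x \<in> X \<Longrightarrow> G i x $ k $ j = G j x $ k $ i"
    and N: "\<And>x y k i. (x, y) \<in> bundle_coords S A c \<Longrightarrow> x \<in> X \<Longrightarrow>
      nonlinear_conn (F \<circ> bundle_point S c) k i (x, y) = (G i x *v y) $ k"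
    and sm: "smooth_on X u" "smooth_on X v" "smooth_on X x3" "smooth_on X x4"
    and H: "smooth_on T H" "\<And>x. x \<in> X \<Longrightarrow> (u x, x3 x, x4 x) \<in> T"
    and indep: "\<And>x y. x \<in> X \<Longrightarrow> dirderiv y u x = 0 \<Longrightarrow> dirderiv y v x = 0 \<Longrightarrow> dirderiv y x3 x = 0 \<Longrightarrow>
      dirderiv y x4 x = 0 \<Longrightarrow> y = 0"
    and form: "\<And>x y. (x, y) \<in> bundle_coords S A c \<Longrightarrow> x \<in> X \<Longrightarrow> \<exists>r s.
      is_power \<bar>- 2 * dirderiv y u x * dirderiv y v x + H (u x, x3 x, x4 x) * (dirderiv y u x)\<^sup>2
        + (dirderiv y x3 x)\<^sup>2 + (dirderiv y x4 x)\<^sup>2\<bar> ((1 + m) / 2) r \<and>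
      is_power (dirderiv y u x) (- m) s \<and> F (bundle_point S c (x, y)) = r * s"
    and x: "x \<in> X"
  shows "ricci G x $ i $ j + ricci G x $ j $ i
    = - transverse_laplacian H (u x, x3 x, x4 x) * dirderiv (axis i 1) u x * dirderiv (axis j 1) u x"
proof -
  interpret lf: local_finsler "F \<circ> bundle_point S c" "bundle_coords S A c" by (rule lf[OF c])
  define w where "w x = (u x, x3 x, x4 x)" for x
  \<comment> \<open>The coefficients to be expected: the exterior derivative of
    \<open>l = dv - (H/2) du\<close> is the antisymmetric part dictated by
    \<open>\<nabla>l = b \<otimes> (\<tau> e + \<tau>' e')\<close>.\<close>
  define \<tau> where "\<tau> x = dirderiv (0, 1, 0) H (w x) / 2" for x
  define \<tau>' where "\<tau>' x = dirderiv (0, 0, 1) H (w x) / 2" for x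
  define b where "b = grad u"
  define e where "e = grad x3"
  define e' where "e' = grad x4"
  define l where "l = (\<lambda>x. grad v x - (H (w x) / 2) *\<^sub>R b x)"
  have wT: "w x \<in> T" if "x \<in> X" for x using H(2)[OF that] by (simp add: w_def)
  have sw: "smooth_on X w" unfolding w_def by (intro smooth_on_Pair X sm)
  have d: "u differentiable at x" "v differentiable at x" "x3 differentiable at x" "x4 differentiable at x"
    "w differentiable at x" if "x \<in> X" for x
    by (rule smooth_on_differentiable[OF _ that], fact sm sw)+
  have dw: "dirderiv y w x = (dirderiv y u x, dirderiv y x3 x, dirderiv y x4 x)" if xX: "x \<in> X" for x y
    unfolding w_def
    by (rule dirderiv_eqI) (intro has_derivative_Pair has_derivative_dirderiv d[OF xX])
  have chain: "dirderiv y (\<lambda>x. f (w x)) x = dirderiv y u x * dirderiv (1, 0, 0) f (w x)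
      + dirderiv y x3 x * dirderiv (0, 1, 0) f (w x) + dirderiv y x4 x * dirderiv (0, 0, 1) f (w x)"
    if f: "smooth_on T f" and xX: "x \<in> X" for f :: "real \<times> real \<times> real \<Rightarrow> real" and x y
  proof -
    note fd = smooth_on_differentiable[OF f wT[OF xX]]
    interpret linear "\<lambda>v. dirderiv v f (w x)" by (rule linear_dirderiv[OF fd])
    have "dirderiv y (\<lambda>x. f (w x)) x = dirderiv (dirderiv y w x) f (w x)" by (rule dirderiv_compose[OF d(5)[OF xX] fd])
    also have "dirderiv y w x = dirderiv y u x *\<^sub>R (1, 0, 0) + dirderiv y x3 x *\<^sub>R (0, 1, 0) + dirderiv y x4 x *\<^sub>R (0, 0, 1)"
      by (simp add: dw[OF xX])
    finally show ?thesis by (simp only: add scale real_scaleR_def)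
  qed
  have sH: "smooth_on X (\<lambda>x. H (w x))" by (rule smooth_on_compose[OF X(1) H(1) sw wT])
  have sH': "smooth_on T (dirderiv (0, 1, 0) H)" "smooth_on T (dirderiv (0, 0, 1) H)"
    by (intro smooth_on_dirderiv H)+
  have s\<tau>: "smooth_on X \<tau>" "smooth_on X \<tau>'" unfolding \<tau>_def \<tau>'_def
    by (intro smooth_on_divide smooth_on_const X smooth_on_compose[OF X(1) _ sw wT] sH'; simp)+
  have d\<tau>: "dirderiv y \<tau> x = dirderiv y (\<lambda>x. dirderiv (0, 1, 0) H (w x)) x / 2"
    "dirderiv y \<tau>' x = dirderiv y (\<lambda>x. dirderiv (0, 0, 1) H (w x)) x / 2" if "x \<in> X" for x y
  proof -
    have "dirderiv y (\<lambda>x. f (w x) / 2) x = dirderiv y (\<lambda>x. f (w x)) x / 2"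
      if "smooth_on T f" for f :: "real \<times> real \<times> real \<Rightarrow> real"
      by (rule dirderiv_comp_linear[OF bounded_linear_divide])
         (rule smooth_on_differentiable[OF smooth_on_compose[OF X(1) that sw wT] \<open>x \<in> X\<close>])
    from this[OF sH'(1)] this[OF sH'(2)]
    show "dirderiv y \<tau> x = dirderiv y (\<lambda>x. dirderiv (0, 1, 0) H (w x)) x / 2"
      "dirderiv y \<tau>' x = dirderiv y (\<lambda>x. dirderiv (0, 0, 1) H (w x)) x / 2"
      unfolding \<tau>_def \<tau>'_def .
  qed
  have sb: "smooth_on X b" and se: "smooth_on X e" and se': "smooth_on X e'" and sl: "smooth_on X l"
    unfolding b_def e_def e'_def l_def
    by (intro smooth_grad smooth_on_diff smooth_on_scaleR smooth_on_divide smooth_on_const X sm sH; simp)+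
  have bi: "b x \<bullet> y = dirderiv y u x" "e x \<bullet> y = dirderiv y x3 x" "e' x \<bullet> y = dirderiv y x4 x"
    "l x \<bullet> y = dirderiv y v x - H (w x) / 2 * dirderiv y u x" if "x \<in> X" for x y
    using d[OF that] by (simp_all add: b_def e_def e'_def l_def grad_inner inner_diff_left)
  have ker: "y = 0" if "x \<in> X" "b x \<bullet> y = 0" "l x \<bullet> y = 0" "e x \<bullet> y = 0" "e' x \<bullet> y = 0" for x y
    using that(2-) by (intro indep[OF that(1)]) (simp_all add: bi[OF that(1)])
  define a where "a x = (\<chi> i j. e x $ i * e x $ j) + (\<chi> i j. e' x $ i * e' x $ j)
    - ((\<chi> i j. b x $ i * l x $ j) + (\<chi> i j. l x $ i * b x $ j))" for x
  have frame: "y \<bullet> (a x *v z) = - ((b x \<bullet> y) * (l x \<bullet> z) + (l x \<bullet> y) * (b x \<bullet> z))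
      + (e x \<bullet> y) * (e x \<bullet> z) + (e' x \<bullet> y) * (e' x \<bullet> z)" for x y z
    unfolding a_def matrix_vector_mult_diff_rdistrib matrix_vector_mult_add_rdistrib inner_diff_right inner_add_right
      outer_product by simp
  have asym: "transpose (a x) = a x" for x by (simp add: a_def transpose_def vec_eq_iff mult.commute)
  have sa: "smooth_on X a"
  proof -
    have "smooth_on X (\<lambda>x. a x $ i $ j)" for i j
      unfolding a_def vector_minus_component vector_add_component vec_lambda_beta
      by (intro smooth_on_diff smooth_on_add smooth_on_mult smooth_on_vec_nth X sb se se' sl)
    then show ?thesis by (simp add: smooth_on_matrix[OF X(1)])
  qed
  have q: "y \<bullet> (a x *v y) = - 2 * dirderiv y u x * dirderiv y v x + H (u x, x3 x, x4 x) * (dirderiv y u x)\<^sup>2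
        + (dirderiv y x3 x)\<^sup>2 + (dirderiv y x4 x)\<^sup>2" if "x \<in> X" for x y
    unfolding frame bi[OF that] by (simp add: w_def power2_eq_square algebra_simps)
  have nondeg: "invertible (a x)" if xX: "x \<in> X" for x
  proof -
    obtain B K E E' where dd: "b x \<bullet> B = 1" "b x \<bullet> K = 0" "b x \<bullet> E = 0" "b x \<bullet> E' = 0"
      "l x \<bullet> B = 0" "l x \<bullet> K = 1" "l x \<bullet> E = 0" "l x \<bullet> E' = 0"
      "e x \<bullet> B = 0" "e x \<bullet> K = 0" "e x \<bullet> E = 1" "e x \<bullet> E' = 0"
      "e' x \<bullet> B = 0" "e' x \<bullet> K = 0" "e' x \<bullet> E = 0" "e' x \<bullet> E' = 1"
      using dual_basis[OF ker[OF xX]] .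
    have "y = 0" if "a x *v y = 0" for y
    proof -
      have "z \<bullet> (a x *v y) = 0" for z using that by simp
      from this[of B] this[of K] this[of E] this[of E'] show ?thesis
        by (intro ker[OF xX]) (simp_all add: frame dd)
    qed
    then have "\<exists>D. D ** a x = mat 1" by (subst matrix_left_invertible_ker) blast
    then show ?thesis using invertible_left_inverse by blast
  qed
  define D where "D = bundle_coords S A c \<inter> X \<times> UNIV"
  have D: "open D" unfolding D_def using lf.D X(1) by (intro open_Int open_Times) auto
  have conn: "b x v* G i x = dirderiv (axis i 1) b x
      \<and> e x v* G i x = dirderiv (axis i 1) e x - (\<tau> x * b x $ i) *\<^sub>R b x
      \<and> e' x v* G i x = dirderiv (axis i 1) e' x - (\<tau>' x * b x $ i) *\<^sub>R b x
      \<and> l x v* G i x = dirderiv (axis i 1) l x - b x $ i *\<^sub>R (\<tau> x *\<^sub>R e x + \<tau>' x *\<^sub>R e' x)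
      \<and> dirderiv (axis i 1) a x = transpose (G i x) ** a x + a x ** G i x"
    if xX: "x \<in> X" for x i
  proof -
    note ds = smooth_on_differentiable[OF sb xX] smooth_on_differentiable[OF se xX]
      smooth_on_differentiable[OF se' xX] smooth_on_differentiable[OF sl xX] smooth_on_differentiable[OF sa xX]
    have dl: "dirderiv (axis i 1) l x $ j = dirderiv (axis i 1) (grad v) x $ j
        - (H (w x) / 2 * dirderiv (axis i 1) b x $ j
          + (dirderiv (axis i 1) u x * dirderiv (1, 0, 0) H (w x) / 2 + \<tau> x * e x $ i + \<tau>' x * e' x $ i) * b x $ j)" for i j
    proof -
      have h: "(\<lambda>x. H (w x) / 2) differentiable at x"
        by (rule smooth_on_differentiable[OF smooth_on_divide[OF X(1) sH smooth_on_const] xX]) simp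
      have gv: "grad v differentiable at x" by (rule smooth_on_differentiable[OF smooth_grad[OF X(1) sm(2)] xX])
      have hb: "(\<lambda>x. (H (w x) / 2) *\<^sub>R b x) differentiable at x"
        by (rule differentiable_bilinear[OF bounded_bilinear_scaleR h ds(1)])
      have "dirderiv (axis i 1) l x = dirderiv (axis i 1) (grad v) x
          - ((H (w x) / 2) *\<^sub>R dirderiv (axis i 1) b x + dirderiv (axis i 1) (\<lambda>x. H (w x) / 2) x *\<^sub>R b x)"
        unfolding l_def dirderiv_diff[OF gv hb] dirderiv_bilinear[OF bounded_bilinear_scaleR h ds(1)] ..
      moreover have "dirderiv (axis i 1) (\<lambda>x. H (w x) / 2) x = dirderiv (axis i 1) (\<lambda>x. H (w x)) x / 2"
        by (rule dirderiv_comp_linear[OF bounded_linear_divide smooth_on_differentiable[OF sH xX]])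
      moreover have "e x $ i = dirderiv (axis i 1) x3 x" "e' x $ i = dirderiv (axis i 1) x4 x"
        by (simp_all add: e_def e'_def grad_def)
      ultimately show ?thesis by (simp add: chain[OF H(1) xX] \<tau>_def \<tau>'_def add_divide_distrib mult_ac)
    qed
    have bu: "b x $ i = dirderiv (axis i 1) u x" for i by (simp add: b_def grad_def)
    \<comment> \<open>The structure equations with \<open>om = 0\<close>,
      \<open>mu = \<tau> b\<close> and \<open>nu = \<tau>' b\<close>, solved for the action of the
      unknown connection on each coframe row.\<close>
    define Wb where "Wb i = dirderiv (axis i 1) b x" for i
    define We where "We i = dirderiv (axis i 1) e x - (\<tau> x * b x $ i) *\<^sub>R b x" for i
    define We' where "We' i = dirderiv (axis i 1) e' x - (\<tau>' x * b x $ i) *\<^sub>R b x" for i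
    define Wl where "Wl i = dirderiv (axis i 1) l x - b x $ i *\<^sub>R (\<tau> x *\<^sub>R e x + \<tau>' x *\<^sub>R e' x)" for i
    have sWb: "Wb i $ j = Wb j $ i" for i j
      unfolding Wb_def b_def by (rule dirderiv_grad[OF X(1) xX sm(1)])
    have sWe: "We i $ j = We j $ i" for i j
      using dirderiv_grad[OF X(1) xX sm(3), of i j] by (simp add: We_def e_def[symmetric] mult_ac)
    have sWe': "We' i $ j = We' j $ i" for i j
      using dirderiv_grad[OF X(1) xX sm(4), of i j] by (simp add: We'_def e'_def[symmetric] mult_ac)
    \<comment> \<open>The asymmetry in the derivative of \<open>l\<close> comes from
      \<open>dH \<and> du\<close> alone, and the correction term has the same antisymmetric
      part.\<close>
    have sWl: "Wl i $ j = Wl j $ i" for i j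
      using sWb[of i j] dirderiv_grad[OF X(1) xX sm(2), of i j]
      by (simp add: Wl_def dl Wb_def bu[symmetric] algebra_simps)
    obtain M where M: "\<And>i. b x v* M i = Wb i" "\<And>i. l x v* M i = Wl i" "\<And>i. e x v* M i = We i" "\<And>i. e' x v* M i = We' i"
      and Msym: "\<And>i j k. M i $ k $ j = M j $ k $ i"
    proof -
      have "\<exists>M. (\<forall>i. b x v* M i = Wb i \<and> l x v* M i = Wl i \<and> e x v* M i = We i \<and> e' x v* M i = We' i) \<and>
        (\<forall>i j k. M i $ k $ j = M j $ k $ i)"
        by (rule connection_from_coframe[OF ker[OF xX] sWb sWl sWe sWe'])
      then obtain M where "(\<forall>i. b x v* M i = Wb i \<and> l x v* M i = Wl i \<and> e x v* M i = We i \<and> e' x v* M i = We' i) \<and>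
        (\<forall>i j k. M i $ k $ j = M j $ k $ i)" ..
      with that[of M] show thesis by simp
    qed
    have Mi: "\<theta> \<bullet> (M i *v y) = (\<theta> v* M i) \<bullet> y" for \<theta> i y by (simp add: dot_lmul_matrix)
    \<comment> \<open>Metric compatibility is checked on the quadratic form only; it then holds
      fully because the covariant derivative of \<open>a\<close> is symmetric.\<close>
    have T0: "y \<bullet> ((dirderiv (axis i 1) a x - (transpose (M i) ** a x + a x ** M i)) *v y) = 0" for i y
    proof -
      let ?i = "axis i 1 :: real ^ 4"
      have inner: "dirderiv ?i (\<lambda>x. \<theta> x \<bullet> y) x = dirderiv ?i \<theta> x \<bullet> y" "(\<lambda>x. \<theta> x \<bullet> y) differentiable at x"
        if "\<theta> differentiable at x" for \<theta> :: "real ^ 4 \<Rightarrow> real ^ 4"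
        using dirderiv_comp_linear[OF bounded_linear_inner_left that]
          differentiableI[OF bounded_linear.has_derivative[OF bounded_linear_inner_left has_derivative_dirderiv[OF that]]]
        by auto
      have prod: "dirderiv ?i (\<lambda>x. (\<theta> x \<bullet> y) * (\<psi> x \<bullet> y)) x
          = (\<theta> x \<bullet> y) * (dirderiv ?i \<psi> x \<bullet> y) + (dirderiv ?i \<theta> x \<bullet> y) * (\<psi> x \<bullet> y)"
        "(\<lambda>x. (\<theta> x \<bullet> y) * (\<psi> x \<bullet> y)) differentiable at x"
        if "\<theta> differentiable at x" "\<psi> differentiable at x" for \<theta> \<psi> :: "real ^ 4 \<Rightarrow> real ^ 4"
        using dirderiv_mult[OF inner(2)[OF that(1)] inner(2)[OF that(2)]] inner that
          differentiable_bilinear[OF bounded_bilinear_mult inner(2)[OF that(1)] inner(2)[OF that(2)]] by auto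
      have "bounded_linear (\<lambda>M :: real ^ 4 ^ 4. y \<bullet> (M *v y))"
        by (intro bounded_linear_compose[OF bounded_linear_inner_right]
            bounded_bilinear.bounded_linear_left[OF bounded_bilinear_matrix_vector])
      from dirderiv_comp_linear[OF this ds(5)]
      have "y \<bullet> (dirderiv ?i a x *v y) = dirderiv ?i (\<lambda>x. y \<bullet> (a x *v y)) x" by simp
      also have "(\<lambda>x. y \<bullet> (a x *v y)) = (\<lambda>x. ((e x \<bullet> y) * (e x \<bullet> y) + (e' x \<bullet> y) * (e' x \<bullet> y))
          - ((b x \<bullet> y) * (l x \<bullet> y) + (l x \<bullet> y) * (b x \<bullet> y)))"
        by (simp add: frame fun_eq_iff)
      finally have 1: "y \<bullet> (dirderiv ?i a x *v y)
          = ((e x \<bullet> y) * (dirderiv ?i e x \<bullet> y) + (dirderiv ?i e x \<bullet> y) * (e x \<bullet> y)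
            + ((e' x \<bullet> y) * (dirderiv ?i e' x \<bullet> y) + (dirderiv ?i e' x \<bullet> y) * (e' x \<bullet> y)))
          - ((b x \<bullet> y) * (dirderiv ?i l x \<bullet> y) + (dirderiv ?i b x \<bullet> y) * (l x \<bullet> y)
            + ((l x \<bullet> y) * (dirderiv ?i b x \<bullet> y) + (dirderiv ?i l x \<bullet> y) * (b x \<bullet> y)))"
        by (simp only: dirderiv_diff dirderiv_add differentiable_add prod ds)
      have "y \<bullet> ((transpose (M i) ** a x) *v y) = (M i *v y) \<bullet> (a x *v y)"
        by (simp only: matrix_vector_mul_assoc[symmetric] inner_transpose)
      moreover have "y \<bullet> ((a x ** M i) *v y) = y \<bullet> (a x *v (M i *v y))"
        by (simp only: matrix_vector_mul_assoc)
      ultimately show ?thesis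
        unfolding matrix_vector_mult_diff_rdistrib matrix_vector_mult_add_rdistrib inner_diff_right inner_add_right 1 frame Mi M
        by (simp add: Wb_def We_def We'_def Wl_def inner_diff_left inner_add_left algebra_simps)
    qed
    have Lf: "lf.L (x, y) = exp ((1 + m) / 2 * ln ((y \<bullet> (a x *v y))\<^sup>2) - m * ln ((b x \<bullet> y)\<^sup>2))"
      if z: "(x, y) \<in> D" and nz: "y \<bullet> (a x *v y) \<noteq> 0" "b x \<bullet> y \<noteq> 0" for x y
    proof -
      have xX: "x \<in> X" and z': "(x, y) \<in> bundle_coords S A c" using z by (auto simp: D_def)
      obtain r s where "is_power \<bar>y \<bullet> (a x *v y)\<bar> ((1 + m) / 2) r" "is_power (b x \<bullet> y) (- m) s"
        "F (bundle_point S c (x, y)) = r * s"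
        using form[OF z' xX] unfolding q[OF xX] bi[OF xX] by blast
      then show ?thesis using kropina_square[OF _ _ nz] by (simp add: lf.L_def)
    qed
    have pres: "dx i lf.L (x, y) = dirderiv (0, M i *v y) lf.L (x, y)"
      if "(x, y) \<in> bundle_coords S A c" "y \<bullet> (a x *v y) \<noteq> 0" "b x \<bullet> y \<noteq> 0" for y i
    proof (rule kropina_preserved_iff[THEN iffD2, OF D X(1) _ sa sb Lf])
      show "(x, y) \<in> D" using that(1) xX by (simp add: D_def)
      show "(1 + m) * (y \<bullet> ((dirderiv (axis i 1) a x - (transpose (M i) ** a x + a x ** M i)) *v y) * (b x \<bullet> y)) =
        2 * m * (y \<bullet> (a x *v y) * ((dirderiv (axis i 1) b x - b x v* M i) \<bullet> y))"
        by (simp add: T0 M Wb_def)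
    qed (use that in \<open>auto simp: D_def\<close>)
    have xc: "x \<in> chart_image c" using X(2) xX by blast
    obtain y0 where y0: "(x, y0) \<in> bundle_coords S A c" using fibre[OF c xc] .
    define Y where "Y = {y. (x, y) \<in> bundle_coords S A c}"
    have Y: "open Y" "Y \<noteq> {}" using lf.vertical_fibre[OF y0] by (auto simp: Y_def)
    have "\<exists>B. b x \<bullet> B = 1 \<and> e x \<bullet> B = 1 \<and> l x \<bullet> B = 0"
    proof -
      obtain B K E E' where dd: "b x \<bullet> B = 1" "b x \<bullet> K = 0" "b x \<bullet> E = 0" "b x \<bullet> E' = 0"
        "l x \<bullet> B = 0" "l x \<bullet> K = 1" "l x \<bullet> E = 0" "l x \<bullet> E' = 0"
        "e x \<bullet> B = 0" "e x \<bullet> K = 0" "e x \<bullet> E = 1" "e x \<bullet> E' = 0"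
        "e' x \<bullet> B = 0" "e' x \<bullet> K = 0" "e' x \<bullet> E = 0" "e' x \<bullet> E' = 1"
        using dual_basis[OF ker[OF xX]] .
      show ?thesis by (rule exI[of _ "B + E"]) (simp add: inner_add_right dd)
    qed
    then obtain B where B: "b x \<bullet> B = 1 \<and> e x \<bullet> B = 1 \<and> l x \<bullet> B = 0" ..
    have bn: "b x \<noteq> 0" using B by (metis inner_zero_left zero_neq_one)
    have an: "a x \<noteq> 0"
    proof
      assume "a x = 0"
      then have "0 = B \<bullet> (a x *v B)" by simp
      also have "\<dots> = 1 + (e' x \<bullet> B) * (e' x \<bullet> B)" unfolding frame using B by simp
      also have "\<dots> > 0" by (simp add: add_pos_nonneg)
      finally show False by simp
    qed
    obtain y1 where y1: "y1 \<in> Y" "y1 \<bullet> (a x *v y1) \<noteq> 0" "b x \<bullet> y1 \<noteq> 0"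
      using form_nonzero_in_open[OF Y asym an bn] .
    define Y' where "Y' = Y \<inter> {y. (y \<bullet> (a x *v y)) * (b x \<bullet> y) \<noteq> 0}"
    have "open {y. (y \<bullet> (a x *v y)) * (b x \<bullet> y) \<noteq> 0}"
      by (intro open_Collect_neq continuous_intros linear_continuous_on matrix_vector_mul_bounded_linear)
    then have Y': "open Y'" unfolding Y'_def using Y by blast
    have y1': "y1 \<in> Y'" using y1 by (simp add: Y'_def)
    \<comment> \<open>A symmetric connection that preserves F^2 on an open set of directions is the
      Berwald connection there; by linearity the two matrices then agree.\<close>
    have "M i *v y = G i x *v y" if "y \<in> Y'" for y
    proof -
      have "nonlinear_conn (F \<circ> bundle_point S c) k i (x, y) = (M i *v y) $ k" for k
        by (rule lf.preserves_berwald[OF Msym Y' that]) (use pres in \<open>auto simp: Y'_def Y_def\<close>)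
      moreover have "nonlinear_conn (F \<circ> bundle_point S c) k i (x, y) = (G i x *v y) $ k" for k
        using N[OF _ xX] that by (simp add: Y'_def Y_def)
      ultimately show ?thesis by (simp add: vec_eq_iff)
    qed
    from matrix_eq_on_open[OF Y' y1' this] have MG: "M i = G i x" .
    have symT: "transpose (dirderiv (axis i 1) a x - (transpose (M i) ** a x + a x ** M i))
        = dirderiv (axis i 1) a x - (transpose (M i) ** a x + a x ** M i)"
    proof -
      have tr: "bounded_linear (transpose :: real ^ 4 ^ 4 \<Rightarrow> _)"
        by (rule linear_conv_bounded_linear[THEN iffD1]) (auto intro!: linearI simp: transpose_def vec_eq_iff)
      have "transpose (dirderiv (axis i 1) a x) = dirderiv (axis i 1) a x"
        using dirderiv_comp_linear[OF tr ds(5), of "axis i 1"] unfolding asym by (rule sym)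
      moreover have "transpose (P + Q) = transpose P + transpose Q" "transpose (P - Q) = transpose P - transpose Q"
        for P Q :: "real ^ 4 ^ 4" by (simp_all add: transpose_def vec_eq_iff)
      ultimately show ?thesis by (simp add: matrix_transpose_mul asym add.commute)
    qed
    from symmetric_form_eq_0[OF symT T0]
    have "dirderiv (axis i 1) a x - (transpose (G i x) ** a x + a x ** G i x) = 0" unfolding MG .
    then have "dirderiv (axis i 1) a x = transpose (G i x) ** a x + a x ** G i x" by (rule eq_iff_diff_eq_0[THEN iffD2])
    then show ?thesis
      using M(1)[of i] M(2)[of i] M(3)[of i] M(4)[of i]
      unfolding MG Wb_def We_def We'_def Wl_def by (intro conjI)
  qed
  obtain r where r: "r > 0" "ball x r \<subseteq> X" using X(1) x open_contains_ball by blast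
  interpret nc: null_coframe x r a G b e e' l
  proof
    show "smooth_on (ball x r) a" "smooth_on (ball x r) (G i)" "smooth_on (ball x r) b" "smooth_on (ball x r) e"
      "smooth_on (ball x r) e'" "smooth_on (ball x r) l" for i
      using sa G sb se se' sl r(2) smooth_on_subset by blast+
    show "G i z $ k $ j = G j z $ k $ i" if "z \<in> ball x r" for z i j k using Gsym r(2) that by blast
    show "dirderiv (axis i 1) a z = transpose (G i z) ** a z + a z ** G i z"
      "dirderiv (axis i 1) b z = b z v* G i z" if "z \<in> ball x r" for z i
      using conn[of z i] r(2) that by (auto simp del: transpose_matrix_vector)
    show "invertible (a z)" if "z \<in> ball x r" for z using nondeg r(2) that by blast
  qed (rule r(1), rule frame)
  have xr: "x \<in> ball x r" using r(1) by simp
  have co: "nc.om i z = 0" "nc.mu i z = \<tau> z * b z $ i" "nc.nu i z = \<tau>' z * b z $ i" if z: "z \<in> ball x r" for z i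
  proof -
    have "z \<in> X" using z r(2) by blast
    from conn[OF this, of i]
    have "covd G i e z = (\<tau> z * b z $ i) *\<^sub>R b z" "covd G i e' z = (\<tau>' z * b z $ i) *\<^sub>R b z"
      by (simp_all add: covd_def)
    from nc.coeffs_from_covd[OF z this]
    show "nc.om i z = 0" "nc.mu i z = \<tau> z * b z $ i" "nc.nu i z = \<tau>' z * b z $ i" .
  qed
  have s\<tau>r: "smooth_on (ball x r) \<tau>" "smooth_on (ball x r) \<tau>'" using s\<tau> r(2) smooth_on_subset by blast+
  have fMm: "nc.form2 nc.Mm x P Q = dirderiv P \<tau> x * (b x \<bullet> Q) - dirderiv Q \<tau> x * (b x \<bullet> P)" for P Q
    by (rule nc.form2_multiple_b[OF xr s\<tau>r(1), of nc.mu])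
       (simp_all only: co nc.Mm_def co(1)[OF xr] mult_zero_left diff_self add_0_right)
  have fMn: "nc.form2 nc.Mn x P Q = dirderiv P \<tau>' x * (b x \<bullet> Q) - dirderiv Q \<tau>' x * (b x \<bullet> P)" for P Q
    by (rule nc.form2_multiple_b[OF xr s\<tau>r(2), of nc.nu])
       (simp_all only: co nc.Mn_def co(1)[OF xr] mult_zero_left diff_self add_0_right)
  have fOm: "nc.form2 nc.Om x P Q = 0" for P Q
  proof -
    have "nc.Om i j x = 0" for i j
    proof -
      have "dirderiv (axis i 1) (nc.om j) x = dirderiv (axis i 1) (\<lambda>x. 0) x" for i j
        by (rule dirderiv_cong_open[OF nc.o xr co(1)])
      then show ?thesis by (simp add: nc.Om_def)
    qed
    then show ?thesis by (simp add: nc.form2_def inner_matrix_sum)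
  qed
  note dual = nc.dual[OF xr]
  \<comment> \<open>On functions of (u, x3, x4) the frame vectors \<open>Ev\<close> and
    \<open>E'v\<close> act as the partial derivatives in \<open>x3\<close> and \<open>x4\<close>,
    and \<open>Kv\<close> acts as zero.\<close>
  have vals: "dirderiv (nc.Kv x) \<tau> x = 0" "dirderiv (nc.Kv x) \<tau>' x = 0"
    "dirderiv (nc.Ev x) \<tau> x = dirderiv (0, 1, 0) (dirderiv (0, 1, 0) H) (w x) / 2"
    "dirderiv (nc.E'v x) \<tau>' x = dirderiv (0, 0, 1) (dirderiv (0, 0, 1) H) (w x) / 2"
    using dual by (simp_all add: d\<tau>[OF x] chain[OF sH'(1) x] chain[OF sH'(2) x] bi[OF x])
  \<comment> \<open>In the frame trace only the derivatives of \<open>\<tau>\<close> along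
    \<open>Ev\<close> and of \<open>\<tau>'\<close> along \<open>E'v\<close> survive, and they add
    up to half the Laplacian.\<close>
  have "Y \<bullet> (ricci G x *v Z) = - (transverse_laplacian H (w x) / 2) * (b x \<bullet> Y) * (b x \<bullet> Z)" for Y Z
    unfolding nc.Rt_ricci[OF xr, symmetric] nc.frame_curvature[OF xr] fMm fMn fOm dual vals
    by (simp add: transverse_laplacian_def algebra_simps add_divide_distrib)
  from this[of "axis i 1" "axis j 1"] this[of "axis j 1" "axis i 1"]
  show ?thesis
    by (simp add: inner_axis' matrix_vector_axis w_def bi[OF x])
qed

end

section \<open>From Ricci-flat metrics to pp-wave charts and back\<close>

lemma open_transverse_image: "open U \<Longrightarrow> open (transverse ` U)"
proof (rule open_surjective_linear_image)
  show "linear transverse" by (rule linearI) (simp_all add: transverse_def)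
  show "surj transverse"
  proof (rule surjI)
    fix w :: "real \<times> real \<times> real"
    show "transverse (\<chi> i. if i = 1 then fst w else if i = 3 then fst (snd w) else snd (snd w)) = w"
      by (simp add: transverse_def)
  qed
qed

context null_kropina
begin

text \<open>The pp-wave coordinates enter as component functions of the transition from an arbitrary
  chart \<open>d\<close> to \<open>c\<close>. Ricci-flatness in every chart is thus read off from
  one formula.\<close>

lemma finsler_ricci_pp_wave:
  assumes d: "d \<in> S" and c: "c \<in> S" and H: "smooth_on (transverse ` chart_image c) H"
    and form: "\<And>x y. (x, y) \<in> bundle_coords S A c \<Longrightarrow> \<exists>r s. is_power \<bar>pp_wave_quadratic H x y\<bar> ((1 + m) / 2) r \<and>
      is_power (y $ 1) (- m) s \<and> F (bundle_point S c (x, y)) = r * s"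
    and z: "(x, y) \<in> bundle_coords S A d" and p: "chart_inv d x \<in> fst c"
  shows "finsler_ricci (F \<circ> bundle_point S d) i j (x, y) = - (1 / 2) * transverse_laplacian H (transverse (transition d c x))
    * dirderiv (axis i 1) (transition d c) x $ 1 * dirderiv (axis j 1) (transition d c) x $ 1"
proof -
  interpret lf: local_finsler "F \<circ> bundle_point S d" "bundle_coords S A d" by (rule lf[OF d])
  have xd: "x \<in> chart_image d" by (rule coords_in[OF z])
  obtain X G where X: "open X" "x \<in> X" "X \<subseteq> chart_image d" and G: "\<And>i. smooth_on X (G i)"
    and Gsym: "\<And>x i j k. x \<in> X \<Longrightarrow> G i x $ k $ j = G j x $ k $ i"
    and N: "\<And>x y k i. (x, y) \<in> bundle_coords S A d \<Longrightarrow> x \<in> X \<Longrightarrow>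
      nonlinear_conn (F \<circ> bundle_point S d) k i (x, y) = (G i x *v y) $ k"
  proof (rule parallel_data[OF d chart_inv_in[OF d xd]])
    fix X and G :: "4 \<Rightarrow> real ^ 4 \<Rightarrow> real ^ 4 ^ 4"
    assume 1: "open X" and 2: "snd d (chart_inv d x) \<in> X" and 3: "X \<subseteq> chart_image d"
      and 4: "\<And>i. smooth_on X (G i)" and 5: "\<And>x i j k. x \<in> X \<Longrightarrow> G i x $ k $ j = G j x $ k $ i"
      and 6: "\<And>x y k i. (x, y) \<in> bundle_coords S A d \<Longrightarrow> x \<in> X \<Longrightarrow>
        nonlinear_conn (F \<circ> bundle_point S d) k i (x, y) = (G i x *v y) $ k"
    have "x \<in> X" using 2 d xd by simp
    from that[OF 1 this 3 4 5 6] show thesis .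
  qed
  define \<phi> where "\<phi> = transition d c"
  define X' where "X' = X \<inter> snd d ` (fst d \<inter> fst c)"
  have X': "open X'" "X' \<subseteq> X" "X' \<subseteq> chart_image d"
    using X(1,3) open_image[OF d open_dom[OF c]] by (auto simp: X'_def)
  have X'c: "chart_inv d x \<in> fst c" if "x \<in> X'" for x using that image_eq[OF d, of "fst c"] by (auto simp: X'_def)
  have x': "x \<in> X'" using X(2) xd p image_eq[OF d, of "fst c"] by (auto simp: X'_def)
  note tr = d c subsetD[OF X'(3)] X'c
  have s\<phi>: "smooth_on X' \<phi>"
    unfolding \<phi>_def by (rule smooth_on_subset[OF transition_smooth[OF d c]]) (auto simp: X'_def)
  have nth: "dirderiv y (\<lambda>x. \<phi> x $ k) x = dirderiv y \<phi> x $ k" if "x \<in> X'" for x y k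
    by (rule dirderiv_nth[OF smooth_on_differentiable[OF s\<phi> that]])
  have ric: "ricci G x $ i $ j + ricci G x $ j $ i
    = - transverse_laplacian H (\<phi> x $ 1, \<phi> x $ 3, \<phi> x $ 4)
      * dirderiv (axis i 1) (\<lambda>x. \<phi> x $ 1) x * dirderiv (axis j 1) (\<lambda>x. \<phi> x $ 1) x"
  proof (rule pp_wave_ricci[OF d X'(1) X'(3) _ _ _ _ _ _ _ H _ _ _ x'])
    show "smooth_on X' (G i)" for i using G X'(2) smooth_on_subset by blast
    show "G i x $ k $ j = G j x $ k $ i" if "x \<in> X'" for x i j k using Gsym X'(2) that by blast
    show "nonlinear_conn (F \<circ> bundle_point S d) k i (x, y) = (G i x *v y) $ k"
      if "(x, y) \<in> bundle_coords S A d" "x \<in> X'" for x y k i using N[OF that(1)] X'(2) that(2) by blast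
    show "smooth_on X' (\<lambda>x. \<phi> x $ 1)" "smooth_on X' (\<lambda>x. \<phi> x $ 2)" "smooth_on X' (\<lambda>x. \<phi> x $ 3)" "smooth_on X' (\<lambda>x. \<phi> x $ 4)"
      by (intro smooth_on_vec_nth X' s\<phi>)+
    show "(\<phi> x $ 1, \<phi> x $ 3, \<phi> x $ 4) \<in> transverse ` chart_image c" if "x \<in> X'" for x
      using transition_in(1)[OF tr, OF that that] by (auto simp: \<phi>_def transverse_def)
  next
    fix x y assume x: "x \<in> X'" and "dirderiv y (\<lambda>x. \<phi> x $ 1) x = 0" "dirderiv y (\<lambda>x. \<phi> x $ 2) x = 0"
      "dirderiv y (\<lambda>x. \<phi> x $ 3) x = 0" "dirderiv y (\<lambda>x. \<phi> x $ 4) x = 0"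
    then have "dirderiv y \<phi> x = 0" by (simp add: nth vec_eq_iff forall_4)
    \<comment> \<open>The transition maps are mutually inverse, so the Jacobian of
      \<open>\<phi>\<close> has trivial kernel.\<close>
    moreover have "y = dirderiv (dirderiv y \<phi> x) (transition c d) (\<phi> x)"
      using transition_chain[OF d c d subsetD[OF X'(3) x] X'c[OF x] chart_inv_in[OF d subsetD[OF X'(3) x]], of y]
        transition_self[OF d subsetD[OF X'(3) x], of y] by (simp add: \<phi>_def)
    moreover have "dirderiv 0 (transition c d) (\<phi> x) = 0"
      unfolding \<phi>_def using transition_in[OF tr, OF x x] chart_inv_in[OF d subsetD[OF X'(3) x]]
      by (intro linear_0[OF linear_dirderiv[OF transition_diff[OF c d]]]) simp_all
    ultimately show "y = 0" by simp
  next
    fix x y assume zz: "(x, y) \<in> bundle_coords S A d" and x: "x \<in> X'"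
    have "(\<phi> x, dirderiv y \<phi> x) \<in> bundle_coords S A c"
      using bundle_coords_transition[OF tr, OF x x] zz by (simp add: \<phi>_def)
    from form[OF this]
    show "\<exists>r s. is_power \<bar>- 2 * dirderiv y (\<lambda>x. \<phi> x $ 1) x * dirderiv y (\<lambda>x. \<phi> x $ 2) x
          + H (\<phi> x $ 1, \<phi> x $ 3, \<phi> x $ 4) * (dirderiv y (\<lambda>x. \<phi> x $ 1) x)\<^sup>2
          + (dirderiv y (\<lambda>x. \<phi> x $ 3) x)\<^sup>2 + (dirderiv y (\<lambda>x. \<phi> x $ 4) x)\<^sup>2\<bar> ((1 + m) / 2) r \<and>
        is_power (dirderiv y (\<lambda>x. \<phi> x $ 1) x) (- m) s \<and> F (bundle_point S d (x, y)) = r * s"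
      using bundle_point_transition[OF tr, OF x x, of y, folded \<phi>_def]
      unfolding nth[OF x] pp_wave_quadratic_def transverse_def by simp
  qed
  have "finsler_ricci (F \<circ> bundle_point S d) i j (x, y) = (1 / 2) * (ricci G x $ i $ j + ricci G x $ j $ i)"
  proof (rule finsler_ricci_berwald[where D = "bundle_coords S A d \<inter> X' \<times> UNIV", OF _ X'(1)])
    show "open (bundle_coords S A d \<inter> X' \<times> UNIV)" using lf.D X'(1) by (intro open_Int open_Times) auto
    show "smooth_on X' (G i)" for i using G X'(2) smooth_on_subset by blast
    show "nonlinear_conn (F \<circ> bundle_point S d) k i (x, y) = (G i x *v y) $ k"
      if "(x, y) \<in> bundle_coords S A d \<inter> X' \<times> UNIV" for x y k i using N[of x y k i] X'(2) that by blast
  qed (use z x' in auto)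
  also have "\<dots> = (1 / 2) * (- transverse_laplacian H (\<phi> x $ 1, \<phi> x $ 3, \<phi> x $ 4)
      * dirderiv (axis i 1) \<phi> x $ 1 * dirderiv (axis j 1) \<phi> x $ 1)"
    unfolding ric nth[OF x'] ..
  finally show ?thesis by (simp add: \<phi>_def transverse_def)
qed

lemma ricci_flat_if_pp_wave:
  assumes "\<forall>p. \<exists>c\<in>S. p \<in> fst c \<and> (\<exists>H. smooth_on (transverse ` chart_image c) H \<and>
    (\<forall>w\<in>transverse ` chart_image c. transverse_laplacian H w = 0) \<and>
    (\<forall>x y. (x, y) \<in> bundle_coords S A c \<longrightarrow> (\<exists>r s. is_power \<bar>pp_wave_quadratic H x y\<bar> ((1 + m) / 2) r \<and>
      is_power (y $ 1) (- m) s \<and> F (bundle_point S c (x, y)) = r * s)))"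
  shows "ricci_flat S A F"
  unfolding ricci_flat_def
proof (intro ballI allI)
  fix d z i j assume d: "d \<in> S" and z: "z \<in> bundle_coords S A d"
  obtain x y where xy: "z = (x, y)" by (cases z)
  have xd: "x \<in> chart_image d" using z xy coords_in by simp
  obtain c where c: "c \<in> S" "chart_inv d x \<in> fst c" "\<exists>H. smooth_on (transverse ` chart_image c) H \<and>
    (\<forall>w\<in>transverse ` chart_image c. transverse_laplacian H w = 0) \<and>
    (\<forall>x y. (x, y) \<in> bundle_coords S A c \<longrightarrow> (\<exists>r s. is_power \<bar>pp_wave_quadratic H x y\<bar> ((1 + m) / 2) r \<and>
      is_power (y $ 1) (- m) s \<and> F (bundle_point S c (x, y)) = r * s))"
    using assms[rule_format, of "chart_inv d x"] by blast
  from c(3) obtain H where H: "smooth_on (transverse ` chart_image c) H"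
    "\<forall>w\<in>transverse ` chart_image c. transverse_laplacian H w = 0"
    "\<forall>x y. (x, y) \<in> bundle_coords S A c \<longrightarrow> (\<exists>r s. is_power \<bar>pp_wave_quadratic H x y\<bar> ((1 + m) / 2) r \<and>
      is_power (y $ 1) (- m) s \<and> F (bundle_point S c (x, y)) = r * s)" by (elim exE conjE)
  show "finsler_ricci (F \<circ> bundle_point S d) i j z = 0"
    unfolding xy
    using finsler_ricci_pp_wave[OF d c(1) H(1) H(3)[rule_format] z[unfolded xy] c(2), of i j]
      H(2)[rule_format, OF imageI[OF transition_in(1)[OF d c(1) xd c(2)]]] by simp
qed

text \<open>The parallel multiple of \<open>b\<close> is closed; taking a potential of it as first
  coordinate makes \<open>b\<close> proportional to \<open>du\<close>. The other coordinates are
  linear and adapted to a null frame at \<open>p\<close>, which supplies the positivity from which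
  completing squares starts.\<close>

lemma adapted_chart:
  obtains c where "c \<in> S" "p \<in> fst c" "\<forall>x\<in>chart_image c. \<forall>j. j \<noteq> 1 \<longrightarrow> comp1 S b c x $ j = 0"
    "comp2 S a c (snd c p) $ 3 $ 3 = 1" "comp2 S a c (snd c p) $ 4 $ 4 = 1" "comp2 S a c (snd c p) $ 3 $ 4 = 0"
proof -
  obtain c where c: "c \<in> S" "p \<in> fst c" by (rule covering)
  define x0 where "x0 = snd c p"
  have x0c: "x0 \<in> chart_image c" using c by (simp add: x0_def)
  obtain X b' G where X: "open X" "x0 \<in> X" "X \<subseteq> chart_image c" and sb: "smooth_on X b'"
    and Gsym: "\<And>x i j k. x \<in> X \<Longrightarrow> (G i x :: real ^ 4 ^ 4) $ k $ j = G j x $ k $ i"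
    and db: "\<And>x i. x \<in> X \<Longrightarrow> dirderiv (axis i 1) b' x = b' x v* G i x"
    and \<sigma>: "\<And>x. x \<in> X \<Longrightarrow> \<exists>\<sigma>>0. b' x = \<sigma> *\<^sub>R comp1 S b c x"
  proof (rule parallel_data[OF c])
    fix X b' and G :: "4 \<Rightarrow> real ^ 4 \<Rightarrow> real ^ 4 ^ 4"
    assume 1: "open X" and 2: "snd c p \<in> X" and 3: "X \<subseteq> chart_image c" and 4: "smooth_on X b'"
      and 5: "\<And>x i j k. x \<in> X \<Longrightarrow> G i x $ k $ j = G j x $ k $ i"
      and 6: "\<And>x i. x \<in> X \<Longrightarrow> dirderiv (axis i 1) b' x = b' x v* G i x"
      and 7: "\<And>x. x \<in> X \<Longrightarrow> \<exists>\<sigma>>0. b' x = \<sigma> *\<^sub>R comp1 S b c x"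
    from that[OF 1 2[folded x0_def] 3 4 5 6 7] show thesis .
  qed
  obtain R where R: "R > 0" "ball x0 R \<subseteq> X" using X(1,2) open_contains_ball by blast
  define W where "W = ball x0 R"
  have W: "open W" "W \<subseteq> chart_image c" "x0 \<in> W" "W \<subseteq> X" using R X by (auto simp: W_def)
  have "\<exists>f. smooth_on (ball x0 R) f \<and> (\<forall>x\<in>ball x0 R. \<forall>y. dirderiv y f x = b' x \<bullet> y)"
  proof (rule poincare[OF R(1) smooth_on_subset[OF sb R(2)]])
    fix x i j assume "x \<in> ball x0 R"
    then have "x \<in> X" using R(2) by blast
    then show "dirderiv (axis i 1) b' x $ j = dirderiv (axis j 1) b' x $ i"
      by (simp add: db vector_matrix_mult_def Gsym[of x i _ j])
  qed
  then obtain u where "smooth_on W u \<and> (\<forall>x\<in>W. \<forall>y. dirderiv y u x = b' x \<bullet> y)" unfolding W_def ..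
  then have u: "smooth_on W u" "\<And>x y. x \<in> W \<Longrightarrow> dirderiv y u x = b' x \<bullet> y" by simp_all
  let ?a = "comp2 S a c x0" and ?b = "comp1 S b c x0"
  obtain K E E' where fr: "?a *v K = ?b" "?b \<bullet> K = 0" "?b \<bullet> E = 0" "?b \<bullet> E' = 0"
    "E \<bullet> (?a *v E) = 1" "E' \<bullet> (?a *v E') = 1" "E \<bullet> (?a *v E') = 0" "E' \<bullet> (?a *v E) = 0"
    using frame_at[OF c(1) x0c] .
  have bn: "?b \<noteq> 0" by (rule b_nonzero[OF c(1) x0c])
  \<comment> \<open>Any vector with \<open>?b \<bullet> B = 1\<close> completes \<open>K\<close>,
    \<open>E\<close>, \<open>E'\<close> to a basis.\<close>
  define B where "B = (1 / (?b \<bullet> ?b)) *\<^sub>R ?b"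
  have B: "?b \<bullet> B = 1" using bn by (simp add: B_def)
  define C :: "real ^ 4 ^ 4" where
    "C = (\<chi> i j. (if j = 1 then B else if j = 2 then K else if j = 3 then E else E') $ i)"
  have Cv: "C *v z = z $ 1 *\<^sub>R B + z $ 2 *\<^sub>R K + z $ 3 *\<^sub>R E + z $ 4 *\<^sub>R E'" for z
    by (simp add: vec_eq_iff C_def matrix_vector_mult_def sum_4 mult.commute)
  have Cker: "z = 0" if "C *v z = 0" for z
  proof -
    have "?b \<bullet> (C *v z) = z $ 1" by (simp add: Cv inner_add_right fr B)
    then have z1: "z $ 1 = 0" using that by simp
    have KE: "E \<bullet> (?a *v K) = 0" "E' \<bullet> (?a *v K) = 0" using fr by (simp_all add: inner_commute)
    have "E \<bullet> (?a *v (C *v z)) = z $ 3" "E' \<bullet> (?a *v (C *v z)) = z $ 4"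
      by (simp_all add: Cv z1 matrix_vector_right_distrib matrix_vector_mult_scaleR inner_add_right fr(5-8) KE)
    then have z34: "z $ 3 = 0" "z $ 4 = 0" using that by simp_all
    have "K \<noteq> 0" using fr(1) bn by auto
    moreover have "z $ 2 *\<^sub>R K = 0" using that unfolding Cv by (simp add: z1 z34)
    ultimately have "z $ 2 = 0" by simp
    then show ?thesis using z1 z34 by (simp add: vec_eq_iff forall_4)
  qed
  have "\<exists>D. D ** C = mat 1" by (subst matrix_left_invertible_ker) (use Cker in blast)
  then have Ci: "invertible C" using invertible_left_inverse by blast
  define L where "L = matrix_inv C"
  have LC: "L *v (C *v z) = z" for z
    unfolding L_def by (simp only: matrix_vector_mul_assoc matrix_inv_mult[OF Ci] matrix_vector_mul_lid)
  have CL: "C *v (L *v z) = z" for z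
    unfolding L_def by (simp only: matrix_vector_mul_assoc matrix_inv_mult[OF Ci] matrix_vector_mul_lid)
  \<comment> \<open>Linear coordinates with respect to \<open>B\<close>, \<open>K\<close>,
    \<open>E\<close>, \<open>E'\<close>, except that the first is replaced by the potential, whose
    differential at \<open>x0\<close> is a positive multiple of the replaced one.\<close>
  define \<Phi> :: "real ^ 4 \<Rightarrow> real ^ 4" where "\<Phi> = (\<lambda>x. \<chi> i. if i = 1 then u x else (L *v x) $ i)"
  have bl: "bounded_linear (\<lambda>x. (L *v x) $ i)" for i
    by (intro bounded_linear_compose[OF bounded_linear_vec_nth] matrix_vector_mul_bounded_linear)
  have sc: "smooth_on W (\<lambda>x. if i = 1 then u x else (L *v x) $ i)" for i
    using u(1) smooth_on_linear[OF bl] by (cases "i = 1") simp_all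
  have s\<Phi>: "smooth_on W \<Phi>" unfolding \<Phi>_def by (rule smooth_on_vec_lambda[OF W(1) sc])
  have d\<Phi>: "dirderiv y \<Phi> x $ i = (if i = 1 then b' x \<bullet> y else (L *v y) $ i)" if "x \<in> W" for x y i
  proof -
    have "dirderiv y \<Phi> x $ i = dirderiv y (\<lambda>x. \<Phi> x $ i) x"
      by (rule dirderiv_nth[OF smooth_on_differentiable[OF s\<Phi> that], symmetric])
    then show ?thesis using u(2)[OF that] dirderiv_linear[OF bl] by (cases "i = 1") (simp_all add: \<Phi>_def)
  qed
  obtain \<sigma>0 where \<sigma>0: "\<sigma>0 > 0" "b' x0 = \<sigma>0 *\<^sub>R ?b" using \<sigma>[OF X(2)] by blast
  have "y = 0" if "dirderiv y \<Phi> x0 = 0" for y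
  proof -
    have *: "(if i = 1 then b' x0 \<bullet> y else (L *v y) $ i) = 0" for i
      using d\<Phi>[OF W(3), of y i] that by simp
    have "(L *v y) $ 1 = ?b \<bullet> (C *v (L *v y))" by (simp only: Cv) (simp add: inner_add_right fr B)
    also have "\<dots> = 0" unfolding CL using *[of 1] \<sigma>0 by simp
    finally have "L *v y = 0" using *[of 2] *[of 3] *[of 4] by (simp add: vec_eq_iff forall_4)
    then show ?thesis using CL[of y] by simp
  qed
  then have "\<exists>D. D ** matrix (\<lambda>v. dirderiv v \<Phi> x0) = mat 1"
    using fun_cong[OF matrix_vector_mul(2)[OF linear_dirderiv[OF smooth_on_differentiable[OF s\<Phi> W(3)]]]]
    by (subst matrix_left_invertible_ker) simp
  then have inv: "invertible (matrix (\<lambda>v. dirderiv v \<Phi> x0))" using invertible_left_inverse by blast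
  obtain d where d: "d \<in> S" "fst d \<subseteq> fst c" "chart_inv c x0 \<in> fst d" "\<And>p. p \<in> fst d \<Longrightarrow> snd c p \<in> W"
    "\<And>x. x \<in> chart_image c \<Longrightarrow> chart_inv c x \<in> fst d \<Longrightarrow> transition c d x = \<Phi> x"
  proof (rule exists_chart[OF c(1) W(1-3) s\<Phi> inv])
    fix d
    assume 1: "d \<in> S" and 2: "fst d \<subseteq> fst c" and 3: "chart_inv c x0 \<in> fst d"
      and 4: "\<And>p. p \<in> fst d \<Longrightarrow> snd c p \<in> W"
      and 5: "\<And>x. x \<in> chart_image c \<Longrightarrow> chart_inv c x \<in> fst d \<Longrightarrow> transition c d x = \<Phi> x"
    show thesis by (rule that[OF 1 2 3 4 5])
  qed
  have pd: "p \<in> fst d" using d(3) c by (simp add: x0_def)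
  have dtr: "dirderiv y (transition c d) x = dirderiv y \<Phi> x" if "x \<in> chart_image c" "chart_inv c x \<in> fst d" for x y
  proof (rule dirderiv_cong_open[OF open_image[OF c(1) open_dom[OF d(1)]]])
    show "x \<in> snd c ` (fst c \<inter> fst d)" using that by (simp add: image_eq[OF c(1)])
    show "transition c d x = \<Phi> x" if "x \<in> snd c ` (fst c \<inter> fst d)" for x
      using that d(5) by (simp add: image_eq[OF c(1)])
  qed
  show thesis
  proof (rule that[OF d(1) pd], intro ballI allI impI)
    fix x j assume x: "x \<in> chart_image d" and j: "j \<noteq> (1 :: 4)"
    define z where "z = transition d c x"
    have q: "chart_inv d x \<in> fst d" "chart_inv d x \<in> fst c" using chart_inv_in[OF d(1) x] d(2) by auto
    have z: "z \<in> chart_image c" "chart_inv c z = chart_inv d x"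
      unfolding z_def using transition_in[OF d(1) c(1) x q(2)] by auto
    have zW: "z \<in> W" using d(4)[OF q(1)] by (simp add: z_def transition_def)
    have zd: "transition c d z = x" using x d(1) z by (simp add: transition_def)
    \<comment> \<open>The \<open>j\<close>-th coordinate vector of \<open>d\<close> seen in
      \<open>c\<close>. As \<open>u\<close> is the first coordinate of \<open>d\<close>, this vector
      is annihilated by \<open>du\<close> and hence by \<open>b\<close>.\<close>
    define y where "y = dirderiv (axis j 1) (transition d c) x"
    have y: "dirderiv y (transition c d) z = axis j 1"
      using transition_chain[OF d(1) c(1) d(1) x q(2,1), of "axis j 1"] transition_self[OF d(1) x]
      by (simp add: y_def z_def)
    have zq: "chart_inv c z \<in> fst d" using z q by simp
    obtain s where s: "s > 0" "b' z = s *\<^sub>R comp1 S b c z" using \<sigma> zW W(4) by blast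
    have "b' z \<bullet> y = axis j 1 $ 1" using d\<Phi>[OF zW, of y 1] dtr[OF z(1) zq] y by simp
    also have "\<dots> = (0 :: real)" using j by (simp add: axis_def)
    finally have "comp1 S b c z \<bullet> y = 0" using s by simp
    then have "comp1 S b d x \<bullet> axis j 1 = 0"
      using comp1_transition[OF c(1) d(1) z(1) zq oneb, of y] y zd by simp
    then show "comp1 S b d x $ j = 0" by (simp add: inner_axis)
  next
    have pq: "chart_inv c x0 \<in> fst d" using d(3) .
    have tx: "transition c d x0 = snd d p" using c by (simp add: transition_def x0_def)
    \<comment> \<open>For \<open>k \<noteq> 1\<close> the basis vector lies in ker \<open>b\<close>,
      so replacing the first coordinate does not affect it.\<close>
    have ax: "dirderiv (C *v axis k 1) \<Phi> x0 = axis k 1" if "k \<noteq> 1" for k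
    proof -
      have "?b \<bullet> (C *v axis k 1) = axis k 1 $ 1" by (simp only: Cv) (simp add: inner_add_right fr B)
      then have "?b \<bullet> (C *v axis k 1) = 0" using that by (simp add: axis_def)
      then show ?thesis
        using that by (simp add: vec_eq_iff d\<Phi>[OF W(3)] LC \<sigma>0) (auto simp: axis_def)
    qed
    have E: "C *v axis 3 1 = E" "C *v axis 4 1 = E'" by (simp_all only: Cv) (simp_all add: axis_def)
    have dE: "dirderiv E (transition c d) x0 = axis 3 1" "dirderiv E' (transition c d) x0 = axis 4 1"
      unfolding dtr[OF x0c pq] using ax[of 3] ax[of 4] by (simp_all add: E)
    note t = comp2_transition[OF c(1) d(1) x0c pq UNIV_I pra, unfolded tx]
    from t[of E E] t[of E' E'] t[of E E']
    show "comp2 S a d (snd d p) $ 3 $ 3 = 1" "comp2 S a d (snd d p) $ 4 $ 4 = 1" "comp2 S a d (snd d p) $ 3 $ 4 = 0"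
      unfolding dE fr by (simp_all add: inner_axis' matrix_vector_axis)
  qed
qed

text \<open>Convexity of the ball keeps the segment inside the region where the derivative along
  \<open>v\<close> vanishes; on a general open set the conclusion can fail.\<close>

lemma ball_constant_along:
  assumes f: "\<And>x. x \<in> ball z R \<Longrightarrow> f differentiable at x" "\<And>x. x \<in> ball z R \<Longrightarrow> dirderiv v f x = 0"
    and xy: "x \<in> ball z R" "x + t *\<^sub>R v \<in> ball z R"
  shows "f (x + t *\<^sub>R v) = f x"
proof -
  have in_ball: "x + s *\<^sub>R t *\<^sub>R v \<in> ball z R" if "s \<in> {0..1}" for s :: real
  proof -
    have "(1 - s) *\<^sub>R x + s *\<^sub>R (x + t *\<^sub>R v) \<in> ball z R"
      using convexD_alt[OF convex_ball xy] that by simp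
    then show ?thesis by (simp add: algebra_simps)
  qed
  have "((\<lambda>s. f (x + s *\<^sub>R t *\<^sub>R v)) has_derivative (\<lambda>h. 0)) (at s within {0..1})" if s: "s \<in> {0..1}" for s :: real
  proof -
    interpret D: linear "\<lambda>h. dirderiv h f (x + s *\<^sub>R t *\<^sub>R v)"
      by (rule linear_dirderiv[OF f(1)[OF in_ball[OF s]]])
    have "((\<lambda>s. x + s *\<^sub>R t *\<^sub>R v) has_derivative (\<lambda>h. h *\<^sub>R t *\<^sub>R v)) (at s within {0..1})"
      by (auto intro!: derivative_eq_intros)
    from has_derivative_compose[OF this has_derivative_dirderiv[OF f(1)[OF in_ball[OF s]]]]
    show ?thesis by (simp only: D.scale f(2)[OF in_ball[OF s]] scaleR_zero_right)
  qed
  from has_derivative_zero_constant[OF _ this]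
  obtain k where "\<And>s. s \<in> {0..1} \<Longrightarrow> f (x + s *\<^sub>R t *\<^sub>R v) = k" by auto
  from this[of 0] this[of 1] show ?thesis by simp
qed

text \<open>The frame construction only provides an \<open>H\<close> that is independent of
  \<open>v\<close>; its harmonicity comes from evaluating the Ricci formula in the new chart
  itself.\<close>

lemma pp_wave_chart:
  assumes flat: "ricci_flat S A F"
  shows "\<exists>c\<in>S. p \<in> fst c \<and> (\<exists>H. smooth_on (transverse ` chart_image c) H \<and>
    (\<forall>w\<in>transverse ` chart_image c. transverse_laplacian H w = 0) \<and>
    (\<forall>x y. (x, y) \<in> bundle_coords S A c \<longrightarrow> (\<exists>r s. is_power \<bar>pp_wave_quadratic H x y\<bar> ((1 + m) / 2) r \<and>
      is_power (y $ 1) (- m) s \<and> F (bundle_point S c (x, y)) = r * s)))"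
proof -
  obtain c where c: "c \<in> S" "p \<in> fst c" and adapted: "\<forall>x\<in>chart_image c. \<forall>j. j \<noteq> 1 \<longrightarrow> comp1 S b c x $ j = 0"
    and a34: "comp2 S a c (snd c p) $ 3 $ 3 = 1" "comp2 S a c (snd c p) $ 4 $ 4 = 1" "comp2 S a c (snd c p) $ 3 $ 4 = 0"
    using adapted_chart[of p] .
  define x0 where "x0 = snd c p"
  have x0c: "x0 \<in> chart_image c" using c by (simp add: x0_def)
  interpret lf: local_finsler "F \<circ> bundle_point S c" "bundle_coords S A c" by (rule lf[OF c(1)])
  obtain X a' b' G where X: "open X" "x0 \<in> X" "X \<subseteq> chart_image c"
    and sab: "smooth_on X a'" "smooth_on X b'" and sG: "\<And>i. smooth_on X (G i)"
    and Gsym: "\<And>x i j k. x \<in> X \<Longrightarrow> (G i x :: real ^ 4 ^ 4) $ k $ j = G j x $ k $ i"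
    and sym: "\<And>x. x \<in> X \<Longrightarrow> transpose (a' x) = a' x"
    and da: "\<And>x i. x \<in> X \<Longrightarrow> dirderiv (axis i 1) a' x = transpose (G i x) ** a' x + a' x ** G i x"
    and db: "\<And>x i. x \<in> X \<Longrightarrow> dirderiv (axis i 1) b' x = b' x v* G i x"
    and N: "\<And>x y k i. (x, y) \<in> bundle_coords S A c \<Longrightarrow> x \<in> X \<Longrightarrow>
      nonlinear_conn (F \<circ> bundle_point S c) k i (x, y) = (G i x *v y) $ k"
    and form: "\<And>x y. (x, y) \<in> bundle_coords S A c \<Longrightarrow> x \<in> X \<Longrightarrow>
      \<exists>r s. is_power \<bar>y \<bullet> (a' x *v y)\<bar> ((1 + m) / 2) r \<and> is_power (b' x \<bullet> y) (- m) s \<and>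
        F (bundle_point S c (x, y)) = r * s"
    and K: "\<And>x. x \<in> X \<Longrightarrow> \<exists>K. a' x *v K = b' x \<and> b' x \<bullet> K = 0"
    and \<sigma>: "\<And>x. x \<in> X \<Longrightarrow> \<exists>\<sigma>>0. b' x = \<sigma> *\<^sub>R comp1 S b c x"
    and \<rho>: "\<And>x. x \<in> X \<Longrightarrow> \<exists>\<rho>>0. a' x = \<rho> *\<^sub>R comp2 S a c x"
    and nondeg: "\<And>x. x \<in> X \<Longrightarrow> invertible (a' x)"
  proof (rule parallel_data[OF c])
    fix X a' b' and G :: "4 \<Rightarrow> real ^ 4 \<Rightarrow> real ^ 4 ^ 4"
    assume 1: "open X" and 2: "snd c p \<in> X" and 3: "X \<subseteq> chart_image c" and 4: "smooth_on X a'" "smooth_on X b'"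
      and 5: "\<And>i. smooth_on X (G i)" and 6: "\<And>x i j k. x \<in> X \<Longrightarrow> G i x $ k $ j = G j x $ k $ i"
      and 7: "\<And>x. x \<in> X \<Longrightarrow> transpose (a' x) = a' x"
      and 8: "\<And>x i. x \<in> X \<Longrightarrow> dirderiv (axis i 1) a' x = transpose (G i x) ** a' x + a' x ** G i x"
      and 9: "\<And>x i. x \<in> X \<Longrightarrow> dirderiv (axis i 1) b' x = b' x v* G i x"
      and 10: "\<And>x y k i. (x, y) \<in> bundle_coords S A c \<Longrightarrow> x \<in> X \<Longrightarrow>
        nonlinear_conn (F \<circ> bundle_point S c) k i (x, y) = (G i x *v y) $ k"
      and 11: "\<And>x y. (x, y) \<in> bundle_coords S A c \<Longrightarrow> x \<in> X \<Longrightarrow>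
        \<exists>r s. is_power \<bar>y \<bullet> (a' x *v y)\<bar> ((1 + m) / 2) r \<and> is_power (b' x \<bullet> y) (- m) s \<and>
          F (bundle_point S c (x, y)) = r * s"
      and 12: "\<And>x. x \<in> X \<Longrightarrow> \<exists>K E E'. a' x *v K = b' x \<and> b' x \<bullet> K = 0 \<and> b' x \<bullet> E = 0 \<and> b' x \<bullet> E' = 0 \<and>
        E \<bullet> (a' x *v E) = 1 \<and> E' \<bullet> (a' x *v E') = 1 \<and> E \<bullet> (a' x *v E') = 0 \<and> E' \<bullet> (a' x *v E) = 0"
      and 13: "\<And>x. x \<in> X \<Longrightarrow> \<exists>\<sigma>>0. b' x = \<sigma> *\<^sub>R comp1 S b c x"
      and 14: "\<And>x. x \<in> X \<Longrightarrow> \<exists>\<rho>>0. a' x = \<rho> *\<^sub>R comp2 S a c x"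
      and 15: "\<And>x. x \<in> X \<Longrightarrow> invertible (a' x)"
    have 16: "\<exists>K. a' x *v K = b' x \<and> b' x \<bullet> K = 0" if "x \<in> X" for x using 12[OF that] by blast
    show thesis by (rule that[OF 1 2[folded x0_def] 3 4 5 6 7 8 9 10 11 16 13 14 15])
  qed
  have b0: "b' x $ j = 0" if x: "x \<in> X" and j: "j \<noteq> 1" for x j
  proof -
    obtain s where "b' x = s *\<^sub>R comp1 S b c x" using \<sigma>[OF x] by blast
    then show ?thesis using adapted j X(3) x by auto
  qed
  have b1: "b' x $ 1 \<noteq> 0" if x: "x \<in> X" for x
  proof
    assume 0: "b' x $ 1 = 0"
    obtain s where s: "s > 0" "b' x = s *\<^sub>R comp1 S b c x" using \<sigma>[OF x] by blast
    have "b' x = 0" using 0 b0[OF x] by (simp add: vec_eq_iff forall_4)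
    then show False using s b_nonzero[OF c(1), of x] X(3) x by auto
  qed
  have ric: "ricci G x $ i $ j + ricci G x $ j $ i = 0" if x: "x \<in> X" for x i j
  proof -
    have "x \<in> chart_image c" using x X(3) by blast
    then obtain y where y: "(x, y) \<in> bundle_coords S A c" using fibre[OF c(1)] by blast
    have "finsler_ricci (F \<circ> bundle_point S c) i j (x, y) = (1 / 2) * (ricci G x $ i $ j + ricci G x $ j $ i)"
    proof (rule finsler_ricci_berwald[where D = "bundle_coords S A c \<inter> X \<times> UNIV", OF _ X(1) _ sG])
      show "open (bundle_coords S A c \<inter> X \<times> UNIV)" using lf.D X(1) by (intro open_Int open_Times) auto
      show "nonlinear_conn (F \<circ> bundle_point S c) k i (x, y) = (G i x *v y) $ k"
        if "(x, y) \<in> bundle_coords S A c \<inter> X \<times> UNIV" for x y k i using N[of x y k i] that by blast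
    qed (use y x in auto)
    then show ?thesis using flat c(1) y by (simp add: ricci_flat_def)
  qed
  \<comment> \<open>The parallel metric is a positive multiple of \<open>a\<close>, whose block in
    the coordinates 3 and 4 is the identity at \<open>x0\<close>.\<close>
  have pos: "a' x0 $ 3 $ 3 > 0" "a' x0 $ 3 $ 3 * a' x0 $ 4 $ 4 - a' x0 $ 3 $ 4 * a' x0 $ 3 $ 4 > 0"
  proof -
    obtain s where "s > 0" "a' x0 = s *\<^sub>R comp2 S a c x0" using \<rho>[OF X(2)] by blast
    then show "a' x0 $ 3 $ 3 > 0" "a' x0 $ 3 $ 3 * a' x0 $ 4 $ 4 - a' x0 $ 3 $ 4 * a' x0 $ 3 $ 4 > 0"
      using a34 by (simp_all add: x0_def)
  qed
  have "\<exists>r e e' l. local_frame x0 r a' G b' e e' l \<and> ball x0 r \<subseteq> X"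
    by (rule initial_frame[OF X(1,2) sab sG Gsym da db nondeg sym b0 b1 ric K pos])
  then obtain r e e' l where fr: "local_frame x0 r a' G b' e e' l" and rX: "ball x0 r \<subseteq> X" by (elim exE conjE)
  interpret fr: local_frame x0 r a' G b' e e' l by (rule fr)
  obtain u v x3 x4 h where suv: "smooth_on fr.\<Omega> u" "smooth_on fr.\<Omega> v" "smooth_on fr.\<Omega> x3" "smooth_on fr.\<Omega> x4"
    and sh: "smooth_on fr.\<Omega> h"
    and pp: "\<forall>x\<in>fr.\<Omega>. \<forall>y. b' x \<bullet> y = dirderiv y u x \<and>
      y \<bullet> (a' x *v y) = - 2 * dirderiv y u x * dirderiv y v x + 2 * h x * (dirderiv y u x)\<^sup>2
        + (dirderiv y x3 x)\<^sup>2 + (dirderiv y x4 x)\<^sup>2 \<and>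
      (dirderiv y u x = 0 \<and> dirderiv y x3 x = 0 \<and> dirderiv y x4 x = 0 \<longrightarrow> dirderiv y h x = 0) \<and>
      (dirderiv y u x = 0 \<and> dirderiv y v x = 0 \<and> dirderiv y x3 x = 0 \<and> dirderiv y x4 x = 0 \<longrightarrow> y = 0)"
    using fr.pp_coordinates by (elim exE conjE)
  define W where "W = ball x0 r"
  have W: "open W" "W \<subseteq> chart_image c" "x0 \<in> W" using fr.r rX X(3) by (auto simp: W_def)
  define \<Phi> :: "real ^ 4 \<Rightarrow> real ^ 4" where
    "\<Phi> = (\<lambda>x. \<chi> i. if i = 1 then u x else if i = 2 then v x else if i = 3 then x3 x else x4 x)"
  have sc: "smooth_on W (\<lambda>x. if i = 1 then u x else if i = 2 then v x else if i = 3 then x3 x else x4 x)" for i :: 4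
    using suv by (cases "i = 1"; cases "i = 2"; cases "i = 3") (simp_all add: W_def)
  have s\<Phi>: "smooth_on W \<Phi>" unfolding \<Phi>_def by (rule smooth_on_vec_lambda[OF W(1) sc])
  have d\<Phi>: "dirderiv y u x = dirderiv y \<Phi> x $ 1" "dirderiv y v x = dirderiv y \<Phi> x $ 2"
    "dirderiv y x3 x = dirderiv y \<Phi> x $ 3" "dirderiv y x4 x = dirderiv y \<Phi> x $ 4" if "x \<in> W" for x y
    unfolding dirderiv_nth[OF smooth_on_differentiable[OF s\<Phi> that], symmetric] by (simp_all add: \<Phi>_def)
  have "y = 0" if "dirderiv y \<Phi> x0 = 0" for y
    using pp[rule_format, of x0 y] W(3) that by (simp add: d\<Phi>[OF W(3)] W_def[symmetric])
  then have "\<exists>D. D ** matrix (\<lambda>v. dirderiv v \<Phi> x0) = mat 1"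
    using fun_cong[OF matrix_vector_mul(2)[OF linear_dirderiv[OF smooth_on_differentiable[OF s\<Phi> W(3)]]]]
    by (subst matrix_left_invertible_ker) simp
  then have inv: "invertible (matrix (\<lambda>v. dirderiv v \<Phi> x0))" using invertible_left_inverse by blast
  obtain d R where d: "d \<in> S" "0 < R" "chart_image d = ball (\<Phi> x0) R" "fst d \<subseteq> fst c"
    "chart_inv c x0 \<in> fst d" "\<And>p. p \<in> fst d \<Longrightarrow> snd c p \<in> W"
    "\<And>x. x \<in> chart_image c \<Longrightarrow> chart_inv c x \<in> fst d \<Longrightarrow> transition c d x = \<Phi> x"
  proof (rule exists_chart[OF c(1) W s\<Phi> inv])
    fix d R
    assume 1: "d \<in> S" "0 < R" "chart_image d = ball (\<Phi> x0) R" "fst d \<subseteq> fst c" "chart_inv c x0 \<in> fst d"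
      and 2: "\<And>p. p \<in> fst d \<Longrightarrow> snd c p \<in> W"
      and 3: "\<And>x. x \<in> chart_image c \<Longrightarrow> chart_inv c x \<in> fst d \<Longrightarrow> transition c d x = \<Phi> x"
    show thesis by (rule that[OF 1 2 3])
  qed
  have pd: "p \<in> fst d" using d(5) c by (simp add: x0_def)
  define \<psi> where "\<psi> = transition d c"
  have dc: "chart_inv d x \<in> fst c" if "x \<in> chart_image d" for x using chart_inv_in[OF d(1) that] d(4) by blast
  have \<psi>W: "\<psi> x \<in> W" if "x \<in> chart_image d" for x
    using d(6)[OF chart_inv_in[OF d(1) that]] by (simp add: \<psi>_def transition_def)
  have s\<psi>: "smooth_on (chart_image d) \<psi>"
  proof -
    have "fst d \<inter> fst c = fst d" using d(4) by blast
    then show ?thesis using transition_smooth[OF d(1) c(1)] by (simp add: \<psi>_def)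
  qed
  have \<Phi>\<psi>: "\<Phi> (\<psi> x) = x" if "x \<in> chart_image d" for x
    using d(7)[of "\<psi> x"] transition_in[OF d(1) c(1) that dc[OF that]] chart_inv_in[OF d(1) that] that d(1)
    by (simp add: \<psi>_def transition_def)
  have od: "open (chart_image d)" using d(3) by simp
  have d\<Phi>\<psi>: "dirderiv (dirderiv y \<psi> x) \<Phi> (\<psi> x) = y" if x: "x \<in> chart_image d" for x y
  proof -
    have "dirderiv (dirderiv y \<psi> x) \<Phi> (\<psi> x) = dirderiv y (\<lambda>x. \<Phi> (\<psi> x)) x"
      by (rule dirderiv_compose[OF smooth_on_differentiable[OF s\<psi> x] smooth_on_differentiable[OF s\<Phi> \<psi>W[OF x]], symmetric])
    also have "\<dots> = dirderiv y (\<lambda>x. x) x" by (rule dirderiv_cong_open[OF od x \<Phi>\<psi>])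
    also have "\<dots> = y" by (rule dirderiv_linear[OF bounded_linear_ident])
    finally show ?thesis .
  qed
  define h' where "h' = (\<lambda>x. h (\<psi> x))"
  have sh': "smooth_on (chart_image d) h'"
    unfolding h'_def by (rule smooth_on_compose[OF od sh s\<psi>]) (use \<psi>W in \<open>simp add: W_def\<close>)
  \<comment> \<open>In the new chart \<open>axis 2 1\<close> is the coordinate vector of
    \<open>v\<close>, on which \<open>du\<close>, \<open>dx3\<close> and \<open>dx4\<close>
    vanish.\<close>
  have dh': "dirderiv (axis 2 1) h' x = 0" if x: "x \<in> chart_image d" for x
  proof -
    have "dirderiv (axis 2 1) h' x = dirderiv (dirderiv (axis 2 1) \<psi> x) h (\<psi> x)"
      unfolding h'_def
      by (rule dirderiv_compose[OF smooth_on_differentiable[OF s\<psi> x] smooth_on_differentiable[OF sh]])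
        (use \<psi>W[OF x] in \<open>simp add: W_def\<close>)
    also have "\<dots> = 0"
      using pp[rule_format, of "\<psi> x" "dirderiv (axis 2 1) \<psi> x"] \<psi>W[OF x]
      by (simp add: d\<Phi>[OF \<psi>W[OF x]] d\<Phi>\<psi>[OF x] W_def[symmetric]) (simp add: axis_def)
    finally show ?thesis .
  qed
  define T where "T = transverse ` chart_image d"
  have T: "open T" unfolding T_def by (rule open_transverse_image[OF od])
  define z0 where "z0 = \<Phi> x0"
  \<comment> \<open>A section of \<open>transverse\<close> that sets \<open>v\<close> to its value
    at the centre of the ball, which brings no point further from the centre.\<close>
  define sec :: "real \<times> real \<times> real \<Rightarrow> real ^ 4" where
    "sec = (\<lambda>w. \<chi> i. if i = 1 then fst w else if i = 2 then z0 $ 2 else if i = 3 then fst (snd w) else snd (snd w))"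
  have ssec: "smooth_on T sec"
    unfolding sec_def
  proof (rule smooth_on_vec_lambda[OF T])
    have "smooth_on T (\<lambda>w :: real \<times> real \<times> real. fst w)" "smooth_on T (\<lambda>w :: real \<times> real \<times> real. fst (snd w))"
      "smooth_on T (\<lambda>w :: real \<times> real \<times> real. snd (snd w))"
      by (intro smooth_on_linear bounded_linear_fst bounded_linear_compose[OF bounded_linear_fst]
          bounded_linear_compose[OF bounded_linear_snd] bounded_linear_snd)+
    then show "smooth_on T (\<lambda>w. if i = 1 then fst w else if i = 2 then z0 $ 2 else if i = 3 then fst (snd w) else snd (snd w))"
      for i :: 4 using smooth_on_const by (cases "i = 1"; cases "i = 2"; cases "i = 3") simp_all
  qed
  have sec_ball: "sec (transverse x) \<in> ball z0 R" if "x \<in> ball z0 R" for x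
  proof -
    have "norm (sec (transverse x) - z0) \<le> norm (x - z0)"
    proof (rule norm_le_componentwise_cart)
      fix i :: 4
      show "norm ((sec (transverse x) - z0) $ i) \<le> norm ((x - z0) $ i)"
        using exhaust_4[of i] by (auto simp: sec_def transverse_def)
    qed
    then show ?thesis using that by (simp add: dist_norm norm_minus_commute)
  qed
  have sec_h: "h' (sec (transverse x)) = h' x" if x: "x \<in> ball z0 R" for x
  proof -
    have "x = sec (transverse x) + (x $ 2 - z0 $ 2) *\<^sub>R axis 2 1"
      by (simp add: vec_eq_iff forall_4 sec_def transverse_def axis_def)
    moreover have "h' (sec (transverse x) + (x $ 2 - z0 $ 2) *\<^sub>R axis 2 1) = h' (sec (transverse x))"
      by (rule ball_constant_along[of z0 R])
        (use smooth_on_differentiable[OF sh'] dh' sec_ball[OF x] x calculation in \<open>simp_all add: d(3) z0_def\<close>)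
    ultimately show ?thesis by metis
  qed
  \<comment> \<open>The factor 2 matches the coefficient \<open>2 * h x\<close> of the square of
    \<open>du\<close> in \<open>pp_coordinates\<close>.\<close>
  define H where "H = (\<lambda>w. 2 * h' (sec w))"
  have sH: "smooth_on (transverse ` chart_image d) H"
    unfolding T_def[symmetric] H_def
    by (intro smooth_on_mult T smooth_on_const smooth_on_compose[OF T sh' ssec])
      (use sec_ball in \<open>auto simp: T_def d(3) z0_def\<close>)
  have Hx: "H (transverse x) = 2 * h (\<psi> x)" if "x \<in> chart_image d" for x
    using sec_h[of x] that by (simp add: H_def h'_def d(3) z0_def)
  have formd: "\<exists>r s. is_power \<bar>pp_wave_quadratic H x y\<bar> ((1 + m) / 2) r \<and>
      is_power (y $ 1) (- m) s \<and> F (bundle_point S d (x, y)) = r * s" if z: "(x, y) \<in> bundle_coords S A d" for x y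
  proof -
    have x: "x \<in> chart_image d" by (rule coords_in[OF z])
    let ?y = "dirderiv y \<psi> x"
    have "(\<psi> x, ?y) \<in> bundle_coords S A c"
      using bundle_coords_transition[OF d(1) c(1) x dc[OF x]] z by (simp add: \<psi>_def)
    moreover have "\<psi> x \<in> X" using \<psi>W[OF x] rX by (auto simp: W_def)
    ultimately have "\<exists>r s. is_power \<bar>?y \<bullet> (a' (\<psi> x) *v ?y)\<bar> ((1 + m) / 2) r \<and> is_power (b' (\<psi> x) \<bullet> ?y) (- m) s \<and>
        F (bundle_point S c (\<psi> x, ?y)) = r * s"
      by (rule form)
    moreover have "?y \<bullet> (a' (\<psi> x) *v ?y) = pp_wave_quadratic H x y" "b' (\<psi> x) \<bullet> ?y = y $ 1"
      using pp[rule_format, of "\<psi> x" ?y] \<psi>W[OF x]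
      by (simp_all add: d\<Phi>[OF \<psi>W[OF x]] d\<Phi>\<psi>[OF x] W_def[symmetric] pp_wave_quadratic_def Hx[OF x])
    moreover have "bundle_point S c (\<psi> x, ?y) = bundle_point S d (x, y)"
      unfolding \<psi>_def by (rule bundle_point_transition[OF d(1) c(1) x dc[OF x]])
    ultimately show ?thesis by simp
  qed
  have lap: "transverse_laplacian H w = 0" if w: "w \<in> transverse ` chart_image d" for w
  proof -
    obtain x where x: "x \<in> chart_image d" "w = transverse x" using w by blast
    obtain y where y: "(x, y) \<in> bundle_coords S A d" using fibre[OF d(1) x(1)] .
    \<comment> \<open>Comparing \<open>d\<close> with itself makes the transition the identity, and
      for both indices 1 the components of \<open>du\<close> are 1, so the formula isolates the
      Laplacian.\<close>
    have "0 = finsler_ricci (F \<circ> bundle_point S d) 1 1 (x, y)"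
      using flat d(1) y by (simp add: ricci_flat_def)
    also have "\<dots> = - (1 / 2) * transverse_laplacian H (transverse (transition d d x))
        * dirderiv (axis 1 1) (transition d d) x $ 1 * dirderiv (axis 1 1) (transition d d) x $ 1"
      by (rule finsler_ricci_pp_wave[OF d(1) d(1) sH formd y chart_inv_in[OF d(1) x(1)]])
    also have "\<dots> = - (1 / 2) * transverse_laplacian H w"
      using x(1) d(1) by (simp add: transition_self[OF d(1) x(1)] x(2)) (simp add: transition_def)
    finally show ?thesis by simp
  qed
  show ?thesis
    by (intro bexI[OF _ d(1)] conjI pd exI[of _ H] sH ballI allI impI lap formd)
qed

end

theorem proposition24:
  fixes S :: "('m::{t2_space, second_countable_topology}, 4) chart set"
    and A :: "('m \<times> ('m, 4) tvec) set"
    and F :: "'m \<times> ('m, 4) tvec \<Rightarrow> real"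
    and a :: "('m, 4) form2"
    and b :: "('m, 4) form1"
    and m :: real
  assumes "smooth_structure S"
    and "m \<noteq> 0"
    and "m_kropina S A m a b F"
    and "lorentzian S a"
    and "null_form S a b"
    and "berwald S A F"
    and "locally_metrizable S A F"
  shows "ricci_flat S A F \<longleftrightarrow>
    (\<forall>p. \<exists>c\<in>S. p \<in> fst c \<and>
      (\<exists>H :: real \<times> real \<times> real \<Rightarrow> real.
         smooth_on (transverse ` chart_image c) H \<and>
         (\<forall>w\<in>transverse ` chart_image c. transverse_laplacian H w = 0) \<and>
         (\<forall>x y. (x, y) \<in> bundle_coords S A c \<longrightarrow>
            (\<exists>r s. is_power \<bar>pp_wave_quadratic H x y\<bar> ((1 + m) / 2) r \<and>
               is_power (y $ 1) (- m) s \<and>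
               F (bundle_point S c (x, y)) = r * s))))"
proof -
  interpret null_kropina S A F a b m
    by unfold_locales (fact assms)+
  show ?thesis
    by (rule iffI, rule allI, erule pp_wave_chart, rule ricci_flat_if_pp_wave)
qed

end
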